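(* Let $D\subset\mathbb R^3$ be the open unit ball centered at the origin, with elastic parameters $(\tilde\lambda,\tilde\mu,\tilde\rho)$, embedded in the homogeneous elastic medium $(\mathbb R^3\setminus\overline D;\lambda,\mu,\rho)$, and let $B_R\supseteq D$ be the ball of radius $R$ centered at the origin. Assume $\tilde\lambda=\lambda/\delta$, $\tilde\mu=\mu/\delta$, $\tilde\rho=\rho/\epsilon$ with constants $0<\delta\ll1$, $0<\epsilon\ll1$, $\tau=\sqrt{\delta/\epsilon}<1$; $\lambda,\mu,\rho=\mathcal O(1)$; and $\omega=o(1)$ (sub-wavelength regime). Let the incident wave be $$\mathbf u^i(\mathbf x)=\sum_{m=-n}^n f_{n,m}\,j_n(k_s|\mathbf x|)\,\mathcal T_n^m(\theta,\varphi),$$ with $(f_{n,-n},\dots,f_{n,n})\in\mathbb C^{2n+1}$ nonzero, and let $\mathbf u$ in $D$ (internal total field) and $\mathbf u^s$ in $\mathbb R^3\setminus\overline D$ (external scattered field) be given by the solution of the elastic transmission scattering problem described in the context with this incident wave. For any $\gamma_1\in(0,1)$, $\gamma_2\in(1,R)$ and sufficiently small $\varepsilon\in\mathbb R_+$, if the index $n$ of $\mathbf u^i$ satisfies $n\ge\max\{n_1,n_2\}$, where $$n_1=\left\lfloor\frac12\left(\frac{\ln\varepsilon}{\ln\gamma_1}-3\right)\right\rfloor+1,\qquad n_2=\left\lfloor\frac12\left(1-\frac{\ln\varepsilon}{\ln\gamma_2}\right)\right\rfloor+1,$$ then $$\frac{\|\mathbf u\|^2_{L^2(D\setminus\mathcal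 M_-^{1-\gamma_1}(\partial D))^3}}{\|\mathbf u\|^2_{L^2(D)^3}}\le\varepsilon+\mathcal O(\varepsilon\omega^2)\ll1,\qquad \frac{\|\mathbf u^s\|^2_{L^2((B_R\setminus\overline D)\setminus\mathcal M_+^{\gamma_2-1}(\partial D))^3}}{\|\mathbf u^s\|^2_{L^2(B_R\setminus\overline D)^3}}\le\varepsilon+\mathcal O(\varepsilon\omega^2)\ll1 .$$
   Context: Scattering problem. $\omega>0$ is the angular frequency. $\mathcal L_{\lambda,\mu}=\mu\Delta+(\lambda+\mu)\nabla\nabla\cdot$ is the Lamé operator; $\lambda,\mu$ are real with $\mu>0$, $3\lambda+2\mu>0$, likewise $\tilde\mu>0$, $3\tilde\lambda+2\tilde\mu>0$; the densities $\rho,\tilde\rho$ are positive. The incident field $\mathbf u^i$ is an entire solution of $\mathcal L_{\lambda,\mu}\mathbf u^i+\omega^2\rho\mathbf u^i=0$ in $\mathbb R^3$. The total field $\mathbf u$ (with $\mathbf u=\mathbf u^i+\mathbf u^s$ outside $D$) satisfies $\mathcal L_{\tilde\lambda,\tilde\mu}\mathbf u+\omega^2\tilde\rho\mathbf u=0$ in $D$; $\mathcal L_{\lambda,\mu}\mathbf u+\omega^2\rho\mathbf u=0$ in $\mathbb R^3\setminus\overline D$; $\mathbf u|_-=\mathbf u|_+$ and $\partial_{\nu,\tilde\lambda,\tilde\mu}\mathbf u|_-=\partial_{\nu,\lambda,\mu}\mathbf u|_+$ on $\partial D$ ($\pm$ = limits from outside/inside $D$), where $\partial_{\nu,\lambda,\mu}\mathbf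 u=\lambda(\nabla\cdot\mathbf u)\nu+\mu(\nabla\mathbf u+\nabla\mathbf u^\top)\nu$ and $\nu$ is the outward unit normal; and $\mathbf u^s$ satisfies the radiation condition, as $|\mathbf x|\to\infty$, $(\nabla\times\nabla\times\mathbf u^s)\times\frac{\mathbf x}{|\mathbf x|}-\mathrm i k_s\nabla\times\mathbf u^s=\mathcal O(|\mathbf x|^{-2})$ and $\frac{\mathbf x}{|\mathbf x|}\cdot\nabla(\nabla\cdot\mathbf u^s)-\mathrm i k_p\nabla\cdot\mathbf u^s=\mathcal O(|\mathbf x|^{-2})$. Here $k_s=\omega\sqrt{\rho/\mu}$, $k_p=\omega\sqrt{\rho/(\lambda+2\mu)}$. Special functions. $n\ge1$ is an integer; $(\theta,\varphi)$ are the spherical angles of $\mathbf x$; $j_n$ is the spherical Bessel function of order $n$; $Y_n^m(\theta,\varphi)=C_n^mP_n^{|m|}(\cos\theta)e^{\mathrm i m\varphi}$ with $C_n^m=\sqrt{\frac{2n+1}{4\pi}\frac{(n-|m|)!}{(n+|m|)!}}$ and $P_n^{|m|}$ the associated Legendre functions; $\mathcal T_n^m=\nabla_{\mathbb S^2}Y_n^m\wedge\nu$ ($\wedge$ the cross product, $\nu=\mathbf x/|\mathbf x|$, $\nabla_{\mathbb S^2}$ the surface gradient). Boundary layers. $\mathcal M_-^{\xi}(\partial D)=\{\mathbf x\in D:\ d_{\partial D}(\mathbf x)<\xi\}$ and $\mathcal M_+^{\xi}(\partial D)=\{\mathbf x\in B_R\setminus\overline D:\ d_{\partial D}(\mathbf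 x)<\xi\}$, with $d_{\partial D}$ the Euclidean distance to $\partial D$. $\lfloor\cdot\rfloor$ is the floor function. Asymptotics. $\mathcal O(\cdot)$ and $o(\cdot)$ refer to the regime $\omega\to0$; $a\ll1$ means $a$ is sufficiently small. $\delta$ is the Lamé contrast and $\epsilon$ the density contrast; $\varepsilon$ (a different symbol) is the boundary localization level. *)

theory Defs
  imports "HOL-Analysis.Analysis" "HOL-Library.Landau_Symbols"
begin

definition pd :: "3 \<Rightarrow> (real^3 \<Rightarrow> 'b::real_normed_vector) \<Rightarrow> real^3 \<Rightarrow> 'b" where
  "pd i f x = frechet_derivative f (at x) (axis i 1)"

definition C2_on :: "(real^3) set \<Rightarrow> (real^3 \<Rightarrow> 'b::real_normed_vector) \<Rightarrow> bool" where
  "C2_on S f \<longleftrightarrow>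
     (\<forall>x\<in>S. f differentiable (at x)) \<and>
     (\<forall>i. \<forall>x\<in>S. pd i f differentiable (at x)) \<and>
     (\<forall>i j. continuous_on S (pd j (pd i f)))"

definition grad :: "(real^3 \<Rightarrow> complex) \<Rightarrow> real^3 \<Rightarrow> complex^3" where
  "grad p x = (\<chi> i. pd i p x)"

definition jac :: "(real^3 \<Rightarrow> complex^3) \<Rightarrow> real^3 \<Rightarrow> complex^3^3" where
  "jac u x = (\<chi> i j. pd j u x $ i)"

definition div_field :: "(real^3 \<Rightarrow> complex^3) \<Rightarrow> real^3 \<Rightarrow> complex" where
  "div_field u x = (\<Sum>i\<in>UNIV. pd i u x $ i)"

definition curl :: "(real^3 \<Rightarrow> complex^3) \<Rightarrow> real^3 \<Rightarrow> complex^3" where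
  "curl u x = vector [pd 2 u x $ 3 - pd 3 u x $ 2,
                      pd 3 u x $ 1 - pd 1 u x $ 3,
                      pd 1 u x $ 2 - pd 2 u x $ 1]"

definition laplacian :: "(real^3 \<Rightarrow> complex^3) \<Rightarrow> real^3 \<Rightarrow> complex^3" where
  "laplacian u x = (\<Sum>i\<in>UNIV. pd i (pd i u) x)"

definition cvec :: "real^3 \<Rightarrow> complex^3" where
  "cvec x = (\<chi> i. complex_of_real (x $ i))"

text \<open>The cross product of the library (\<^const>\<open>cross3\<close>) is restricted to real vectors; this is its
  complex bilinear extension.\<close>

definition ccross :: "complex^3 \<Rightarrow> complex^3 \<Rightarrow> complex^3" where
  "ccross a b = vector [a $ 2 * b $ 3 - a $ 3 * b $ 2,
                        a $ 3 * b $ 1 - a $ 1 * b $ 3,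
                        a $ 1 * b $ 2 - a $ 2 * b $ 1]"

definition lame :: "real \<Rightarrow> real \<Rightarrow> (real^3 \<Rightarrow> complex^3) \<Rightarrow> real^3 \<Rightarrow> complex^3" where
  "lame lam mu u x = mu *\<^sub>R laplacian u x + (lam + mu) *\<^sub>R grad (div_field u) x"

text \<open>The conormal derivative, in the direction \<open>n\<close>, of \<open>u\<close> at \<open>x\<close>; \<open>n\<close> is kept separate from \<open>x\<close>
  so that the one-sided limits of the field at a boundary point can be taken with the normal of
  that boundary point.\<close>

definition traction ::
    "real \<Rightarrow> real \<Rightarrow> real^3 \<Rightarrow> (real^3 \<Rightarrow> complex^3) \<Rightarrow> real^3 \<Rightarrow> complex^3" where
  "traction lam mu n u x =
     lam *\<^sub>R (div_field u x *s cvec n) + mu *\<^sub>R ((jac u x + transpose (jac u x)) *v cvec n)"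

definition k_shear :: "real \<Rightarrow> real \<Rightarrow> real \<Rightarrow> real" where
  "k_shear mu rho \<omega> = \<omega> * sqrt (rho / mu)"

definition k_pressure :: "real \<Rightarrow> real \<Rightarrow> real \<Rightarrow> real \<Rightarrow> real" where
  "k_pressure lam mu rho \<omega> = \<omega> * sqrt (rho / (lam + 2 * mu))"

definition radiating :: "real \<Rightarrow> real \<Rightarrow> (real^3 \<Rightarrow> complex^3) \<Rightarrow> bool" where
  "radiating kp ks v \<longleftrightarrow>
     (\<lambda>x. norm (ccross (curl (curl v) x) (cvec (x /\<^sub>R norm x)) - (\<i> * of_real ks) *s curl v x))
        \<in> O[at_infinity](\<lambda>x. 1 / norm x ^ 2) \<and>
     (\<lambda>x. norm ((\<Sum>i\<in>UNIV. cvec (x /\<^sub>R norm x) $ i * grad (div_field v) x $ i)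
                - \<i> * of_real kp * div_field v x))
        \<in> O[at_infinity](\<lambda>x. 1 / norm x ^ 2)"

text \<open>\<open>elastic_scattering D \<nu> lam mu rho lam' mu' rho' \<omega> ui u\<close>: the total field \<open>u\<close> is a classical
  solution of the transmission problem for the inclusion \<open>D\<close> with outward unit normal \<open>\<nu>\<close>,
  parameters \<open>lam', mu', rho'\<close> inside and \<open>lam, mu, rho\<close> outside, and incident field \<open>ui\<close>.
  Classical means \<open>C\<^sup>2\<close> on each side of the interface, with the gradient (from each side)
  extending continuously to the interface; the values of \<open>u\<close> on the interface itself are
  irrelevant.\<close>

definition elastic_scattering ::
    "(real^3) set \<Rightarrow> (real^3 \<Rightarrow> real^3) \<Rightarrow> real \<Rightarrow> real \<Rightarrow> real \<Rightarrow> real \<Rightarrow> real \<Rightarrow> real \<Rightarrow> real \<Rightarrow>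
     (real^3 \<Rightarrow> complex^3) \<Rightarrow> (real^3 \<Rightarrow> complex^3) \<Rightarrow> bool" where
  "elastic_scattering D \<nu> lam mu rho lam' mu' rho' \<omega> ui u \<longleftrightarrow>
     C2_on D u \<and> C2_on (- closure D) u \<and>
     (\<forall>x\<in>D. lame lam' mu' u x + (\<omega>\<^sup>2 * rho') *\<^sub>R u x = 0) \<and>
     (\<forall>x\<in>- closure D. lame lam mu u x + (\<omega>\<^sup>2 * rho) *\<^sub>R u x = 0) \<and>
     (\<forall>y\<in>frontier D.
        (\<exists>G. (jac u \<longlongrightarrow> G) (at y within D)) \<and>
        (\<exists>G. (jac u \<longlongrightarrow> G) (at y within - closure D)) \<and>
        (\<exists>a. (u \<longlongrightarrow> a) (at y within D) \<and> (u \<longlongrightarrow> a) (at y within - closure D)) \<and>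
        (\<exists>t. (traction lam' mu' (\<nu> y) u \<longlongrightarrow> t) (at y within D) \<and>
             (traction lam mu (\<nu> y) u \<longlongrightarrow> t) (at y within - closure D))) \<and>
     radiating (k_pressure lam mu rho \<omega>) (k_shear mu rho \<omega>) (\<lambda>x. u x - ui x)"

text \<open>Power series of the spherical Bessel function of order \<open>n\<close>; the product is the double
  factorial \<open>(2 (n + p) + 1)!!\<close>.\<close>

definition sph_bessel_j :: "nat \<Rightarrow> real \<Rightarrow> real" where
  "sph_bessel_j n t =
     (\<Sum>p. (- 1) ^ p * t ^ (n + 2 * p) / (2 ^ p * fact p * (\<Prod>i\<le>n + p. 2 * real i + 1)))"

text \<open>Rodrigues' formula, without the Condon--Shortley factor \<open>(- 1) ^ m\<close>.\<close>

definition legendre_poly :: "nat \<Rightarrow> real poly" where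
  "legendre_poly n = smult (1 / (2 ^ n * fact n)) ((pderiv ^^ n) ([:- 1, 0, 1:] ^ n))"

definition assoc_legendre :: "nat \<Rightarrow> nat \<Rightarrow> real \<Rightarrow> real" where
  "assoc_legendre n m t = sqrt (1 - t\<^sup>2) ^ m * poly ((pderiv ^^ m) (legendre_poly n)) t"

definition polar_angle :: "real^3 \<Rightarrow> real" where
  "polar_angle x = arccos (x $ 3 / norm x)"

definition azimuth :: "real^3 \<Rightarrow> real" where
  "azimuth x = Arg (Complex (x $ 1) (x $ 2))"

definition sph_harm :: "nat \<Rightarrow> int \<Rightarrow> real^3 \<Rightarrow> complex" where
  "sph_harm n m x =
     of_real (sqrt ((2 * real n + 1) / (4 * pi) * (fact (n - nat \<bar>m\<bar>) / fact (n + nat \<bar>m\<bar>)))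
              * assoc_legendre n (nat \<bar>m\<bar>) (cos (polar_angle x)))
     * exp (\<i> * of_int m * of_real (azimuth x))"

text \<open>The surface gradient at a point of the unit sphere is the gradient of the extension that is
  constant along rays.\<close>

definition surface_grad :: "(real^3 \<Rightarrow> complex) \<Rightarrow> real^3 \<Rightarrow> complex^3" where
  "surface_grad Y = grad (\<lambda>x. Y (x /\<^sub>R norm x))"

definition sph_T :: "nat \<Rightarrow> int \<Rightarrow> real^3 \<Rightarrow> complex^3" where
  "sph_T n m x = ccross (surface_grad (sph_harm n m) (x /\<^sub>R norm x)) (cvec (x /\<^sub>R norm x))"

definition incident_T :: "real \<Rightarrow> nat \<Rightarrow> (int \<Rightarrow> complex) \<Rightarrow> real^3 \<Rightarrow> complex^3" where
  "incident_T ks n f x =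
     (\<Sum>m = - int n..int n. (f m * of_real (sph_bessel_j n (ks * norm x))) *s sph_T n m x)"

definition inner_layer :: "(real^3) set \<Rightarrow> real \<Rightarrow> (real^3) set" where
  "inner_layer D \<xi> = {x \<in> D. infdist x (frontier D) < \<xi>}"

definition outer_layer :: "(real^3) set \<Rightarrow> real \<Rightarrow> real \<Rightarrow> (real^3) set" where
  "outer_layer D R \<xi> = {x \<in> ball 0 R - closure D. infdist x (frontier D) < \<xi>}"

definition L2_norm_sq :: "(real^3) set \<Rightarrow> (real^3 \<Rightarrow> complex^3) \<Rightarrow> real" where
  "L2_norm_sq S v = (LINT x:S|lborel. (norm (v x))\<^sup>2)"

definition n_interior :: "real \<Rightarrow> real \<Rightarrow> int" where
  "n_interior \<gamma> e = \<lfloor>(ln e / ln \<gamma> - 3) / 2\<rfloor> + 1"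

definition n_exterior :: "real \<Rightarrow> real \<Rightarrow> int" where
  "n_exterior \<gamma> e = \<lfloor>(1 - ln e / ln \<gamma>) / 2\<rfloor> + 1"

end

theory Submission
 imports Defs
begin

text \<open>The transmission solution is unique: flux balance and Rellich's lemma annihilate the exterior field,
a Pohozaev identity then the interior one. So the field is the toroidal mode with radial factor \<open>j\<^sub>n\<close> inside
and \<open>h\<^sub>n\<close> outside, nearly \<open>r\<^sup>n\<close> and \<open>r\<^bsup>-n-1\<^esup>\<close> uniformly in \<open>n\<close>. Dilating the full domain
onto the part off the layer gives the ratios \<open>\<gamma>\<^sub>1\<^bsup>2n+3\<^esup>\<close> and \<open>\<gamma>\<^sub>2\<^bsup>1-2n\<^esup>\<close>.\<close>

text \<open>The field \<open>u\<close> is an arbitrary classical solution, only \<open>C^2\<close>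
  on each side, so its divergence and curl need not have the second derivatives that a Helmholtz
  equation asks for. They satisfy it weakly and are mollified before any decay argument applies.
  Since the inclusion is a ball, no general surface theory enters: integrals over spheres are
  differentiated in the radius, and the rotation fields \<open>x_i d_j - x_j d_i\<close> integrate
  to zero, which replaces the divergence theorem. Uniqueness alone does not give the shape of
  \<open>u\<close>: a solution made of modes must exist and must not degenerate. This is a two by
  two system whose determinant and scattering coefficient are nonzero for \<open>n \<ge> 2\<close>,
  exterior wave number at most 1/2 and Lame contrast below 1/2. A localization level below the fifth
  power of \<open>\<gamma>\<^sub>1\<close> enforces \<open>n \<ge> 2\<close>. The error constant has
  to be independent of \<open>n\<close>. Dividing the radial functions by double factorials leaves
  factors close to 1 with an error quadratic in the wave number, so each comparison of two points
  costs one factor \<open>1 + 12 * q\<close>.\<close>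

type_synonym cfun = "real^3 => complex"

notation scaleR (infixr "*r" 75) and tendsto (infixr "--->" 55)

lemmas ags = algebra_simps

abbreviation cr :: "real => 'a::real_algebra_1" where "cr == of_real"

abbreviation rc :: "real => complex" where "rc == of_real"

abbreviation cont_on :: "'a::topological_space set => ('a => 'b::topological_space) => bool" where
  "cont_on == continuous_on"

abbreviation nnL :: "('a::euclidean_space => ennreal) => ennreal" (binder "NN " 10) where
  "nnL f == nn_integral lborel f"

abbreviation lbL :: "('a::euclidean_space => 'b::{banach, second_countable_topology}) => 'b" (binder "LB " 10) where
  "lbL f == integral\<^sup>L lborel f"

abbreviation sumU :: "('a::finite => 'b::comm_monoid_add) => 'b" (binder "SU " 10) where
  "sumU f == sum f UNIV"

section \<open>Partial derivatives of scalar functions\<close>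

lemma pd_eqI: "(f has_derivative f') (at x) ==> pd i f x = f' (axis i 1)"
 unfolding pd_def by (metis frechet_derivative_at)

lemma has_derivative_cong_open:
 assumes "open S" "x : S" "!!y. y : S ==> f y = g y"
 shows "(f has_derivative f') (at x) \<longleftrightarrow> (g has_derivative f') (at x)"
 using has_derivative_transform_within_open[OF _ assms(1,2), of f f' UNIV g]
  has_derivative_transform_within_open[OF _ assms(1,2), of g f' UNIV f] assms(3) by auto

lemma pd_cong_open:
 assumes "open S" "x : S" "!!y. y : S ==> f y = g y"
 shows "pd i f x = pd i g x"
 using has_derivative_cong_open[OF assms] by (simp add: pd_def frechet_derivative_def)

lemma diff_cong_open:
 assumes "open S" "x : S" "!!y. y : S ==> f y = g y" "f differentiable (at x)"
 shows "g differentiable (at x)"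
 using assms(4) has_derivative_cong_open[OF assms(1-3)] by (simp add: differentiable_def)

lemma has_derivative_pd:
 fixes f :: "real^3 => 'b::real_normed_vector"
 assumes "f differentiable (at x)"
 shows "(f has_derivative (%h. SU i. (h $ i) *r pd i f x)) (at x)"
proof -
 let ?D = "frechet_derivative f (at x)"
 have D: "(f has_derivative ?D) (at x)"
  using assms by (simp add: frechet_derivative_works)
 then interpret linear ?D by (rule has_derivative_linear)
 have "?D h = (SU i. (h $ i) *r pd i f x)" for h
 proof -
  have "h = (SU i. (h $ i) *r axis i 1)"
  by (simp add: vec_eq_iff axis_def if_distrib[of "(*) _"] cong: if_cong)
  then have "?D h = ?D (SU i. (h $ i) *r axis i 1)" by simp
  also have "... = (SU i. (h $ i) *r ?D (axis i 1))"
  by (simp add: sum scale)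
  finally show ?thesis by (simp add: pd_def)
 qed
 then have "?D = (%h. SU i. (h $ i) *r pd i f x)" by blast
 then show ?thesis using D by simp
qed

lemma pd_const [simp]: "pd i (%x. c) x = 0"
 by (simp add: pd_def)

lemma pd_add:
 assumes "f differentiable (at x)" "g differentiable (at x)"
 shows "pd i (%x. f x + g x) x = pd i f x + pd i g x"
 using assms by (intro pd_eqI[THEN trans] has_derivative_add)
  (auto simp: frechet_derivative_works pd_def)

lemma pd_diff:
 assumes "f differentiable (at x)" "g differentiable (at x)"
 shows "pd i (%x. f x - g x) x = pd i f x - pd i g x"
 using assms by (intro pd_eqI[THEN trans] has_derivative_diff)
  (auto simp: frechet_derivative_works pd_def)

lemma pd_minus:
 assumes "f differentiable (at x)"
 shows "pd i (%x. - f x) x = - pd i f x"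
 using assms by (intro pd_eqI[THEN trans] has_derivative_minus)
  (auto simp: frechet_derivative_works pd_def)

lemma pd_sum:
 assumes "!!k. k : A ==> f k differentiable (at x)"
 shows "pd i (%x. \<Sum>k\<in>A. f k x) x = (\<Sum>k\<in>A. pd i (f k) x)"
 using assms by (intro pd_eqI[THEN trans] has_derivative_sum)
  (auto simp: frechet_derivative_works pd_def)

lemma pd_mult:
 fixes f g :: "real^3 => 'b::real_normed_algebra"
 assumes "f differentiable (at x)" "g differentiable (at x)"
 shows "pd i (%x. f x * g x) x = pd i f x * g x + f x * pd i g x"
 using pd_eqI[OF has_derivative_mult[OF assms[unfolded frechet_derivative_works]]]
 by (simp add: pd_def add.commute)

lemma pd_linear:
 assumes "bounded_linear h" "f differentiable (at x)"
 shows "pd i (%x. h (f x)) x = h (pd i f x)"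
 using pd_eqI[OF bounded_linear.has_derivative[OF assms[unfolded frechet_derivative_works]]]
 by (simp add: pd_def)

lemma diff_linear:
 assumes "bounded_linear h" "f differentiable (at x)"
 shows "(%x. h (f x)) differentiable (at x)"
 using assms bounded_linear.has_derivative unfolding differentiable_def by blast

lemmas pd_cnj = pd_linear[OF bounded_linear_cnj]
lemmas diff_cnj = diff_linear[OF bounded_linear_cnj]
lemmas pd_nth = pd_linear[OF bounded_linear_vec_nth]
lemmas diff_nth = diff_linear[OF bounded_linear_vec_nth]
lemmas pd_of_real = pd_linear[OF bounded_linear_of_real]
lemmas diff_of_real = diff_linear[OF bounded_linear_of_real]

lemma bounded_linear_axis: "bounded_linear (axis j :: complex => complex^3)"
proof (rule bounded_linear_intro[where K=1])
 show "axis j (x + y) = axis j x + axis j y" for x y :: complex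
  by (simp add: axis_def vec_eq_iff)
 show "axis j (r *r x) = r *r axis j x" for r and x :: complex
  by (simp add: axis_def vec_eq_iff)
 show "norm (axis j x :: complex^3) <= norm x * 1" for x :: complex
 proof -
  have "(SU i. (norm ((axis j x :: complex^3) $ i))^2) = (SU i. if i = j then (norm x)^2 else 0)"
  by (intro sum.cong) (auto simp: axis_def)
  then show ?thesis by (simp add: norm_vec_def L2_set_def)
 qed
qed

lemma diff_vec:
 fixes f :: "real^3 => complex^3"
 assumes "!!j. (%x. f x $ j) differentiable (at x)"
 shows "f differentiable (at x)"
proof -
 have "f = (%x. SU j. axis j (f x $ j))"
  by (simp add: fun_eq_iff vec_eq_iff axis_def)
 moreover have "(%x. SU j. axis j (f x $ j)) differentiable (at x)"
  by (intro differentiable_sum finite ballI diff_linear[OF bounded_linear_axis] assms)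
 ultimately show ?thesis by simp
qed

lemma diff_coord [simp]: "(%x::real^3. x $ j) differentiable (at x)"
 by (rule bounded_linear_imp_differentiable[OF bounded_linear_vec_nth])

lemma pd_coord: "pd i (%x::real^3. x $ j) x = (if i = j then 1 else 0)"
 by (subst pd_eqI[OF bounded_linear_imp_has_derivative[OF bounded_linear_vec_nth]])
  (auto simp: axis_def)

lemma diff_ccoord [simp]: "(%x::real^3. rc (x $ j)) differentiable (at x)"
 by (rule diff_of_real) simp

lemma pd_ccoord: "pd i (%x::real^3. rc (x $ j)) x = (if i = j then 1 else 0)"
 by (subst pd_of_real) (auto simp: pd_coord)

lemma norm_3: "norm (x::real^3) ^ 2 = x $ 1 ^ 2 + x $ 2 ^ 2 + x $ 3 ^ 2"
 by (simp add: norm_vec_def L2_set_def sum_3 real_sqrt_pow2)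

text \<open>One layer of differentiability: \<open>C2_on\<close> splits into \<open>C1_on\<close>
  for the function and for each of its partial derivatives, so closure rules are proved at first
  order and lifted by \<open>C2_onI_eq\<close>.\<close>

definition C1_on :: "(real^3) set => (real^3 => 'b::real_normed_vector) => bool" where
 "C1_on S f \<longleftrightarrow> (\<forall>x\<in>S. f differentiable (at x)) & (\<forall>i. cont_on S (pd i f))"

lemma C1_onD:
 assumes "C1_on S f"
 shows "x : S ==> f differentiable (at x)" "cont_on S (pd i f)" "cont_on S f"
 using assms unfolding C1_on_def
 by (auto intro!: differentiable_imp_continuous_on differentiable_at_imp_differentiable_on)

lemma C2_onD:
 assumes "C2_on S f"
 shows "C1_on S f" "C1_on S (pd i f)"
 using assms unfolding C2_on_def C1_on_def
 by (auto intro!: differentiable_imp_continuous_on differentiable_at_imp_differentiable_on)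

lemma C2_onI:
 assumes "C1_on S f" "!!i. C1_on S (pd i f)"
 shows "C2_on S f"
 using assms unfolding C2_on_def C1_on_def by auto

lemma C1_on_subset: "C1_on S f ==> T \<subseteq> S ==> C1_on T f"
 unfolding C1_on_def by (blast intro: continuous_on_subset)

lemma C2_on_subset: "C2_on S f ==> T \<subseteq> S ==> C2_on T f"
 unfolding C2_on_def by (blast intro: continuous_on_subset)

lemma C1_onI_eq:
 assumes 1: "!!x. x : S ==> f differentiable (at x)" and 2: "!!i x. x : S ==> pd i f x = g i x"
  and 3: "!!i. cont_on S (g i)"
 shows "C1_on S f"
 unfolding C1_on_def
proof (intro conjI ballI allI)
 show "f differentiable (at x)" if "x : S" for x using that by (rule 1)
 fix i
 have eq: "g i x = pd i f x" if "x : S" for x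
  using that by (simp add: 2)
 show "cont_on S (pd i f)"
  using 3[of i] eq by (rule continuous_on_eq)
qed

lemma C1_on_cong:
 assumes S: "open S" and eq: "!!x. x : S ==> f x = g x" and f: "C1_on S f"
 shows "C1_on S g"
proof -
 have 1: "g differentiable (at x)" if x: "x : S" for x
  using S x eq C1_onD(1)[OF f x] by (rule diff_cong_open)
 have 2: "pd i f x = pd i g x" if x: "x : S" for i x
  using S x eq by (rule pd_cong_open)
 have 3: "cont_on S (pd i g)" for i
  using C1_onD(2)[OF f, of i] 2[of _ i] by (rule continuous_on_eq)
 show ?thesis unfolding C1_on_def by (intro conjI ballI allI 1 3)
qed

lemma C2_on_cong:
 assumes S: "open S" and eq: "!!x. x : S ==> f x = g x" and f: "C2_on S f"
 shows "C2_on S g"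
proof (rule C2_onI)
 show "C1_on S g" using S eq C2_onD(1)[OF f] by (rule C1_on_cong)
 have 2: "pd i f x = pd i g x" if x: "x : S" for i x
  using S x eq by (rule pd_cong_open)
 show "C1_on S (pd i g)" for i
  using S 2[of _ i] C2_onD(2)[OF f, of i] by (rule C1_on_cong)
qed

lemma C1_on_const [simp]: "C1_on S (%x. c)"
 by (simp add: C1_on_def pd_def)

lemma C1_on_coord [simp]: "C1_on S (%x. rc (x $ j))"
 by (simp add: C1_on_def pd_ccoord)

lemma C1_on_rcoord [simp]: "C1_on S (%x. x $ j)"
 by (simp add: C1_on_def pd_coord)

lemma C1_on_add:
 assumes f: "C1_on S f" and g: "C1_on S g" shows "C1_on S (%x. f x + g x)"
proof (rule C1_onI_eq)
 fix x assume "x : S"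
 note d = C1_onD(1)[OF f this] C1_onD(1)[OF g this]
 show "(%x. f x + g x) differentiable (at x)" by (intro differentiable_add d)
 show "pd i (%x. f x + g x) x = (%i x. pd i f x + pd i g x) i x" for i by (simp add: pd_add d)
next
 show "cont_on S ((%i x. pd i f x + pd i g x) i)" for i
  by (intro continuous_on_add C1_onD(2,3) f g)
qed

lemma C1_on_diff:
 assumes f: "C1_on S f" and g: "C1_on S g" shows "C1_on S (%x. f x - g x)"
proof (rule C1_onI_eq)
 fix x assume "x : S"
 note d = C1_onD(1)[OF f this] C1_onD(1)[OF g this]
 show "(%x. f x - g x) differentiable (at x)" by (intro differentiable_diff d)
 show "pd i (%x. f x - g x) x = (%i x. pd i f x - pd i g x) i x" for i by (simp add: pd_diff d)
next
 show "cont_on S ((%i x. pd i f x - pd i g x) i)" for i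
  by (intro continuous_on_diff C1_onD(2,3) f g)
qed

lemma C1_on_mult:
 fixes f g :: "real^3 => 'b::real_normed_algebra"
 assumes f: "C1_on S f" and g: "C1_on S g" shows "C1_on S (%x. f x * g x)"
proof (rule C1_onI_eq)
 fix x assume "x : S"
 note d = C1_onD(1)[OF f this] C1_onD(1)[OF g this]
 show "(%x. f x * g x) differentiable (at x)" by (intro differentiable_mult d)
 show "pd i (%x. f x * g x) x = (%i x. pd i f x * g x + f x * pd i g x) i x" for i by (simp add: pd_mult d)
next
 show "cont_on S ((%i x. pd i f x * g x + f x * pd i g x) i)" for i
  by (intro continuous_on_add continuous_on_mult C1_onD(2,3) f g)
qed

lemma C1_on_linear:
 assumes h: "bounded_linear h" and f: "C1_on S f" shows "C1_on S (%x. h (f x))"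
proof (rule C1_onI_eq)
 fix x assume "x : S"
 note d = C1_onD(1)[OF f this]
 show "(%x. h (f x)) differentiable (at x)" by (rule diff_linear[OF h d])
 show "pd i (%x. h (f x)) x = (%i x. h (pd i f x)) i x" for i by (simp add: pd_linear[OF h d])
next
 show "cont_on S ((%i x. h (pd i f x)) i)" for i
  by (intro bounded_linear.continuous_on[OF h] C1_onD(2) f)
qed

lemma C1_on_minus:
 assumes "C1_on S f" shows "C1_on S (%x. - f x)"
 by (rule C1_on_linear[OF bounded_linear_minus[OF bounded_linear_ident] assms])

lemmas C1_on_cnj = C1_on_linear[OF bounded_linear_cnj]
lemma C1_on_sum:
 assumes "!!k. k : A ==> C1_on S (f k)" shows "C1_on S (%x. \<Sum>k\<in>A. f k x)"
 using assms by (induction A rule: infinite_finite_induct) (auto intro!: C1_on_add)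

lemmas C1_intros = C1_on_const C1_on_coord C1_on_rcoord C1_on_add C1_on_diff C1_on_minus
 C1_on_mult C1_on_cnj C1_on_sum

lemma C2_onI_eq:
 assumes "open S" "C1_on S f" "!!i x. x : S ==> pd i f x = g i x" "!!i. C1_on S (g i)"
 shows "C2_on S f"
proof (rule C2_onI[OF assms(2)])
 fix i
 have eq: "g i x = pd i f x" if "x : S" for x
  using that by (simp add: assms(3))
 show "C1_on S (pd i f)"
  using assms(1) eq assms(4)[of i] by (rule C1_on_cong)
qed

lemma C2_on_linear:
 assumes "bounded_linear h" "C2_on S f" "open S" shows "C2_on S (%x. h (f x))"
proof (rule C2_onI_eq[where g="%i x. h (pd i f x)"])
 show "C1_on S (%x. h (f x))" by (rule C1_on_linear[OF assms(1) C2_onD(1)[OF assms(2)]])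
 show "C1_on S (%x. h (pd i f x))" for i by (rule C1_on_linear[OF assms(1) C2_onD(2)[OF assms(2)]])
 show "pd i (%x. h (f x)) x = h (pd i f x)" if "x : S" for i x
  using C1_onD(1)[OF C2_onD(1)[OF assms(2)] that] by (rule pd_linear[OF assms(1)])
qed (rule assms)

lemmas C2_on_nth = C2_on_linear[OF bounded_linear_vec_nth]

lemma C2_on_diff:
 assumes "C2_on S f" "C2_on S g" "open S" shows "C2_on S (%x. f x - g x)"
proof (rule C2_onI_eq[where g="%i x. pd i f x - pd i g x"])
 note C2 = C2_onD[OF assms(1)] C2_onD[OF assms(2)]
 show "C1_on S (%x. f x - g x)" by (intro C1_on_diff C2)
 show "C1_on S (%x. pd i f x - pd i g x)" for i by (intro C1_on_diff C2)
 show "pd i (%x. f x - g x) x = pd i f x - pd i g x" if "x : S" for i x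
  by (intro pd_diff C1_onD(1)[OF _ that] C2)
qed (rule assms)

lemma C2_on_mult:
 fixes f g :: "real^3 => 'b::real_normed_algebra"
 assumes "C2_on S f" "C2_on S g" "open S" shows "C2_on S (%x. f x * g x)"
proof (rule C2_onI_eq[where g="%i x. pd i f x * g x + f x * pd i g x"])
 note C2 = C2_onD[OF assms(1)] C2_onD[OF assms(2)]
 show "C1_on S (%x. f x * g x)" by (intro C1_on_mult C2)
 show "C1_on S (%x. pd i f x * g x + f x * pd i g x)" for i by (intro C1_on_mult C1_on_add C2)
 show "pd i (%x. f x * g x) x = pd i f x * g x + f x * pd i g x" if "x : S" for i x
  by (intro pd_mult C1_onD(1)[OF _ that] C2)
qed (rule assms)

lemma C1_on_vec:
 fixes f :: "real^3 => complex^3"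
 assumes "!!j. C1_on S (%x. f x $ j)"
 shows "C1_on S f"
proof -
 have d: "f differentiable (at x)" if "x : S" for x
  by (rule diff_vec) (rule C1_onD(1)[OF assms that])
 have "cont_on S (%x. \<chi> j. pd i f x $ j)" for i
 proof (rule continuous_on_vec_lambda)
  fix j
  have "cont_on S (pd i (%x. f x $ j))" by (rule C1_onD(2)[OF assms])
  then show "cont_on S (%x. pd i f x $ j)"
  by (rule continuous_on_eq) (simp add: pd_nth d)
 qed
 then show ?thesis unfolding C1_on_def using d by simp
qed

lemma C2_on_vec:
 fixes f :: "real^3 => complex^3"
 assumes "!!j. C2_on S (%x. f x $ j)" "open S"
 shows "C2_on S f"
proof (rule C2_onI)
 show c1: "C1_on S f" by (rule C1_on_vec[OF C2_onD(1)[OF assms(1)]])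
 fix i
 have "C1_on S (%x. pd i f x $ j)" for j
 proof (rule C1_on_cong[OF assms(2)])
  show "C1_on S (pd i (%x. f x $ j))" by (rule C2_onD(2)[OF assms(1)])
  show "pd i (%x. f x $ j) x = pd i f x $ j" if "x : S" for x
  by (rule pd_nth[OF C1_onD(1)[OF c1 that]])
 qed
 then show "C1_on S (pd i f)" by (rule C1_on_vec)
qed

section \<open>Symmetry of second derivatives by finite differences\<close>

lemma pd_line_deriv:
 fixes f :: "real^3 => 'b::real_normed_vector"
 assumes "f differentiable (at (x + s *r axis i 1))"
 shows "((%s. f (x + s *r axis i 1)) has_vector_derivative pd i f (x + s *r axis i 1)) (at s)"
proof -
 let ?y = "x + s *r axis i 1"
 have 1: "(f has_derivative frechet_derivative f (at ?y)) (at ?y)"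
  using assms by (simp add: frechet_derivative_works)
 have 2: "((%s. x + s *r axis i 1) has_derivative (%t. t *r axis i 1)) (at s)"
  by (auto intro!: derivative_eq_intros)
 have 3: "((%s. f (x + s *r axis i 1)) has_derivative
  (%t. frechet_derivative f (at ?y) (t *r axis i 1))) (at s)"
  using diff_chain_at[OF 2 1] by (simp add: o_def)
 have "linear (frechet_derivative f (at ?y))" using 1 has_derivative_linear by blast
 then show ?thesis
  using 3 unfolding has_vector_derivative_def pd_def by (simp add: linear_cmul)
qed

text \<open>The mean value theorem is applied twice: in direction \<open>i\<close> to the difference
  \<open>\<phi>\<close> of \<open>f\<close> along two parallel segments, then in direction
  \<open>j\<close> to the resulting partial derivative. The left side is symmetric in
  \<open>i\<close> and \<open>j\<close>, the right side is not; this asymmetry yields the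
  interchange of derivatives.\<close>

lemma second_difference:
 fixes f :: "real^3 => real"
 assumes "open S" "C2_on S f" "cball x (2 * h) \<subseteq> S" "h > 0"
 shows "\<exists>y. dist x y <= 2 * h &
  f (x + h *r axis i 1 + h *r axis j 1) - f (x + h *r axis i 1) - f (x + h *r axis j 1) + f x
  = h^2 * pd j (pd i f) y"
proof -
 have inS: "x + s *r axis i 1 + t *r axis j 1 : S"
  "dist x (x + s *r axis i 1 + t *r axis j 1) <= 2 * h"
  if "0 <= s" "s <= h" "0 <= t" "t <= h" for s t
 proof -
  have "norm (s *r axis i 1 + t *r axis j (1::real) :: real^3) <= \<bar>s\<bar> + \<bar>t\<bar>"
  by (rule norm_triangle_le) (simp add: norm_axis_1)
  then show "dist x (x + s *r axis i 1 + t *r axis j 1) <= 2 * h"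
  using that norm_minus_commute[of x "x + (s *r axis i 1 + t *r axis j 1)"]
  by (simp add: dist_norm add.assoc)
  then show "x + s *r axis i 1 + t *r axis j 1 : S" using assms(3) by auto
 qed
 have d: "f differentiable (at y)" "pd i f differentiable (at y)" if "y : S" for y
  using assms that by (auto simp: C2_on_def)
 define \<phi> where "\<phi> s = f (x + s *r axis i 1 + h *r axis j 1) - f (x + s *r axis i 1)" for s
 have "\<exists>z>0. z < h & \<phi> h - \<phi> 0 = (h - 0) * (pd i f (x + z *r axis i 1 + h *r axis j 1) - pd i f (x + z *r axis i 1))"
 proof (rule MVT2)
  fix s assume s: "0 <= s" "s <= h"
  have a: "((%s. f ((x + h *r axis j 1) + s *r axis i 1)) has_vector_derivative
  pd i f ((x + h *r axis j 1) + s *r axis i 1)) (at s)"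
  by (rule pd_line_deriv, rule d) (use inS[of s h] s assms(4) in \<open>simp add: add_ac\<close>)
  have b: "((%s. f (x + s *r axis i 1)) has_vector_derivative
  pd i f (x + s *r axis i 1)) (at s)"
  by (rule pd_line_deriv, rule d) (use inS[of s 0] s assms(4) in \<open>simp add: add_ac\<close>)
  show "(\<phi> has_real_derivative pd i f (x + s *r axis i 1 + h *r axis j 1) - pd i f (x + s *r axis i 1)) (at s)"
  using has_vector_derivative_diff[OF a b] unfolding \<phi>_def
  by (simp add: has_real_derivative_iff_has_vector_derivative add_ac)
 qed (use assms in auto)
 then obtain z where z: "0 < z" "z < h"
  "\<phi> h - \<phi> 0 = h * (pd i f (x + z *r axis i 1 + h *r axis j 1) - pd i f (x + z *r axis i 1))" by auto
 have "\<exists>t>0. t < h & pd i f (x + z *r axis i 1 + h *r axis j 1) - pd i f (x + z *r axis i 1 + 0 *r axis j 1)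
  = (h - 0) * pd j (pd i f) (x + z *r axis i 1 + t *r axis j 1)"
 proof (rule MVT2)
  fix t assume t: "0 <= t" "t <= h"
  show "((%t. pd i f (x + z *r axis i 1 + t *r axis j 1)) has_real_derivative
  pd j (pd i f) (x + z *r axis i 1 + t *r axis j 1)) (at t)"
  unfolding has_real_derivative_iff_has_vector_derivative
  by (rule pd_line_deriv, rule d) (use inS[of z t] t z in auto)
 qed (use assms in auto)
 then obtain t where t: "0 < t" "t < h"
  "pd i f (x + z *r axis i 1 + h *r axis j 1) - pd i f (x + z *r axis i 1)
  = h * pd j (pd i f) (x + z *r axis i 1 + t *r axis j 1)" by auto
 show ?thesis
  by (rule exI[of _ "x + z *r axis i 1 + t *r axis j 1"])
  (use inS[of z t] z t in \<open>simp add: \<phi>_def power2_eq_square\<close>)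
qed

lemma pd_commute_real:
 fixes f :: "real^3 => real"
 assumes "open S" "C2_on S f" "x : S"
 shows "pd i (pd j f) x = pd j (pd i f) x"
proof -
 obtain e where e: "e > 0" "cball x e \<subseteq> S" using assms open_contains_cball by blast
 have ex: "\<exists>y z. dist x y <= 2 * h & dist x z <= 2 * h & pd j (pd i f) y = pd i (pd j f) z"
  if h: "0 < h" "2 * h <= e" for h
 proof -
  have c: "cball x (2 * h) \<subseteq> S" using e h by auto
  obtain y where y: "dist x y <= 2 * h"
  "f (x + h *r axis i 1 + h *r axis j 1) - f (x + h *r axis i 1) - f (x + h *r axis j 1) + f x
  = h^2 * pd j (pd i f) y"
  using second_difference[OF assms(1,2) c h(1)] by blast
  obtain z where z: "dist x z <= 2 * h"
  "f (x + h *r axis j 1 + h *r axis i 1) - f (x + h *r axis j 1) - f (x + h *r axis i 1) + f x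
  = h^2 * pd i (pd j f) z"
  using second_difference[OF assms(1,2) c h(1)] by blast
  have "h^2 * pd j (pd i f) y = h^2 * pd i (pd j f) z"
  unfolding y(2)[symmetric] z(2)[symmetric] by (simp add: add_ac)
  then show ?thesis using y z h by auto
 qed
 \<comment> \<open>Scales with \<open>2 * h n <= e\<close> that shrink to 0: both evaluation points
   are driven to \<open>x\<close>, and continuity of the two mixed partials does the rest.\<close>
 define h where "h n = e / 2 / real (Suc n)" for n
 have h: "0 < h n" "2 * h n <= e" for n
  using e by (auto simp: h_def field_simps)
 obtain y z where yz: "!!n. dist x (y n) <= 2 * h n" "!!n. dist x (z n) <= 2 * h n"
  "!!n. pd j (pd i f) (y n) = pd i (pd j f) (z n)"
  using ex[OF h] by metis
 have h0: "(%n. 2 * h n) \<longlonglongrightarrow> 0"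
  using LIMSEQ_Suc[OF lim_const_over_n[of e]] by (simp add: h_def field_simps del: of_nat_Suc)
 have lim: "u \<longlonglongrightarrow> x" if "!!n. dist x (u n) <= 2 * h n" for u
 proof (rule iffD2[OF tendsto_dist_iff], rule tendsto_sandwich[OF _ _ tendsto_const h0])
  show "\<forall>\<^sub>F n in sequentially. dist (u n) x <= 2 * h n"
  using that by (simp add: dist_commute)
 qed simp
 have cont: "isCont (pd j (pd i f)) x" "isCont (pd i (pd j f)) x"
  using assms by (auto simp: C2_on_def continuous_on_eq_continuous_at)
 have "(%n. pd j (pd i f) (y n)) \<longlonglongrightarrow> pd j (pd i f) x"
  by (rule isCont_tendsto_compose[OF cont(1) lim[OF yz(1)]])
 moreover have "(%n. pd i (pd j f) (z n)) \<longlonglongrightarrow> pd i (pd j f) x"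
  by (rule isCont_tendsto_compose[OF cont(2) lim[OF yz(2)]])
 ultimately show ?thesis unfolding yz(3) using LIMSEQ_unique by blast
qed

lemma pd_commute:
 fixes f :: "cfun"
 assumes "open S" "C2_on S f" "x : S"
 shows "pd i (pd j f) x = pd j (pd i f) x"
proof -
 have lin: "h (pd i (pd j f) x) = pd i (pd j (%x. h (f x))) x" if "bounded_linear h" for h and i j
 proof -
  have "pd i (pd j (%x. h (f x))) x = pd i (%x. h (pd j f x)) x"
  by (rule pd_cong_open[OF assms(1,3)]) (use assms(2) that in \<open>auto simp: C2_on_def pd_linear\<close>)
  also have "... = h (pd i (pd j f) x)"
  using assms that by (auto simp: C2_on_def pd_linear)
  finally show ?thesis by simp
 qed
 have "Re (pd i (pd j f) x) = Re (pd j (pd i f) x)"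
  unfolding lin[OF bounded_linear_Re]
  by (rule pd_commute_real[OF assms(1) C2_on_linear[OF bounded_linear_Re assms(2,1)] assms(3)])
 moreover have "Im (pd i (pd j f) x) = Im (pd j (pd i f) x)"
  unfolding lin[OF bounded_linear_Im]
  by (rule pd_commute_real[OF assms(1) C2_on_linear[OF bounded_linear_Im assms(2,1)] assms(3)])
 ultimately show ?thesis by (simp add: complex_eq_iff)
qed

section \<open>Integration over the unit sphere\<close>

text \<open>Surface measure up to a factor: the push-forward of volume on the punctured unit ball
  under radial projection. The total mass is the volume of the ball, one third of the area of the
  sphere, and this is the origin of the factor 3 in the polar formula. Finiteness and rotation
  invariance are inherited from Lebesgue measure.\<close>

definition sphM :: "(real^3) measure" where
 "sphM = distr (restrict_space lborel (ball 0 1 - {0})) (restrict_space borel (sphere 0 1))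
  (%x. x /\<^sub>R norm x)"

lemma space_sphM [simp]: "space sphM = sphere 0 1"
 by (simp add: sphM_def space_restrict_space)

lemma sets_sphM [measurable_cong]: "sets sphM = sets (restrict_space borel (sphere 0 1))"
 by (simp add: sphM_def)

lemma sphM_map [measurable]:
 "(%x. x /\<^sub>R norm x) : restrict_space lborel (ball 0 1 - {0}) \<rightarrow>\<^sub>M restrict_space borel (sphere 0 (1::real) :: (real^3) set)"
 by (intro measurable_restrict_space2 measurable_restrict_space1) (auto simp: space_restrict_space)

lemma nn_integral_sphM:
 assumes [measurable]: "f : borel_measurable borel"
 shows "(\<integral>\<^sup>+x. f x \<partial>sphM) = (NN x. f (x /\<^sub>R norm x) * indicator (ball 0 1 - {0}) x)"
proof -
 have f: "f : borel_measurable (distr (restrict_space lborel (ball 0 1 - {0}))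
  (restrict_space borel (sphere 0 1)) (%x. x /\<^sub>R norm x))"
  unfolding measurable_distr_eq1 by (rule measurable_restrict_space1) measurable
 have "(\<integral>\<^sup>+x. f x \<partial>sphM) = (\<integral>\<^sup>+x. f (x /\<^sub>R norm x) \<partial>restrict_space lborel (ball 0 1 - {0}))"
  unfolding sphM_def by (rule nn_integral_distr[OF sphM_map f])
 also have "... = (NN x. f (x /\<^sub>R norm x) * indicator (ball 0 1 - {0}) x)"
  by (rule nn_integral_restrict_space) simp
 finally show ?thesis .
qed

lemma finite_measure_sphM: "finite_measure sphM"
proof
 have "emeasure sphM (space sphM) = emeasure (restrict_space lborel (ball 0 1 - {0::real^3})) (ball 0 1 - {0})"
  using emeasure_distr[OF sphM_map, of "sphere 0 1"]
  by (simp add: sphM_def space_restrict_space vimage_def sets_restrict_space_iff)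
  (auto intro!: arg_cong2[where f=emeasure] simp: space_restrict_space)
 also have "... = emeasure lborel (ball 0 1 - {0::real^3})"
  by (rule emeasure_restrict_space) auto
 also have "... <= emeasure lborel (ball 0 1 :: (real^3) set)"
  by (rule emeasure_mono) auto
 also have "... < \<infinity>" by (rule emeasure_lborel_ball_finite)
 finally show "emeasure sphM (space sphM) ~= \<infinity>" by simp
qed

interpretation sphM: finite_measure sphM by (rule finite_measure_sphM)

lemma nn_integral_lborel_scale:
 fixes f :: "real^3 => ennreal"
 assumes [measurable]: "f : borel_measurable borel" and c: "c > 0"
 shows "(NN x. f x) = ennreal (c ^ 3) * (NN x. f (c *r x))"
 using c
 by (subst lborel_affine[of c 0])
  (simp_all add: nn_integral_density nn_integral_distr nn_integral_cmult ennreal_power)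

lemma nn_integral_inverse_pow4:
 assumes "a > 0"
 shows "(NN t. ennreal (3 / t ^ 4) * indicator {a<..} t) = ennreal (1 / a ^ 3)"
proof -
 have "(NN t. ennreal (3 / t ^ 4) * indicator {a<..} t) =
  (NN t. ennreal (3 / t ^ 4) * indicator {a..} t)"
  by (rule nn_integral_cong_AE, rule AE_mp[OF AE_lborel_singleton[of a]])
  (auto simp: indicator_def)
 also have "... = ennreal (0 - (- (1 / a ^ 3)))"
 proof (rule nn_integral_FTC_atLeast)
  show "((%t::real. 3 / t ^ 4)) : borel_measurable borel" by measurable
  show "((%t. - (1 / t ^ 3)) has_real_derivative 3 / t ^ 4) (at t)" if "a <= t" for t
  using that assms by (auto intro!: derivative_eq_intros simp: field_simps eval_nat_numeral)
  show "0 <= 3 / t ^ 4" for t :: real by simp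
  show "((%t::real. - (1 / t ^ 3)) ---> 0) at_top"
  using tendsto_minus[OF tendsto_divide_0[OF tendsto_const filterlim_at_top_imp_at_infinity[OF
  filterlim_pow_at_top[OF _ filterlim_ident, of 3]], of 1]] by simp
 qed
 finally show ?thesis by simp
qed

text \<open>The sphere measure is itself a volume integral, so this is pure Fubini in
  \<open>r\<close> and \<open>x\<close>. The substitutions \<open>r = |x| t\<close> and
  \<open>y = t x\<close> leave the weight \<open>3 / t^4\<close> over \<open>t > |y|\<close>, whose
  integral \<open>|y|^-3\<close> cancels the remaining Jacobian \<open>|y|^3\<close>.\<close>

lemma nn_integral_polar:
 fixes f :: "real^3 => ennreal"
 assumes f[measurable]: "f : borel_measurable borel"
 shows "(NN x. f x) =
  (NN r. ennreal (3 * r^2) * indicator {0<..} r * (\<integral>\<^sup>+y. f (r *r y) \<partial>sphM))"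
proof -
 define I where "I = (%x::real^3. indicator (ball 0 1 - {0}) x :: ennreal)"
 have [measurable]: "I : borel_measurable borel" unfolding I_def
  by (rule borel_measurable_indicator) simp
 define J where "J = (%r::real. indicator {0<..} r :: ennreal)"
 have [measurable]: "J : borel_measurable borel" unfolding J_def by measurable
 let ?h = "%t y. ennreal (norm y ^ 3) * f y * I (y /\<^sub>R t)"
 let ?g = "%t x. ennreal (norm x ^ 3) * f (t *r x) * I x"
 have "(NN r. ennreal (3 * r^2) * J r * (\<integral>\<^sup>+y. f (r *r y) \<partial>sphM))
  = (NN r. (NN x. ennreal (3 * r^2) * J r * (f (r *r (x /\<^sub>R norm x)) * I x)))"
  by (simp add: nn_integral_sphM[of "%y. f (_ *r y)"] I_def[symmetric] nn_integral_cmult)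
 also have "... = (NN x. (NN r. ennreal (3 * r^2) * J r * (f (r *r (x /\<^sub>R norm x)) * I x)))"
  by (rule lborel_pair.Fubini') measurable
 also have "... = (NN x. (NN t. ennreal (3 * t^2) * J t * ?g t x))"
 proof (rule nn_integral_cong)
  fix x :: "real^3"
  show "(NN r. ennreal (3 * r^2) * J r * (f (r *r (x /\<^sub>R norm x)) * I x)) =
  (NN t. ennreal (3 * t^2) * J t * ?g t x)"
  proof (cases "x = 0")
  case True then show ?thesis by (simp add: I_def)
  next
  case False
  then have n: "norm x > 0" by simp
  have "(NN r. ennreal (3 * r^2) * J r * (f (r *r (x /\<^sub>R norm x)) * I x)) =
  ennreal \<bar>norm x\<bar> * (NN t. ennreal (3 * (0 + norm x * t)^2) * J (0 + norm x * t) * (f ((0 + norm x * t) *r (x /\<^sub>R norm x)) * I x))"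
  by (rule nn_integral_real_affine) (use n in auto)
  also have "... = (NN t. ennreal (norm x) * (ennreal (3 * (norm x * t)^2) * J (norm x * t) * (f ((norm x * t) *r (x /\<^sub>R norm x)) * I x)))"
  by (subst nn_integral_cmult) auto
  also have "... = (NN t. ennreal (3 * t^2) * J t * ?g t x)"
  proof (rule nn_integral_cong)
  fix t :: real
  have 1: "J (norm x * t) = J t" using n by (simp add: J_def indicator_def zero_less_mult_iff)
  have 2: "(norm x * t) *r (x /\<^sub>R norm x) = t *r x" using n by simp
  have 3: "ennreal (norm x) * ennreal (3 * (norm x * t)^2) = ennreal (3 * t^2) * ennreal (norm x ^ 3)"
  proof -
  have "norm x * (3 * (norm x * t)^2) = 3 * t^2 * norm x ^ 3"
  by (simp add: power_mult_distrib power2_eq_square power3_eq_cube)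
  then show ?thesis by (simp add: ennreal_mult[symmetric])
  qed
  show "ennreal (norm x) * (ennreal (3 * (norm x * t)^2) * J (norm x * t) * (f ((norm x * t) *r (x /\<^sub>R norm x)) * I x)) =
  ennreal (3 * t^2) * J t * ?g t x"
  unfolding 1 2 using arg_cong[OF 3, of "%z. z * (J t * (f (t *r x) * I x))"] by (simp only: mult_ac)
  qed
  finally show ?thesis .
  qed
 qed
 also have "... = (NN t. (NN x. ennreal (3 * t^2) * J t * ?g t x))"
  by (rule lborel_pair.Fubini'[symmetric]) measurable
 also have "... = (NN t. (NN y. ennreal (3 / t ^ 4) * J t * ?h t y))"
 proof (rule nn_integral_cong)
  fix t :: real
  show "(NN x. ennreal (3 * t^2) * J t * ?g t x)
  = (NN y. ennreal (3 / t ^ 4) * J t * ?h t y)"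
  proof (cases "t > 0")
  case False then show ?thesis by (simp add: J_def)
  next
  case True
  have "(NN y. ennreal (3 / t ^ 4) * J t * ?h t y)
  = ennreal (t ^ 3) * (NN x. ennreal (3 / t ^ 4) * J t * (ennreal (norm (t *r x) ^ 3) * f (t *r x) * (I ((t *r x) /\<^sub>R t))))"
  using True by (intro nn_integral_lborel_scale) auto
  also have "... = (NN x. ennreal (t ^ 3) * (ennreal (3 / t ^ 4) * J t * (ennreal (norm (t *r x) ^ 3) * f (t *r x) * (I ((t *r x) /\<^sub>R t)))))"
  by (subst nn_integral_cmult) auto
  also have "... = (NN x. ennreal (3 * t^2) * J t * ?g t x)"
  proof (rule nn_integral_cong)
  fix x :: "real^3"
  have 1: "(t *r x) /\<^sub>R t = x" using True by simp
  have 2: "ennreal (t ^ 3) * ennreal (3 / t ^ 4) * ennreal (norm (t *r x) ^ 3) = ennreal (3 * t^2) * ennreal (norm x ^ 3)"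
  proof -
  have "t ^ 3 * (3 / t ^ 4) * norm (t *r x) ^ 3 = 3 * t^2 * norm x ^ 3"
  using True by (simp add: power_mult_distrib field_simps eval_nat_numeral)
  then show ?thesis using True by (simp add: ennreal_mult[symmetric])
  qed
  show "ennreal (t ^ 3) * (ennreal (3 / t ^ 4) * J t * (ennreal (norm (t *r x) ^ 3) * f (t *r x) * (I ((t *r x) /\<^sub>R t))))
  = ennreal (3 * t^2) * J t * ?g t x"
  unfolding 1 using arg_cong[OF 2, of "%z. z * (J t * (f (t *r x) * I x))"] by (simp only: mult_ac)
  qed
  finally show ?thesis by simp
  qed
 qed
 also have "... = (NN y. (NN t. ennreal (3 / t ^ 4) * J t * ?h t y))"
  by (rule lborel_pair.Fubini') measurable
 also have "... = (NN y. f y)"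
 proof (rule nn_integral_cong_AE, rule AE_mp[OF AE_lborel_singleton[of 0]], rule AE_I2, rule impI)
  fix y :: "real^3" assume y: "y ~= 0"
  have "(NN t. ennreal (3 / t ^ 4) * J t * ?h t y)
  = (NN t. (ennreal (norm y ^ 3) * f y) * (ennreal (3 / t ^ 4) * indicator {norm y<..} t))"
  proof (rule nn_integral_cong)
  fix t :: real
  have "J t * I (y /\<^sub>R t) = indicator {norm y<..} t"
  proof (cases "t > 0")
  case True
  then show ?thesis using y by (auto simp: J_def I_def indicator_def field_simps)
  next
  case False
  then have "\<not> norm y < t" using norm_ge_zero[of y] by linarith
  with False show ?thesis by (simp add: J_def)
  qed
  from arg_cong[OF this, of "%z. z * (ennreal (3 / t ^ 4) * (ennreal (norm y ^ 3) * f y))"]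
  show "ennreal (3 / t ^ 4) * J t * ?h t y =
  (ennreal (norm y ^ 3) * f y) * (ennreal (3 / t ^ 4) * indicator {norm y<..} t)"
  by (simp only: mult_ac)
  qed
  also have "... = (ennreal (norm y ^ 3) * f y) * ennreal (1 / norm y ^ 3)"
  using y by (subst nn_integral_cmult) (auto simp: nn_integral_inverse_pow4)
  also have "... = f y * (ennreal (norm y ^ 3) * ennreal (1 / norm y ^ 3))"
  by (simp add: mult_ac)
  also have "ennreal (norm y ^ 3) * ennreal (1 / norm y ^ 3) = 1"
  using y by (subst ennreal_mult[symmetric]) auto
  finally show "(NN t. ennreal (3 / t ^ 4) * J t * ?h t y) = f y"
  by simp
 qed
 finally show ?thesis by (simp add: J_def)
qed

text \<open>Dominated convergence for difference quotients. The uniform bound \<open>B\<close> on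
  the derivative and the convexity of \<open>U\<close> bound each remainder by \<open>2 * B\<close>
  times the increment, and constants are integrable on a finite measure space.\<close>

lemma has_derivative_integral_bounded:
 fixes f :: "'a::euclidean_space => 'b => 'c::{banach, second_countable_topology}"
 assumes "finite_measure M" and U: "open U" "convex U" "x0 : U"
  and d: "!!x m. x : U ==> m : space M ==> ((%x. f x m) has_derivative f' x m) (at x)"
  and int: "!!x. x : U ==> integrable M (f x)"
  and meas: "!!h. (%m. f' x0 m h) : borel_measurable M"
  and bnd: "!!x m h. x : U ==> m : space M ==> norm (f' x m h) <= B * norm h"
 shows "((%x. \<integral>m. f x m \<partial>M) has_derivative (%h. \<integral>m. f' x0 m h \<partial>M)) (at x0)"
proof -
 interpret finite_measure M by fact
 have int': "integrable M (%m. f' x0 m h)" for h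
  by (rule integrable_const_bound[where B="B * norm h"]) (use bnd U meas in auto)
 have lin: "linear (f' x0 m)" if "m : space M" for m
  using d[OF U(3) that] by (rule has_derivative_linear)
 show ?thesis
  unfolding has_derivative_at
 proof
  show "bounded_linear (%h. \<integral>m. f' x0 m h \<partial>M)"
  proof (rule bounded_linear_intro[where K="B * measure M (space M)"])
  fix h k :: 'a and r :: real
  show "(\<integral>m. f' x0 m (h + k) \<partial>M) = (\<integral>m. f' x0 m h \<partial>M) + (\<integral>m. f' x0 m k \<partial>M)"
  by (subst Bochner_Integration.integral_add[symmetric, OF int' int'])
  (auto intro!: Bochner_Integration.integral_cong simp: linear_add[OF lin])
  show "(\<integral>m. f' x0 m (r *r h) \<partial>M) = r *r (\<integral>m. f' x0 m h \<partial>M)"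
  proof -
  have "(\<integral>m. f' x0 m (r *r h) \<partial>M) = (\<integral>m. r *r f' x0 m h \<partial>M)"
  by (rule Bochner_Integration.integral_cong) (auto simp: linear_cmul[OF lin])
  then show ?thesis by simp
  qed
  have "norm (\<integral>m. f' x0 m h \<partial>M) <= (\<integral>m. norm (f' x0 m h) \<partial>M)"
  by (rule integral_norm_bound)
  also have "... <= (\<integral>m. B * norm h \<partial>M)"
  by (rule integral_mono) (use int' bnd U in auto)
  finally show "norm (\<integral>m. f' x0 m h \<partial>M) <= norm h * (B * measure M (space M))"
  by (simp add: mult_ac)
  qed
  obtain e where e: "e > 0" "ball x0 e \<subseteq> U" using U openE by blast
  define q where "q h m = (f (x0 + h) m - f x0 m - f' x0 m h) /\<^sub>R norm h" for h m
  show "(%h. norm ((\<integral>m. f (x0 + h) m \<partial>M) - (\<integral>m. f x0 m \<partial>M) - (\<integral>m. f' x0 m h \<partial>M)) / norm h) \<midarrow>0\<rightarrow> 0"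
  proof (rule tendsto_at_iff_sequentially[THEN iffD2], intro allI impI)
  fix X :: "nat => 'a"
  assume X: "\<forall>i. X i : UNIV - {0}" "X \<longlonglongrightarrow> 0"
  have evU: "\<forall>\<^sub>F i in sequentially. x0 + X i : U"
  proof -
  have "\<forall>\<^sub>F i in sequentially. dist (X i) 0 < e" using X(2) e(1) by (rule tendstoD)
  then show ?thesis by eventually_elim (use e(2) in \<open>auto simp: dist_norm subset_eq\<close>)
  qed
  have eq: "\<forall>\<^sub>F i in sequentially. norm ((\<integral>m. f (x0 + X i) m \<partial>M) - (\<integral>m. f x0 m \<partial>M) - (\<integral>m. f' x0 m (X i) \<partial>M)) / norm (X i)
  = norm (\<integral>m. q (X i) m \<partial>M)"
  using evU
  proof eventually_elim
  case (elim i)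
  have "(\<integral>m. q (X i) m \<partial>M) = ((\<integral>m. f (x0 + X i) m \<partial>M) - (\<integral>m. f x0 m \<partial>M) - (\<integral>m. f' x0 m (X i) \<partial>M)) /\<^sub>R norm (X i)"
  unfolding q_def using int[OF elim] int[OF U(3)] int'
  by (simp add: Bochner_Integration.integral_diff)
  then show ?case by (simp add: divide_inverse mult.commute)
  qed
  \<comment> \<open>The increments bring \<open>x0\<close> into \<open>U\<close> only eventually;
    dropping the first \<open>N\<close> terms makes the domination hold for every index.\<close>
  obtain N where N: "!!i. i \<ge> N ==> x0 + X i : U"
  using evU unfolding eventually_sequentially by blast
  have "(%i. \<integral>m. q (X (i + N)) m \<partial>M) \<longlonglongrightarrow> (\<integral>m. 0 \<partial>M)"
  proof (rule integral_dominated_convergence[where w="%_. 2 * B"])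
  show "(%x. 0::'c) : borel_measurable M" by simp
  show "(%m. q (X (i + N)) m) : borel_measurable M" for i
  unfolding q_def using int[OF N, of "i + N"] int[OF U(3)] int'
  by (intro borel_measurable_scaleR borel_measurable_diff borel_measurable_const
  borel_measurable_integrable) auto
  show "integrable M (%_. 2 * B)" by simp
  show "AE m in M. (%i. q (X (i + N)) m) \<longlonglongrightarrow> 0"
  proof (rule AE_I2)
  fix m assume m: "m : space M"
  have "(%h. norm (f (x0 + h) m - f x0 m - f' x0 m h) / norm h) \<midarrow>0\<rightarrow> 0"
  using d[OF U(3) m] unfolding has_derivative_at by blast
  then have "(%h. norm (q h m)) \<midarrow>0\<rightarrow> 0"
  by (simp add: q_def divide_inverse mult.commute)
  then have "(%h. q h m) \<midarrow>0\<rightarrow> 0" by (rule tendsto_norm_zero_cancel)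
  then have "((%h. q h m) \<circ> X) \<longlonglongrightarrow> 0"
  using X tendsto_at_iff_sequentially[of "%h. q h m" 0 0 UNIV] by blast
  then have "(%i. q (X i) m) \<longlonglongrightarrow> 0" by (simp add: o_def)
  then show "(%i. q (X (i + N)) m) \<longlonglongrightarrow> 0" by (rule LIMSEQ_ignore_initial_segment)
  qed
  show "AE m in M. norm (q (X (i + N)) m) <= 2 * B" for i
  proof (rule AE_I2)
  fix m assume m: "m : space M"
  let ?h = "X (i + N)"
  have hU: "x0 + ?h : U" by (rule N) simp
  have h0: "norm ?h > 0" using X(1) by auto
  have "norm (f (x0 + ?h) m - f x0 m) <= B * norm (x0 + ?h - x0)"
  proof (rule differentiable_bound[OF U(2) _ _ hU U(3)])
  fix x assume x: "x : U"
  show "((%x. f x m) has_derivative f' x m) (at x within U)"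
  using d[OF x m] by (rule has_derivative_at_withinI)
  show "onorm (f' x m) <= B" by (rule onorm_le) (use bnd[OF x m] in auto)
  qed
  moreover have "norm (f' x0 m ?h) <= B * norm ?h" using bnd U(3) m by blast
  ultimately have "norm (f (x0 + ?h) m - f x0 m - f' x0 m ?h) <= 2 * B * norm ?h"
  using norm_triangle_ineq4[of "f (x0 + ?h) m - f x0 m" "f' x0 m ?h"] by simp
  then show "norm (q ?h m) <= 2 * B"
  using h0 by (simp add: q_def mult.commute[of "inverse _"] divide_inverse[symmetric] pos_divide_le_eq)
  qed
  qed
  then have "(%i. \<integral>m. q (X i) m \<partial>M) \<longlonglongrightarrow> 0"
  using LIMSEQ_offset[of "%i. \<integral>m. q (X i) m \<partial>M" N 0] by simp
  then have "(%i. norm (\<integral>m. q (X i) m \<partial>M)) \<longlonglongrightarrow> 0" by (rule tendsto_norm_zero)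
  then show "((%h. norm ((\<integral>m. f (x0 + h) m \<partial>M) - (\<integral>m. f x0 m \<partial>M) - (\<integral>m. f' x0 m h \<partial>M)) / norm h) \<circ> X) \<longlonglongrightarrow> 0"
  unfolding o_def using eq by (subst tendsto_cong) auto
  qed
 qed
qed

lemma continuous_on_integral_bounded:
 fixes f :: "'a::euclidean_space => 'b => 'c::{banach, second_countable_topology}"
 assumes "finite_measure M" and U: "open U"
  and c: "!!m. m : space M ==> cont_on U (%x. f x m)"
  and meas: "!!x. x : U ==> f x : borel_measurable M"
  and bnd: "!!x. x : U ==> \<exists>e>0. \<exists>B. \<forall>y\<in>ball x e \<inter> U. \<forall>m\<in>space M. norm (f y m) <= B"
 shows "cont_on U (%x. \<integral>m. f x m \<partial>M)"
proof (rule continuous_at_imp_continuous_on, rule ballI)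
 interpret finite_measure M by fact
 fix x assume x: "x : U"
 from bnd[OF this] obtain e B where e: "e > 0" and B: "!!y m. y : ball x e \<inter> U ==> m : space M ==> norm (f y m) <= B"
  by blast
 show "isCont (%x. \<integral>m. f x m \<partial>M) x"
 proof (rule continuous_at_sequentiallyI)
  fix X :: "nat => 'a" assume X: "X \<longlonglongrightarrow> x"
  have "\<forall>\<^sub>F i in sequentially. X i : ball x e \<inter> U"
  using topological_tendstoD[OF X, of "ball x e \<inter> U"] U x e by auto
  then obtain N where N: "!!i. i \<ge> N ==> X i : ball x e \<inter> U"
  unfolding eventually_sequentially by blast
  have "(%i. \<integral>m. f (X (i + N)) m \<partial>M) \<longlonglongrightarrow> (\<integral>m. f x m \<partial>M)"
  proof (rule integral_dominated_convergence[where w="%_. B"])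
  show "f x : borel_measurable M" by (rule meas[OF x])
  show "f (X (i + N)) : borel_measurable M" for i using N[of "i + N"] by (intro meas) auto
  show "integrable M (%_. B)" by simp
  show "AE m in M. (%i. f (X (i + N)) m) \<longlonglongrightarrow> f x m"
  proof (rule AE_I2)
  fix m assume "m : space M"
  from c[OF this] have "isCont (%x. f x m) x" using U x continuous_on_eq_continuous_at by blast
  then have "(%i. f (X i) m) \<longlonglongrightarrow> f x m" using X by (rule isCont_tendsto_compose)
  then show "(%i. f (X (i + N)) m) \<longlonglongrightarrow> f x m" by (rule LIMSEQ_ignore_initial_segment)
  qed
  show "AE m in M. norm (f (X (i + N)) m) <= B" for i
  using B[OF N[of "i + N"]] by (auto intro!: AE_I2)
  qed
  then show "(%i. \<integral>m. f (X i) m \<partial>M) \<longlonglongrightarrow> (\<integral>m. f x m \<partial>M)" by (rule LIMSEQ_offset)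
 qed
qed

section \<open>Spherical means and their radial derivatives\<close>

definition sph :: "(real^3 => 'a::{banach, second_countable_topology}) => 'a" where
 "sph f = integral\<^sup>L sphM f"

abbreviation sphr :: "real => (real^3 => 'a::{banach, second_countable_topology}) => 'a" where
  "sphr r f == sph (%y. f (r *r y))"

lemma measurable_sphM_continuous:
 fixes f :: "real^3 => 'a::{banach, second_countable_topology}"
 assumes "cont_on (sphere 0 1) f"
 shows "f : borel_measurable sphM"
 using borel_measurable_continuous_on_restrict[OF assms]
 by (simp add: measurable_cong_sets[OF sets_sphM refl])

lemma integrable_sphM_continuous:
 fixes f :: "real^3 => 'a::{banach, second_countable_topology}"
 assumes "cont_on (sphere 0 1) f"
 shows "integrable sphM f"
proof -
 have "bounded (f ` sphere 0 1)"
  using assms by (intro compact_imp_bounded compact_continuous_image) auto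
 then obtain B where "!!x. x : sphere 0 1 ==> norm (f x) <= B" unfolding bounded_iff by blast
 then show ?thesis
  by (intro sphM.integrable_const_bound[where B=B] measurable_sphM_continuous[OF assms])
  (auto intro!: AE_I2)
qed

definition shell :: "real => real => (real^3) set" where
 "shell a b = {x. a < norm x & norm x < b}"

lemma open_shell [simp]: "open (shell a b)"
 unfolding shell_def by (intro open_Collect_conj open_Collect_less continuous_intros)

lemma shell_scale: "y : sphere 0 1 ==> 0 <= a ==> a < r ==> r < b ==> r *r y : shell a b"
 by (simp add: shell_def)

lemma continuous_on_shell_sphere:
 assumes "cont_on (shell a b) f" "0 <= a" "a < r" "r < b"
 shows "cont_on (sphere 0 1) (%y. f (r *r y))"
 by (rule continuous_on_compose2[OF assms(1)]) (use assms shell_scale in \<open>auto intro!: continuous_intros\<close>)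

lemma integrable_shell:
 fixes f :: "real^3 => 'a::{banach, second_countable_topology}"
 assumes "cont_on (shell a b) f" "0 <= a" "a < r" "r < b"
 shows "integrable sphM (%y. f (r *r y))"
 by (rule integrable_sphM_continuous[OF continuous_on_shell_sphere[OF assms]])

text \<open>Compactness of a closed shell around the sphere of radius \<open>r\<close> supplies the
  uniform bound that differentiation and continuity in the radius require.\<close>

lemma shell_bounded:
 fixes f :: "real^3 => 'a::real_normed_vector"
 assumes "cont_on (shell a b) f" "0 <= a" "a < r" "r < b"
 obtains e B where "e > 0" "a < r - e" "r + e < b"
  "!!s y. \<bar>s - r\<bar> <= e ==> y : sphere 0 1 ==> norm (f (s *r y)) <= B"
proof -
 define e where "e = min (r - a) (b - r) / 2"
 have e: "e > 0" "a < r - e" "r + e < b" using assms by (auto simp: e_def min_def field_simps)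
 let ?K = "(%(s, y). s *r y) ` ({r - e..r + e} \<times> (sphere 0 1 :: (real^3) set))"
 have "compact ?K"
  by (intro compact_continuous_image compact_Times)
  (auto intro!: continuous_intros simp: split_beta)
 moreover have sub: "?K \<subseteq> shell a b" using e assms by (auto simp: shell_def)
 ultimately have "bounded (f ` ?K)"
  using continuous_on_subset[OF assms(1) sub] by (metis compact_continuous_image compact_imp_bounded)
 then obtain B where B: "!!x. x : ?K ==> norm (f x) <= B" unfolding bounded_iff by blast
 show thesis
 proof (rule that[OF e])
  fix s y assume "\<bar>s - r\<bar> <= e" "y : sphere (0::real^3) 1"
  then have "(s, y) : {r - e..r + e} \<times> sphere 0 1" by auto
  then show "norm (f (s *r y)) <= B" by (intro B) (rule image_eqI[of _ _ "(s, y)"], simp_all)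
 qed
qed

lemma continuous_on_sph:
 fixes f :: "real^3 => 'a::{banach, second_countable_topology}"
 assumes f: "cont_on (shell a b) f" and a: "0 <= a"
 shows "cont_on {a<..<b} (%r. sphr r f)"
 unfolding sph_def
proof (rule continuous_on_integral_bounded)
 show "cont_on {a<..<b} (%r. f (r *r m))" if "m : space sphM" for m
 proof (rule continuous_on_compose2[OF f])
  show "cont_on {a<..<b} (%r. r *r m)" by (intro continuous_intros)
  show "(%r. r *r m) ` {a<..<b} \<subseteq> shell a b" using that a by (auto simp: shell_def)
 qed
 show "(%m. f (r *r m)) : borel_measurable sphM" if "r : {a<..<b}" for r
  by (rule measurable_sphM_continuous[OF continuous_on_shell_sphere[OF f a]]) (use that in auto)
 show "\<exists>e>0. \<exists>B. \<forall>s\<in>ball r e \<inter> {a<..<b}. \<forall>m\<in>space sphM. norm (f (s *r m)) <= B"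
  if "r : {a<..<b}" for r
 proof -
  from that have r: "a < r" "r < b" by auto
  obtain e B where eB: "e > 0" "a < r - e" "r + e < b"
  "!!s y. \<bar>s - r\<bar> <= e ==> y : sphere 0 1 ==> norm (f (s *r y)) <= B"
  by (rule shell_bounded[OF f a r]) (rule that)
  show ?thesis
  proof (rule exI[of _ e], rule conjI[OF eB(1)], rule exI[of _ B], intro ballI)
  fix s m assume "s : ball r e \<inter> {a<..<b}" "m : space sphM"
  then show "norm (f (s *r m)) <= B" by (intro eB(4)) (auto simp: dist_real_def)
  qed
 qed
qed (simp_all add: finite_measure_sphM)

text \<open>The Euler derivative \<open>x . grad\<close>, that is \<open>r d/dr\<close>. It becomes
  plain differentiation in the variable \<open>ln r\<close>.\<close>

definition euler :: "(real^3 => 'a::real_normed_vector) => real^3 => 'a" where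
 "euler f x = (SU i. (x $ i) *r pd i f x)"

lemma ray_deriv:
 fixes f :: "real^3 => 'a::real_normed_vector"
 assumes "f differentiable (at (r *r y))"
 shows "((%r. f (r *r y)) has_derivative (%h. h *r (SU i. (y $ i) *r pd i f (r *r y)))) (at r)"
proof -
 have 1: "((%r. r *r y) has_derivative (%h. h *r y)) (at r)"
  by (auto intro!: derivative_eq_intros)
 show ?thesis
  using diff_chain_at[OF 1 has_derivative_pd[OF assms]]
  by (simp add: o_def scaleR_sum_right)
qed

lemma continuous_on_euler:
 assumes "C1_on S f" shows "cont_on S (euler f)"
 unfolding euler_def by (intro continuous_intros C1_onD(2)[OF assms])

lemma sph_deriv:
 fixes f :: "real^3 => 'a::euclidean_space"
 assumes f: "C1_on (shell a b) f" and a: "0 <= a" "a < r" "r < b"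
 shows "((%r. sphr r f) has_vector_derivative (1 / r) *r sphr r (euler f)) (at r)"
proof -
 define g where "g s y = (SU i. (y $ i) *r pd i f (s *r y))" for s :: real and y :: "real^3"
 have cp: "cont_on (shell a b) (pd i f)" for i by (rule C1_onD(2)[OF f])
 have g: "g s y = (1 / s) *r euler f (s *r y)" if "s ~= 0" for s y
  using that by (simp add: g_def euler_def scaleR_sum_right)
 obtain e B where e: "e > 0" "a < r - e" "r + e < b"
  and B: "!!s y. \<bar>s - r\<bar> <= e ==> y : sphere 0 1 ==> norm (euler f (s *r y)) <= B"
  by (rule shell_bounded[OF continuous_on_euler[OF f] a]) (rule that)
 have "r - e > 0" using e a by auto
 have cg: "cont_on (sphere 0 1) (g r)"
  unfolding g_def by (intro continuous_intros continuous_on_shell_sphere[OF cp a])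
 have "((%r. \<integral>y. f (r *r y) \<partial>sphM) has_derivative (%h. \<integral>y. h *r g r y \<partial>sphM)) (at r)"
 proof (rule has_derivative_integral_bounded[where U="{r - e<..<r + e}" and B="B / (r - e)"
  and f'="%s y h. h *r g s y"])
  fix s y assume s: "s : {r - e<..<r + e}" and y: "y : space sphM"
  have "s *r y : shell a b" by (rule shell_scale) (use s y e a in auto)
  then show "((%r. f (r *r y)) has_derivative (%h. h *r g s y)) (at s)"
  unfolding g_def by (intro ray_deriv C1_onD(1)[OF f])
  fix h :: real
  have "norm (g s y) <= B / (r - e)"
  proof -
  have nB: "norm (euler f (s *r y)) <= B" using s y by (intro B) auto
  then have B0: "0 <= B" using norm_ge_zero order_trans by blast
  have "norm (g s y) = norm (euler f (s *r y)) / s"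
  using s `r - e > 0` by (subst g) (auto simp: divide_inverse mult.commute)
  also have "... <= B / (r - e)"
  using s `r - e > 0` nB B0 by (intro frac_le) auto
  finally show ?thesis .
  qed
  then show "norm (h *r g s y) <= B / (r - e) * norm h"
  using mult_left_mono[of "norm (g s y)" "B / (r - e)" "norm h"] by (simp add: mult.commute)
 next
  show "integrable sphM (%y. f (s *r y))" if "s : {r - e<..<r + e}" for s
  by (rule integrable_shell[OF C1_onD(3)[OF f]]) (use that e a in auto)
  show "(%y. h *r g r y) : borel_measurable sphM" for h :: real
  by (intro borel_measurable_scaleR borel_measurable_const measurable_sphM_continuous[OF cg])
 qed (use e finite_measure_sphM in auto)
 moreover have "(\<integral>y. h *r g r y \<partial>sphM) = h *r ((1 / r) *r sphr r (euler f))" for h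
 proof -
  have "(\<integral>y. h *r g r y \<partial>sphM) = h *r (\<integral>y. g r y \<partial>sphM)"
  by simp
  also have "(\<integral>y. g r y \<partial>sphM) = (\<integral>y. (1 / r) *r euler f (r *r y) \<partial>sphM)"
  using a by (intro Bochner_Integration.integral_cong) (auto simp: g)
  finally show ?thesis by (simp add: sph_def)
 qed
 ultimately show ?thesis unfolding has_vector_derivative_def sph_def by simp
qed

section \<open>Rotations and tangential derivatives\<close>

text \<open>The generator of rotations in the plane of the axes \<open>i\<close> and
  \<open>j\<close>. These derivatives are tangent to all spheres about the origin and commute with
  \<open>euler\<close>; together with it they span all first derivatives off the origin.\<close>

definition ang :: "3 => 3 => (real^3 => 'a::real_normed_vector) => real^3 => 'a" where
 "ang i j f x = (x $ i) *r pd j f x - (x $ j) *r pd i f x"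

definition rot :: "3 => 3 => real => real^3 => real^3" where
 "rot i j t x = (\<chi> k. if k = i then cos t * x $ i - sin t * x $ j
  else if k = j then cos t * x $ j + sin t * x $ i else x $ k)"

lemma rot_0 [simp]: "rot i j 0 x = x"
 by (simp add: rot_def vec_eq_iff)

lemma rot_norm [simp]:
 assumes "i ~= j"
 shows "norm (rot i j t x) = norm x"
proof -
 have "(c * a - s * b)^2 + (c * b + s * a)^2 = (c^2 + s^2) * (a^2 + b^2)" for a b c s :: real
  by (simp add: power2_eq_square ags)
 from this[of "cos t" _ "sin t"]
 have *: "(cos t * a - sin t * b)^2 + (cos t * b + sin t * a)^2 = a^2 + b^2" for a b
  by (simp del: power2_eq_square)
 have "norm (rot i j t x) ^ 2 = norm x ^ 2"
  using assms *[of "x $ 1" "x $ 2"] *[of "x $ 2" "x $ 1"] *[of "x $ 1" "x $ 3"]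
  *[of "x $ 3" "x $ 1"] *[of "x $ 2" "x $ 3"] *[of "x $ 3" "x $ 2"]
  unfolding norm_3 using exhaust_3[of i] exhaust_3[of j]
  by (elim disjE) (simp_all add: rot_def)
 then show ?thesis by simp
qed

lemma rot_linear: "linear (rot i j t)"
 by (rule linearI) (auto simp: rot_def vec_eq_iff ags)

lemma continuous_on_rot: "cont_on A (rot i j t)"
 by (rule linear_continuous_on[OF linear_conv_bounded_linear[THEN iffD1, OF rot_linear]])

lemma rot_orth: "i ~= j ==> orthogonal_transformation (rot i j t)"
 by (simp add: orthogonal_transformation rot_linear)

text \<open>Lebesgue measure is determined by its values on boxes, and the preimage of a box under
  an orthogonal map is its image under the inverse, again orthogonal and hence volume
  preserving.\<close>

lemma lborel_distr_orthogonal: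
 fixes f :: "real^3 => real^3"
 assumes "orthogonal_transformation f"
 shows "distr lborel borel f = lborel"
proof (rule sym, rule lborel_eqI)
 have lin: "linear f" using assms by (rule orthogonal_transformation_linear)
 have fm[measurable]: "f : borel_measurable borel"
  by (rule borel_measurable_continuous_onI)
  (rule linear_continuous_on[OF linear_conv_bounded_linear[THEN iffD1, OF lin]])
 have bij: "bij f" using assms by (rule orthogonal_transformation_bij)
 have oi: "orthogonal_transformation (inv f)" using assms by (rule orthogonal_transformation_inv)
 fix l u :: "real^3" assume lu: "!!b. b : Basis ==> l \<bullet> b <= u \<bullet> b"
 have vi: "f -` box l u = inv f ` box l u" using bij by (rule bij_vimage_eq_inv_image)
 have ms: "f -` box l u : sets borel"
  using measurable_sets[OF fm, of "box l u"] by simp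
 have lm: "inv f ` box l u : lmeasurable"
  by (rule measurable_orthogonal_image[OF oi]) simp
 have "emeasure (distr lborel borel f) (box l u) = emeasure lborel (f -` box l u)"
  by (subst emeasure_distr) auto
 also have "... = emeasure lebesgue (inv f ` box l u)"
  using ms unfolding vi by simp
 also have "... = ennreal (measure lebesgue (inv f ` box l u))"
  by (rule emeasure_eq_measure2) (rule lm)
 also have "measure lebesgue (inv f ` box l u) = measure lebesgue (box l u)"
  by (rule measure_orthogonal_image[OF oi]) simp
 also have "ennreal (measure lebesgue (box l u)) = (\<Prod>b\<in>Basis. (u - l) \<bullet> b)"
  using lu by (simp add: measure_lborel_box_eq)
 finally show "emeasure (distr lborel borel f) (box l u) = (\<Prod>b\<in>Basis. (u - l) \<bullet> b)" .
qed simp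

text \<open>Radial projection commutes with rotations and the punctured ball is invariant under
  them, so the invariance of volume passes to the sphere measure.\<close>

lemma sph_rot:
 fixes g :: "real^3 => 'a::{banach, second_countable_topology}"
 assumes g: "cont_on (sphere 0 1) g" and ij: "i ~= j"
 shows "sph (%y. g (rot i j t y)) = sph g"
proof -
 let ?R = "rot i j t"
 have cR: "cont_on A ?R" for A by (rule continuous_on_rot)
 have Rm[measurable]: "?R : borel_measurable borel"
  by (rule borel_measurable_continuous_onI[OF cR])
 have sphI: "sph h = (LB x. indicator (ball 0 1 - {0}) x *r h (x /\<^sub>R norm x))"
  if h: "cont_on (sphere 0 1) h" for h :: "real^3 => 'a"
 proof -
  have "sph h = (\<integral>x. h (x /\<^sub>R norm x) \<partial>restrict_space lborel (ball 0 1 - {0}))"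
  unfolding sph_def sphM_def
  by (rule integral_distr[OF sphM_map borel_measurable_continuous_on_restrict[OF h]])
  then show ?thesis by (subst (asm) integral_restrict_space) simp_all
 qed
 have cgR: "cont_on (sphere 0 1) (%y. g (?R y))"
  by (rule continuous_on_compose2[OF g cR]) (use ij in auto)
 define F where "F x = indicator (ball 0 1 - {0}) x *r g (x /\<^sub>R norm x)" for x :: "real^3"
 have cF: "cont_on (ball 0 1 - {0}) (%x. g (x /\<^sub>R norm x))"
  by (rule continuous_on_compose2[OF g]) (auto intro!: continuous_intros left_inverse)
 have Fm: "F : borel_measurable borel"
  unfolding F_def
  by (rule borel_measurable_continuous_on_indicator[OF _ cF]) simp
 have "sph (%y. g (?R y)) = (LB x. F (?R x))"
  unfolding sphI[OF cgR]
 proof (rule Bochner_Integration.integral_cong[OF refl])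
  fix x :: "real^3"
  have "?R x = 0 \<longleftrightarrow> x = 0" using rot_norm[OF ij, of t x] by (metis norm_eq_zero)
  then have "indicator (ball 0 1 - {0}) (?R x) = (indicator (ball 0 1 - {0}) x :: real)"
  by (simp add: indicator_def rot_norm[OF ij])
  then show "indicator (ball 0 1 - {0}) x *r g (?R (x /\<^sub>R norm x)) = F (?R x)"
  unfolding F_def by (simp add: rot_norm[OF ij] linear_cmul[OF rot_linear])
 qed
 also have "... = (\<integral>x. F x \<partial>distr lborel borel ?R)"
  by (rule integral_distr[symmetric]) (use Fm in auto)
 also have "... = sph g"
  unfolding lborel_distr_orthogonal[OF rot_orth[OF ij]] sphI[OF g] F_def ..
 finally show ?thesis .
qed

lemma continuous_on_ang:
 assumes "C1_on S f" shows "cont_on S (ang i j f)"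
 unfolding ang_def by (intro continuous_intros C1_onD(2)[OF assms])

text \<open>By \<open>sph_rot\<close> the integral of \<open>f\<close> composed with the rotation by
  angle \<open>t\<close> does not depend on \<open>t\<close>; its derivative at \<open>t = 0\<close>
  is the integral of \<open>ang i j f\<close>. This stands in for the divergence theorem on the
  sphere and leaves no boundary term when integrating by parts.\<close>

lemma sph_ang_zero:
 fixes f :: "real^3 => 'a::euclidean_space"
 assumes f: "C1_on (shell a b) f" and r: "0 <= a" "a < r" "r < b"
 shows "sph (%y. ang i j f (r *r y)) = 0"
proof (cases "i = j")
 case True
 then show ?thesis by (simp add: ang_def sph_def)
next
 case ij: False
 have cf: "cont_on (shell a b) f" by (rule C1_onD(3)[OF f])
 have "r > 0" using r by simp
 have inS: "r *r rot i j t y : shell a b" if "y : sphere 0 1" for t y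
  using that r ij by (simp add: shell_def)
 obtain e B where e: "e > 0" "a < r - e" "r + e < b"
  and B: "!!s y. \<bar>s - r\<bar> <= e ==> y : sphere 0 1 ==> norm (ang i j f (s *r y)) <= B"
  by (rule shell_bounded[OF continuous_on_ang[OF f] r]) (rule that)
 have B': "norm (ang i j f (r *r rot i j t y)) <= B" if "y : sphere 0 1" for t y
  by (rule B) (use that ij e in auto)
 have "((%t. \<integral>y. f (r *r rot i j t y) \<partial>sphM) has_derivative
  (%h. \<integral>y. h *r ang i j f (r *r rot i j 0 y) \<partial>sphM)) (at 0)"
 proof (rule has_derivative_integral_bounded[where U=UNIV and B=B
  and f'="%t y h. h *r ang i j f (r *r rot i j t y)"])
  fix t :: real and y :: "real^3" assume y: "y : space sphM"
  then have y1: "y : sphere 0 1" by simp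
  let ?x = "r *r rot i j t y"
  \<comment> \<open>The velocity of the rotating point: a quarter turn of its \<open>i\<close>,
    \<open>j\<close> components, with the others at rest.\<close>
  define v :: "real^3" where "v = (\<chi> k. if k = i then - (?x $ j) else if k = j then ?x $ i else 0)"
  have "((%t. \<chi> k. r * (if k = i then cos t * y $ i - sin t * y $ j
  else if k = j then cos t * y $ j + sin t * y $ i else y $ k)) has_derivative (%h. h *r v)) (at t)"
  proof (subst has_derivative_componentwise_within, rule ballI)
  fix b :: "real^3" assume "b : Basis"
  then obtain k where k: "b = axis k 1" by (auto simp: Basis_vec_def)
  show "((%t. (\<chi> k. r * (if k = i then cos t * y $ i - sin t * y $ j
  else if k = j then cos t * y $ j + sin t * y $ i else y $ k)) \<bullet> b) has_derivative (%h. (h *r v) \<bullet> b)) (at t)"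
  unfolding k inner_axis
  using ij by (auto simp: v_def rot_def ags intro!: derivative_eq_intros)
  qed
  moreover have "(%t. \<chi> k. r * (if k = i then cos t * y $ i - sin t * y $ j
  else if k = j then cos t * y $ j + sin t * y $ i else y $ k)) = (%t. r *r rot i j t y)"
  by (simp add: fun_eq_iff vec_eq_iff rot_def)
  ultimately have 1: "((%t. r *r rot i j t y) has_derivative (%h. h *r v)) (at t)" by simp
  have "((%t. f (r *r rot i j t y)) has_derivative (%h. SU k. ((h *r v) $ k) *r pd k f ?x)) (at t)"
  using diff_chain_at[OF 1 has_derivative_pd[OF C1_onD(1)[OF f inS[OF y1]]]] by (simp add: o_def)
  moreover have "(SU k. ((h *r v) $ k) *r pd k f ?x) = h *r ang i j f ?x" for h
  proof -
  have "(SU k. ((h *r v) $ k) *r pd k f ?x) = (\<Sum>k\<in>{i, j}. ((h *r v) $ k) *r pd k f ?x)"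
  by (rule sum.mono_neutral_right) (auto simp: v_def)
  also have "... = h *r ang i j f ?x"
  using ij by (simp add: v_def ang_def ags)
  finally show ?thesis .
  qed
  ultimately show "((%t. f (r *r rot i j t y)) has_derivative (%h. h *r ang i j f ?x)) (at t)"
  by simp
  show "norm (h *r ang i j f ?x) <= B * norm h" for h
  using mult_left_mono[OF B'[OF y1, of t], of "norm h"] by (simp add: mult.commute)
 next
  fix t :: real
  show "integrable sphM (%y. f (r *r rot i j t y))"
  proof (rule integrable_sphM_continuous, rule continuous_on_compose2[OF cf])
  show "cont_on (sphere 0 1) (%y. r *r rot i j t y)"
  by (intro continuous_intros continuous_on_rot)
  qed (use inS in auto)
 next
  show "(%y. h *r ang i j f (r *r rot i j 0 y)) : borel_measurable sphM" for h
  using continuous_on_shell_sphere[OF continuous_on_ang[OF f] r]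
  by (intro borel_measurable_scaleR borel_measurable_const measurable_sphM_continuous) simp
 qed (auto simp: finite_measure_sphM)
 moreover have "(%t. \<integral>y. f (r *r rot i j t y) \<partial>sphM) = (%t. sphr r f)"
  using sph_rot[OF continuous_on_shell_sphere[OF cf r] ij] unfolding sph_def by (intro ext)
 ultimately have "((%t::real. sphr r f) has_derivative
  (%h. h *r (\<integral>y. ang i j f (r *r y) \<partial>sphM))) (at 0)"
  by simp
 then have "(%h. h *r (\<integral>y. ang i j f (r *r y) \<partial>sphM)) = (%h::real. 0)"
  by (rule has_derivative_unique) (rule has_derivative_const)
 then show ?thesis unfolding sph_def by (metis scaleR_one)
qed

section \<open>Rellich's lemma\<close>

text \<open>The radial argument in abstract form. Think of \<open>z(t)\<close> in a Hilbert space
  with \<open>z'' = (A - ka) z\<close> and \<open>A\<close> nonnegative: \<open>n = |z|^2\<close>,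
  \<open>Z = |z'|^2\<close>, \<open>L = <A z, z>\<close>, and the energy
  \<open>Q = Z - L + ka n\<close> changes only through \<open>ka' = 2 ka\<close>. If its increments
  over unit intervals die out, the solution is zero.\<close>

lemma rellich_ode:
 fixes n n1 n2 Q Z L ka :: "real => real"
 assumes dn: "!!t. t > t0 ==> (n has_real_derivative n1 t) (at t)"
  and dn1: "!!t. t > t0 ==> (n1 has_real_derivative n2 t) (at t)"
  and dQ: "!!t. t > t0 ==> (Q has_real_derivative 2 * ka t * n t) (at t)"
  and n2: "!!t. t > t0 ==> n2 t = 2 * Z t + 2 * L t - 2 * ka t * n t"
  and Q: "!!t. t > t0 ==> Q t = Z t - L t + ka t * n t"
  and cs: "!!t. t > t0 ==> (n1 t)^2 <= 4 * n t * Z t"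
  and pos: "!!t. t > t0 ==> 0 <= n t" "!!t. t > t0 ==> 0 <= Z t" "!!t. t > t0 ==> 0 <= L t"
  and ka: "ka0 > 0" "!!t. t > t0 ==> ka0 <= ka t"
  and lim: "((%s. Q (s + 1) - Q s) ---> 0) at_top"
  and s: "s > t0"
 shows "n s = 0"
proof -
 have Qinc: "\<exists>\<xi>>u. \<xi> < v & Q v - Q u = (v - u) * (2 * ka \<xi> * n \<xi>)" if "t0 < u" "u < v" for u v
  by (rule MVT2) (use that dQ in auto)
 have Qmono: "Q u <= Q v" if uv: "t0 < u" "u <= v" for u v
 proof (cases "u = v")
  case False
  then obtain \<xi> where "\<xi> > u" "\<xi> < v" "Q v - Q u = (v - u) * (2 * ka \<xi> * n \<xi>)"
  using Qinc[of u v] uv by auto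
  moreover have "0 <= (v - u) * (2 * ka \<xi> * n \<xi>)"
  using ka(2)[of \<xi>] ka(1) pos(1)[of \<xi>] calculation uv by (intro mult_nonneg_nonneg) auto
  ultimately show ?thesis by linarith
 qed simp
 have lim': "\<exists>T>t0. \<forall>s\<ge>T. Q (s + 1) - Q s < e" if "e > 0" for e
 proof -
  have "\<forall>\<^sub>F s in at_top. Q (s + 1) - Q s < e" using order_tendstoD(2)[OF lim that] .
  then obtain T where "!!s. s \<ge> T ==> Q (s + 1) - Q s < e" unfolding eventually_at_top_linorder by blast
  then show ?thesis by (intro exI[of _ "max T (t0 + 1)"]) auto
 qed
 \<comment> \<open>A positive lower bound for \<open>n'\<close> would make \<open>n\<close> at least
   1 eventually, and then \<open>Q\<close> would gain at least \<open>2 * ka0\<close> over a unit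
   interval.\<close>
 have unb: False if T: "t0 < T" and d: "d > 0" and n1d: "!!t. t \<ge> T ==> d <= n1 t" for T d
 proof -
  obtain T1 where T1: "T1 > t0" "!!s. s \<ge> T1 ==> Q (s + 1) - Q s < 2 * ka0"
  using lim'[of "2 * ka0"] ka by auto
  have grow: "n T + d * (t - T) <= n t" if t: "t > T" for t
  proof -
  obtain \<xi> where "\<xi> > T" "\<xi> < t" "n t - n T = (t - T) * n1 \<xi>"
  using MVT2[of T t n n1] t T dn by auto
  moreover have "(t - T) * d <= (t - T) * n1 \<xi>"
  using n1d[of \<xi>] calculation t by (intro mult_left_mono) auto
  ultimately show ?thesis unfolding mult.commute[of d] by linarith
  qed
  define s where "s = max (T + 1 / d) T1"
  have sT: "s > T" using d by (auto simp: s_def less_max_iff_disj)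
  obtain \<xi> where \<xi>: "\<xi> > s" "\<xi> < s + 1" "Q (s + 1) - Q s = 2 * ka \<xi> * n \<xi>"
  using Qinc[of s "s + 1"] sT T by auto
  have "1 <= d * (\<xi> - T)"
  proof -
  have "1 / d <= \<xi> - T" using \<xi> unfolding s_def by linarith
  then show ?thesis using d by (simp add: field_simps)
  qed
  then have "1 <= n \<xi>" using grow[of \<xi>] pos(1)[OF T] \<xi> sT by linarith
  then have "ka0 * 1 <= ka \<xi> * n \<xi>"
  using ka(1) ka(2)[of \<xi>] \<xi> sT T by (intro mult_mono) auto
  then show False using T1(2)[of s] \<xi>(3) by (simp add: s_def)
 qed
 \<comment> \<open>Once the energy reaches \<open>q > 0\<close> it stays above, and
   \<open>n' + 2 Q\<close> has derivative \<open>2 Q + 4 L\<close>, at least \<open>2 q\<close>. As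
   \<open>Q\<close> itself gains less than \<open>q / 2\<close> per unit, \<open>n'\<close> gains at
   least \<open>q\<close> per unit and becomes large, which \<open>unb\<close> excludes.\<close>
 have Qneg: "Q t <= 0" if t: "t > t0" for t
 proof (rule ccontr)
  assume "\<not> Q t <= 0"
  define q where "q = Q t"
  have q: "q > 0" using `\<not> Q t <= 0` by (simp add: q_def)
  obtain T0 where T0: "T0 > t0" "!!s. s \<ge> T0 ==> Q (s + 1) - Q s < q / 2"
  using lim'[of "q / 2"] q by auto
  define T where "T = max T0 t"
  have T: "T > t0" "T \<ge> t" "!!s. s \<ge> T ==> Q (s + 1) - Q s < q / 2"
  using T0 t by (auto simp: T_def)
  define g where "g u = n1 u + 2 * Q u" for u
  have g: "g u + 2 * q * (v - u) <= g v" if uv: "T <= u" "u < v" for u v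
  proof -
  have "\<exists>z>u. z < v & g v - g u = (v - u) * (n2 z + 2 * (2 * ka z * n z))"
  unfolding g_def by (rule MVT2) (use uv T in \<open>auto intro!: derivative_eq_intros dn1 dQ\<close>)
  then obtain z where z: "z > u" "z < v" "g v - g u = (v - u) * (n2 z + 2 * (2 * ka z * n z))" by blast
  have "q <= Q z" unfolding q_def using Qmono[of t z] t T z uv by auto
  then have "2 * q <= n2 z + 2 * (2 * ka z * n z)"
  using n2[of z] Q[of z] pos(3)[of z] z uv T by auto
  then have "(v - u) * (2 * q) <= (v - u) * (n2 z + 2 * (2 * ka z * n z))"
  using uv by (intro mult_left_mono) auto
  then show ?thesis unfolding z(3)[symmetric] by (simp add: mult.commute)
  qed
  have step: "n1 u + q <= n1 (u + 1)" if "u \<ge> T" for u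
  using g[of u "u + 1"] T(3)[of u] that by (simp add: g_def)
  have steps: "n1 T + real m * q <= n1 (T + real m)" for m
  proof (induction m)
  case (Suc m)
  then show ?case using step[of "T + real m"] by (simp add: ags)
  qed simp
  have loc: "n1 u - q <= n1 v" if uv: "T <= u" "u <= v" "v <= u + 1" for u v
  proof (cases "u = v")
  case False
  then have "g u <= g v" using g[of u v] uv q
  by (smt (verit) mult_nonneg_nonneg)
  moreover have "Q v <= Q (u + 1)" using Qmono[of v "u + 1"] uv T by auto
  ultimately show ?thesis using T(3)[of u] uv q by (simp add: g_def)
  qed (use q in simp)
  obtain m where m: "real m * q > 1 + q - n1 T"
  using reals_Archimedean3[OF q] by blast
  have "1 <= n1 v" if v: "v \<ge> T + real m" for v
  proof -
  define k where "k = nat \<lfloor>v - T\<rfloor>"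
  have k: "real k <= v - T" "v - T <= real k + 1" "m <= k"
  using v by (auto simp: k_def le_nat_floor)
  have "real m * q <= real k * q" using k q by (intro mult_right_mono) auto
  then show ?thesis using steps[of k] loc[of "T + real k" v] k m by (auto simp: ags)
  qed
  then show False using unb[of "T + real m" 1] T by auto
 qed
 \<comment> \<open>Eliminating \<open>L\<close> gives \<open>n'' = 4 Z - 2 Q\<close>, so
   \<open>n\<close> is convex now that \<open>Q\<close> is nonpositive.\<close>
 have n2pos: "4 * Z t <= n2 t - 2 * (- Q t)" "0 <= n2 t" if "t > t0" for t
  using n2[OF that] Q[OF that] Qneg[OF that] pos(2)[OF that] by auto
 have n1neg: "n1 t <= 0" if t: "t > t0" for t
 proof (rule ccontr)
  assume "\<not> n1 t <= 0"
  moreover have "n1 t <= n1 v" if "v \<ge> t" for v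
  proof (rule DERIV_nonneg_imp_nondecreasing[OF that])
  show "\<exists>y. (n1 has_real_derivative y) (at x) & 0 <= y" if "t <= x" for x
  using dn1[of x] n2pos(2)[of x] that t by auto
  qed
  ultimately show False using unb[OF t, of "n1 t"] by auto
 qed
 show ?thesis
 proof (rule ccontr)
  assume "n s ~= 0"
  then have ns: "n s > 0" using pos(1)[OF s] by simp
  define c where "c = - n1 s / n s"
  have c: "c \<ge> 0" using n1neg[OF s] ns by (simp add: c_def divide_le_0_iff)
  \<comment> \<open>Cauchy-Schwarz in the form \<open>n'^2 <= 4 n Z <= n n''\<close> makes
    \<open>n' / n\<close> nondecreasing, so \<open>n\<close> decays at most like
    \<open>exp (- c t)\<close>. The shift to \<open>n + e\<close> avoids division by a zero of
    \<open>n\<close> before positivity is known.\<close>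
  have lower: "- c * n t <= n1 t" if t: "t \<ge> s" for t
  proof -
  have eps: "- c * (n t + e) <= n1 t" if e: "e > 0" for e
  proof -
  have p: "n u + e > 0" if "u \<ge> s" for u using pos(1)[of u] e s that by auto
  have "n1 s / (n s + e) <= n1 t / (n t + e)"
  proof (rule DERIV_nonneg_imp_nondecreasing[OF t])
  fix u assume u: "s <= u" "u <= t"
  have d: "((%u. n1 u / (n u + e)) has_real_derivative (n2 u * (n u + e) - n1 u * n1 u) / ((n u + e) * (n u + e))) (at u)"
  using u s p[of u] by (auto intro!: derivative_eq_intros dn1 dn)
  have "(n1 u)^2 <= 4 * Z u * n u" using cs[of u] u s by (simp add: mult_ac)
  also have "... <= n2 u * (n u + e)"
  using n2pos[of u] pos[of u] Qneg[of u] e u s by (intro mult_mono) auto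
  finally have "0 <= (n2 u * (n u + e) - n1 u * n1 u) / ((n u + e) * (n u + e))"
  using p[of u] u by (intro divide_nonneg_nonneg) (auto simp: power2_eq_square)
  with d show "\<exists>y. ((%u. n1 u / (n u + e)) has_real_derivative y) (at u) & 0 <= y" by blast
  qed
  moreover have "- c <= n1 s / (n s + e)"
  using ns e n1neg[OF s] unfolding c_def by (simp add: divide_left_mono_neg)
  ultimately have "- c <= n1 t / (n t + e)" by simp
  then show ?thesis using p[of t] t by (simp add: pos_le_divide_eq)
  qed
  show ?thesis
  proof (rule field_le_epsilon)
  fix e :: real assume e: "e > 0"
  have "- c * (n t + e / (c + 1)) <= n1 t" using eps[of "e / (c + 1)"] e c by auto
  moreover have "c * (e / (c + 1)) <= e" using c e by (simp add: field_simps)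
  ultimately show "- c * n t <= n1 t + e" by (simp add: ags)
  qed
  qed
  have decay: "n u * exp (c * u) <= n v * exp (c * v)" if uv: "s <= u" "u <= v" for u v
  proof (rule DERIV_nonneg_imp_nondecreasing[OF uv(2)])
  fix x assume x: "u <= x" "x <= v"
  have "((%u. n u * exp (c * u)) has_real_derivative (n1 x + c * n x) * exp (c * x)) (at x)"
  by (rule derivative_eq_intros dn refl | use x uv s in \<open>simp add: ags\<close>)+
  then show "\<exists>y. ((%u. n u * exp (c * u)) has_real_derivative y) (at x) & 0 <= y"
  using lower[of x] x uv by (intro exI conjI) (auto intro!: mult_nonneg_nonneg)
  qed
  have npos: "n t > 0" if "t \<ge> s" for t
  proof -
  have "0 < n s * exp (c * s)" using ns by simp
  also have "... <= n t * exp (c * t)" using decay[of s t] that by simp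
  finally show ?thesis by (simp add: zero_less_mult_iff)
  qed
  \<comment> \<open>Since \<open>Q\<close> is nonpositive at \<open>t + 1\<close>,
    \<open>- Q t\<close> is at least the gain over one unit, which is \<open>2 ka n\<close> at an
    intermediate time and, by the decay estimate, at least a multiple of \<open>n t\<close>.
    Inserted into \<open>n'' = 4 Z - 2 Q\<close>, this lets \<open>n' / n\<close> grow at rate at
    least \<open>d\<close>.\<close>
  define d where "d = 4 * ka0 * exp (- c)"
  have d: "d > 0" using ka by (simp add: d_def)
  have PQ: "2 * (- Q t) \<ge> d * n t" if t: "t \<ge> s" for t
  proof -
  obtain \<xi> where \<xi>: "\<xi> > t" "\<xi> < t + 1" "Q (t + 1) - Q t = 2 * ka \<xi> * n \<xi>"
  using Qinc[of t "t + 1"] t s by auto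
  have "n t * exp (c * t) <= n \<xi> * exp (c * \<xi>)" using decay[of t \<xi>] \<xi> t by simp
  also have "... <= n \<xi> * exp (c * (t + 1))"
  using \<xi> c npos[of \<xi>] t by (intro mult_left_mono) (auto intro!: mult_left_mono)
  also have "... = n \<xi> * exp c * exp (c * t)" by (simp add: ags exp_add)
  finally have "n t <= n \<xi> * exp c" by simp
  then have nx: "n t * exp (- c) <= n \<xi>" by (simp add: exp_minus field_simps)
  have "ka0 * (n t * exp (- c)) <= ka \<xi> * n \<xi>"
  using ka(1) ka(2)[of \<xi>] \<xi> t s nx npos[OF t] by (intro mult_mono) auto
  then show ?thesis using \<xi>(3) Qneg[of "t + 1"] t s by (simp add: d_def mult_ac)
  qed
  \<comment> \<open>By this time \<open>n' / n\<close> has risen from \<open>- c\<close> to at least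
    1, which contradicts \<open>n1neg\<close>.\<close>
  define T where "T = s + (c + 1) / d"
  have T: "T > s" using c d by (simp add: T_def add_nonneg_pos)
  have "n1 s / n s - d * s <= n1 T / n T - d * T"
  proof (rule DERIV_nonneg_imp_nondecreasing[where f="%u. n1 u / n u - d * u", OF less_imp_le[OF T]])
  fix u assume u: "s <= u" "u <= T"
  have nu: "n u > 0" using npos u by simp
  have der: "((%u. n1 u / n u - d * u) has_real_derivative (n2 u * n u - n1 u * n1 u) / (n u * n u) - d) (at u)"
  using u s nu by (auto intro!: derivative_eq_intros dn1 dn)
  have "(n1 u)^2 <= 4 * Z u * n u" using cs[of u] u s by (simp add: mult_ac)
  also have "... <= (n2 u - d * n u) * n u"
  using n2pos(1)[of u] PQ[of u] u s nu by (intro mult_right_mono) auto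
  finally have "d * (n u * n u) <= n2 u * n u - n1 u * n1 u"
  by (simp add: power2_eq_square ags)
  then have "0 <= (n2 u * n u - n1 u * n1 u) / (n u * n u) - d"
  using nu by (simp add: pos_le_divide_eq)
  with der show "\<exists>y. ((%u. n1 u / n u - d * u) has_real_derivative y) (at u) & 0 <= y" by blast
  qed
  moreover have "d * T = d * s + (c + 1)" using d by (simp add: T_def field_simps)
  moreover have "n1 s / n s = - c" by (simp add: c_def)
  ultimately have "1 <= n1 T / n T" by simp
  then show False using n1neg[of T] npos[of T] T s by (simp add: pos_le_divide_eq)
 qed
qed

section \<open>Linearity, order and integration by parts for spherical means\<close>

lemma sph_add:
 fixes f g :: "real^3 => 'a::{banach, second_countable_topology}"
 assumes "cont_on (sphere 0 1) f" "cont_on (sphere 0 1) g"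
 shows "sph (%y. f y + g y) = sph f + sph g"
 unfolding sph_def by (intro Bochner_Integration.integral_add integrable_sphM_continuous assms)

lemma sph_diff:
 fixes f g :: "real^3 => 'a::{banach, second_countable_topology}"
 assumes "cont_on (sphere 0 1) f" "cont_on (sphere 0 1) g"
 shows "sph (%y. f y - g y) = sph f - sph g"
 unfolding sph_def by (intro Bochner_Integration.integral_diff integrable_sphM_continuous assms)

lemma sph_sum:
 fixes f :: "'i => real^3 => 'a::{banach, second_countable_topology}"
 assumes "!!i. i : I ==> cont_on (sphere 0 1) (f i)"
 shows "sph (%y. \<Sum>i\<in>I. f i y) = (\<Sum>i\<in>I. sph (f i))"
 unfolding sph_def by (intro Bochner_Integration.integral_sum integrable_sphM_continuous assms)

lemma sph_mono:
 fixes f g :: "real^3 => real"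
 assumes "cont_on (sphere 0 1) f" "cont_on (sphere 0 1) g" "!!y. norm y = 1 ==> f y <= g y"
 shows "sph f <= sph g"
 unfolding sph_def
 by (intro integral_mono integrable_sphM_continuous assms(1,2)) (use assms(3) in auto)

lemma sph_nonneg:
 fixes f :: "real^3 => real"
 assumes "!!y. norm y = 1 ==> 0 <= f y"
 shows "0 <= sph f"
 unfolding sph_def by (rule Bochner_Integration.integral_nonneg) (use assms in auto)

lemma sph_cong:
 assumes "!!y. norm y = 1 ==> f y = g y"
 shows "sph f = sph g"
 unfolding sph_def by (rule Bochner_Integration.integral_cong) (use assms in auto)

lemma sph_linear:
 fixes f :: "real^3 => 'a::{banach, second_countable_topology}" and h :: "'a => 'b::{banach, second_countable_topology}"
 assumes "bounded_linear h" "cont_on (sphere 0 1) f"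
 shows "sph (%y. h (f y)) = h (sph f)"
 unfolding sph_def by (rule integral_bounded_linear[OF assms(1) integrable_sphM_continuous[OF assms(2)]])

text \<open>The points of the punctured ball that project into the cap form an open set containing
  \<open>y / 2\<close>, and nonempty open sets have positive volume. This is what lets a vanishing
  mean of a nonnegative continuous function be read pointwise.\<close>

lemma sphM_ball_null:
 assumes "y : sphere 0 1" "e > 0"
 shows "measure sphM (sphere 0 1 \<inter> ball y e) > 0"
proof -
 let ?U = "sphere 0 1 \<inter> ball y e"
 let ?m = "%x::real^3. x /\<^sub>R norm x"
 have y: "y ~= 0" "norm y = 1" using assms by auto
 have m: "?U : sets sphM" unfolding sets_sphM sets_restrict_space by auto
 let ?V = "?m -` ?U \<inter> space (restrict_space lborel (ball 0 1 - {0}))"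
 have V: "?V = ?m -` ball y e \<inter> (ball 0 1 - {0})"
  by (auto simp: space_restrict_space intro!: left_inverse)
 have "open ?V"
  unfolding V Int_commute[of _ "ball 0 1 - {0}"]
  by (rule continuous_open_preimage) (auto intro!: continuous_intros open_delete)
 moreover have "(1/2) *r y : ?V" unfolding V using y assms by simp
 ultimately have "\<not> negligible ?V" using open_not_negligible by blast
 then have "emeasure lborel ?V ~= 0"
  using `open ?V` by (auto simp: negligible_iff_null_sets null_sets_def)
 have "emeasure sphM ?U = emeasure (restrict_space lborel (ball 0 1 - {0})) ?V"
  unfolding sphM_def by (rule emeasure_distr[OF sphM_map]) (use m in \<open>simp add: sets_sphM\<close>)
 also have "... = emeasure lborel ?V"
  by (rule emeasure_restrict_space) (auto simp: space_restrict_space)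
 finally have "emeasure sphM ?U ~= 0" using `emeasure lborel ?V ~= 0` by simp
 then show ?thesis by (simp add: sphM.emeasure_eq_measure measure_nonneg less_le)
qed

lemma sph_eq_0D:
 fixes f :: "real^3 => real"
 assumes f: "cont_on (sphere 0 1) f" and nn: "!!y. norm y = 1 ==> 0 <= f y"
  and 0: "sph f <= 0" and y: "norm y = 1"
 shows "f y = 0"
proof (rule ccontr)
 assume "f y ~= 0"
 define d where "d = f y / 2"
 have d: "d > 0" using nn[OF y] `f y ~= 0` by (simp add: d_def)
 have ys: "y : sphere 0 1" using y by simp
 obtain e where e: "e > 0" "!!z. z : sphere 0 1 ==> dist z y < e ==> dist (f z) (f y) < d"
  using f ys d unfolding continuous_on_iff by blast
 let ?U = "sphere 0 1 \<inter> ball y e"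
 have m: "?U : sets sphM" unfolding sets_sphM sets_restrict_space by auto
 have U: "?U \<inter> sphere 0 1 = ?U" by auto
 have "d * measure sphM ?U = (\<integral>z. d * indicator ?U z \<partial>sphM)"
  using m by (simp add: U)
 also have "... <= sph f"
  unfolding sph_def
 proof (rule integral_mono)
  show "integrable sphM (%z. d * indicator ?U z)"
  by (rule integrable_mult_right, rule integrable_real_indicator[OF m]) (simp add: sphM.emeasure_eq_measure)
  show "integrable sphM f" by (rule integrable_sphM_continuous[OF f])
  fix z assume z: "z : space sphM"
  show "d * indicator ?U z <= f z"
  proof (cases "z : ball y e")
  case True
  then have "dist (f z) (f y) < d" using e(2)[of z] z by (simp add: dist_commute)
  then have "d <= f z" unfolding dist_real_def d_def by linarith
  then show ?thesis using True z by simp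
  qed (use nn z in simp)
 qed
 finally show False using sphM_ball_null[OF ys e(1)] d 0
  by (meson less_le_trans mult_pos_pos not_le order.trans)
qed

lemma sph_real:
 fixes f :: "cfun"
 assumes "cont_on (sphere 0 1) f"
 shows "Re (sph f) = sph (%y. Re (f y))" "Im (sph f) = sph (%y. Im (f y))" "cnj (sph f) = sph (%y. cnj (f y))"
 using sph_linear[OF bounded_linear_Re assms] sph_linear[OF bounded_linear_Im assms]
  sph_linear[OF bounded_linear_cnj assms] by auto

lemma ang_mult:
 fixes f g :: "cfun"
 assumes "f differentiable (at x)" "g differentiable (at x)"
 shows "ang i j (%x. f x * g x) x = ang i j f x * g x + f x * ang i j g x"
 by (simp add: ang_def pd_mult[OF assms] scaleR_conv_of_real ags)

lemma sph_ang_parts: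
 fixes f g :: "cfun"
 assumes f: "C1_on (shell a b) f" and g: "C1_on (shell a b) g" and r: "0 <= a" "a < r" "r < b"
 shows "sph (%y. ang i j f (r *r y) * g (r *r y)) = - sph (%y. f (r *r y) * ang i j g (r *r y))"
proof -
 have "0 = sph (%y. ang i j (%x. f x * g x) (r *r y))"
  by (rule sph_ang_zero[symmetric, OF C1_on_mult[OF f g] r])
 also have "... = sph (%y. ang i j f (r *r y) * g (r *r y) + f (r *r y) * ang i j g (r *r y))"
  by (rule sph_cong, rule ang_mult) (use r in \<open>auto intro!: C1_onD(1)[OF f] C1_onD(1)[OF g] simp: shell_def\<close>)
 also have "... = sph (%y. ang i j f (r *r y) * g (r *r y)) + sph (%y. f (r *r y) * ang i j g (r *r y))"
  by (intro sph_add continuous_on_mult continuous_on_shell_sphere[OF continuous_on_ang r]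
  continuous_on_shell_sphere[OF C1_onD(3) r] f g)
 finally show ?thesis by (simp add: eq_neg_iff_add_eq_0)
qed

text \<open>In the variable \<open>t = ln r\<close> the factor \<open>1 / r\<close> of
  \<open>sph_deriv\<close> disappears.\<close>

lemma sph_deriv_exp:
 fixes f :: "real^3 => 'a::euclidean_space"
 assumes f: "C1_on (shell a b) f" and a: "0 <= a" "a < exp t" "exp t < b"
 shows "((%t. sph (%y. f (exp t *r y))) has_vector_derivative sph (%y. euler f (exp t *r y))) (at t)"
proof -
 have "(exp has_vector_derivative exp t) (at t)"
  by (rule has_real_derivative_iff_has_vector_derivative[THEN iffD1]) (rule DERIV_exp)
 from vector_diff_chain_at[OF this sph_deriv[OF f a]] show ?thesis
  by (simp add: o_def)
qed

lemma euler_mult: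
 fixes f g :: "cfun"
 assumes "f differentiable (at x)" "g differentiable (at x)"
 shows "euler (%x. f x * g x) x = euler f x * g x + f x * euler g x"
 by (simp add: euler_def pd_mult[OF assms] sum_3 scaleR_conv_of_real ags)

lemma euler_cnj: "f differentiable (at x) ==> euler (%x. cnj (f x)) x = cnj (euler f x)"
 by (simp add: euler_def pd_cnj)

lemma ang_cnj: "f differentiable (at x) ==> ang i j (%x. cnj (f x)) x = cnj (ang i j f x)"
 by (simp add: ang_def pd_cnj)

lemma C1_on_euler:
 fixes f :: "cfun"
 assumes "C2_on S f" shows "C1_on S (euler f)"
 unfolding euler_def[abs_def] scaleR_conv_of_real
 by (intro C1_intros C2_onD[OF assms])

lemma C1_on_ang:
 fixes f :: "cfun"
 assumes "C2_on S f" shows "C1_on S (ang i j f)"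
 unfolding ang_def[abs_def] scaleR_conv_of_real
 by (intro C1_intros C2_onD[OF assms])

lemma pd_coord_mult:
 fixes f :: "cfun"
 assumes "f differentiable (at x)"
 shows "pd i (%x. cr (x $ j) * f x) x = (if i = j then f x else 0) + cr (x $ j) * pd i f x"
 by (subst pd_mult) (use assms in \<open>auto simp: pd_ccoord\<close>)

lemma pd_euler:
 fixes f :: "cfun"
 assumes "C2_on S f" "x : S"
 shows "pd i (euler f) x = pd i f x + (SU j. cr (x $ j) * pd i (pd j f) x)"
proof -
 have d: "pd j f differentiable (at x)" for j using assms by (auto simp: C2_on_def)
 show ?thesis
  unfolding euler_def[abs_def] scaleR_conv_of_real
  by (subst pd_sum) (auto simp: pd_coord_mult[OF d] d sum.distrib intro!: differentiable_mult)
qed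

lemma pd_ang:
 fixes f :: "cfun"
 assumes "C2_on S f" "x : S"
 shows "pd k (ang i j f) x = (if k = i then pd j f x else 0) + cr (x $ i) * pd k (pd j f) x
  - ((if k = j then pd i f x else 0) + cr (x $ j) * pd k (pd i f) x)"
proof -
 have d: "pd j f differentiable (at x)" for j using assms by (auto simp: C2_on_def)
 show ?thesis
  unfolding ang_def[abs_def] scaleR_conv_of_real
  by (subst pd_diff) (auto simp: pd_coord_mult[OF d] d intro!: differentiable_mult)
qed

lemma euler_ang_commute:
 fixes f :: "cfun"
 assumes "open S" "C2_on S f" "x : S"
 shows "euler (ang i j f) x = ang i j (euler f) x"
proof -
 note c = pd_commute[OF assms]
 have "euler (ang i j f) x = (SU k. cr (x $ k) * ((if k = i then pd j f x else 0) + cr (x $ i) * pd k (pd j f) x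
  - ((if k = j then pd i f x else 0) + cr (x $ j) * pd k (pd i f) x)))"
  unfolding euler_def[of "ang i j f"] scaleR_conv_of_real pd_ang[OF assms(2,3)] ..
 also have "... = cr (x $ i) * pd j f x - cr (x $ j) * pd i f x
  + (SU k. cr (x $ k) * (cr (x $ i) * pd j (pd k f) x - cr (x $ j) * pd i (pd k f) x))"
  unfolding c[of _ j] c[of _ i]
  by (simp add: distrib_left right_diff_distrib sum.distrib sum_subtractf if_distrib[of "(*) _"] cong: if_cong)
 also have "... = ang i j (euler f) x"
  unfolding ang_def scaleR_conv_of_real pd_euler[OF assms(2,3)]
  by (simp add: distrib_left right_diff_distrib sum_distrib_left sum_subtractf mult_ac)
 finally show ?thesis .
qed

text \<open>The Laplacian in polar form: \<open>(r d/dr)^2 = r^2 Lap - r d/dr - Lap_S\<close>, with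
  the spherical Laplacian as a sum of squared rotation derivatives. The factor 1/2 is there because
  the double sum counts each pair of axes twice.\<close>

lemma euler_euler:
 fixes f :: "cfun"
 assumes "open S" "C2_on S f" "x : S"
 shows "euler (euler f) x = cr ((norm x)^2) * (SU i. pd i (pd i f) x) - euler f x
  - (1/2) * (SU i j. ang i j (ang i j f) x)"
proof -
 note c = pd_commute[OF assms]
 have c3: "pd 2 (pd 1 f) x = pd 1 (pd 2 f) x" "pd 3 (pd 1 f) x = pd 1 (pd 3 f) x"
  "pd 3 (pd 2 f) x = pd 2 (pd 3 f) x" by (rule c)+
 have e: "euler (euler f) x = (SU i. cr (x $ i) * (pd i f x + (SU j. cr (x $ j) * pd i (pd j f) x)))"
  unfolding euler_def[of "euler f"] scaleR_conv_of_real pd_euler[OF assms(2,3)] ..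
 have a: "ang i j (ang i j f) x = cr (x $ i) * ((if j = i then pd j f x else 0) + cr (x $ i) * pd j (pd j f) x
  - (pd i f x + cr (x $ j) * pd j (pd i f) x))
  - cr (x $ j) * (pd j f x + cr (x $ i) * pd i (pd j f) x
  - ((if i = j then pd i f x else 0) + cr (x $ j) * pd i (pd i f) x))" for i j
  unfolding ang_def[of i j "ang i j f"] scaleR_conv_of_real pd_ang[OF assms(2,3)] by simp
 show ?thesis
  unfolding e a norm_3
  by (simp add: sum_3 c3 power2_eq_square euler_def scaleR_conv_of_real) (simp add: field_simps)
qed

lemma quadratic_nonneg_discriminant:
 fixes a b c :: real
 assumes "!!s. 0 <= c + 2 * s * b + s^2 * a" "0 <= a"
 shows "b^2 <= a * c"
proof (cases "a = 0")
 case True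
 have "b = 0"
 proof (rule ccontr)
  assume "b ~= 0"
  then have "c + 2 * (- (c + 1) / (2 * b)) * b = - 1" by (simp add: field_simps)
  then show False using assms(1)[of "- (c + 1) / (2 * b)"] True by simp
 qed
 then show ?thesis using True by simp
next
 case False
 then have "a > 0" using assms(2) by simp
 have "0 <= a * (c + 2 * (- b / a) * b + (- b / a)^2 * a)"
  using mult_nonneg_nonneg[OF assms(2) assms(1)[of "- b / a"]] .
 also have "... = a * c - b^2" using `a > 0` by (simp add: field_simps power2_eq_square)
 finally show ?thesis by simp
qed

text \<open>With \<open>t = ln r\<close> and \<open>z(t) = exp (t / 2) w\<close> on the sphere of
  radius \<open>exp t\<close>, the Helmholtz equation becomes
  \<open>z'' = (1/4 - Lap_S - k^2 exp (2 t)) z\<close>, the setting of \<open>rellich_ode\<close>;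
  the half power removes the first-order term. The increments of the energy over unit intervals are
  \<open>2 k^2\<close> times the shell integrals that the hypothesis sends to 0.\<close>

lemma rellich:
 fixes w :: "cfun"
 assumes r0: "0 <= r0" and w: "C2_on {x. r0 < norm x} w" and k: "0 < k"
  and helm: "!!x. r0 < norm x ==> (SU i. pd i (pd i w) x) + cr (k^2) * w x = 0"
  and lim: "((%a. integral {a..exp 1 * a} (%r. r^2 * sph (%y. (cmod (w (r *r y)))^2))) ---> 0) at_top"
  and x: "r0 < norm x"
 shows "w x = 0"
proof -
 define U where "U = {x::real^3. r0 < norm x}"
 have oU: "open U" unfolding U_def by (intro open_Collect_less continuous_intros)
 note w = w[folded U_def]
 have shU: "shell r0 b \<subseteq> U" for b by (auto simp: shell_def U_def)
 have inU: "exp t *r y : U" if "r0 < exp t" "norm y = 1" for t y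
  using that by (simp add: U_def)
 define Om where "Om t \<longleftrightarrow> r0 < exp t" for t :: real
 define C where "C f t = sph (%y. f (exp t *r y))" for f :: "cfun" and t
 have cS: "cont_on (sphere 0 1) (%y. f (exp t *r y))" if "cont_on U f" "Om t" for f :: "cfun" and t
  by (rule continuous_on_compose2[OF that(1)]) (use inU that in \<open>auto intro!: continuous_intros simp: Om_def\<close>)
 have dC: "((%t. Re (C f t)) has_real_derivative Re (C (euler f) t)) (at t)" if f: "C1_on U f" and t: "Om t" for f t
 proof -
  have "((%t. C f t) has_vector_derivative C (euler f) t) (at t)"
  unfolding C_def by (rule sph_deriv_exp[OF C1_on_subset[OF f shU[of "exp t + 1"]]]) (use r0 t in \<open>auto simp: Om_def\<close>)
  then show ?thesis
  unfolding has_real_derivative_iff_has_vector_derivative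
  by (rule bounded_linear.has_vector_derivative[OF bounded_linear_Re])
 qed
 have parts: "C (%x. ang i j f x * g x) t = - C (%x. f x * ang i j g x) t"
  if "C1_on U f" "C1_on U g" "Om t" for f g i j t
  unfolding C_def
  by (rule sph_ang_parts[OF C1_on_subset[OF that(1) shU[of "exp t + 1"]] C1_on_subset[OF that(2) shU[of "exp t + 1"]]])
  (use r0 that in \<open>auto simp: Om_def\<close>)
 have Ccong: "C f t = C g t" if "Om t" "!!x. x : U ==> norm x = exp t ==> f x = g x" for f g t
  unfolding C_def by (rule sph_cong) (use that inU in \<open>auto simp: Om_def\<close>)
 have Cadd: "C (%x. f x + g x) t = C f t + C g t" if "cont_on U f" "cont_on U g" "Om t" for f g t
  unfolding C_def by (intro sph_add cS that)
 have Csum: "C (%x. \<Sum>i\<in>I. f i x) t = (\<Sum>i\<in>I. C (f i) t)" if "!!i. i : I ==> cont_on U (f i)" "Om t"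
  for f and I :: "3 set" and t
  unfolding C_def by (intro sph_sum cS that)
 have Ccm: "C (%x. z * f x) t = z * C f t" for f t z
  unfolding C_def sph_def by simp
 have Ccnj: "C (%x. cnj (f x)) t = cnj (C f t)" for f t
  unfolding C_def sph_def by simp
 define E where "E = euler w"
 define L where "L i j = ang i j w" for i j
 note Ew = C1_on_euler[OF w, folded E_def] and Lw = C1_on_ang[OF w, folded L_def]
 have w1: "C1_on U w" by (rule C2_onD[OF w])
 note c1 = w1 Ew Lw C1_on_cnj[OF w1] C1_on_cnj[OF Ew] C1_on_cnj[OF Lw]
 note cc = C1_onD(3)[OF w1] C1_onD(3)[OF Ew] C1_onD(3)[OF Lw]
  C1_onD(3)[OF C1_on_cnj[OF w1]] C1_onD(3)[OF C1_on_cnj[OF Ew]] C1_onD(3)[OF C1_on_cnj[OF Lw]]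
  continuous_on_euler[OF Ew] continuous_on_euler[OF Lw] continuous_on_ang[OF Ew] continuous_on_ang[OF Lw]
 have dU: "f differentiable (at x)" if "C1_on U f" "x : U" for f :: "cfun" and x
  using that by (rule C1_onD(1))
 \<comment> \<open>Squared norms over the sphere of radius \<open>exp t\<close>: \<open>a\<close>
   for \<open>w\<close>, \<open>c\<close> for its Euler derivative, \<open>l\<close> for its
   rotation derivatives, with \<open>b\<close> the mixed term. The Helmholtz equation closes the
   system of their derivatives up to \<open>l'\<close>, which cancels in
   \<open>c - l\<close>.\<close>
 define a where "a t = Re (C (%x. w x * cnj (w x)) t)" for t
 define b where "b t = Re (C (%x. E x * cnj (w x)) t)" for t
 define c where "c t = Re (C (%x. E x * cnj (E x)) t)" for t
 define l where "l t = (1/2) * (SU i j. Re (C (%x. L i j x * cnj (L i j x)) t))" for t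
 define l' where "l' t = (SU i j. Re (C (%x. L i j x * cnj (euler (L i j) x)) t))" for t
 define ka where "ka t = k^2 * exp (2 * t)" for t
 have ReCcnj: "Re (C (%x. f x * cnj (g x)) t) = Re (C (%x. g x * cnj (f x)) t)" for f g t
 proof -
  have "C (%x. f x * cnj (g x)) t = C (%x. cnj (g x * cnj (f x))) t" by (simp add: mult.commute)
  also have "... = cnj (C (%x. g x * cnj (f x)) t)" by (rule Ccnj)
  finally show ?thesis by simp
 qed
 have dprod: "((%t. Re (C (%x. f x * cnj (g x)) t)) has_real_derivative
  Re (C (%x. euler f x * cnj (g x)) t) + Re (C (%x. f x * cnj (euler g x)) t)) (at t)"
  if f: "C1_on U f" and g: "C1_on U g" and t: "Om t" for f g t
 proof -
  have "C (euler (%x. f x * cnj (g x))) t = C (%x. euler f x * cnj (g x) + f x * cnj (euler g x)) t"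
  by (rule Ccong[OF t])
  (simp add: euler_mult euler_cnj dU[OF f] dU[OF g] dU[OF C1_on_cnj[OF g]])
  also have "... = C (%x. euler f x * cnj (g x)) t + C (%x. f x * cnj (euler g x)) t"
  by (intro Cadd continuous_on_mult continuous_on_cnj continuous_on_euler C1_onD(3) f g t)
  finally show ?thesis using dC[OF C1_on_mult[OF f C1_on_cnj[OF g]] t] by simp
 qed
 have EE: "euler E x = - E x - (1/2) * (SU i j. ang i j (L i j) x) - cr (ka t) * w x"
  if "x : U" "norm x = exp t" for x t
 proof -
  have lap: "(SU i. pd i (pd i w) x) = - cr (k^2) * w x"
  using helm[of x] that by (simp add: U_def eq_neg_iff_add_eq_0)
  have "(norm x)^2 = exp (2 * t)" unfolding that(2) by (simp add: exp_double)
  then have n2: "cr ((norm x)^2) * (- cr (k^2) * w x) = - (cr (ka t) * w x)"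
  unfolding ka_def by simp
  show ?thesis
  using euler_euler[OF oU w that(1)] unfolding lap n2 by (simp add: E_def L_def[abs_def])
 qed
 have CEE: "C (%x. euler E x * cnj (g x)) t = - C (%x. E x * cnj (g x)) t
  + (1/2) * (SU i j. C (%x. L i j x * cnj (ang i j g x)) t) - cr (ka t) * C (%x. w x * cnj (g x)) t"
  if g: "C1_on U g" and t: "Om t" for g t
 proof -
  have g': "C1_on U (%x. cnj (g x))" by (rule C1_on_cnj[OF g])
  note cg = C1_onD(3)[OF g']
  have "C (%x. euler E x * cnj (g x)) t =
  C (%x. (- 1) * (E x * cnj (g x)) + ((- 1/2) * (SU i j. ang i j (L i j) x * cnj (g x))
  + (- cr (ka t)) * (w x * cnj (g x)))) t"
  by (rule Ccong[OF t]) (simp add: EE ags sum_distrib_left sum_distrib_right sum_negf)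
  also have "... = (- 1) * C (%x. E x * cnj (g x)) t + ((- 1/2) * (SU i j. C (%x. ang i j (L i j) x * cnj (g x)) t)
  + (- cr (ka t)) * C (%x. w x * cnj (g x)) t)"
  proof -
  have s: "C (%x. (SU i j. ang i j (L i j) x * cnj (g x))) t
  = (SU i j. C (%x. ang i j (L i j) x * cnj (g x)) t)"
  by (subst Csum; (intro continuous_intros cc cg t)?)+ (auto intro!: sum.cong Csum continuous_on_mult cc cg t)
  show ?thesis
  unfolding s[symmetric] Ccm[symmetric]
  by (subst Cadd; (intro continuous_intros cc cg t)?)+ simp
  qed
  also have "(SU i j. C (%x. ang i j (L i j) x * cnj (g x)) t)
  = - (SU i j. C (%x. L i j x * cnj (ang i j g x)) t)"
  unfolding sum_negf[symmetric]
  proof (intro sum.cong refl)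
  fix i j :: 3
  have "C (%x. ang i j (L i j) x * cnj (g x)) t = - C (%x. L i j x * ang i j (%x. cnj (g x)) x) t"
  by (rule parts[OF Lw g' t])
  also have "C (%x. L i j x * ang i j (%x. cnj (g x)) x) t = C (%x. L i j x * cnj (ang i j g x)) t"
  by (rule Ccong[OF t]) (simp add: ang_cnj dU[OF g])
  finally show "C (%x. ang i j (L i j) x * cnj (g x)) t = - C (%x. L i j x * cnj (ang i j g x)) t" .
  qed
  finally show ?thesis by simp
 qed
 have da: "(a has_real_derivative 2 * b t) (at t)" if "Om t" for t
  using dprod[OF w1 w1 that] ReCcnj[of w E t] unfolding a_def[abs_def] b_def E_def by simp
 have db: "(b has_real_derivative c t - b t + l t - ka t * a t) (at t)" if "Om t" for t
 proof -
  have "Re (C (%x. euler E x * cnj (w x)) t) = - b t + l t - ka t * a t"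
  unfolding CEE[OF w1 that] a_def b_def l_def L_def[symmetric] by simp
  then have eq: "c t - b t + l t - ka t * a t = Re (C (%x. euler E x * cnj (w x)) t) + Re (C (%x. E x * cnj (euler w x)) t)"
  by (simp add: c_def E_def)
  show ?thesis unfolding eq unfolding b_def[abs_def] by (rule dprod[OF Ew w1 that])
 qed
 have dl: "(l has_real_derivative l' t) (at t)" if t: "Om t" for t
 proof -
  have "(l has_real_derivative (1/2) * (SU i j. (Re (C (%x. euler (L i j) x * cnj (L i j x)) t) + Re (C (%x. L i j x * cnj (euler (L i j) x)) t)))) (at t)"
  unfolding l_def[abs_def]
  by (intro DERIV_cmult DERIV_sum dprod Lw t)
  then show ?thesis
  unfolding ReCcnj[of "euler (L _ _)"] l'_def by (simp add: sum_distrib_left)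
 qed
 have dc: "(c has_real_derivative - 2 * c t + l' t - 2 * ka t * b t) (at t)" if t: "Om t" for t
 proof -
  have ea: "C (%x. L i j x * cnj (ang i j E x)) t = C (%x. L i j x * cnj (euler (L i j) x)) t" for i j
  by (rule Ccong[OF t]) (simp add: E_def L_def euler_ang_commute[OF oU w])
  have "(c has_real_derivative 2 * Re (C (%x. euler E x * cnj (E x)) t)) (at t)"
  using dprod[OF Ew Ew t] ReCcnj[of E "euler E" t] unfolding c_def[abs_def] by simp
  also have "2 * Re (C (%x. euler E x * cnj (E x)) t) = - 2 * c t + l' t - 2 * ka t * b t"
  unfolding CEE[OF Ew t] ea c_def l'_def b_def ReCcnj[of E w] by (simp add: ags)
  finally show ?thesis .
 qed
 have pos: "0 <= Re (C (%x. f x * cnj (f x)) t)" if "cont_on U f" "Om t" for f t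
 proof -
  have "Re (C (%x. f x * cnj (f x)) t) = sph (%y. Re (f (exp t *r y) * cnj (f (exp t *r y))))"
  unfolding C_def by (rule sph_real(1)[OF cS]) (intro continuous_intros that)+
  also have "0 <= ..." by (rule sph_nonneg) (simp add: complex_norm_square[symmetric] flip: of_real_power)
  finally show ?thesis .
 qed
 have apos: "0 <= a t" and cpos: "0 <= c t" and lpos: "0 <= l t" if "Om t" for t
  unfolding a_def c_def l_def by (intro mult_nonneg_nonneg sum_nonneg pos cc that; simp)+
 \<comment> \<open>Cauchy-Schwarz for real parts: \<open>c + 2 s b + s^2 a\<close> is the squared
   norm of \<open>E + s w\<close> for every real \<open>s\<close>.\<close>
 have CS: "(b t)^2 <= a t * c t" if t: "Om t" for t
 proof (rule quadratic_nonneg_discriminant)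
  fix s :: real
  have "0 <= Re (C (%x. (E x + cr s * w x) * cnj (E x + cr s * w x)) t)"
  by (intro pos continuous_intros cc t)
  also have "C (%x. (E x + cr s * w x) * cnj (E x + cr s * w x)) t
  = C (%x. E x * cnj (E x) + (cr s * (E x * cnj (w x)) + (cr s * (w x * cnj (E x)) + cr (s^2) * (w x * cnj (w x))))) t"
  by (rule Ccong[OF t]) (simp add: ags power2_eq_square)
  also have "... = C (%x. E x * cnj (E x)) t + (cr s * C (%x. E x * cnj (w x)) t
  + (cr s * C (%x. w x * cnj (E x)) t + cr (s^2) * C (%x. w x * cnj (w x)) t))"
  unfolding Ccm[symmetric] by (subst Cadd; (intro continuous_intros cc t)?)+ simp
  also have "Re ... = c t + 2 * s * b t + s^2 * a t"
  using ReCcnj[of w E t] by (simp add: a_def b_def c_def)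
  finally show "0 <= c t + 2 * s * b t + s^2 * a t" .
 qed (rule apos[OF t])
 \<comment> \<open>The start of the \<open>t\<close> interval: \<open>ln r0\<close> for a positive
   \<open>r0\<close>, otherwise a number below \<open>ln (norm x)\<close>. A finite start gives
   \<open>ka\<close> the positive lower bound \<open>k^2 * exp (2 * t0)\<close>.\<close>
 define t0 where "t0 = (if r0 = 0 then ln (norm x) - 1 else ln r0)"
 have nx: "norm x > 0" using x r0 by linarith
 have Omt: "Om t" if t: "t > t0" for t
 proof (cases "r0 = 0")
  case False
  then have "exp (ln r0) < exp t" using t by (simp add: t0_def)
  then show ?thesis using False r0 by (simp add: Om_def)
 qed (simp add: Om_def)
 define s where "s = ln (norm x)"
 have xs: "exp s = norm x" using nx by (simp add: s_def)
 have st0: "s > t0" using x r0 nx by (auto simp: s_def t0_def)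
 \<comment> \<open>In terms of \<open>z\<close> this is \<open>|z'|^2\<close> minus the angular
   energy plus \<open>ka |z|^2\<close>; the quarter of \<open>a\<close> in each of the first two
   terms cancels.\<close>
 define Q where "Q t = exp t * (c t + b t - l t + ka t * a t)" for t
 have kad: "(ka has_real_derivative 2 * ka t) (at t)" for t
  unfolding ka_def[abs_def] by (auto intro!: derivative_eq_intros)
 have dQ: "(Q has_real_derivative 2 * ka t * (exp t * a t)) (at t)" if "Om t" for t
  unfolding Q_def[abs_def]
  by (rule derivative_eq_intros da[OF that] db[OF that] dc[OF that] dl[OF that] kad refl | simp add: ags)+
 have a_eq: "a t = sph (%y. (cmod (w (exp t *r y)))^2)" if "Om t" for t
 proof -
  have "a t = sph (%y. Re (w (exp t *r y) * cnj (w (exp t *r y))))"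
  unfolding a_def C_def by (rule sph_real(1)[OF cS]) (intro continuous_intros cc that)+
  then show ?thesis by (simp add: complex_norm_square[symmetric] flip: of_real_power)
 qed
 \<comment> \<open>The energy has derivative \<open>2 ka exp t a\<close>; going back to
   \<open>r = exp t\<close>, \<open>dt = dr / r\<close> turns this into the weight
   \<open>2 k^2 r^2\<close>.\<close>
 have Qint: "Q (s + 1) - Q s = 2 * k^2 * integral {exp s..exp 1 * exp s} (%r. r^2 * sph (%y. (cmod (w (r *r y)))^2))"
  if s: "s > t0" for s
 proof -
  have "((%r. 2 * k^2 * (r^2 * sph (%y. (cmod (w (r *r y)))^2))) has_integral (Q (ln (exp (s + 1))) - Q (ln (exp s)))) {exp s..exp (s + 1)}"
  proof (rule fundamental_theorem_of_calculus)
  fix r assume r: "r : {exp s..exp (s + 1)}"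
  then have r0': "r > 0" by (auto intro: less_le_trans[OF exp_gt_zero])
  then have "s <= ln r" using r by (simp add: ln_ge_iff)
  then have Om: "Om (ln r)" using s by (intro Omt) auto
  have d: "((%r. Q (ln r)) has_real_derivative 2 * ka (ln r) * (exp (ln r) * a (ln r)) * (1 / r)) (at r)"
  using DERIV_chain2[OF dQ[OF Om] DERIV_ln_divide[OF r0']] by simp
  have "ka (ln r) = k^2 * r^2" using r0' by (simp add: ka_def exp_double)
  then have "2 * ka (ln r) * (exp (ln r) * a (ln r)) * (1 / r) = 2 * k^2 * (r^2 * sph (%y. (cmod (w (r *r y)))^2))"
  using r0' a_eq[OF Om] by simp
  with d show "((%r. Q (ln r)) has_vector_derivative 2 * k^2 * (r^2 * sph (%y. (cmod (w (r *r y)))^2))) (at r within {exp s..exp (s + 1)})"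
  by (simp add: has_real_derivative_iff_has_vector_derivative has_vector_derivative_at_within)
  qed simp
  from integral_unique[OF this] show ?thesis by (simp add: exp_add[symmetric] add.commute)
 qed
 have "exp s * a s = 0"
 proof (rule rellich_ode[where n="%t. exp t * a t" and ?n1.0="%t. exp t * (a t + 2 * b t)"
  and Z="%t. exp t * (c t + b t + a t / 4)" and L="%t. exp t * (l t + a t / 4)"
  and ?n2.0="%t. exp t * (a t + 2 * b t + 2 * c t + 2 * l t - 2 * ka t * a t)"
  and Q=Q and ka=ka and ?ka0.0="k^2 * exp (2 * t0)" and ?t0.0=t0])
  fix t assume "t > t0"
  then have t: "Om t" by (rule Omt)
  show "((%t. exp t * a t) has_real_derivative exp t * (a t + 2 * b t)) (at t)"
  by (rule derivative_eq_intros da[OF t] refl | simp add: ags)+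
  show "((%t. exp t * (a t + 2 * b t)) has_real_derivative exp t * (a t + 2 * b t + 2 * c t + 2 * l t - 2 * ka t * a t)) (at t)"
  by (rule derivative_eq_intros da[OF t] db[OF t] refl | simp add: ags)+
  show "(Q has_real_derivative 2 * ka t * (exp t * a t)) (at t)" by (rule dQ[OF t])
  show "exp t * (a t + 2 * b t + 2 * c t + 2 * l t - 2 * ka t * a t)
  = 2 * (exp t * (c t + b t + a t / 4)) + 2 * (exp t * (l t + a t / 4)) - 2 * ka t * (exp t * a t)"
  by (simp add: ags)
  show "Q t = exp t * (c t + b t + a t / 4) - exp t * (l t + a t / 4) + ka t * (exp t * a t)"
  by (simp add: Q_def ags)
  show "(exp t * (a t + 2 * b t))^2 <= 4 * (exp t * a t) * (exp t * (c t + b t + a t / 4))"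
  proof -
  have "(a t + 2 * b t)^2 <= 4 * a t * (c t + b t + a t / 4)"
  using CS[OF t] by (simp add: power2_eq_square ags)
  from mult_left_mono[OF this, of "exp t * exp t"] show ?thesis
  by (simp add: power2_eq_square mult_ac)
  qed
  show "0 <= exp t * a t" using apos[OF t] by simp
  have "0 <= c t + b t + a t / 4"
  proof (cases "a t = 0")
  case True
  then show ?thesis using CS[OF t] cpos[OF t] by simp
  next
  case False
  then have "a t > 0" using apos[OF t] by simp
  have "0 <= (b t + a t / 2)^2" by simp
  also have "... <= a t * (c t + b t + a t / 4)"
  using CS[OF t] by (simp add: power2_eq_square ags)
  finally show ?thesis using `a t > 0` by (simp add: zero_le_mult_iff)
  qed
  then show "0 <= exp t * (c t + b t + a t / 4)" by simp
  show "0 <= exp t * (l t + a t / 4)" using lpos[OF t] apos[OF t] by simp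
  show "k^2 * exp (2 * t0) <= ka t" using `t > t0` unfolding ka_def by (intro mult_left_mono) auto
 next
  show "((%s. Q (s + 1) - Q s) ---> 0) at_top"
  proof (rule Lim_transform_eventually)
  show "((%s. 2 * k^2 * integral {exp s..exp 1 * exp s} (%r. r^2 * sph (%y. (cmod (w (r *r y)))^2))) ---> 0) at_top"
  using tendsto_mult_left[OF filterlim_compose[OF lim exp_at_top], of "2 * k^2"] by simp
  show "\<forall>\<^sub>F s in at_top. 2 * k^2 * integral {exp s..exp 1 * exp s} (%r. r^2 * sph (%y. (cmod (w (r *r y)))^2)) = Q (s + 1) - Q s"
  using eventually_gt_at_top[of t0] by eventually_elim (simp add: Qint)
  qed
 qed (use k st0 in auto)
 then have as: "sph (%y. (cmod (w (exp s *r y)))^2) <= 0" using a_eq[OF Omt[OF st0]] by simp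
 have "(cmod (w (exp s *r (x /\<^sub>R norm x))))^2 = 0"
 proof (rule sph_eq_0D[OF _ _ as])
  show "cont_on (sphere 0 1) (%y. (cmod (w (exp s *r y)))^2)"
  by (intro continuous_intros cS cc Omt[OF st0])
 qed (use nx in auto)
 then show ?thesis using nx by (simp add: xs)
qed

section \<open>Mollification of weak solutions\<close>

lemma integrable_compact_support:
 fixes g :: "cfun"
 assumes "cont_on K g" "compact K" "!!x. x \<notin> K ==> g x = 0"
 shows "integrable lborel g"
proof -
 have "integrable lborel (%x. indicator K x *r g x)"
  by (rule borel_integrable_compact[OF assms(2,1)])
 moreover have "(%x. indicator K x *r g x) = g"
  using assms(3) by (auto simp: fun_eq_iff indicator_def)
 ultimately show ?thesis by simp
qed

lemma integral_translate:
 fixes g :: "cfun"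
 assumes [measurable]: "g : borel_measurable borel"
 shows "(LB x. g (c + x)) = (LB x. g x)"
proof -
 have "(\<integral>x. g x \<partial>distr lborel borel ((+) c)) = (LB x. g (c + x))"
  by (rule integral_distr) auto
 then show ?thesis by (simp add: lborel_distr_plus)
qed

lemma pd_zero_outside:
 assumes "closed K" "!!x. x \<notin> K ==> g x = 0" "x \<notin> K"
 shows "pd i g x = 0"
proof -
 have "pd i g x = pd i (%x. 0) x"
  by (rule pd_cong_open[of "- K"]) (use assms in auto)
 then show ?thesis by simp
qed

text \<open>Translation invariance makes the integral of \<open>g (x + t e)\<close> constant in
  \<open>t\<close>, and its derivative at 0 is the integral of the partial derivative. The radius
  \<open>R + 1\<close> keeps the shifted support inside one finite measure space for all
  \<open>t\<close> of modulus below 1.\<close>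

lemma integral_pd_zero:
 fixes g :: "cfun"
 assumes g: "C1_on UNIV g" and K: "compact K" "!!x. x \<notin> K ==> g x = 0"
 shows "(LB x. pd i g x) = 0"
proof -
 obtain R where R: "R > 0" "K \<subseteq> ball 0 R"
  using compact_imp_bounded[OF K(1)] bounded_subset_ballD by blast
 have g0: "g x = 0" if "norm x \<ge> R" for x
  by (rule K(2)) (use that R(2) in auto)
 have pg0: "pd i g x = 0" if "norm x \<ge> R" for x
  by (rule pd_zero_outside[OF compact_imp_closed[OF K(1)] K(2)]) (use that R in auto)
 have cg: "cont_on UNIV g" and cp: "cont_on UNIV (pd i g)" using C1_onD[OF g] by auto
 define M where "M = restrict_space lborel (cball (0::real^3) (R + 1))"
 have cbs: "cball (0::real^3) (R + 1) : sets lborel" by simp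
 have M: "finite_measure M"
 proof
  have "emeasure M (space M) = emeasure lborel (cball (0::real^3) (R + 1))"
  unfolding M_def space_restrict_space by (subst emeasure_restrict_space) auto
  then show "emeasure M (space M) ~= \<infinity>" using emeasure_lborel_cball_finite[of "0::real^3" "R + 1"] by simp
 qed
 have mM: "f : borel_measurable M" if "cont_on UNIV f" for f :: "cfun"
  unfolding M_def by (intro measurable_restrict_space1) (use borel_measurable_continuous_onI[OF that] in simp)
 have iM: "(\<integral>x. f x \<partial>M) = (LB x. f x)" if "!!x. norm x \<ge> R + 1 ==> f x = 0" for f :: "cfun"
 proof -
  have "(\<integral>x. f x \<partial>M) = (LB x. indicator (cball 0 (R + 1)) x *r f x)"
  unfolding M_def by (rule integral_restrict_space) simp
  also have "... = (LB x. f x)"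
  by (rule Bochner_Integration.integral_cong) (auto simp: indicator_def that)
  finally show ?thesis .
 qed
 let ?e = "axis i 1 :: real^3"
 have "bounded (pd i g ` cball 0 R)"
  by (intro compact_imp_bounded compact_continuous_image continuous_on_subset[OF cp]) auto
 then obtain B where B: "!!x. x : cball 0 R ==> norm (pd i g x) <= B" unfolding bounded_iff by blast
 have B0: "0 <= B" using B[of 0] R(1) norm_ge_zero order_trans by (metis centre_in_cball less_eq_real_def)
 have B': "norm (pd i g x) <= B" for x
  using B[of x] pg0[of x] B0 by (cases "norm x \<ge> R") auto
 have "((%t. \<integral>x. g (x + t *r ?e) \<partial>M) has_derivative (%h. \<integral>x. h *r pd i g (x + 0 *r ?e) \<partial>M)) (at 0)"
 proof (rule has_derivative_integral_bounded[OF M, where U="{-1<..<1}" and B=B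
  and f'="%t x h. h *r pd i g (x + t *r ?e)"])
  fix t :: real and x :: "real^3"
  show "((%t. g (x + t *r ?e)) has_derivative (%h. h *r pd i g (x + t *r ?e))) (at t)"
  using pd_line_deriv[OF C1_onD(1)[OF g UNIV_I]] unfolding has_vector_derivative_def .
  show "norm (h *r pd i g (x + t *r ?e)) <= B * norm h" for h
  using mult_left_mono[OF B', of "norm h"] by (simp add: mult.commute)
 next
  fix t :: real
  have c: "cont_on UNIV (%x. g (x + t *r ?e))"
  by (rule continuous_on_compose2[OF cg]) (auto intro!: continuous_intros)
  have "bounded (g ` cball 0 R)"
  by (intro compact_imp_bounded compact_continuous_image continuous_on_subset[OF cg]) auto
  then obtain A where A: "!!x. x : cball 0 R ==> norm (g x) <= A" unfolding bounded_iff by blast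
  have "norm (g x) <= max A 0" for x
  using A[of x] g0[of x] by (cases "norm x \<ge> R") auto
  then show "integrable M (%x. g (x + t *r ?e))"
  by (intro finite_measure.integrable_const_bound[OF M, where B="max A 0"] mM c) auto
 next
  show "(%x. h *r pd i g (x + 0 *r ?e)) : borel_measurable M" for h
  by (intro borel_measurable_scaleR borel_measurable_const) (use mM[OF cp] in simp)
 qed auto
 moreover have "\<forall>\<^sub>F t in at 0. (\<integral>x. g (x + t *r ?e) \<partial>M) = (LB x. g x)"
 proof -
  have "\<forall>\<^sub>F t in at (0::real). dist t 0 < 1"
  by (rule tendstoD[OF tendsto_ident_at]) simp
  then show ?thesis
  proof eventually_elim
  case (elim t)
  have "(\<integral>x. g (x + t *r ?e) \<partial>M) = (LB x. g (x + t *r ?e))"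
  proof (rule iM, rule g0)
  fix x :: "real^3" assume "R + 1 <= norm x"
  moreover have "norm x <= norm (x + t *r ?e) + norm (t *r ?e)"
  using norm_triangle_sub[of x "- (t *r ?e)"] by simp
  moreover have "norm (t *r ?e) < 1" using elim by (simp add: norm_axis_1)
  ultimately show "R <= norm (x + t *r ?e)" by linarith
  qed
  also have "... = (LB x. g x)"
  using integral_translate[OF borel_measurable_continuous_onI[OF cg], of "t *r ?e"]
  by (simp add: add.commute)
  finally show ?case .
  qed
 qed
 moreover have "(\<integral>x. g (x + 0 *r ?e) \<partial>M) = (LB x. g x)"
  using g0 by (simp add: iM)
 ultimately have "((%t::real. LB x. g x) has_derivative (%h. \<integral>x. h *r pd i g (x + 0 *r ?e) \<partial>M)) (at 0)"
  by (rule has_derivative_transform_eventually) simp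
 then have "(%h. \<integral>x. h *r pd i g (x + 0 *r ?e) \<partial>M) = (%h::real. 0)"
  by (rule has_derivative_unique) (rule has_derivative_const)
 from fun_cong[OF this, of 1] have "(\<integral>x. pd i g x \<partial>M) = 0" by simp
 then show ?thesis using pg0 by (simp add: iM)
qed

section \<open>Test functions and integration by parts in space\<close>

definition supp_in :: "(real^3) set => (cfun) => bool" where
 "supp_in U ps \<longleftrightarrow> (\<exists>K. compact K & K \<subseteq> U & (\<forall>x. x \<notin> K \<longrightarrow> ps x = 0))"

lemma supp_in_pd: "supp_in U ps ==> supp_in U (pd i ps)"
 unfolding supp_in_def by (blast intro: pd_zero_outside compact_imp_closed)

lemma supp_in_integrable:
 assumes "cont_on U f" "cont_on UNIV ps" "supp_in U ps"
 shows "integrable lborel (%x. f x * ps x)"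
proof -
 obtain K where K: "compact K" "K \<subseteq> U" "!!x. x \<notin> K ==> ps x = 0"
  using assms(3) unfolding supp_in_def by blast
 show ?thesis
  by (rule integrable_compact_support[OF _ K(1)])
  (use K in \<open>auto intro!: continuous_on_mult continuous_on_subset[OF assms(1)] continuous_on_subset[OF assms(2)]\<close>)
qed

text \<open>\<open>f\<close> is controlled only on \<open>U\<close>, but its product with
  \<open>ps\<close> is \<open>C^1\<close> on the whole space, because \<open>U\<close> and the
  complement of the support cover it and the product is 0 on the latter.\<close>

lemma integral_parts:
 fixes f ps :: "cfun"
 assumes U: "open U" and f: "C1_on U f" and ps: "C1_on UNIV ps" and s: "supp_in U ps"
 shows "(LB x. pd i f x * ps x) = - (LB x. f x * pd i ps x)"
proof -
 obtain K where K: "compact K" "K \<subseteq> U" "!!x. x \<notin> K ==> ps x = 0"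
  using s unfolding supp_in_def by blast
 define g where "g x = f x * ps x" for x
 have gK: "g x = 0" if "x \<notin> K" for x using K(3)[OF that] by (simp add: g_def)
 have cK: "closed K" by (rule compact_imp_closed[OF K(1)])
 have gU: "C1_on U g"
  unfolding g_def[abs_def] by (intro C1_on_mult f C1_on_subset[OF ps]) simp
 have gN: "C1_on (- K) g"
  by (rule C1_on_cong[of _ "%x. 0"]) (use cK gK in auto)
 have UN: "U \<union> - K = UNIV" using K(2) by auto
 have g: "C1_on UNIV g"
  unfolding C1_on_def
 proof (intro conjI ballI allI)
  show "g differentiable (at x)" for x
  using C1_onD(1)[OF gU, of x] C1_onD(1)[OF gN, of x] UN by blast
  show "cont_on UNIV (pd i g)" for i
  using continuous_on_open_Un[OF U open_Compl[OF cK] C1_onD(2)[OF gU] C1_onD(2)[OF gN], of i] UN by simp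
 qed
 have pdg: "pd i g x = pd i f x * ps x + f x * pd i ps x" for i and x
 proof (cases "x : U")
  case True
  then show ?thesis unfolding g_def[abs_def]
  by (intro pd_mult C1_onD(1)[OF f] C1_onD(1)[OF ps]) auto
 next
  case False
  then have x: "x \<notin> K" using K(2) by auto
  show ?thesis using pd_zero_outside[OF cK gK x] pd_zero_outside[OF cK K(3) x] K(3)[OF x] by simp
 qed
 have "0 = (LB x. pd i f x * ps x + f x * pd i ps x)"
  using integral_pd_zero[OF g K(1) gK, of i] unfolding pdg by simp
 also have "... = (LB x. pd i f x * ps x) + (LB x. f x * pd i ps x)"
  by (intro Bochner_Integration.integral_add supp_in_integrable[of U] C1_onD[OF f] C1_onD[OF ps] s supp_in_pd)
 finally show ?thesis by (simp add: eq_neg_iff_add_eq_0)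
qed

text \<open>At 0 the difference quotient is bounded by a positive power of \<open>|h|\<close>; an
  exponent of at least 2 is what guarantees this.\<close>

lemma has_real_derivative_max_pow:
 "((%s::real. max 0 s ^ Suc (Suc n)) has_real_derivative real (Suc (Suc n)) * max 0 s ^ Suc n) (at s)"
proof -
 consider "s < 0" | "s > 0" | "s = 0" by linarith
 then show ?thesis
 proof cases
  case 1
  have "((%s::real. 0) has_real_derivative 0) (at s)" by simp
  then have "((%s::real. max 0 s ^ Suc (Suc n)) has_real_derivative 0) (at s)"
  by (rule has_field_derivative_transform_within_open[of _ _ _ "{..<0}"]) (use 1 in auto)
  then show ?thesis using 1 by simp
 next
  case 2
  have "((%s::real. s ^ Suc (Suc n)) has_real_derivative real (Suc (Suc n)) * s ^ Suc n) (at s)"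
  using DERIV_pow[of "Suc (Suc n)" s] by simp
  then have "((%s::real. max 0 s ^ Suc (Suc n)) has_real_derivative real (Suc (Suc n)) * s ^ Suc n) (at s)"
  by (rule has_field_derivative_transform_within_open[of _ _ _ "{0<..}"]) (use 2 in auto)
  then show ?thesis using 2 by simp
 next
  case 3
  have "(%h::real. max 0 h ^ Suc (Suc n) / h) \<midarrow>0\<rightarrow> 0"
  proof (rule Lim_null_comparison)
  show "\<forall>\<^sub>F h::real in at 0. norm (max 0 h ^ Suc (Suc n) / h) <= \<bar>h\<bar> ^ Suc n"
  proof (intro always_eventually allI)
  fix h :: real
  show "norm (max 0 h ^ Suc (Suc n) / h) <= \<bar>h\<bar> ^ Suc n"
  proof (cases "h > 0")
  case False
  then have "max 0 h = 0" by simp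
  then show ?thesis by (simp del: power_Suc)
  qed simp
  qed
  show "(%h::real. \<bar>h\<bar> ^ Suc n) \<midarrow>0\<rightarrow> 0" by (auto intro!: tendsto_eq_intros)
  qed
  then show ?thesis using 3 by (simp add: DERIV_def)
 qed
qed

lemma pd_compose_real:
 fixes q :: "real^3 => real"
 assumes "(F has_real_derivative F') (at (q x))" "q differentiable (at x)"
 shows "(%x. F (q x)) differentiable (at x)" "pd i (%x. F (q x)) x = F' * pd i q x"
proof -
 have q: "(q has_derivative frechet_derivative q (at x)) (at x)"
  using assms(2) by (simp add: frechet_derivative_works)
 have "((%x. F (q x)) has_derivative (%h. F' * frechet_derivative q (at x) h)) (at x)"
  using diff_chain_at[OF q assms(1)[unfolded has_field_derivative_def]] by (simp add: o_def)
 then show "(%x. F (q x)) differentiable (at x)" "pd i (%x. F (q x)) x = F' * pd i q x"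
  by (auto simp: differentiable_def pd_def dest: pd_eqI)
qed

lemma C1_on_compose_real:
 fixes q :: "real^3 => real"
 assumes "!!s. (F has_real_derivative F' s) (at s)" "cont_on UNIV F'" "C1_on S q"
 shows "C1_on S (%x. F (q x))"
proof (rule C1_onI_eq)
 fix x assume x: "x : S"
 show "(%x. F (q x)) differentiable (at x)"
  by (rule pd_compose_real(1)[OF assms(1) C1_onD(1)[OF assms(3) x]])
 show "pd i (%x. F (q x)) x = (%i x. F' (q x) * pd i q x) i x" for i
  using pd_compose_real(2)[OF assms(1) C1_onD(1)[OF assms(3) x]] by simp
next
 show "cont_on S ((%i x. F' (q x) * pd i q x) i)" for i
  by (intro continuous_on_mult C1_onD(2)[OF assms(3)]
  continuous_on_compose2[OF assms(2) C1_onD(3)[OF assms(3)]]) auto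
qed

text \<open>A mollifier without normalisation: sign, support and two continuous derivatives are what
  matter. The cube is the lowest integer power of the truncated quadratic that is \<open>C^2\<close>
  across the sphere of radius \<open>h\<close>.\<close>

definition bump :: "real => cfun" where
 "bump h y = cr (max 0 (h^2 - (norm y)^2) ^ 3)"

lemma bump_zero: "h > 0 ==> h <= norm y ==> bump h y = 0"
 by (simp add: bump_def max_def power_mono)

lemma C2_on_bump: "C2_on UNIV (bump h)"
proof -
 define q :: "real^3 => real" where "q y = h^2 - (norm y)^2" for y
 have qe: "q = (%y. h^2 - (y $ 1 * y $ 1 + y $ 2 * y $ 2 + y $ 3 * y $ 3))"
  unfolding q_def norm_3 by (simp add: power2_eq_square)
 have qC: "C1_on UNIV q" unfolding qe by (intro C1_intros)
 have pdq: "pd i q y = - 2 * y $ i" for i y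
  unfolding qe using exhaust_3[of i]
  by (auto simp: pd_diff pd_add pd_mult pd_coord)
 have qd: "q differentiable (at y)" for y using C1_onD(1)[OF qC] by simp
 let ?m = "%n y. max 0 (q y) ^ n"
 have m3: "(%y. ?m 3 y) differentiable (at y)" "pd i (%y. ?m 3 y) y = - 6 * (y $ i * ?m 2 y)" for i y
  using pd_compose_real(1)[OF has_real_derivative_max_pow[of 1 "q y"] qd]
  pd_compose_real(2)[OF has_real_derivative_max_pow[of 1 "q y"] qd, of i]
  by (simp_all add: pdq numeral_3_eq_3 numeral_2_eq_2 del: power_Suc)
 have m2C: "C1_on UNIV (%y. ?m 2 y)"
  using C1_on_compose_real[OF has_real_derivative_max_pow[of 0] _ qC]
  by (simp add: numeral_2_eq_2 continuous_intros del: power_Suc)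
 have pC: "C1_on UNIV (%y. - 6 * (y $ i * ?m 2 y))" for i
  by (intro C1_intros m2C)
 have "C2_on UNIV (%y. ?m 3 y)"
 proof (rule C2_onI_eq[where g="%i y. - 6 * (y $ i * ?m 2 y)"])
  show "C1_on UNIV (%y. ?m 3 y)"
  by (rule C1_onI_eq[where g="%i y. - 6 * (y $ i * ?m 2 y)"]) (use m3 C1_onD(3)[OF pC] in auto)
 qed (use m3 pC in auto)
 from C2_on_linear[OF bounded_linear_of_real this] show ?thesis
  unfolding bump_def[abs_def] q_def by simp
qed

section \<open>Convolution with a compactly supported kernel\<close>

definition conv :: "(cfun) => (cfun) => cfun" where
 "conv ps p x = (LB z. p z * ps (x - z))"

abbreviation cbM :: "real^3 => real => (real^3) measure" where "cbM x r \<equiv> restrict_space lborel (cball x r)"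

text \<open>For all \<open>x\<close> near \<open>x0\<close> the integrand lives in one fixed ball, a
  finite measure space, so the results on integrals with bounded integrands apply.\<close>

lemma conv_local:
 fixes p ps :: "cfun"
 assumes "!!y. h <= norm y ==> ps y = 0" "x : ball x0 dd"
 shows "conv ps p x = (\<integral>z. p z * ps (x - z) \<partial>cbM x0 (h + dd))"
proof -
 have "(\<integral>z. p z * ps (x - z) \<partial>cbM x0 (h + dd)) =
  (LB z. indicator (cball x0 (h + dd)) z *r (p z * ps (x - z)))"
  by (rule integral_restrict_space) simp
 also have "... = conv ps p x"
  unfolding conv_def
 proof (rule Bochner_Integration.integral_cong[OF refl])
  fix z
  show "indicator (cball x0 (h + dd)) z *r (p z * ps (x - z)) = p z * ps (x - z)"
  proof (cases "z : cball x0 (h + dd)")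
  case False
  have "dist x0 z <= dist x0 x + dist x z" by (rule dist_triangle)
  then have "h <= norm (x - z)" using False assms(2) by (simp add: dist_norm)
  then show ?thesis using assms(1) by simp
  qed simp
 qed
 finally show ?thesis by simp
qed

lemma
 fixes p ps :: "cfun" and x0 :: "real^3"
 assumes p: "cont_on {x. r0 < norm x} p" and ps0: "!!y. h <= norm y ==> ps y = 0"
  and h: "h > 0"
 shows conv_continuous: "cont_on UNIV ps ==> cont_on {x. r0 + h < norm x} (conv ps p)"
  and conv_pd: "C1_on UNIV ps ==> r0 + h < norm x0 ==> conv ps p differentiable (at x0) & pd i (conv ps p) x0 = conv (pd i ps) p x0"
proof -
 have loc: "\<exists>dd>0. \<exists>A. cball x0 (h + dd) \<subseteq> {x. r0 < norm x} &
  finite_measure (cbM x0 (h + dd)) &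
  p : borel_measurable (cbM x0 (h + dd)) &
  (\<forall>z\<in>cball x0 (h + dd). norm (p z) <= A) & 0 <= A"
  if x0: "r0 + h < norm x0" for x0 :: "real^3"
 proof -
  define dd where "dd = (norm x0 - (r0 + h)) / 2"
  have dd: "dd > 0" using x0 by (simp add: dd_def)
  have sub: "cball x0 (h + dd) \<subseteq> {x. r0 < norm x}"
  proof
  fix z assume "z : cball x0 (h + dd)"
  then have "norm (x0 - z) <= h + dd" by (simp add: dist_norm)
  moreover have "norm x0 <= norm z + norm (x0 - z)" using norm_triangle_sub[of x0 z] by simp
  ultimately show "z : {x. r0 < norm x}" using x0 unfolding dd_def by (simp add: field_simps)
  qed
  have c: "cont_on (cball x0 (h + dd)) p" by (rule continuous_on_subset[OF p sub])
  have fin: "finite_measure (cbM x0 (h + dd))"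
  proof
  have "emeasure (cbM x0 (h + dd)) (space (cbM x0 (h + dd))) = emeasure lborel (cball x0 (h + dd))"
  unfolding space_restrict_space by (subst emeasure_restrict_space) auto
  then show "emeasure (cbM x0 (h + dd)) (space (cbM x0 (h + dd))) ~= \<infinity>"
  using emeasure_lborel_cball_finite[of x0 "h + dd"] by simp
  qed
  have m: "p : borel_measurable (cbM x0 (h + dd))"
  using borel_measurable_continuous_on_restrict[OF c] by (simp cong: measurable_cong_sets add: sets_restrict_space)
  have "bounded (p ` cball x0 (h + dd))" by (intro compact_imp_bounded compact_continuous_image c) simp
  then obtain A where A: "!!z. z : cball x0 (h + dd) ==> norm (p z) <= A" unfolding bounded_iff by blast
  have "0 <= A" by (rule order_trans[OF norm_ge_zero A[of x0]]) (use h dd in simp)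
  then show ?thesis using dd sub fin m A by blast
 qed
 have bdd: "\<exists>B\<ge>0. \<forall>y. norm (ps y) <= B" if c: "cont_on UNIV ps" and z: "!!y. h <= norm y ==> ps y = 0" for ps :: "cfun"
 proof -
  have "bounded (ps ` cball 0 h)"
  by (intro compact_imp_bounded compact_continuous_image continuous_on_subset[OF c]) auto
  then obtain B where B: "!!x. x : cball 0 h ==> norm (ps x) <= B" unfolding bounded_iff by blast
  have "norm (ps y) <= max B 0" for y
  using B[of y] z[of y] by (cases "h <= norm y") auto
  then show ?thesis by (intro exI[of _ "max B 0"]) auto
 qed
 have meas: "(%z. ps (x - z)) : borel_measurable (restrict_space lborel K)" if "cont_on UNIV ps" for ps :: "cfun" and x K
 proof -
  have "cont_on UNIV (%z. ps (x - z))"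
  by (rule continuous_on_compose2[OF that]) (auto intro!: continuous_intros)
  from borel_measurable_continuous_onI[OF this] show ?thesis
  by (intro measurable_restrict_space1) simp
 qed
 show "cont_on {x. r0 + h < norm x} (conv ps p)" if c: "cont_on UNIV ps"
 proof (rule continuous_at_imp_continuous_on, rule ballI)
  fix x0 :: "real^3" assume "x0 : {x. r0 + h < norm x}"
  then obtain dd A where dd: "dd > 0" "finite_measure (cbM x0 (h + dd))"
  "p : borel_measurable (cbM x0 (h + dd))"
  "!!z. z : cball x0 (h + dd) ==> norm (p z) <= A" "0 <= A"
  using loc[of x0] by blast
  obtain B where B: "B \<ge> 0" "!!y. norm (ps y) <= B" using bdd[OF c ps0] by blast
  have "cont_on (ball x0 dd) (%x. \<integral>z. p z * ps (x - z) \<partial>cbM x0 (h + dd))"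
  proof (rule continuous_on_integral_bounded[OF dd(2) open_ball])
  show "cont_on (ball x0 dd) (%x. p m * ps (x - m))" for m
  by (intro continuous_on_mult continuous_on_const continuous_on_compose2[OF c]) (auto intro!: continuous_intros)
  show "(%z. p z * ps (x - z)) : borel_measurable (cbM x0 (h + dd))" for x
  by (intro borel_measurable_times dd meas c)
  fix x assume "x : ball x0 dd"
  have "norm (p m * ps (y - m)) <= A * B" if "m : space (cbM x0 (h + dd))" for y m
  unfolding norm_mult using that dd B by (intro mult_mono) (auto simp: space_restrict_space)
  then show "\<exists>e>0. \<exists>B. \<forall>y\<in>ball x e \<inter> ball x0 dd. \<forall>m\<in>space (cbM x0 (h + dd)). norm (p m * ps (y - m)) <= B"
  using dd(1) by blast
  qed
  then have "cont_on (ball x0 dd) (conv ps p)"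
  by (rule continuous_on_eq) (rule conv_local[OF ps0, symmetric])
  then show "isCont (conv ps p) x0" using dd(1) by (simp add: continuous_on_eq_continuous_at)
 qed
 show "conv ps p differentiable (at x0) & pd i (conv ps p) x0 = conv (pd i ps) p x0"
  if ps: "C1_on UNIV ps" and x0: "r0 + h < norm x0"
 proof -
  obtain dd A where dd: "dd > 0" "finite_measure (cbM x0 (h + dd))"
  "p : borel_measurable (cbM x0 (h + dd))"
  "!!z. z : cball x0 (h + dd) ==> norm (p z) <= A" "0 <= A"
  using loc[OF x0] by blast
  let ?M = "cbM x0 (h + dd)"
  have c: "cont_on UNIV ps" and cp: "cont_on UNIV (pd j ps)" for j using C1_onD[OF ps] by auto
  have pdint: "pd j ps y = 0" if "h < norm y" for j y
  proof -
  have "pd j ps y = pd j (%x. 0) y"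
  by (rule pd_cong_open[of "{y. h < norm y}"])
  (use that ps0 in \<open>auto intro!: open_Collect_less continuous_intros\<close>)
  then show ?thesis by simp
  qed
  \<comment> \<open>Strictly outside the ball the derivative vanishes because \<open>ps\<close>
    does; on the bounding sphere it follows by continuity along the outward ray.\<close>
  have pd0: "pd j ps y = 0" if y: "h <= norm y" for j y
  proof (cases "h = norm y")
  case True
  have "((%s. pd j ps (s *r y)) ---> pd j ps (1 *r y)) (at_right 1)"
  proof -
  have "cont_on UNIV (%s. pd j ps (s *r y))"
  by (rule continuous_on_compose2[OF cp[of j]]) (auto intro!: continuous_intros)
  then have "isCont (%s. pd j ps (s *r y)) 1" by (simp add: continuous_on_eq_continuous_at)
  then show ?thesis unfolding isCont_def by (rule filterlim_mono) (auto intro: at_le)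
  qed
  moreover have "\<forall>\<^sub>F s in at_right 1. pd j ps (s *r y) = 0"
  using eventually_at_right_less[of "1::real"]
  by eventually_elim (rule pdint, use True h in simp)
  ultimately have "((%s::real. 0) ---> pd j ps y) (at_right 1)"
  by (subst (asm) tendsto_cong) auto
  then show ?thesis using tendsto_unique[of "at_right (1::real)"] by (metis tendsto_const trivial_limit_at_right_real)
  next
  case False then show ?thesis using y pdint by simp
  qed
  obtain B where B: "B \<ge> 0" "!!y. norm (ps y) <= B" using bdd[OF c ps0] by blast
  have "\<forall>j. \<exists>B'\<ge>0. \<forall>y. norm (pd j ps y) <= B'" using bdd[OF cp pd0] by blast
  then obtain B' where B': "!!j. B' j \<ge> 0" "!!j y. norm (pd j ps y) <= B' j" by metis
  have "((%x. \<integral>z. p z * ps (x - z) \<partial>?M) has_derivative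
  (%k. \<integral>z. (SU j. (k $ j) *r (p z * pd j ps (x0 - z))) \<partial>?M)) (at x0)"
  proof (rule has_derivative_integral_bounded[OF dd(2) open_ball[of x0 dd] convex_ball, where B="A * (SU j. B' j)"
  and f'="%x z k. SU j. (k $ j) *r (p z * pd j ps (x - z))"])
  show "x0 : ball x0 dd" using dd by simp
  fix x z assume z: "z : space ?M"
  have 1: "((%x. x - z) has_derivative (%k. k)) (at x)" by (auto intro!: derivative_eq_intros)
  show "((%x. p z * ps (x - z)) has_derivative (%k. SU j. (k $ j) *r (p z * pd j ps (x - z)))) (at x)"
  using has_derivative_mult_right[OF diff_chain_at[OF 1 has_derivative_pd[OF C1_onD(1)[OF ps UNIV_I]]], of "p z"]
  by (simp add: o_def sum_distrib_left)
  fix k :: "real^3"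
  have "norm (SU j. (k $ j) *r (p z * pd j ps (x - z))) <= (SU j. norm k * (A * B' j))"
  proof (rule sum_norm_le)
  fix j :: 3
  have "norm (p z * pd j ps (x - z)) <= A * B' j"
  unfolding norm_mult using z dd B' by (intro mult_mono) (auto simp: space_restrict_space)
  then show "norm ((k $ j) *r (p z * pd j ps (x - z))) <= norm k * (A * B' j)"
  unfolding norm_scaleR using component_le_norm_cart[of k j] by (intro mult_mono) auto
  qed
  then show "norm (SU j. (k $ j) *r (p z * pd j ps (x - z))) <= A * (SU j. B' j) * norm k"
  by (simp add: sum_distrib_left mult_ac)
  next
  fix x
  show "integrable ?M (%z. p z * ps (x - z))"
  proof (rule finite_measure.integrable_const_bound[OF dd(2), where B="A * B"])
  show "(%z. p z * ps (x - z)) : borel_measurable ?M"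
  by (intro borel_measurable_times dd meas c)
  show "AE z in ?M. norm (p z * ps (x - z)) <= A * B"
  unfolding norm_mult using dd B by (intro AE_I2 mult_mono) (auto simp: space_restrict_space)
  qed
  next
  show "(%z. SU j. (k $ j) *r (p z * pd j ps (x0 - z))) : borel_measurable ?M" for k :: "real^3"
  by (intro borel_measurable_sum borel_measurable_scaleR borel_measurable_const borel_measurable_times dd meas cp)
  qed
  then have d: "(conv ps p has_derivative
  (%k. \<integral>z. (SU j. (k $ j) *r (p z * pd j ps (x0 - z))) \<partial>?M)) (at x0)"
  by (rule has_derivative_transform_within_open[OF _ open_ball[of x0 dd]])
  (use dd conv_local[OF ps0, symmetric] in auto)
  have "pd i (conv ps p) x0 = (\<integral>z. p z * pd i ps (x0 - z) \<partial>?M)"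
  using pd_eqI[OF d, of i] by (simp add: axis_def if_distrib[of "%c. c *r _"] cong: if_cong)
  also have "... = conv (pd i ps) p x0"
  by (rule conv_local[OF pd0, symmetric]) (use dd in auto)
  finally show ?thesis using d by (auto simp: differentiable_def)
 qed
qed

lemma pd_reflect:
 fixes f :: "cfun"
 assumes "f differentiable (at (x - z))"
 shows "(%z. f (x - z)) differentiable (at z)" "pd i (%z. f (x - z)) z = - pd i f (x - z)"
proof -
 have 1: "((%z. x - z) has_derivative (%k. - k)) (at z)" by (auto intro!: derivative_eq_intros)
 have D: "(f has_derivative frechet_derivative f (at (x - z))) (at (x - z))"
  using assms by (simp add: frechet_derivative_works)
 have 2: "((%z. f (x - z)) has_derivative (%k. frechet_derivative f (at (x - z)) (- k))) (at z)"
  using diff_chain_at[OF 1 D] by (simp add: o_def)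
 have "linear (frechet_derivative f (at (x - z)))" using D by (rule has_derivative_linear)
 then show "(%z. f (x - z)) differentiable (at z)" "pd i (%z. f (x - z)) z = - pd i f (x - z)"
  using 2 pd_eqI[OF 2, of i] by (auto simp: differentiable_def pd_def linear_neg)
qed

lemma C1_on_reflect:
 fixes f :: "cfun"
 assumes "C1_on UNIV f"
 shows "C1_on UNIV (%z. f (x - z))"
proof (rule C1_onI_eq)
 show "(%z. f (x - z)) differentiable (at z)" for z
  by (rule pd_reflect) (rule C1_onD(1)[OF assms UNIV_I])
 show "pd i (%z. f (x - z)) z = (%i z. - pd i f (x - z)) i z" for i z
  by (simp add: pd_reflect(2) C1_onD(1)[OF assms UNIV_I])
 show "cont_on UNIV ((%i z. - pd i f (x - z)) i)" for i
  by (intro continuous_intros continuous_on_compose2[OF C1_onD(2)[OF assms]]) auto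
qed

lemma C2_on_reflect:
 fixes f :: "cfun"
 assumes f: "C2_on UNIV f"
 shows "C2_on UNIV (%z. f (x - z))" "pd j (pd i (%z. f (x - z))) z = pd j (pd i f) (x - z)"
proof -
 have p: "pd i (%z. f (x - z)) = (%z. - pd i f (x - z))" for i
  by (rule ext, rule pd_reflect) (rule C1_onD(1)[OF C2_onD(1)[OF f] UNIV_I])
 show "C2_on UNIV (%z. f (x - z))"
  by (rule C2_onI) (auto simp: p intro!: C1_on_minus C1_on_reflect C2_onD[OF f])
 show "pd j (pd i (%z. f (x - z))) z = pd j (pd i f) (x - z)"
  unfolding p by (simp add: pd_minus pd_reflect C1_onD(1)[OF C2_onD(2)[OF f] UNIV_I])
qed

lemma conv_C1:
 assumes p: "cont_on {x. r0 < norm x} p" and z: "!!y. h <= norm y ==> ps y = 0"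
  "!!i y. h <= norm y ==> pd i ps y = 0"
  and h: "h > 0" and ps: "C1_on UNIV ps"
 shows "C1_on {x. r0 + h < norm x} (conv ps p)"
proof (rule C1_onI_eq[where g="%i. conv (pd i ps) p"])
 note d = conv_pd[OF p z(1) h ps]
 show "conv ps p differentiable (at x)" if "x : {x. r0 + h < norm x}" for x
  using d[of x undefined] that by simp
 show "pd i (conv ps p) x = conv (pd i ps) p x" if "x : {x. r0 + h < norm x}" for i x
  using d[of x i] that by simp
 show "cont_on {x. r0 + h < norm x} (conv (pd i ps) p)" for i
  by (rule conv_continuous[OF p z(2) h C1_onD(2)[OF ps]])
qed

text \<open>The weak equation is tested with the reflected translate \<open>bump h (x - z)\<close>
  as a function of \<open>z\<close>. Each reflection changes the sign of a first derivative, so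
  second derivatives keep theirs, and the tested identity is the pointwise equation of the mollified
  field at \<open>x\<close>.\<close>

lemma bump_conv:
 fixes p :: "cfun"
 assumes p: "cont_on {x. r0 < norm x} p" and h: "h > 0" and r0: "0 <= r0"
  and weak: "!!ps. C2_on UNIV ps ==> supp_in {x. r0 < norm x} ps ==>
  (LB z. p z * ((SU i. pd i (pd i ps) z) + cr (k^2) * ps z)) = 0"
 shows "C2_on {x. r0 + 2 * h < norm x} (conv (bump h) p)"
  and "r0 + 2 * h < norm x ==> (SU i. pd i (pd i (conv (bump h) p)) x) + cr (k^2) * conv (bump h) p x = 0"
proof -
 let ?V = "{x::real^3. r0 + 2 * h < norm x}"
 have oV: "open ?V" by (intro open_Collect_less continuous_intros)
 have b0: "bump h y = 0" if "y \<notin> cball 0 h" for y using that h by (auto intro: bump_zero)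
 have b1: "pd i (bump h) y = 0" if "y \<notin> cball 0 h" for i y
  by (rule pd_zero_outside[OF closed_cball b0 that])
 have b2: "pd j (pd i (bump h)) y = 0" if "y \<notin> cball 0 h" for i j y
  by (rule pd_zero_outside[OF closed_cball b1 that])
 \<comment> \<open>The radius \<open>2 * h\<close> is used because the derivatives are known to
   vanish strictly outside the closed ball of radius \<open>h\<close>, whereas the convolution rules
   ask for vanishing from the given radius on, that radius included.\<close>
 have out: "y \<notin> cball 0 h" if "2 * h <= norm y" for y using that h by auto
 have h2: "2 * h > 0" using h by simp
 note B = C2_on_bump[of h]
 have c1: "C1_on ?V (conv (bump h) p)"
  by (rule conv_C1[OF p b0[OF out] b1[OF out] h2 C2_onD(1)[OF B]])
 have c2: "C1_on ?V (conv (pd i (bump h)) p)" for i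
  by (rule conv_C1[OF p b1[OF out] b2[OF out] h2 C2_onD(2)[OF B]])
 have p1: "pd i (conv (bump h) p) x = conv (pd i (bump h)) p x" if "x : ?V" for i x
  using conv_pd[OF p b0[OF out] h2 C2_onD(1)[OF B], of x i] that by simp
 show "C2_on ?V (conv (bump h) p)" by (rule C2_onI_eq[OF oV c1 p1 c2])
 assume x: "r0 + 2 * h < norm x"
 have p2: "pd i (pd i (conv (bump h) p)) x = conv (pd i (pd i (bump h))) p x" for i
 proof -
  have "pd i (pd i (conv (bump h) p)) x = pd i (conv (pd i (bump h)) p) x"
  by (rule pd_cong_open[OF oV]) (use x p1 in auto)
  also have "... = conv (pd i (pd i (bump h))) p x"
  using conv_pd[OF p b1[OF out] h2 C2_onD(2)[OF B], of x i i] x by simp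
  finally show ?thesis .
 qed
 define ps where "ps z = bump h (x - z)" for z
 have ps: "C2_on UNIV ps" unfolding ps_def[abs_def] by (rule C2_on_reflect[OF B])
 have pps: "pd j (pd i ps) z = pd j (pd i (bump h)) (x - z)" for i j z
  unfolding ps_def[abs_def] by (rule C2_on_reflect[OF B])
 have s: "supp_in {x. r0 < norm x} ps"
  unfolding supp_in_def
 proof (intro exI conjI allI impI)
  show "compact (cball x h)" by simp
  show "cball x h \<subseteq> {x. r0 < norm x}"
  proof
  fix z assume "z : cball x h"
  then have "norm (x - z) <= h" by (simp add: dist_norm)
  moreover have "norm x <= norm z + norm (x - z)" using norm_triangle_sub[of x z] by simp
  ultimately show "z : {x. r0 < norm x}" using x h by simp
  qed
  show "ps z = 0" if "z \<notin> cball x h" for z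
  using that h unfolding ps_def by (intro bump_zero) (auto simp: dist_norm)
 qed
 have i1: "integrable lborel (%z. p z * pd i (pd i ps) z)" for i
  by (rule supp_in_integrable[OF p C1_onD(2)[OF C2_onD(2)[OF ps]] supp_in_pd[OF supp_in_pd[OF s]]])
 have i0: "integrable lborel (%z. p z * ps z)"
  by (rule supp_in_integrable[OF p C1_onD(3)[OF C2_onD(1)[OF ps]] s])
 have "(SU i. pd i (pd i (conv (bump h) p)) x) + cr (k^2) * conv (bump h) p x
  = (SU i. LB z. p z * pd i (pd i ps) z) + cr (k^2) * (LB z. p z * ps z)"
  unfolding p2 conv_def pps[symmetric] ps_def[symmetric] ..
 also have "... = (LB z. (SU i. p z * pd i (pd i ps) z) + cr (k^2) * (p z * ps z))"
  using i1 i0 by (subst Bochner_Integration.integral_add) auto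
 also have "... = (LB z. p z * ((SU i. pd i (pd i ps) z) + cr (k^2) * ps z))"
  by (rule Bochner_Integration.integral_cong) (auto simp: ags sum_distrib_left)
 also have "... = 0" by (rule weak[OF ps s])
 finally show "(SU i. pd i (pd i (conv (bump h) p)) x) + cr (k^2) * conv (bump h) p x = 0" .
qed

section \<open>Decay of the mollified field\<close>

lemma nn_sph:
 assumes "cont_on (sphere 0 1) g" "!!y. norm y = 1 ==> 0 <= g y"
 shows "(\<integral>\<^sup>+y. ennreal (g y) \<partial>sphM) = ennreal (sph g)"
 unfolding sph_def
 by (rule nn_integral_eq_integral[OF integrable_sphM_continuous[OF assms(1)]]) (use assms(2) in auto)

lemma nn_integral_shell:
 fixes g :: "real^3 => real"
 assumes g: "cont_on {x. r0 < norm x} g" "!!x. 0 <= g x" and a: "0 <= r0" "r0 < a"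
 shows "(NN x. ennreal (g x) * indicator {x. a <= norm x & norm x <= b} x)
  = (NN r. ennreal (3 * r^2 * sphr r g) * indicator {a..b} r)"
proof -
 let ?S = "{x::real^3. a <= norm x & norm x <= b}"
 have "?S = (- ball 0 a) \<inter> cball 0 b" by auto
 then have S: "?S : sets borel" by simp
 have "(%x. indicator ?S x *r g x) : borel_measurable borel"
  by (rule borel_measurable_continuous_on_indicator[OF S continuous_on_subset[OF g(1)]]) (use a in auto)
 then have m: "(%x. ennreal (indicator ?S x *r g x)) : borel_measurable borel" by measurable
 have "(NN x. ennreal (g x) * indicator ?S x) = (NN x. ennreal (indicator ?S x *r g x))"
  by (rule nn_integral_cong) (simp add: indicator_def)
 also have "... = (NN r. ennreal (3 * r^2) * indicator {0<..} r * (\<integral>\<^sup>+y. ennreal (indicator ?S (r *r y) *r g (r *r y)) \<partial>sphM))"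
  by (rule nn_integral_polar[OF m])
 also have "... = (NN r. ennreal (3 * r^2 * sphr r g) * indicator {a..b} r)"
 proof (rule nn_integral_cong)
  fix r :: real
  show "ennreal (3 * r^2) * indicator {0<..} r * (\<integral>\<^sup>+y. ennreal (indicator ?S (r *r y) *r g (r *r y)) \<partial>sphM)
  = ennreal (3 * r^2 * sphr r g) * indicator {a..b} r"
  proof (cases "r > 0")
  case False
  then show ?thesis using a by (simp add: indicator_def)
  next
  case True
  show ?thesis
  proof (cases "r : {a..b}")
  case False
  have "(\<integral>\<^sup>+y. ennreal (indicator ?S (r *r y) *r g (r *r y)) \<partial>sphM) = (\<integral>\<^sup>+y. 0 \<partial>sphM)"
  by (rule nn_integral_cong) (use False True in \<open>auto simp: indicator_def\<close>)
  then show ?thesis using False by simp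
  next
  case in_ab: True
  have "(\<integral>\<^sup>+y. ennreal (indicator ?S (r *r y) *r g (r *r y)) \<partial>sphM) = (\<integral>\<^sup>+y. ennreal (g (r *r y)) \<partial>sphM)"
  by (rule nn_integral_cong) (use in_ab True in \<open>auto simp: indicator_def\<close>)
  also have "... = ennreal (sphr r g)"
  proof (rule nn_sph)
  show "cont_on (sphere 0 1) (%y. g (r *r y))"
  by (rule continuous_on_compose2[OF g(1)]) (use in_ab True a in \<open>auto intro!: continuous_intros\<close>)
  qed (rule g(2))
  finally show ?thesis using True in_ab by (simp add: ennreal_mult sph_nonneg g(2))
  qed
  qed
 qed
 finally show ?thesis .
qed

lemma nn_integral_inverse_square:
 assumes "a > 0" "C \<ge> 0"
 shows "(NN r. ennreal (C / r^2) * indicator {a..} r) = ennreal (C / a)"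
proof -
 have "(NN r. ennreal (C / r^2) * indicator {a..} r) = ennreal (0 - (- (C / a)))"
 proof (rule nn_integral_FTC_atLeast)
  show "((%t::real. - (C / t)) ---> 0) at_top"
  using tendsto_minus[OF tendsto_divide_0[OF tendsto_const filterlim_at_top_imp_at_infinity[OF filterlim_ident], of C]] by simp
 qed (use assms in \<open>auto intro!: derivative_eq_intros simp: power2_eq_square\<close>)
 then show ?thesis by simp
qed

text \<open>Cauchy-Schwarz on the ball of radius \<open>h\<close>; the kernel is at most
  \<open>h^6\<close>, and its square accounts for \<open>h^12\<close>.\<close>

lemma conv_bump_bound:
 fixes p :: "cfun"
 assumes p: "cont_on {x. r0 < norm x} p" and h: "h > 0" and x: "r0 + h < norm x"
 shows "ennreal ((norm (conv (bump h) p x))^2) <= ennreal (h ^ 12) * emeasure lborel (ball (0::real^3) h) *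
  (NN z. ennreal ((norm (p z))^2 * indicator (ball x h) z))"
proof -
 let ?U = "{x::real^3. r0 < norm x}"
 have sub: "cball x h \<subseteq> ?U"
 proof
  fix z assume "z : cball x h"
  then have "norm (x - z) <= h" by (simp add: dist_norm)
  moreover have "norm x <= norm z + norm (x - z)" using norm_triangle_sub[of x z] by simp
  ultimately show "z : {x. r0 < norm x}" using x by simp
 qed
 have s: "supp_in ?U (%z. bump h (x - z))"
  unfolding supp_in_def
  by (intro exI[of _ "cball x h"]) (use sub h in \<open>auto simp: dist_norm intro!: bump_zero\<close>)
 have i: "integrable lborel (%z. p z * bump h (x - z))"
  by (rule supp_in_integrable[OF p C1_onD(3)[OF C2_onD(1)[OF C2_on_reflect(1)[OF C2_on_bump]]] s])
 have pm: "(%z. indicator (ball x h) z *r p z) : borel_measurable borel"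
  by (rule borel_measurable_continuous_on_indicator[OF _ continuous_on_subset[OF p]])
  (use order_trans[OF ball_subset_cball sub] in simp_all)
 have pm2: "(%z. ennreal (norm (indicator (ball x h) z *r p z))) : borel_measurable lborel"
  using measurable_compose[OF pm, of "%u. ennreal (norm u)" borel] by simp
 have bb: "norm (bump h y) <= h ^ 6" for y
 proof -
  have "max 0 (h^2 - (norm y)^2) <= h^2" by simp
  from power_mono[OF this, of 3] have "max 0 (h^2 - (norm y)^2) ^ 3 <= h ^ 6"
  by (simp flip: power_mult)
  then show ?thesis unfolding bump_def norm_of_real by simp
 qed
 have "ennreal (norm (conv (bump h) p x)) <= (NN z. ennreal (norm (p z * bump h (x - z))))"
  unfolding conv_def by (rule integral_norm_bound_ennreal[OF i])
 also have "... <= (NN z. ennreal (norm (indicator (ball x h) z *r p z)) * (ennreal (h ^ 6) * indicator (ball x h) z))"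
 proof (rule nn_integral_mono)
  fix z
  show "ennreal (norm (p z * bump h (x - z))) <= ennreal (norm (indicator (ball x h) z *r p z)) * (ennreal (h ^ 6) * indicator (ball x h) z)"
  proof (cases "z : ball x h")
  case True
  then show ?thesis using bb[of "x - z"] h
  by (simp add: norm_mult ennreal_mult[symmetric] mult_left_mono)
  next
  case False
  then have "bump h (x - z) = 0" using h by (intro bump_zero) (auto simp: dist_norm)
  then show ?thesis by simp
  qed
 qed
 finally have 1: "ennreal (norm (conv (bump h) p x)) <= ..." .
 have "ennreal ((norm (conv (bump h) p x))^2) = (ennreal (norm (conv (bump h) p x)))^2"
  by (simp add: ennreal_power)
 also have "... <= (NN z. ennreal (norm (indicator (ball x h) z *r p z)) * (ennreal (h ^ 6) * indicator (ball x h) z))^2"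
  by (rule power_mono[OF 1]) simp
 also have "... <= (NN z. (ennreal (norm (indicator (ball x h) z *r p z)))^2) * (NN z. (ennreal (h ^ 6) * indicator (ball x h) z)^2)"
  by (rule Cauchy_Schwarz_nn_integral[OF pm2])
  (intro borel_measurable_times_ennreal borel_measurable_const borel_measurable_indicator, simp)
 also have "(NN z. (ennreal (norm (indicator (ball x h) z *r p z)))^2) = (NN z. ennreal ((norm (p z))^2 * indicator (ball x h) z))"
  by (rule nn_integral_cong) (auto simp: indicator_def ennreal_power)
 also have "(NN z. (ennreal (h ^ 6) * indicator (ball x h) z)^2) = (NN z. ennreal (h ^ 12) * indicator (ball x h) z)"
  using h by (intro nn_integral_cong) (auto simp: indicator_def ennreal_power simp flip: power_mult)
 also have "... = ennreal (h ^ 12) * emeasure lborel (ball x h)"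
  by (rule nn_integral_cmult_indicator) simp
 also have "emeasure lborel (ball x h) = emeasure lborel (ball (0::real^3) h)"
  using h by (simp add: emeasure_ball)
 finally show ?thesis by (simp add: mult.commute)
qed

text \<open>Decay passes from spherical means of \<open>p\<close> to shell integrals of its
  mollification. When the local bound is integrated over the shell and the order is exchanged, each
  \<open>z\<close> is counted with the volume \<open>V\<close> of a ball, and the tail of
  \<open>r^2 / r^4\<close> from \<open>a - h\<close> on is \<open>1 / (a - h)\<close>.\<close>

lemma conv_bump_decay:
 fixes p :: "cfun"
 assumes p: "cont_on {x. r0 < norm x} p" and h: "h > 0" and r0: "0 <= r0"
  and dec: "!!r. r \<ge> r1 ==> sph (%y. (cmod (p (r *r y)))^2) <= C / r ^ 4"
 shows "((%a. integral {a..exp 1 * a} (%r. r^2 * sph (%y. (cmod (conv (bump h) p (r *r y)))^2))) ---> 0) at_top"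
proof -
 define w where "w = conv (bump h) p"
 define V where "V = measure lborel (ball (0::real^3) h)"
 have eV: "emeasure lborel (ball x h) = ennreal V" for x :: "real^3"
 proof -
  have "emeasure lborel (ball x h) = emeasure lborel (ball (0::real^3) h)" using h by (simp add: emeasure_ball)
  also have "... = ennreal V"
  unfolding V_def by (rule emeasure_eq_ennreal_measure) (use emeasure_lborel_ball_finite[of "0::real^3" h] in simp)
  finally show ?thesis .
 qed
 have V0: "V \<ge> 0" by (simp add: V_def)
 \<comment> \<open>The given constant may be negative; its positive part keeps the extended
   nonnegative integrals meaningful.\<close>
 define C' where "C' = max C 0"
 have dec': "sph (%y. (cmod (p (r *r y)))^2) <= C' / r ^ 4" if "r \<ge> r1" for r
  by (rule order_trans[OF dec[OF that]]) (auto simp: C'_def intro!: divide_right_mono)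
 have cw: "cont_on {x. r0 + 2 * h < norm x} w"
  unfolding w_def by (rule conv_continuous[OF p bump_zero[OF h, OF order_trans, rotated] _ C1_onD(3)[OF C2_onD(1)[OF C2_on_bump]]])
  (use h in auto)
 have main: "integral {a..exp 1 * a} (%r. r^2 * sph (%y. (cmod (w (r *r y)))^2)) <= h ^ 12 * V * V * C' / (a - h)"
  "0 <= integral {a..exp 1 * a} (%r. r^2 * sph (%y. (cmod (w (r *r y)))^2))"
  if a: "a > r0 + 2 * h" "a - h \<ge> r1" "a - h > 0" for a
 proof -
  define b where "b = exp 1 * a"
  let ?A = "{z::real^3. a - h <= norm z & norm z <= b + h}"
  let ?q = "%z. ennreal ((norm (p z))^2 * indicator ?A z)"
  define Q where "Q r = r^2 * sph (%y. (cmod (w (r *r y)))^2)" for r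
  have Q0: "0 <= Q r" for r unfolding Q_def by (intro mult_nonneg_nonneg sph_nonneg) auto
  have S: "?A : sets borel"
  proof -
  have "?A = (- ball 0 (a - h)) \<inter> cball 0 (b + h)" by auto
  then show ?thesis by simp
  qed
  have "(%z. indicator ?A z *r ((norm (p z))^2)) : borel_measurable borel"
  by (rule borel_measurable_continuous_on_indicator[OF S])
  (intro continuous_intros continuous_on_subset[OF p], use a h in auto)
  then have pm[measurable]: "(%z. (norm (p z))^2 * indicator ?A z) : borel_measurable borel"
  by (simp add: mult.commute)
  have Qint: "Q integrable_on {a..b}"
  proof -
  have "cont_on (shell (r0 + 2 * h) (b + 1)) (%x. (cmod (w x))^2)"
  by (intro continuous_intros continuous_on_subset[OF cw]) (auto simp: shell_def)
  from continuous_on_sph[OF this] have "cont_on {r0 + 2 * h<..<b + 1} (%r. sph (%y. (cmod (w (r *r y)))^2))"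
  using r0 h by simp
  then have "cont_on {a..b} Q"
  unfolding Q_def by (intro continuous_intros) (rule continuous_on_subset, use a in auto)
  then show ?thesis by (rule integrable_continuous_interval)
  qed
  show "0 <= integral {a..exp 1 * a} Q"
  unfolding b_def[symmetric] by (rule integral_nonneg[OF Qint]) (rule Q0)
  have "ennreal (3 * integral {a..b} Q) = (NN r. ennreal (indicator {a..b} r * (3 * Q r)))"
  proof (rule nn_integral_has_integral_lebesgue[symmetric])
  show "((%r. 3 * Q r) has_integral 3 * integral {a..b} Q) {a..b}"
  by (intro has_integral_mult_right integrable_integral Qint)
  qed (use Q0 in auto)
  also have "... = (NN r. ennreal (3 * r^2 * sph (%y. (cmod (w (r *r y)))^2)) * indicator {a..b} r)"
  by (rule nn_integral_cong) (auto simp: indicator_def Q_def mult.assoc)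
  also have "... = (NN x. ennreal ((cmod (w x))^2) * indicator {x. a <= norm x & norm x <= b} x)"
  by (rule nn_integral_shell[symmetric, of "r0 + 2 * h"]) (use cw r0 h a in \<open>auto intro!: continuous_intros\<close>)
  also have "... <= (NN x. ennreal (h ^ 12 * V) * ((NN z. ennreal ((norm (p z))^2 * indicator (ball x h) z))
  * indicator {x. a <= norm x & norm x <= b} x))"
  proof (rule nn_integral_mono)
  fix x :: "real^3"
  show "ennreal ((cmod (w x))^2) * indicator {x. a <= norm x & norm x <= b} x <=
  ennreal (h ^ 12 * V) * ((NN z. ennreal ((norm (p z))^2 * indicator (ball x h) z)) * indicator {x. a <= norm x & norm x <= b} x)"
  using conv_bump_bound[OF p h, of x] a h V0
  by (auto simp: indicator_def w_def eV ennreal_mult)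
  qed
  also have "... <= (NN x. ennreal (h ^ 12 * V) * (NN z. ?q z * indicator (ball 0 h) (z - x)))"
  proof (intro nn_integral_mono mult_left_mono)
  fix x :: "real^3"
  show "(NN z. ennreal ((norm (p z))^2 * indicator (ball x h) z)) * indicator {x. a <= norm x & norm x <= b} x
  <= (NN z. ?q z * indicator (ball 0 h) (z - x))"
  proof (cases "a <= norm x & norm x <= b")
  case True
  have eqr: "(norm (p z))^2 * indicator (ball x h) z = (norm (p z))^2 * indicator ?A z * indicator (ball 0 h) (z - x)" for z
  proof (cases "z : ball x h")
  case z: True
  then have "norm (x - z) < h" by (simp add: dist_norm)
  moreover have "norm x <= norm z + norm (x - z)" "norm z <= norm x + norm (x - z)"
  using norm_triangle_sub[of x z] norm_triangle_sub[of z x] norm_minus_commute[of x z] by auto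
  ultimately show ?thesis using True z by (auto simp: indicator_def norm_minus_commute)
  next
  case False
  then show ?thesis by (auto simp: indicator_def dist_norm norm_minus_commute)
  qed
  have "ennreal ((norm (p z))^2 * indicator (ball x h) z) = ?q z * indicator (ball 0 h) (z - x)" for z
  unfolding eqr by (cases "z - x : ball 0 h") simp_all
  then show ?thesis using True by simp
  qed simp
  qed simp
  also have "... = ennreal (h ^ 12 * V) * (NN z. (NN x. ?q z * indicator (ball 0 h) (z - x)))"
  proof -
  have [measurable]: "(indicator (ball (0::real^3) h) :: real^3 => ennreal) : borel_measurable borel"
  by (rule borel_measurable_indicator) simp
  have mm: "(%(x, z). ?q z * indicator (ball 0 h) (z - x)) : borel_measurable (lborel \<Otimes>\<^sub>M lborel)"
  by measurable
  have 1: "(%x. NN z. ?q z * indicator (ball 0 h) (z - x)) : borel_measurable lborel"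
  by (rule lborel.borel_measurable_nn_integral[OF mm])
  have F: "(NN x. (NN z. ?q z * indicator (ball 0 h) (z - x)))
  = (NN z. (NN x. ?q z * indicator (ball 0 h) (z - x)))"
  by (rule lborel_pair.Fubini'[symmetric, OF mm])
  show ?thesis unfolding F[symmetric] by (rule nn_integral_cmult[OF 1])
  qed
  also have "(NN z. (NN x. ?q z * indicator (ball 0 h) (z - x)))
  = (NN z. ennreal V * (ennreal ((norm (p z))^2) * indicator ?A z))"
  proof (rule nn_integral_cong)
  fix z :: "real^3"
  have "(NN x. ?q z * indicator (ball 0 h) (z - x))
  = (NN x. ?q z * indicator (ball z h) x)"
  by (rule nn_integral_cong) (simp add: indicator_def dist_norm norm_minus_commute)
  also have "... = ?q z * ennreal V"
  by (subst nn_integral_cmult_indicator) (auto simp: eV)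
  finally show "(NN x. ?q z * indicator (ball 0 h) (z - x))
  = ennreal V * (ennreal ((norm (p z))^2) * indicator ?A z)"
  by (simp add: indicator_def mult.commute)
  qed
  also have "... = ennreal V * (NN z. (ennreal ((norm (p z))^2) * indicator ?A z))"
  proof (rule nn_integral_cmult)
  have "(%z. ennreal ((norm (p z))^2) * indicator ?A z)
  = (%z. ?q z)"
  by (auto simp: fun_eq_iff indicator_def)
  then show "(%z. ennreal ((norm (p z))^2) * indicator ?A z) : borel_measurable lborel"
  using pm by simp
  qed
  also have "(NN z. (ennreal ((norm (p z))^2) * indicator ?A z))
  = (NN r. ennreal (3 * r^2 * sph (%y. (cmod (p (r *r y)))^2)) * indicator {a - h..b + h} r)"
  by (rule nn_integral_shell[of r0]) (use p r0 h a in \<open>auto intro!: continuous_intros\<close>)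
  also have "... <= (NN r. ennreal (3 * C' / r^2) * indicator {a - h..} r)"
  proof (rule nn_integral_mono)
  fix r :: real
  show "ennreal (3 * r^2 * sph (%y. (cmod (p (r *r y)))^2)) * indicator {a - h..b + h} r <= ennreal (3 * C' / r^2) * indicator {a - h..} r"
  proof (cases "r : {a - h..b + h}")
  case True
  then have r: "r > 0" "r \<ge> r1" using a by auto
  have "3 * r^2 * sph (%y. (cmod (p (r *r y)))^2) <= 3 * r^2 * (C' / r ^ 4)"
  using dec'[OF r(2)] by (intro mult_left_mono) auto
  also have "... = 3 * C' / r^2" using r by (simp add: field_simps eval_nat_numeral)
  finally show ?thesis using True by (auto intro: ennreal_leI)
  qed simp
  qed
  also have "... = ennreal (3 * C' / (a - h))"
  by (rule nn_integral_inverse_square) (use a in \<open>auto simp: C'_def\<close>)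
  finally have "ennreal (3 * integral {a..b} Q) <= ennreal (h ^ 12 * V) * (ennreal V * ennreal (3 * C' / (a - h)))"
  by (simp add: mult_left_mono)
  also have "... = ennreal (3 * (h ^ 12 * V * V * C' / (a - h)))"
  using V0 h a by (simp add: ennreal_mult[symmetric] C'_def mult_ac)
  finally have "3 * integral {a..b} Q <= 3 * (h ^ 12 * V * V * C' / (a - h))"
  using V0 h a by (subst (asm) ennreal_le_iff) (auto simp: C'_def)
  then show "integral {a..exp 1 * a} Q <= h ^ 12 * V * V * C' / (a - h)" by (simp add: b_def)
 qed
 have "filterlim (%a. - h + a) at_top at_top"
  by (rule filterlim_tendsto_add_at_top[OF tendsto_const filterlim_ident])
 then have "filterlim (%a. a - h) at_top at_top" by (simp add: add.commute)
 from tendsto_divide_0[OF tendsto_const filterlim_at_top_imp_at_infinity[OF this]]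
 have lim: "((%a. h ^ 12 * V * V * C' / (a - h)) ---> 0) at_top" .
 have ev: "\<forall>\<^sub>F a in at_top. a > r0 + 2 * h & a - h \<ge> r1 & a - h > 0"
  using eventually_gt_at_top[of "max (r0 + 2 * h) (max (r1 + h) h)"] by eventually_elim auto
 show ?thesis
  unfolding w_def[symmetric]
 proof (rule tendsto_sandwich[OF _ _ tendsto_const lim])
  show "\<forall>\<^sub>F a in at_top. 0 <= integral {a..exp 1 * a} (%r. r^2 * sph (%y. (cmod (w (r *r y)))^2))"
  using ev by (rule eventually_mono) (rule main(2), auto)
  show "\<forall>\<^sub>F a in at_top. integral {a..exp 1 * a} (%r. r^2 * sph (%y. (cmod (w (r *r y)))^2)) <= h ^ 12 * V * V * C' / (a - h)"
  using ev by (rule eventually_mono) (rule main(1), auto)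
 qed
qed

text \<open>If \<open>p x\<close> were nonzero, continuity would keep \<open>p\<close> close to
  \<open>p x\<close> on a small ball, and mollification with a nonnegative kernel could not give 0
  at \<open>x\<close>. But the mollified field is a classical solution with enough decay, so
  \<open>rellich\<close> annihilates it.\<close>

lemma weak_helmholtz_zero:
 fixes p :: "cfun"
 assumes p: "cont_on {x. r0 < norm x} p" and r0: "0 <= r0" and k: "k > 0"
  and weak: "!!ps. C2_on UNIV ps ==> supp_in {x. r0 < norm x} ps ==>
  (LB z. p z * ((SU i. pd i (pd i ps) z) + cr (k^2) * ps z)) = 0"
  and dec: "!!r. r \<ge> r1 ==> sph (%y. (cmod (p (r *r y)))^2) <= C / r ^ 4"
  and x: "r0 < norm x"
 shows "p x = 0"
proof (rule ccontr)
 assume px: "p x ~= 0"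
 let ?U = "{x::real^3. r0 < norm x}"
 have oU: "open ?U" by (intro open_Collect_less continuous_intros)
 have "isCont p x" using p x oU continuous_on_eq_continuous_at by blast
 then obtain d where d: "d > 0" "!!z. dist z x < d ==> dist (p z) (p x) < cmod (p x) / 2"
  unfolding continuous_at_eps_delta using px by (metis half_gt_zero zero_less_norm_iff)
 define h where "h = min d ((norm x - r0) / 3)"
 have h: "h > 0" "h <= d" "r0 + 2 * h < norm x"
  using d x by (auto simp: h_def min_def field_simps)
 define w where "w = conv (bump h) p"
 have "w x = 0"
  unfolding w_def
 proof (rule rellich)
  show "0 <= r0 + 2 * h" using r0 h by simp
  show "C2_on {x. r0 + 2 * h < norm x} (conv (bump h) p)"
  by (rule bump_conv(1)[OF p h(1) r0 weak])
  show "(SU i. pd i (pd i (conv (bump h) p)) x) + cr (k^2) * conv (bump h) p x = 0"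
  if "r0 + 2 * h < norm x" for x
  by (rule bump_conv(2)[OF p h(1) r0 weak that])
  show "((%a. integral {a..exp 1 * a} (%r. r^2 * sph (%y. (cmod (conv (bump h) p (r *r y)))^2))) ---> 0) at_top"
  by (rule conv_bump_decay[OF p h(1) r0 dec])
 qed (use k h in auto)
 have sub: "cball x h \<subseteq> ?U"
 proof
  fix z assume "z : cball x h"
  then have "norm (x - z) <= h" by (simp add: dist_norm)
  moreover have "norm x <= norm z + norm (x - z)" using norm_triangle_sub[of x z] by simp
  ultimately show "z : ?U" using h by simp
 qed
 have s: "supp_in ?U (%z. bump h (x - z))"
  unfolding supp_in_def
  by (intro exI[of _ "cball x h"]) (use sub h in \<open>auto simp: dist_norm intro!: bump_zero\<close>)
 have i: "integrable lborel (%z. p z * bump h (x - z))"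
  by (rule supp_in_integrable[OF p C1_onD(3)[OF C2_onD(1)[OF C2_on_reflect(1)[OF C2_on_bump]]] s])
 \<comment> \<open>Within distance \<open>h / 2\<close> of \<open>x\<close> the kernel is at least
   \<open>(3 / 4 * h^2) ^ 3\<close>, and \<open>Re (cnj (p x) * p z)\<close> is at least half of
   \<open>(cmod (p x))^2\<close>.\<close>
 define c where "c = (cmod (p x))^2 / 2 * (3 / 4 * h^2) ^ 3"
 have c: "c > 0" using px h by (simp add: c_def)
 have lb: "c * indicator (ball x (h / 2)) z <= Re (cnj (p x) * (p z * bump h (x - z)))" for z
 proof (cases "z : ball x h")
  case False
  then have b0: "bump h (x - z) = 0" using h by (intro bump_zero) (auto simp: dist_norm)
  have "z \<notin> ball x (h / 2)" using False h by auto
  then show ?thesis using b0 by simp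
 next
  case True
  then have "dist (p z) (p x) < cmod (p x) / 2" using h by (intro d(2)) (auto simp: dist_commute)
  then have n: "cmod (p z - p x) <= cmod (p x) / 2" by (simp add: dist_norm)
  have sq: "Re (cnj (p x) * p x) = (cmod (p x))^2"
  by (metis Re_complex_of_real complex_norm_square mult.commute)
  have "Re (cnj (p x) * p z) = Re (cnj (p x) * p x) + Re (cnj (p x) * (p z - p x))"
  by (simp add: ags)
  moreover have "\<bar>Re (cnj (p x) * (p z - p x))\<bar> <= cmod (p x) * (cmod (p x) / 2)"
  by (rule order_trans[OF abs_Re_le_cmod]) (simp only: norm_mult complex_mod_cnj mult_left_mono[OF n norm_ge_zero])
  moreover have "cmod (p x) * (cmod (p x) / 2) = (cmod (p x))^2 / 2" by (simp add: power2_eq_square)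
  ultimately have 1: "(cmod (p x))^2 / 2 <= Re (cnj (p x) * p z)"
  using sq by linarith
  let ?b = "max 0 (h^2 - (norm (x - z))^2) ^ 3"
  have 2: "Re (cnj (p x) * (p z * bump h (x - z))) = Re (cnj (p x) * p z) * ?b"
  by (simp add: bump_def flip: mult.assoc)
  have 3: "(3 / 4 * h^2) ^ 3 * indicator (ball x (h / 2)) z <= ?b"
  proof (cases "z : ball x (h / 2)")
  case True
  then have "(norm (x - z))^2 <= (h / 2)^2" by (intro power_mono) (auto simp: dist_norm)
  then have "3 / 4 * h^2 <= max 0 (h^2 - (norm (x - z))^2)" by (simp add: power2_eq_square max_def)
  then show ?thesis using True by (simp only: indicator_simps mult_1_right) (intro power_mono, auto)
  qed simp
  have "c * indicator (ball x (h / 2)) z <= (cmod (p x))^2 / 2 * ?b"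
  unfolding c_def mult.assoc by (intro mult_left_mono 3[unfolded mult.assoc]) auto
  also have "... <= Re (cnj (p x) * p z) * ?b"
  by (intro mult_right_mono 1) auto
  finally show ?thesis unfolding 2 .
 qed
 have mb: "measure lborel (ball x (h / 2)) > 0"
  using h by (simp add: content_ball_pos)
 have "0 < c * measure lborel (ball x (h / 2))" using c mb by simp
 also have "... = (LB z. c * indicator (ball x (h / 2)) z)" by simp
 also have "... <= (LB z. Re (cnj (p x) * (p z * bump h (x - z))))"
 proof (rule integral_mono)
  show "integrable lborel (%z. c * indicator (ball x (h / 2)) z)"
  using emeasure_lborel_ball_finite[of x "h / 2"] by (intro integrable_mult_right integrable_real_indicator) auto
  show "integrable lborel (%z. Re (cnj (p x) * (p z * bump h (x - z))))"
  by (intro integrable_Re integrable_mult_right i)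
 qed (rule lb)
 also have "... = Re (LB z. cnj (p x) * (p z * bump h (x - z)))"
  by (rule integral_Re) (intro integrable_mult_right i)
 also have "... = Re (cnj (p x) * w x)" by (simp add: w_def conv_def)
 also have "... = 0" using `w x = 0` by simp
 finally show False by simp
qed

text \<open>Testing the Lame system with the gradient of \<open>ps\<close> isolates the divergence,
  and testing two components with exchanged derivatives of \<open>ps\<close> isolates a component of
  the curl. The third derivative that the classical computation would put on \<open>v\<close> falls
  on \<open>ps\<close> instead.\<close>

lemma lame_weak:
 fixes v :: "3 => cfun"
 assumes U: "open U" and v: "!!i. C2_on U (v i)"
  and eq: "!!x i. x : U ==> cr mu * (SU j. pd j (pd j (v i)) x)
  + cr (lam + mu) * pd i (%x. SU j. pd j (v j) x) x + cr ka * v i x = 0"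
  and ps: "C2_on UNIV ps" and s: "supp_in U ps"
 shows "(LB z. (SU j. pd j (v j) z) * (cr (lam + 2 * mu) * (SU i. pd i (pd i ps) z) + cr ka * ps z)) = 0" (is ?P)
  and "(LB z. (pd a (v b) z - pd b (v a) z) * (cr mu * (SU i. pd i (pd i ps) z) + cr ka * ps z)) = 0" (is ?C)
proof -
 define I where "I f g = (LB z. f z * g z)" for f g :: "cfun"
 define P where "P x = (SU j. pd j (v j) x)" for x
 have v1: "C1_on U (v i)" and pv: "C1_on U (pd j (v i))" for i j using C2_onD[OF v] by auto
 have P1: "C1_on U P" unfolding P_def[abs_def] by (intro C1_on_sum pv)
 have ps1: "C1_on UNIV ps" and pps: "C1_on UNIV (pd i ps)" for i using C2_onD[OF ps] by auto
 have cps: "cont_on UNIV ps" "cont_on UNIV (pd i ps)" "cont_on UNIV (pd j (pd i ps))" for i j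
  using C1_onD(3)[OF ps1] C1_onD(3)[OF pps] C1_onD(2)[OF pps] by auto
 note sp = s supp_in_pd[OF s] supp_in_pd[OF supp_in_pd[OF s]]
 have ig: "integrable lborel (%z. f z * g z)" if "cont_on U f" "g : insert ps (range (%i. pd i ps) \<union> range (%(i, j). pd i (pd j ps)))" for f g
  using that by (auto intro!: supp_in_integrable[of U] cps sp)
 have parts: "I (pd i f) g = - I f (pd i g)" if "C1_on U f" "g = ps | (\<exists>j. g = pd j ps)" for f g i
  unfolding I_def using that(2) by (elim disjE exE) (auto intro!: integral_parts[OF U that(1)] ps1 pps sp)
 have parts1: "I (pd i f) (pd j ps) = - I f (pd i (pd j ps))" if "C1_on U f" for f i j
  by (rule parts[OF that]) auto
 have zerops: "g x = 0" if "x \<notin> U" "supp_in U g" for g x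
  using that unfolding supp_in_def by blast
 have Icong: "I f g = I f' g" if "!!x. x : U ==> f x = f' x" "supp_in U g" for f f' g
  unfolding I_def
 proof (rule Bochner_Integration.integral_cong[OF refl])
  fix x show "f x * g x = f' x * g x"
  using that(1)[of x] zerops[OF _ that(2), of x] by (cases "x : U") auto
 qed
 have comm: "pd i (pd j ps) = pd j (pd i ps)" for i j
  by (rule ext) (rule pd_commute[OF open_UNIV ps UNIV_I])
 \<comment> \<open>Integration by parts and symmetry of second derivatives, for \<open>v i\<close>
   and for \<open>ps\<close>, move \<open>pd c\<close> to \<open>v i\<close> and both
   \<open>pd j\<close> to \<open>ps\<close>.\<close>
 have A: "(SU j. I (pd j (pd j (v i))) (pd c ps)) = - (SU j. I (pd c (v i)) (pd j (pd j ps)))" for i c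
  unfolding sum_negf[symmetric]
 proof (intro sum.cong refl)
  fix j
  have "I (pd j (pd j (v i))) (pd c ps) = - I (pd j (v i)) (pd j (pd c ps))"
  by (rule parts[OF pv]) auto
  also have "... = - I (pd j (v i)) (pd c (pd j ps))" unfolding comm[of j c] ..
  also have "... = I (pd c (pd j (v i))) (pd j ps)"
  by (simp add: parts1[OF pv])
  also have "... = I (pd j (pd c (v i))) (pd j ps)"
  by (rule Icong[OF _ sp(2)]) (rule pd_commute[OF U v])
  also have "... = - I (pd c (v i)) (pd j (pd j ps))"
  by (rule parts[OF pv]) auto
  finally show "I (pd j (pd j (v i))) (pd c ps) = - I (pd c (v i)) (pd j (pd j ps))" .
 qed
 have E: "cr mu * (SU j. I (pd j (pd j (v i))) (pd c ps)) + cr (lam + mu) * I (pd i P) (pd c ps)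
  + cr ka * I (v i) (pd c ps) = 0" for i c
 proof -
  have r: "pd c ps : insert ps (range (%i. pd i ps) \<union> range (%(i, j). pd i (pd j ps)))" by auto
  have i1: "integrable lborel (%z. pd j (pd j (v i)) z * pd c ps z)" for j
  by (rule ig[OF C1_onD(2)[OF pv] r])
  have i2: "integrable lborel (%z. pd i P z * pd c ps z)" by (rule ig[OF C1_onD(2)[OF P1] r])
  have i3: "integrable lborel (%z. v i z * pd c ps z)" by (rule ig[OF C1_onD(3)[OF v1] r])
  have "cr mu * (SU j. I (pd j (pd j (v i))) (pd c ps)) + cr (lam + mu) * I (pd i P) (pd c ps)
  + cr ka * I (v i) (pd c ps)
  = (LB z. cr mu * (SU j. pd j (pd j (v i)) z * pd c ps z) + cr (lam + mu) * (pd i P z * pd c ps z) + cr ka * (v i z * pd c ps z))"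
  unfolding I_def using i1 i2 i3
  by (subst Bochner_Integration.integral_add; (intro Bochner_Integration.integrable_add integrable_mult_right Bochner_Integration.integrable_sum)?; simp?)+
  also have "... = integral\<^sup>L lborel (%z::real^3. 0)"
  proof (rule Bochner_Integration.integral_cong[OF refl])
  fix z
  show "cr mu * (SU j. pd j (pd j (v i)) z * pd c ps z) + cr (lam + mu) * (pd i P z * pd c ps z) + cr ka * (v i z * pd c ps z) = 0"
  proof (cases "z : U")
  case True
  from eq[OF this, of i] have "(cr mu * (SU j. pd j (pd j (v i)) z)
  + cr (lam + mu) * pd i P z + cr ka * v i z) * pd c ps z = 0"
  unfolding P_def[abs_def] by simp
  then show ?thesis by (simp add: ags sum_distrib_left sum_distrib_right)
  next
  case False
  then show ?thesis using zerops[OF False sp(2)] by simp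
  qed
  qed
  finally show ?thesis by simp
 qed
 have ipd: "integrable lborel (%z. f z * pd i (pd j ps) z)" "integrable lborel (%z. f z * ps z)" if "cont_on U f" for f i j
  using that by (auto intro!: ig)
 have fin: "(LB z. f z * (cr m * (SU i. pd i (pd i ps) z) + cr ka * ps z))
  = cr m * (SU i. I f (pd i (pd i ps))) + cr ka * I f ps" if f: "cont_on U f" for f m
 proof -
  have "(LB z. f z * (cr m * (SU i. pd i (pd i ps) z) + cr ka * ps z))
  = (LB z. cr m * (SU i. f z * pd i (pd i ps) z) + cr ka * (f z * ps z))"
  by (rule Bochner_Integration.integral_cong) (auto simp: ags sum_distrib_left)
  also have "... = cr m * (SU i. I f (pd i (pd i ps))) + cr ka * I f ps"
  unfolding I_def using ipd[OF f]
  by (subst Bochner_Integration.integral_add; (intro integrable_mult_right Bochner_Integration.integrable_sum)?; simp?)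
  finally show ?thesis .
 qed
 have Ivp: "I (v i) (pd c ps) = - I (pd c (v i)) ps" for i c
  using parts[OF v1[of i], of ps c] by simp
 have cpv: "cont_on U (pd j (v i))" for i j by (rule C1_onD(3)[OF pv])
 have Isum: "I P g = (SU j. I (pd j (v j)) g)" if "g = ps | (\<exists>i. g = pd i (pd i ps))" for g
  unfolding I_def P_def using that cpv
  by (auto simp: sum_distrib_right intro!: Bochner_Integration.integral_sum ig)
 have Isum1: "I P (pd i (pd i ps)) = (SU j. I (pd j (v j)) (pd i (pd i ps)))" for i
  by (rule Isum) auto
 have Idiff: "I (%z. pd a (v b) z - pd b (v a) z) g = I (pd a (v b)) g - I (pd b (v a)) g" if "g = ps | (\<exists>i. g = pd i (pd i ps))" for g
  unfolding I_def using that cpv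
  by (auto simp: left_diff_distrib intro!: Bochner_Integration.integral_diff ig)
 have Idiff1: "I (%z. pd a (v b) z - pd b (v a) z) (pd i (pd i ps)) = I (pd a (v b)) (pd i (pd i ps)) - I (pd b (v a)) (pd i (pd i ps))" for i
  by (rule Idiff) auto
 have "0 = (SU i. cr mu * (SU j. I (pd j (pd j (v i))) (pd i ps)) + cr (lam + mu) * I (pd i P) (pd i ps)
  + cr ka * I (v i) (pd i ps))"
  unfolding E by simp
 also have "... = - (cr mu * (SU i j. I (pd i (v i)) (pd j (pd j ps))) + cr (lam + mu) * (SU i. I P (pd i (pd i ps)))
  + cr ka * (SU i. I (pd i (v i)) ps))"
 proof -
  have gen: "(SU i. x * (- S i) + y * (- T i) + z * (- V i)) = - (x * sum S UNIV + y * sum T UNIV + z * sum V UNIV)"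
  for x y z :: complex and S T V :: "3 => complex"
  by (simp add: sum.distrib sum_negf sum_subtractf sum_distrib_left)
  show ?thesis unfolding parts1[OF P1]
  unfolding A Ivp by (simp only: gen)
 qed
 also have "(SU i j. I (pd i (v i)) (pd j (pd j ps))) = (SU j. I P (pd j (pd j ps)))"
  by (subst sum.swap) (simp add: Isum1)
 also have "(SU i. I (pd i (v i)) ps) = I P ps" by (simp add: Isum)
 finally have "cr (lam + 2 * mu) * (SU i. I P (pd i (pd i ps))) + cr ka * I P ps = 0"
  by (simp add: ags)
 then show ?P using fin[OF C1_onD(3)[OF P1], of "lam + 2 * mu"] unfolding P_def by simp
 \<comment> \<open>The gradient of the divergence contributes the same to both tested equations, by
   this exchange of \<open>a\<close> and \<open>b\<close>, and so drops out of their
   difference.\<close>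
 have q: "I (pd b P) (pd a ps) = I (pd a P) (pd b ps)"
 proof -
  have "I (pd b P) (pd a ps) = - I P (pd b (pd a ps))" by (rule parts1[OF P1])
  also have "... = - I P (pd a (pd b ps))" unfolding comm[of b a] ..
  also have "... = I (pd a P) (pd b ps)" by (simp add: parts1[OF P1])
  finally show ?thesis .
 qed
 have "cr mu * (SU i. I (%z. pd a (v b) z - pd b (v a) z) (pd i (pd i ps))) + cr ka * I (%z. pd a (v b) z - pd b (v a) z) ps = 0"
 proof -
  have 1: "(SU i. I (%z. pd a (v b) z - pd b (v a) z) (pd i (pd i ps)))
  = (SU i. I (pd a (v b)) (pd i (pd i ps))) - (SU i. I (pd b (v a)) (pd i (pd i ps)))"
  by (simp add: Idiff1 sum_subtractf)
  have 2: "I (%z. pd a (v b) z - pd b (v a) z) ps = I (pd a (v b)) ps - I (pd b (v a)) ps" by (simp add: Idiff)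
  show ?thesis
  unfolding 1 2 using E[of b a] E[of a b] q unfolding A Ivp by (simp add: ags)
 qed
 moreover have "cont_on U (%z. pd a (v b) z - pd b (v a) z)" by (intro continuous_intros cpv)
 ultimately show ?C using fin[of "%z. pd a (v b) z - pd b (v a) z" mu] by simp
qed

section \<open>Energy and Pohozaev identities for the Lame system\<close>

lemma ang_ccoord: "ang i j (%x. rc (x $ i)) x = (if i = j then 0 else - cr (x $ j))"
 by (auto simp: ang_def pd_ccoord scaleR_conv_of_real)

text \<open>The divergence theorem in differential form: \<open>r\<close> times the integral of
  \<open>x . g\<close> is the flux through the sphere of radius \<open>r\<close>, up to the
  normalisation of the measure. Pointwise, \<open>r^2 div g\<close> is \<open>x . euler g\<close>
  plus the terms \<open>x_i ang i j g_j\<close>; by parts the latter integrate to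
  \<open>2 x . g\<close>, one part of which belongs to the Euler derivative of \<open>x . g\<close>
  and the other to the factor \<open>r\<close>.\<close>

lemma sph_divergence:
 fixes g :: "3 => cfun"
 assumes g: "!!j. C1_on (shell a b) (g j)" and r: "0 <= a" "a < r" "r < b"
 shows "((%r. r *r sph (%y. SU j. cr ((r *r y) $ j) * g j (r *r y))) has_vector_derivative
  r^2 *r sph (%y. SU j. pd j (g j) (r *r y))) (at r)"
proof -
 define H where "H x = (SU j. cr (x $ j) * g j x)" for x
 have H1: "C1_on (shell a b) H" unfolding H_def[abs_def] by (intro C1_intros g)
 have r0: "r > 0" using r by simp
 have inS: "r *r y : shell a b" if "norm y = 1" for y using that r by (simp add: shell_def)
 have cS: "cont_on (sphere 0 1) (%y. f (r *r y))" if "cont_on (shell a b) f" for f :: "cfun"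
  by (rule continuous_on_shell_sphere[OF that r])
 define I where "I f = sphr r f" for f :: "cfun"
 have cc: "cont_on (shell a b) (%x. rc (x $ i))" for i by (intro continuous_intros)
 note cg = C1_onD(3)[OF g] C1_onD(2)[OF g] continuous_on_ang[OF g] continuous_on_euler[OF g]
 have ang: "I (%x. cr (x $ i) * ang i j (g j) x) = (if i = j then 0 else I (%x. cr (x $ j) * g j x))" for i j
 proof -
  have "I (%x. cr (x $ i) * ang i j (g j) x) = I (%x. ang i j (g j) x * cr (x $ i))"
  by (simp add: mult.commute)
  also have "... = - I (%x. g j x * ang i j (%x. cr (x $ i)) x)"
  unfolding I_def by (rule sph_ang_parts[OF g C1_on_coord r])
  also have "... = - I (%x. if i = j then 0 else - (cr (x $ j) * g j x))"
  by (simp add: ang_ccoord mult.commute if_distrib cong: if_cong)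
  also have "... = (if i = j then 0 else I (%x. cr (x $ j) * g j x))"
  by (simp add: I_def sph_def)
  finally show ?thesis .
 qed
 have Isum: "I (%x. SU i. f i x) = (SU i. I (f i))" if "!!i. cont_on (shell a b) (f i)" for f :: "3 => cfun"
  unfolding I_def by (intro sph_sum cS that)
 have Iadd: "I (%x. f x + g x) = I f + I g" if "cont_on (shell a b) f" "cont_on (shell a b) g" for f g
  unfolding I_def by (intro sph_add cS that)
 have Icong: "I f = I f'" if "!!x. x : shell a b ==> norm x = r ==> f x = f' x" for f f'
  unfolding I_def by (rule sph_cong) (use that inS r0 in auto)
 have dg: "g j differentiable (at x)" if "x : shell a b" for j x using that by (rule C1_onD(1)[OF g])
 have EH: "euler H x = H x + (SU j. cr (x $ j) * euler (g j) x)" if "x : shell a b" for x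
 proof -
  have "pd i H x = g i x + (SU j. cr (x $ j) * pd i (g j) x)" for i
  unfolding H_def[abs_def]
  by (subst pd_sum) (auto simp: pd_coord_mult[OF dg[OF that]] dg[OF that] sum.distrib intro!: differentiable_mult)
  then show ?thesis
  unfolding euler_def[of H] by (simp add: euler_def H_def scaleR_conv_of_real sum_3 ags)
 qed
 have rd: "cr (r^2) * (SU j. pd j (g j) x) = (SU j. cr (x $ j) * euler (g j) x)
  + (SU j i. cr (x $ i) * ang i j (g j) x)" if "norm x = r" for x
  unfolding that[symmetric] norm_3
  by (simp add: euler_def ang_def sum_3 scaleR_conv_of_real power2_eq_square ags)
 have "cr (r^2) * I (%x. SU j. pd j (g j) x) = I (%x. cr (r^2) * (SU j. pd j (g j) x))"
  unfolding I_def sph_def by simp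
 also have "... = I (%x. (SU j. cr (x $ j) * euler (g j) x)
  + (SU j i. cr (x $ i) * ang i j (g j) x))"
  by (rule Icong) (rule rd)
 also have "... = I (%x. SU j. cr (x $ j) * euler (g j) x)
  + (SU j i. I (%x. cr (x $ i) * ang i j (g j) x))"
 proof -
  have c1: "cont_on (shell a b) (%x. SU j. cr (x $ j) * euler (g j) x)"
  and c2: "cont_on (shell a b) (%x. SU j i. cr (x $ i) * ang i j (g j) x)"
  and c3: "!!j. cont_on (shell a b) (%x. SU i. cr (x $ i) * ang i j (g j) x)"
  and c4: "!!i j. cont_on (shell a b) (%x. cr (x $ i) * ang i j (g j) x)"
  by (intro continuous_on_sum continuous_on_mult cc cg)+
  show ?thesis unfolding Iadd[OF c1 c2] Isum[OF c3] Isum[OF c4] ..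
 qed
 also have "(SU j i. I (%x. cr (x $ i) * ang i j (g j) x)) = 2 * I H"
 proof -
  have "I H = (SU j. I (%x. cr (x $ j) * g j x))"
  unfolding H_def[abs_def] by (intro Isum continuous_on_mult cc cg)
  then show ?thesis unfolding ang by (simp add: sum_3)
 qed
 also have "I (%x. SU j. cr (x $ j) * euler (g j) x) + 2 * I H = I H + I (euler H)"
 proof -
  have "I (euler H) = I (%x. H x + (SU j. cr (x $ j) * euler (g j) x))"
  by (rule Icong) (rule EH)
  also have "... = I H + I (%x. SU j. cr (x $ j) * euler (g j) x)"
  by (intro Iadd C1_onD(3)[OF H1] continuous_on_sum continuous_on_mult cc cg)
  finally show ?thesis by simp
 qed
 finally have div: "r^2 *r I (%x. SU j. pd j (g j) x) = I H + I (euler H)"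
  by (simp add: scaleR_conv_of_real)
 have "((%r. r *r sphr r H) has_vector_derivative
  r *r ((1 / r) *r sphr r (euler H)) + 1 *r sphr r H) (at r)"
  by (rule has_vector_derivative_scaleR[OF _ sph_deriv[OF H1 r]]) (rule DERIV_ident)
 then have "((%r. r *r sphr r H) has_vector_derivative
  r^2 *r I (%x. SU j. pd j (g j) x)) (at r)"
  unfolding div using r0 by (simp add: I_def add.commute)
 then show ?thesis unfolding H_def I_def .
qed

text \<open>Limits are assumed pointwise on the sphere, without uniformity. A sequence with
  unbounded values would accumulate at a boundary point by compactness, against the existence of the
  limit there.\<close>

lemma bounded_near_sphere:
 fixes f :: "real^3 => 'b::real_normed_vector"
 assumes S: "S \<inter> sphere 0 1 = {}" and lim: "!!y. norm y = 1 ==> \<exists>l. (f ---> l) (at y within S)"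
 shows "\<exists>e>0. \<exists>B. \<forall>x\<in>S. \<bar>norm x - 1\<bar> < e \<longrightarrow> norm (f x) <= B"
proof (rule ccontr)
 assume "\<not> ?thesis"
 then have "\<exists>x\<in>S. \<bar>norm x - 1\<bar> < inverse (real (Suc n)) & real n < norm (f x)" for n
  by (meson inverse_positive_iff_positive not_le of_nat_0_less_iff zero_less_Suc)
 then obtain X where X: "!!n. X n : S" "!!n. \<bar>norm (X n) - 1\<bar> < inverse (real (Suc n))" "!!n. real n < norm (f (X n))"
  by metis
 have "X n : cball 0 2" for n
 proof -
  have "inverse (real (Suc n)) <= 1" by (simp add: field_simps)
  then show ?thesis using X(2)[of n] by simp
 qed
 then obtain l s where l: "strict_mono s" "(X \<circ> s) \<longlonglongrightarrow> l"
  using compact_cball[of "0::real^3" 2] unfolding compact_def by metis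
 have "(%n. norm (X n) - 1) \<longlonglongrightarrow> 0"
  by (rule Lim_null_comparison[OF _ LIMSEQ_inverse_real_of_nat]) (use X(2) in \<open>auto intro!: always_eventually less_imp_le\<close>)
 then have "(%n. norm (X (s n)) - 1) \<longlonglongrightarrow> 0" using LIMSEQ_subseq_LIMSEQ[OF _ l(1)] by (simp add: o_def)
 moreover have "(%n. norm (X (s n)) - 1) \<longlonglongrightarrow> norm l - 1"
  using l(2) by (intro tendsto_intros) (simp add: o_def)
 ultimately have nl: "norm l = 1" using LIMSEQ_unique by fastforce
 obtain L where L: "(f ---> L) (at l within S)" using lim[OF nl] by blast
 have "l \<notin> S" using S nl by auto
 then have "X n ~= l" for n using X(1)[of n] by auto
 then have "filterlim (%n. X (s n)) (at l within S) sequentially"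
  unfolding filterlim_at using l(2) X(1) by (auto simp: o_def intro!: always_eventually)
 then have "(%n. f (X (s n))) \<longlonglongrightarrow> L" by (rule filterlim_compose[OF L])
 then have "(%n. norm (f (X (s n)))) \<longlonglongrightarrow> norm L" by (rule tendsto_norm)
 moreover have "filterlim (%n. norm (f (X (s n)))) at_top sequentially"
 proof (rule filterlim_at_top_mono[OF filterlim_real_sequentially])
  show "\<forall>\<^sub>F n in sequentially. real n <= norm (f (X (s n)))"
  using X(3) seq_suble[OF l(1)] by (intro always_eventually allI) (meson less_imp_le of_nat_mono order_trans)
 qed
 ultimately show False using not_tendsto_and_filterlim_at_infinity filterlim_at_top_imp_at_infinity
  by (metis trivial_limit_sequentially)
qed

text \<open>Dominated convergence along sequences of radii with a constant bound. The limit function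
  is measurable because it is a pointwise limit of functions continuous on the sphere.\<close>

lemma sph_limit:
 fixes f :: "cfun"
 assumes F: "F = at_left 1 | F = at_right (1::real)"
  and ev: "\<forall>\<^sub>F r in F. cont_on (sphere 0 1) (%y. f (r *r y))"
  and bd: "\<forall>\<^sub>F r in F. \<forall>y. norm y = 1 \<longrightarrow> norm (f (r *r y)) <= B"
  and lim: "!!y. norm y = 1 ==> ((%r. f (r *r y)) ---> l y) F"
 shows "((%r. sphr r f) ---> sph l) F"
proof -
 have "(%n. sph (%y. f (X n *r y))) \<longlonglongrightarrow> sph l"
  if X: "filterlim X F sequentially" for X
 proof -
  have "\<forall>\<^sub>F n in sequentially. cont_on (sphere 0 1) (%y. f (X n *r y)) & (\<forall>y. norm y = 1 \<longrightarrow> norm (f (X n *r y)) <= B)"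
  using eventually_compose_filterlim[OF eventually_conj[OF ev bd] X] .
  then obtain N where N: "!!n. n \<ge> N ==> cont_on (sphere 0 1) (%y. f (X n *r y))"
  "!!n y. n \<ge> N ==> norm y = 1 ==> norm (f (X n *r y)) <= B"
  unfolding eventually_sequentially by blast
  have lX: "(%n. f (X n *r y)) \<longlonglongrightarrow> l y" if "norm y = 1" for y
  by (rule filterlim_compose[OF lim[OF that] X])
  have mN: "(%y. f (X (n + N) *r y)) : borel_measurable sphM" for n
  by (rule measurable_sphM_continuous[OF N(1)]) simp
  have "l : borel_measurable sphM"
  by (rule borel_measurable_LIMSEQ_metric[OF mN]) (rule LIMSEQ_ignore_initial_segment[OF lX], simp)
  then have "(%n. sph (%y. f (X (n + N) *r y))) \<longlonglongrightarrow> sph l"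
  unfolding sph_def
  by (rule integral_dominated_convergence[where w="%_. B"])
  (use mN N(2) lX in \<open>auto intro!: AE_I2 LIMSEQ_ignore_initial_segment\<close>)
  then show ?thesis by (rule LIMSEQ_offset)
 qed
 then have seq: "(%n. sph (%y. f (X n *r y))) \<longlonglongrightarrow> sph l"
  if "filterlim X F sequentially" for X using that .
 from F obtain A :: "real set" where A: "F = at 1 within A" "1 \<notin> A" by auto
 show ?thesis
  unfolding A(1) tendsto_at_iff_sequentially
 proof (intro allI impI)
  fix X assume X: "\<forall>i. X i : A - {1}" "X \<longlonglongrightarrow> 1"
  have "filterlim X F sequentially"
  unfolding A(1) filterlim_at using X by (auto intro!: always_eventually)
  from seq[OF this] show "((%r. sphr r f) \<circ> X) \<longlonglongrightarrow> sph l" by (simp add: o_def)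
 qed
qed

section \<open>Stress, energy flux and Pohozaev identity of a Lame field\<close>

locale lame_field =
 fixes v :: "3 => cfun" and lam mu ka :: real and U :: "(real^3) set"
 assumes oU: "open U" and v2: "!!i. C2_on U (v i)"
  and lame_eq: "!!x i. x : U ==> cr mu * (SU j. pd j (pd j (v i)) x)
  + cr (lam + mu) * pd i (%x. SU j. pd j (v j) x) x + cr ka * v i x = 0"
begin

definition P :: "cfun" where
 "P x = (SU j. pd j (v j) x)"

text \<open>The Cauchy stress. Its row divergence is \<open>- ka\<close> times the field, the form
  of the Lame system suited to integration by parts.\<close>

definition ta :: "3 => 3 => cfun" where
 "ta i j x = (if i = j then cr lam * P x else 0) + cr mu * (pd j (v i) x + pd i (v j) x)"

definition e :: "cfun" where
 "e x = (SU j i. ta i j x * cnj (pd j (v i) x))"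

definition n2 :: "cfun" where
 "n2 x = (SU i. v i x * cnj (v i x))"

lemma v1: "C1_on U (v i)" and pv1: "C1_on U (pd j (v i))"
 using C2_onD[OF v2] by auto

lemma dv: "x : U ==> v i differentiable (at x)" and dpv: "x : U ==> pd j (v i) differentiable (at x)"
 by (rule C1_onD(1)[OF v1], assumption) (rule C1_onD(1)[OF pv1], assumption)

lemma P1: "C1_on U P"
 unfolding P_def[abs_def] by (intro C1_on_sum pv1)

lemma tau1: "C1_on U (ta i j)"
 unfolding ta_def[abs_def] by (cases "i = j") (auto intro!: C1_intros P1 pv1)

lemma dP: "x : U ==> P differentiable (at x)" and dtau: "x : U ==> ta i j differentiable (at x)"
 by (rule C1_onD(1)[OF P1], assumption) (rule C1_onD(1)[OF tau1], assumption)

lemma pd_P: "x : U ==> pd k P x = (SU j. pd k (pd j (v j)) x)"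
 unfolding P_def[abs_def] by (rule pd_sum) (rule dpv)

lemma pd_comm: "x : U ==> pd k (pd j (v i)) x = pd j (pd k (v i)) x"
 by (rule pd_commute[OF oU v2])

lemma pd_tau:
 assumes x: "x : U"
 shows "pd k (ta i j) x = (if i = j then cr lam * pd k P x else 0) + cr mu * (pd k (pd j (v i)) x + pd k (pd i (v j)) x)"
 unfolding ta_def[abs_def] using dP[OF x] dpv[OF x]
 by (cases "i = j") (simp_all add: pd_add pd_mult)

lemma div_tau:
 assumes x: "x : U"
 shows "(SU j. pd j (ta i j) x) = - cr ka * v i x"
proof -
 have "(SU j. pd j (ta i j) x) = cr lam * pd i P x + cr mu * ((SU j. pd j (pd j (v i)) x) + (SU j. pd j (pd i (v j)) x))"
  unfolding pd_tau[OF x] by (simp add: sum.distrib sum_distrib_left distrib_left)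
 also have "(SU j. pd j (pd i (v j)) x) = pd i P x"
  unfolding pd_P[OF x] pd_comm[OF x, of _ i] ..
 finally have "(SU j. pd j (ta i j) x) = cr mu * (SU j. pd j (pd j (v i)) x) + cr (lam + mu) * pd i P x"
  by (simp add: ags)
 then show ?thesis
  using lame_eq[OF x, of i] unfolding P_def[symmetric] by (simp add: eq_neg_iff_add_eq_0)
qed

lemma e_eq: "e x = cr (lam * (cmod (P x))^2 + mu / 2 * (SU j i. (cmod (pd j (v i) x + pd i (v j) x))^2))"
proof -
 have sq: "cr ((cmod z)^2) = z * cnj z" for z by (rule complex_norm_square)
 show ?thesis
  unfolding of_real_add of_real_mult of_real_sum sq e_def ta_def P_def
  by (simp add: sum_3) (simp add: field_simps)
qed

text \<open>The trace satisfies \<open>|P|^2 <= 3 sum |d_i v_i|^2\<close>, and the diagonal of the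
  symmetrised gradient alone contributes \<open>4 sum |d_i v_i|^2\<close>. So the shear energy
  dominates \<open>2 mu / 3 |P|^2\<close>, which together with \<open>lam |P|^2\<close> is
  nonnegative even for negative \<open>lam\<close>.\<close>

lemma e_nonneg:
 assumes "0 < mu" "0 < 3 * lam + 2 * mu"
 shows "0 <= Re (e x)" "Im (e x) = 0"
proof -
 let ?q = "%i. cmod (pd i (v i) x)"
 have "cmod (P x) <= ?q 1 + ?q 2 + ?q 3"
  unfolding P_def sum_3 by (intro norm_triangle_mono norm_triangle_ineq order_refl)
 then have "(cmod (P x))^2 <= (?q 1 + ?q 2 + ?q 3)^2" by (intro power_mono) auto
 also have "... <= 3 * ((?q 1)^2 + (?q 2)^2 + (?q 3)^2)"
  using sum_squares_ge_zero[of "?q 1 - ?q 2" "?q 2 - ?q 3"] zero_le_power2[of "?q 1 - ?q 3"]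
  by (simp add: power2_eq_square ags)
 finally have 1: "(cmod (P x))^2 <= 3 * ((?q 1)^2 + (?q 2)^2 + (?q 3)^2)" .
 have 2: "4 * ((?q 1)^2 + (?q 2)^2 + (?q 3)^2) <= (SU j i. (cmod (pd j (v i) x + pd i (v j) x))^2)"
 proof -
  have "cmod (z + z) = 2 * cmod z" for z :: complex by (metis mult_2 norm_mult norm_numeral)
  then show ?thesis by (simp add: sum_3 power_mult_distrib)
 qed
 have "0 <= (lam + 2 * mu / 3) * (cmod (P x))^2" using assms by (intro mult_nonneg_nonneg) auto
 also have "... <= lam * (cmod (P x))^2 + mu / 2 * (4 * ((?q 1)^2 + (?q 2)^2 + (?q 3)^2))"
  using mult_left_mono[OF 1, of mu] assms by (simp add: ags)
 also have "... <= lam * (cmod (P x))^2 + mu / 2 * (SU j i. (cmod (pd j (v i) x + pd i (v j) x))^2)"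
  using assms by (intro add_left_mono mult_left_mono 2) auto
 finally show "0 <= Re (e x)" unfolding e_eq by simp
 show "Im (e x) = 0" unfolding e_eq by simp
qed

lemma n2_eq: "n2 x = cr (SU i. (cmod (v i x))^2)"
 by (simp add: n2_def complex_norm_square del: of_real_power)

lemma C1_e: "C1_on U e" and C1_n2: "C1_on U n2"
 unfolding e_def[abs_def] n2_def[abs_def] by (intro C1_intros tau1 pv1 v1)+

definition flux :: "cfun" where
 "flux x = (SU j. cr (x $ j) * (SU i. ta i j x * cnj (v i x)))"

lemma flux_deriv:
 assumes sh: "shell a b \<subseteq> U" and r: "0 <= a" "a < r" "r < b"
 shows "((%r. r *r sphr r flux) has_vector_derivative
  r^2 *r sph (%y. e (r *r y) - cr ka * n2 (r *r y))) (at r)"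
proof -
 define g where "g j x = (SU i. ta i j x * cnj (v i x))" for j x
 have g: "C1_on (shell a b) (g j)" for j
  unfolding g_def[abs_def] by (intro C1_intros C1_on_subset[OF _ sh] tau1 v1)
 have div: "(SU j. pd j (g j) x) = e x - cr ka * n2 x" if x: "x : U" for x
 proof -
  have "pd j (g j) x = (SU i. pd j (ta i j) x * cnj (v i x) + ta i j x * cnj (pd j (v i) x))" for j
  unfolding g_def[abs_def] using dv[OF x] dtau[OF x] diff_cnj[OF dv[OF x]]
  by (subst pd_sum) (auto simp: pd_mult pd_cnj intro!: differentiable_mult)
  then have "(SU j. pd j (g j) x) = (SU i. (SU j. pd j (ta i j) x) * cnj (v i x)) + e x"
  unfolding e_def by (simp add: sum.distrib sum_distrib_right sum.swap[of "%i j. pd j (ta i j) x * cnj (v i x)"])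
  also have "(SU i. (SU j. pd j (ta i j) x) * cnj (v i x)) = - cr ka * n2 x"
  unfolding div_tau[OF x] n2_def by (simp add: sum_distrib_left mult.assoc sum_negf)
  finally show ?thesis by simp
 qed
 have eq: "sph (%y. SU j. pd j (g j) (r *r y)) = sph (%y. e (r *r y) - cr ka * n2 (r *r y))"
  by (rule sph_cong, rule div) (use r sh in \<open>auto simp: shell_def\<close>)
 show ?thesis
  using sph_divergence[where g=g, OF g r] unfolding eq unfolding g_def flux_def .
qed

text \<open>The radial derivative of the weighted flux is the integral of
  \<open>e - ka * n2\<close>, a real density. The imaginary part is therefore conserved; physically
  it is the power crossing the sphere.\<close>

lemma flux_im_const:
 assumes sh: "shell a b \<subseteq> U" and a: "0 <= a" and r: "a < r" "r < b" and s: "a < s" "s < b"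
 shows "Im (r *r sphr r flux) = Im (s *r sphr s flux)"
proof -
 have d: "((%r. Im (r *r sphr r flux)) has_real_derivative 0) (at t)" if t: "a < t" "t < b" for t
 proof -
  have c: "cont_on (sphere 0 1) (%y. e (t *r y) - cr ka * n2 (t *r y))"
  by (rule continuous_on_shell_sphere[of a b "%x. e x - cr ka * n2 x", OF _ a t])
  (intro continuous_on_diff continuous_on_mult continuous_on_const
  continuous_on_subset[OF C1_onD(3)[OF C1_e] sh] continuous_on_subset[OF C1_onD(3)[OF C1_n2] sh])
  have "Im (sph (%y. e (t *r y) - cr ka * n2 (t *r y))) = sph (%y. 0)"
  unfolding sph_real(2)[OF c] by (rule sph_cong) (simp add: e_eq n2_eq)
  also have "... = (0::real)" by (simp add: sph_def)
  finally have z: "Im (sph (%y. e (t *r y) - cr ka * n2 (t *r y))) = 0" .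
  show ?thesis
  using bounded_linear.has_vector_derivative[OF bounded_linear_Im flux_deriv[OF sh a t]] z
  by (simp add: has_real_derivative_iff_has_vector_derivative)
 qed
 have "\<exists>c. \<forall>t\<in>{a<..<b}. Im (t *r sphr t flux) = c"
 proof (rule has_field_derivative_zero_constant)
  show "((%t. Im (t *r sphr t flux)) has_real_derivative 0) (at t within {a<..<b})"
  if "t : {a<..<b}" for t
  by (rule has_field_derivative_at_within[OF d]) (use that in auto)
 qed simp
 then obtain c where c: "\<forall>t\<in>{a<..<b}. Im (t *r sphr t flux) = c" ..
 have "r : {a<..<b}" "s : {a<..<b}" using r s by auto
 from bspec[OF c this(1)] bspec[OF c this(2)] show ?thesis by simp
qed

text \<open>The radial part of the Pohozaev (Rellich) vector field: the stress against the
  conjugated Euler derivative of \<open>v\<close>, minus half the Lagrangian density times the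
  position.\<close>

definition poh :: "cfun" where
 "poh x = (SU j. cr (x $ j) * ((SU i. ta i j x * cnj (euler (v i) x)) - (1/2) * (cr (x $ j) * (e x - cr ka * n2 x))))"

text \<open>The equation is multiplied by the conjugated Euler derivative. In the real part the
  second derivatives combine into the Euler derivative of the density \<open>h\<close>, which the
  second summand of \<open>poh\<close> removes; the coefficient 3/2 is half the divergence of the
  position field in dimension 3.\<close>

lemma poh_deriv:
 assumes sh: "shell a b \<subseteq> U" and r: "0 <= a" "a < r" "r < b"
 shows "((%r. Re (r *r sphr r poh)) has_real_derivative
  r^2 * Re (sph (%y. (3/2) * (cr ka * n2 (r *r y)) - (1/2) * e (r *r y)))) (at r)"
proof -
 define h where "h x = e x - cr ka * n2 x" for x
 have h1: "C1_on U h" unfolding h_def[abs_def] by (intro C1_intros C1_e C1_n2)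
 define g where "g j x = (SU i. ta i j x * cnj (euler (v i) x)) - (1/2) * (cr (x $ j) * h x)" for j x
 have Ev1: "C1_on U (euler (v i))" for i by (rule C1_on_euler[OF v2])
 have g: "C1_on (shell a b) (g j)" for j
  unfolding g_def[abs_def] by (intro C1_intros C1_on_subset[OF _ sh] tau1 Ev1 h1)
 have div: "Re (SU j. pd j (g j) x) = Re ((3/2) * (cr ka * n2 x) - (1/2) * e x)" if x: "x : U" for x
 proof -
  have dE: "euler (v i) differentiable (at x)" for i by (rule C1_onD(1)[OF Ev1 x])
  have dh: "h differentiable (at x)" by (rule C1_onD(1)[OF h1 x])
  have dx: "(%x. cr (x $ j) * h x) differentiable (at x)" for j by (intro differentiable_mult dh diff_ccoord)
  have ds: "(%x. ta i j x * cnj (euler (v i) x)) differentiable (at x)" for i j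
  by (intro differentiable_mult dtau[OF x] diff_cnj dE)
  define X where "X i j = pd j (v i) x" for i j
  define Z where "Z i j = euler (pd j (v i)) x" for i j
  have pdE: "pd j (euler (v i)) x = X i j + Z i j" for i j
  unfolding pd_euler[OF v2 x] X_def Z_def euler_def scaleR_conv_of_real pd_comm[OF x, of j] ..
  have "pd j (g j) x = (SU i. pd j (ta i j) x * cnj (euler (v i) x) + ta i j x * cnj (X i j + Z i j)) - (1/2) * (h x + cr (x $ j) * pd j h x)" for j
  proof -
  have "pd j (g j) x = (SU i. pd j (%x. ta i j x * cnj (euler (v i) x)) x) - pd j (%x. (1/2) * (cr (x $ j) * h x)) x"
  unfolding g_def[abs_def]
  by (subst pd_diff) (auto simp: pd_sum ds dx intro!: differentiable_sum differentiable_mult)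
  also have "pd j (%x. (1/2) * (cr (x $ j) * h x)) x = (1/2) * (h x + cr (x $ j) * pd j h x)"
  by (subst pd_mult) (auto simp: dx pd_coord_mult[OF dh])
  also have "(SU i. pd j (%x. ta i j x * cnj (euler (v i) x)) x) = (SU i. pd j (ta i j) x * cnj (euler (v i) x) + ta i j x * cnj (X i j + Z i j))"
  by (intro sum.cong refl) (simp add: pd_mult[OF dtau[OF x] diff_cnj[OF dE]] pd_cnj[OF dE] pdE)
  finally show ?thesis .
  qed
  then have "(SU j. pd j (g j) x) = (SU j i. pd j (ta i j) x * cnj (euler (v i) x))
  + (SU j i. ta i j x * cnj (X i j)) + (SU j i. ta i j x * cnj (Z i j)) - (3/2) * h x - (1/2) * euler h x"
  by (simp add: sum.distrib sum_subtractf distrib_left euler_def scaleR_conv_of_real sum_distrib_left)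
  also have "(SU j i. pd j (ta i j) x * cnj (euler (v i) x)) = (SU i. - cr ka * v i x * cnj (euler (v i) x))"
  by (subst sum.swap) (simp add: sum_distrib_right[symmetric] div_tau[OF x])
  also have "(SU j i. ta i j x * cnj (X i j)) = e x" by (simp add: e_def X_def)
  finally have 1: "(SU j. pd j (g j) x) = (SU i. - cr ka * v i x * cnj (euler (v i) x)) + e x
  + (SU j i. ta i j x * cnj (Z i j)) - (3/2) * h x - (1/2) * euler h x" .
  have Etau: "euler (ta i j) x = (if i = j then cr lam * (SU k. Z k k) else 0) + cr mu * (Z i j + Z j i)" for i j
  proof -
  have EP: "euler P x = (SU k. Z k k)"
  unfolding Z_def euler_def pd_P[OF x] by (simp add: sum_3 ags)
  have "euler (ta i j) x = (if i = j then cr lam * euler P x else 0) + cr mu * (euler (pd j (v i)) x + euler (pd i (v j)) x)"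
  unfolding euler_def pd_tau[OF x] by (simp add: sum_3 ags scaleR_conv_of_real)
  then show ?thesis unfolding EP Z_def .
  qed
  have Eh: "euler h x = (SU j i. euler (ta i j) x * cnj (X i j) + ta i j x * cnj (Z i j)) - cr ka * (SU i. euler (v i) x * cnj (v i x) + v i x * cnj (euler (v i) x))"
  proof -
  have dt: "(%x. ta i j x * cnj (pd j (v i) x)) differentiable (at x)" for i j
  by (intro differentiable_mult dtau[OF x] diff_cnj dpv[OF x])
  have dn: "(%x. v i x * cnj (v i x)) differentiable (at x)" for i
  by (intro differentiable_mult dv[OF x] diff_cnj)
  have pe: "pd k e x = (SU j i. pd k (ta i j) x * cnj (X i j) + ta i j x * cnj (pd k (pd j (v i)) x))" for k
  unfolding e_def[abs_def] X_def
  by (simp add: pd_sum dt differentiable_sum pd_mult dtau[OF x] dpv[OF x] diff_cnj pd_cnj)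
  have pn: "pd k n2 x = (SU i. pd k (v i) x * cnj (v i x) + v i x * cnj (pd k (v i) x))" for k
  unfolding n2_def[abs_def]
  by (simp add: pd_sum dn pd_mult dv[OF x] diff_cnj pd_cnj)
  have de: "e differentiable (at x)" "n2 differentiable (at x)" using C1_onD(1)[OF C1_e x] C1_onD(1)[OF C1_n2 x] by auto
  have "pd k h x = pd k e x - cr ka * pd k n2 x" for k
  unfolding h_def[abs_def] using de by (simp add: pd_diff pd_mult)
  then have "euler h x = (SU k. cr (x $ k) * pd k e x) - cr ka * (SU k. cr (x $ k) * pd k n2 x)"
  by (simp add: euler_def scaleR_conv_of_real sum_subtractf sum_distrib_left right_diff_distrib mult_ac)
  also have "(SU k. cr (x $ k) * pd k e x) = (SU j i. euler (ta i j) x * cnj (X i j) + ta i j x * cnj (Z i j))"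
  proof -
  have "(SU k. cr (x $ k) * pd k e x) = (SU k j. SU i. cr (x $ k) * pd k (ta i j) x * cnj (X i j) + ta i j x * cnj (cr (x $ k) * pd k (pd j (v i)) x))"
  unfolding pe by (simp add: sum_distrib_left ags)
  also have "... = (SU j i. SU k. cr (x $ k) * pd k (ta i j) x * cnj (X i j) + ta i j x * cnj (cr (x $ k) * pd k (pd j (v i)) x))"
  proof -
  have "(\<Sum>k\<in>A. \<Sum>j\<in>B. \<Sum>i\<in>C. f k j i) = (\<Sum>j\<in>B. \<Sum>i\<in>C. \<Sum>k\<in>A. f k j i)"
  for f :: "3 => 3 => 3 => complex" and A B C
  proof -
  have "(\<Sum>k\<in>A. \<Sum>j\<in>B. \<Sum>i\<in>C. f k j i) = (\<Sum>j\<in>B. \<Sum>k\<in>A. \<Sum>i\<in>C. f k j i)" by (rule sum.swap)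
  also have "... = (\<Sum>j\<in>B. \<Sum>i\<in>C. \<Sum>k\<in>A. f k j i)" by (rule sum.cong[OF refl]) (rule sum.swap)
  finally show ?thesis .
  qed
  then show ?thesis .
  qed
  finally show ?thesis
  by (simp add: euler_def Z_def scaleR_conv_of_real sum.distrib sum_distrib_left sum_distrib_right)
  qed
  also have "(SU k. cr (x $ k) * pd k n2 x) = (SU i. euler (v i) x * cnj (v i x) + v i x * cnj (euler (v i) x))"
  unfolding pn by (simp add: euler_def scaleR_conv_of_real sum_3 ags)
  finally show ?thesis .
  qed
  \<comment> \<open>Symmetry of the elasticity tensor: the stress of \<open>Z\<close> against
    \<open>X\<close> is the conjugate of the stress of \<open>X\<close> against
    \<open>Z\<close>.\<close>
  have herm: "(SU j i. euler (ta i j) x * cnj (X i j)) = cnj (SU j i. ta i j x * cnj (Z i j))"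
  unfolding Etau ta_def P_def X_def[symmetric]
  by (simp add: sum_3) (simp add: ags)
  have "Re (euler h x) = 2 * Re (SU j i. ta i j x * cnj (Z i j)) - 2 * ka * Re (SU i. v i x * cnj (euler (v i) x))"
  proof -
  have "(SU i. euler (v i) x * cnj (v i x)) = cnj (SU i. v i x * cnj (euler (v i) x))"
  by (simp add: mult.commute)
  then show ?thesis unfolding Eh sum.distrib herm by simp
  qed
  moreover have "Re (SU i. - cr ka * v i x * cnj (euler (v i) x)) = - ka * Re (SU i. v i x * cnj (euler (v i) x))"
  proof -
  have "(SU i. - cr ka * v i x * cnj (euler (v i) x)) = - cr ka * (SU i. v i x * cnj (euler (v i) x))"
  by (simp add: sum_distrib_left mult.assoc sum_negf)
  then show ?thesis by simp
  qed
  moreover have lin: "Re (a + b + c - (3/2) * d - (1/2) * f) = Re a + Re b + Re c - 3/2 * Re d - 1/2 * Re f" for a b c d f :: complex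
  by simp
  moreover have "Re (h x) = Re (e x) - ka * Re (n2 x)" by (simp add: h_def)
  moreover have "Re ((3/2) * (cr ka * n2 x) - (1/2) * e x) = 3/2 * (ka * Re (n2 x)) - 1/2 * Re (e x)" by simp
  ultimately show ?thesis unfolding 1 lin by linarith
 qed
 have c: "cont_on (sphere 0 1) (%y. f (r *r y))" if "cont_on U f" for f :: "cfun"
  by (rule continuous_on_shell_sphere[OF continuous_on_subset[OF that sh] r])
 have eq: "Re (sph (%y. SU j. pd j (g j) (r *r y))) = Re (sph (%y. (3/2) * (cr ka * n2 (r *r y)) - (1/2) * e (r *r y)))"
 proof -
  have "cont_on (sphere 0 1) (%y. SU j. pd j (g j) (r *r y))"
  by (rule continuous_on_shell_sphere[OF continuous_on_sum[OF C1_onD(2)[OF g]] r])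
  moreover have "cont_on (sphere 0 1) (%y. (3/2) * (cr ka * n2 (r *r y)) - (1/2) * e (r *r y))"
  by (intro continuous_intros c C1_onD(3)[OF C1_e] C1_onD(3)[OF C1_n2])
  ultimately show ?thesis
  by (simp only: sph_real(1)) (rule sph_cong, rule div, use r sh in \<open>auto simp: shell_def\<close>)
 qed
 have "((%r. Re (r *r sphr r poh)) has_vector_derivative
  Re (r^2 *r sph (%y. SU j. pd j (g j) (r *r y)))) (at r)"
  using bounded_linear.has_vector_derivative[OF bounded_linear_Re sph_divergence[where g=g, OF g r]]
  unfolding g_def h_def poh_def .
 then show ?thesis
  unfolding has_real_derivative_iff_has_vector_derivative using eq by simp
qed

end

lemma sph_norm_le:
 fixes f :: "cfun"
 assumes "!!y. norm y = 1 ==> norm (f y) <= K" "0 <= K"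
 shows "norm (sph f) <= K * measure sphM (sphere 0 1)"
proof (cases "integrable sphM f")
 case True
 have "norm (sph f) <= (\<integral>y. norm (f y) \<partial>sphM)" unfolding sph_def by (rule integral_norm_bound)
 also have "... <= (\<integral>y. K \<partial>sphM)" by (rule integral_mono) (use True assms in auto)
 finally show ?thesis by (simp add: mult.commute)
next
 case False
 then have "sph f = 0" unfolding sph_def by (rule not_integrable_integral_eq)
 then show ?thesis using assms(2) by simp
qed

context lame_field
begin

lemma tau_bound:
 assumes bp: "!!i j. cmod (pd j (v i) x) <= B"
 shows "cmod (ta i j x) <= \<bar>lam\<bar> * (3 * B) + \<bar>mu\<bar> * (2 * B)"
proof -
 have B: "0 <= B" by (rule order_trans[OF norm_ge_zero bp])
 have "cmod (P x) <= (\<Sum>j\<in>(UNIV::3 set). B)" unfolding P_def by (rule sum_norm_le) (rule bp)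
 then have 1: "cmod (if i = j then cr lam * P x else 0) <= \<bar>lam\<bar> * (3 * B)"
  using B by (auto simp: norm_mult intro!: mult_left_mono)
 have 2: "cmod (cr mu * (pd j (v i) x + pd i (v j) x)) <= \<bar>mu\<bar> * (2 * B)"
  using norm_triangle_le[OF add_mono[OF bp[of j i] bp[of i j]]] by (auto simp: norm_mult intro!: mult_left_mono)
 show ?thesis unfolding ta_def by (rule order_trans[OF norm_triangle_ineq add_mono[OF 1 2]])
qed

text \<open>Zero Cauchy data are exploited by the Pohozaev identity instead of unique continuation.
  Adding half the energy flux cancels \<open>e\<close> in the derivative and leaves
  \<open>r^2 * ka\<close> times the mean of \<open>n2\<close>, so \<open>G\<close> is nondecreasing.
  It starts at 0 because the fields are bounded near the origin, and the boundary data keep it from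
  ending above 0; hence it is constant and \<open>n2\<close> vanishes.\<close>

lemma interior_zero:
 assumes sh: "shell 0 1 \<subseteq> U" and pos: "0 < mu" "0 < 3 * lam + 2 * mu" "0 < ka"
  and bv: "!!i x. x : shell 0 1 ==> cmod (v i x) <= B"
  and bp: "!!i j x. x : shell 0 1 ==> cmod (pd j (v i) x) <= B"
  and lv: "!!i y. norm y = 1 ==> ((%r. v i (r *r y)) ---> 0) (at_left 1)"
  and lt: "!!i y. norm y = 1 ==> ((%r. SU j. cr (y $ j) * ta i j (r *r y)) ---> 0) (at_left 1)"
  and x: "x : shell 0 1"
 shows "v i x = 0"
proof -
 let ?t = "%i r y. (SU j. cr (y $ j) * ta i j (r *r y))" and ?s = "%i x. (SU j. cr (x $ j) * ta i j x)"
 have B0: "0 <= B" by (rule order_trans[OF norm_ge_zero bv[OF x]])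
 have cx: "\<bar>x $ i\<bar> <= 1" if "x : shell 0 1" for x i
  using component_le_norm_cart[of x i] that by (simp add: shell_def)
 define B1 where "B1 = \<bar>lam\<bar> * (3 * B) + \<bar>mu\<bar> * (2 * B)"
 have B10: "0 <= B1" unfolding B1_def using B0 by simp
 have bt: "cmod (ta i j x) <= B1" if "x : shell 0 1" for i j x
  unfolding B1_def by (rule tau_bound[OF bp[OF that]])
 have bs: "cmod (SU i. f i) <= 3 * K" if "!!i. cmod (f i) <= K" for f :: "3 => complex" and K
  using sum_norm_bound[of "UNIV :: 3 set" f K] that by simp
 have bm: "cmod (a * b) <= A * C" if "cmod a <= A" "cmod b <= C" for a b A C
  unfolding norm_mult using that order_trans[OF norm_ge_zero that(1)] by (intro mult_mono) auto
 have bx: "cmod (cr (x $ i)) <= 1" if "x : shell 0 1" for x i using cx[OF that] by simp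
 have bE: "cmod (euler (v i) x) <= 3 * (1 * B)" if "x : shell 0 1" for i x
  unfolding euler_def scaleR_conv_of_real by (intro bs bm bx bp that)
 have bE': "cmod (cnj (euler (v i) x)) <= 3 * (1 * B)" if "x : shell 0 1" for i x
  using bE[OF that] by simp
 have bv': "cmod (cnj (v i x)) <= B" if "x : shell 0 1" for i x using bv[OF that] by simp
 have bp': "cmod (cnj (pd j (v i) x)) <= B" if "x : shell 0 1" for i j x using bp[OF that] by simp
 have bn: "cmod (n2 x) <= 3 * (B * B)" if "x : shell 0 1" for x
  unfolding n2_def by (intro bs bm bv bv' that)
 have be: "cmod (e x) <= 3 * (3 * (B1 * B))" if "x : shell 0 1" for x
  unfolding e_def by (intro bs bm bt bp' that)
 have bflux: "cmod (flux x) <= 3 * (1 * (3 * (B1 * B)))" if "x : shell 0 1" for x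
  unfolding flux_def by (intro bs bm bx bt bv' that)
 have bpoh: "cmod (poh x) <= 3 * (1 * (3 * (B1 * (3 * (1 * B))) + 1/2 * (1 * (3 * (3 * (B1 * B)) + \<bar>ka\<bar> * (3 * (B * B))))))" if "x : shell 0 1" for x
  unfolding poh_def
  by (intro bs bm bx order_trans[OF norm_triangle_ineq4 add_mono] bt bE' be bn that) simp_all
 obtain K where K: "0 <= K" "!!x. x : shell 0 1 ==> cmod (flux x) <= K" "!!x. x : shell 0 1 ==> cmod (poh x) <= K"
 proof (rule that)
  let ?K1 = "3 * (1 * (3 * (B1 * B)))"
  let ?K2 = "3 * (1 * (3 * (B1 * (3 * (1 * B))) + 1/2 * (1 * (3 * (3 * (B1 * B)) + \<bar>ka\<bar> * (3 * (B * B))))))"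
  have "0 <= ?K1" "0 <= ?K2" using B0 B10 by (auto intro!: mult_nonneg_nonneg add_nonneg_nonneg)
  then show "0 <= ?K1 + ?K2" by linarith
  show "cmod (flux x) <= ?K1 + ?K2" if "x : shell 0 1" for x using bflux[OF that] `0 <= ?K2` by linarith
  show "cmod (poh x) <= ?K1 + ?K2" if "x : shell 0 1" for x using bpoh[OF that] `0 <= ?K1` by linarith
 qed
 define G where "G r = Re (r *r sphr r poh) + 1/2 * Re (r *r sphr r flux)" for r
 have inS: "r *r y : shell 0 1" if "0 < r" "r < 1" "norm y = 1" for r y
  using that by (simp add: shell_def del: scaleR_eq_0_iff) (use that in auto)
 have cS: "cont_on (sphere 0 1) (%y. f (r *r y))" if "cont_on U f" "0 < r" "r < 1" for f :: "cfun" and r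
  by (rule continuous_on_shell_sphere[OF continuous_on_subset[OF that(1) sh]]) (use that in auto)
 note cc = C1_onD(3)[OF C1_e] C1_onD(3)[OF C1_n2] C1_onD(3)[OF tau1] C1_onD(3)[OF v1] C1_onD(3)[OF C1_on_euler[OF v2]]
 have cflux: "cont_on U flux" unfolding flux_def[abs_def] by (intro continuous_intros cc)
 have cpoh: "cont_on U poh" unfolding poh_def[abs_def] by (intro continuous_intros cc)
 have dG: "(G has_real_derivative r^2 * (ka * Re (sphr r n2))) (at r)" if r: "0 < r" "r < 1" for r
 proof -
  have 1: "((%r. Re (r *r sphr r flux)) has_real_derivative r^2 * Re (sph (%y. e (r *r y) - cr ka * n2 (r *r y)))) (at r)"
  using bounded_linear.has_vector_derivative[OF bounded_linear_Re flux_deriv[OF sh order_refl r]]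
  by (simp add: has_real_derivative_iff_has_vector_derivative)
  have 2: "sph (%y. e (r *r y) - cr ka * n2 (r *r y)) = sphr r e - cr ka * sphr r n2"
  by (subst sph_diff) (auto intro!: continuous_intros cS cc r simp: sph_def)
  have 3: "sph (%y. (3/2) * (cr ka * n2 (r *r y)) - (1/2) * e (r *r y)) = (3/2) * (cr ka * sphr r n2) - (1/2) * sphr r e"
  by (subst sph_diff) (auto intro!: continuous_intros cS cc r simp: sph_def)
  have "(G has_real_derivative r^2 * Re (sph (%y. (3/2) * (cr ka * n2 (r *r y)) - (1/2) * e (r *r y)))
  + 1/2 * (r^2 * Re (sph (%y. e (r *r y) - cr ka * n2 (r *r y))))) (at r)"
  unfolding G_def[abs_def] by (intro DERIV_add DERIV_cmult poh_deriv[OF sh order_refl r] 1)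
  then show ?thesis unfolding 2 3 by (simp add: ags)
 qed
 have n2nn: "0 <= Re (sphr r n2)" if r: "0 < r" "r < 1" for r
  unfolding sph_real(1)[OF cS[OF C1_onD(3)[OF C1_n2] r]] by (rule sph_nonneg) (simp add: n2_eq sum_nonneg)
 have mono: "G r <= G s" if rs: "0 < r" "r <= s" "s < 1" for r s
 proof (rule DERIV_nonneg_imp_nondecreasing[OF rs(2)])
  fix t assume t: "r <= t" "t <= s"
  then have "0 < t" "t < 1" using rs by auto
  from dG[OF this] n2nn[OF this] pos(3) show "\<exists>y. (G has_real_derivative y) (at t) & 0 <= y"
  by (intro exI conjI) (assumption, auto)
 qed
 have lim0: "(G ---> 0) (at_right 0)"
 proof (rule Lim_null_comparison)
  let ?m = "K * measure sphM (sphere 0 1)"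
  show "((%r. r * ?m + 1/2 * (r * ?m)) ---> 0) (at_right 0)"
  by (auto intro!: tendsto_eq_intros)
  show "\<forall>\<^sub>F r in at_right 0. norm (G r) <= r * ?m + 1/2 * (r * ?m)"
  unfolding eventually_at_right_field
  proof (intro exI[of _ 1] conjI allI impI)
  fix r :: real assume r: "0 < r" "r < 1"
  have a: "\<bar>Re (r *r sphr r f)\<bar> <= r * ?m" if "!!x. x : shell 0 1 ==> cmod (f x) <= K" for f
  proof -
  have "\<bar>Re (r *r sphr r f)\<bar> <= cmod (r *r sphr r f)" by (rule abs_Re_le_cmod)
  also have "... = r * cmod (sphr r f)" using r by simp
  also have "... <= r * ?m" using r by (intro mult_left_mono sph_norm_le that inS K) auto
  finally show ?thesis .
  qed
  have "\<bar>G r\<bar> <= \<bar>Re (r *r sphr r poh)\<bar> + 1/2 * \<bar>Re (r *r sphr r flux)\<bar>"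
  unfolding G_def by linarith
  then show "norm (G r) <= r * ?m + 1/2 * (r * ?m)"
  using a[of poh, OF K(3)] a[of flux, OF K(2)] unfolding real_norm_def by linarith
  qed simp
 qed
 have Gpos: "0 <= G r" if r: "0 < r" "r < 1" for r
 proof (rule tendsto_upperbound[OF lim0])
  show "\<forall>\<^sub>F s in at_right 0. G s <= G r"
  unfolding eventually_at_right_field using mono r by (intro exI[of _ r]) auto
 qed simp
 \<comment> \<open>\<open>poh\<close> contains \<open>- |x|^2 e / 2\<close>, and \<open>e\<close>
   need not tend to 0 at the sphere, where trace and traction do. As \<open>e\<close> is nonnegative
   this term may be dropped, which leaves an upper bound each of whose terms carries a factor
   tending to 0.\<close>
 define ub where "ub x = (SU i. ?s i x * cnj (euler (v i) x))
  + (1/2) * (cr (ka * (norm x)^2) * n2 x) + (1/2) * (SU i. ?s i x * cnj (v i x))" for x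
 have Gub: "G r <= Re (r *r sphr r ub)" if r: "0 < r" "r < 1" for r
 proof -
  have cub: "cont_on U ub" unfolding ub_def[abs_def] by (intro continuous_intros cc)
  have le: "Re (poh x) + 1/2 * Re (flux x) <= Re (ub x)" for x
  proof -
  have 1: "poh x = (SU i. ?s i x * cnj (euler (v i) x)) - (1/2) * (cr ((norm x)^2) * (e x - cr ka * n2 x))"
  unfolding poh_def norm_3 by (simp add: sum_3 power2_eq_square ags)
  have 2: "flux x = (SU i. ?s i x * cnj (v i x))"
  unfolding flux_def by (simp add: sum_3 ags)
  have "Re (ub x) = Re (poh x) + 1/2 * Re (flux x) + 1/2 * ((norm x)^2 * Re (e x))"
  proof -
  have "ub x = poh x + (1/2) * flux x + (1/2) * (cr ((norm x)^2) * e x)"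
  unfolding ub_def 1 2 by (simp add: ags)
  then show ?thesis by simp
  qed
  moreover have "0 <= (norm x)^2 * Re (e x)" using e_nonneg(1)[OF pos(1,2)] by simp
  ultimately show ?thesis by linarith
  qed
  have "Re (sphr r poh) + 1/2 * Re (sphr r flux) = sph (%y. Re (poh (r *r y)) + 1/2 * Re (flux (r *r y)))"
  unfolding sph_real(1)[OF cS[OF cpoh r]] sph_real(1)[OF cS[OF cflux r]]
  by (subst sph_add) (auto intro!: continuous_intros cS cpoh cflux r simp: sph_def)
  also have "... <= sph (%y. Re (ub (r *r y)))"
  by (rule sph_mono[OF _ _ le]) (intro continuous_intros cS cpoh cflux cub r)+
  also have "... = Re (sphr r ub)" by (rule sph_real(1)[OF cS[OF cub r], symmetric])
  finally show ?thesis using r unfolding G_def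
  by (simp add: distrib_left[symmetric] mult_left_mono flip: times_divide_eq_right)
 qed
 have bub: "\<exists>K'. \<forall>x\<in>shell 0 1. cmod (ub x) <= K'"
 proof (intro exI ballI)
  fix x :: "real^3" assume x: "x : shell 0 1"
  have bn': "cmod (cr (ka * (norm x)^2)) <= \<bar>ka\<bar> * 1"
  proof -
  have "(norm x)^2 <= 1" using x by (intro power_le_one) (auto simp: shell_def)
  then show ?thesis unfolding norm_of_real abs_mult by (intro mult_left_mono) auto
  qed
  show "cmod (ub x) <= 3 * (3 * (1 * B1) * (3 * (1 * B))) + 1/2 * (\<bar>ka\<bar> * 1 * (3 * (B * B))) + 1/2 * (3 * (3 * (1 * B1) * B))"
  unfolding ub_def
  by (intro bs bm bx order_trans[OF norm_triangle_ineq add_mono] bt bE' bv' be bn bn' x) simp_all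
 qed
 then obtain K' where K': "!!x. x : shell 0 1 ==> cmod (ub x) <= K'" by blast
 have lub: "((%r. sphr r ub) ---> sph (%y. 0)) (at_left 1)"
 proof (rule sph_limit)
  have ev01: "\<forall>\<^sub>F r::real in at_left 1. 0 < r & r < 1"
  unfolding eventually_at_left_field by (intro exI[of _ 0]) auto
  have cub: "cont_on U ub" unfolding ub_def[abs_def] by (intro continuous_intros cc)
  show "\<forall>\<^sub>F r in at_left 1. cont_on (sphere 0 1) (%y. ub (r *r y))"
  using ev01 by eventually_elim (intro cS cub, auto)
  show "\<forall>\<^sub>F r in at_left 1. \<forall>y. norm y = 1 \<longrightarrow> cmod (ub (r *r y)) <= K'"
  using ev01 by eventually_elim (auto intro!: K' inS)
  fix y :: "real^3" assume y: "norm y = 1"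
  have s: "(SU j. cr ((r *r y) $ j) * ta i j (r *r y)) = cr r * ?t i r y" for i r
  by (simp add: sum_distrib_left mult.assoc)
  have t0: "((%r. cr r * ?t i r y) ---> cr 1 * 0) (at_left 1)" for i
  by (intro tendsto_mult tendsto_of_real tendsto_ident_at lt[OF y])
  have "((%r. (cr r * ?t i r y) * cnj (euler (v i) (r *r y))) ---> 0) (at_left 1)" for i
  proof (rule tendsto_0_le[where K="3 * (1 * B)"])
  show "((%r. cr r * ?t i r y) ---> 0) (at_left 1)" using t0[of i] by simp
  show "\<forall>\<^sub>F r in at_left 1. norm ((cr r * ?t i r y) * cnj (euler (v i) (r *r y)))
  <= norm (cr r * ?t i r y) * (3 * (1 * B))"
  using ev01 by eventually_elim (unfold norm_mult[of _ "cnj (euler _ _)"], intro mult_left_mono bE' inS y, auto)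
  qed
  then have "((%r. SU i. (cr r * ?t i r y) * cnj (euler (v i) (r *r y))) ---> (\<Sum>i\<in>(UNIV::3 set). 0)) (at_left 1)"
  by (intro tendsto_sum)
  then have T1: "((%r. SU i. (cr r * ?t i r y) * cnj (euler (v i) (r *r y))) ---> 0) (at_left 1)"
  by simp
  have "((%r. n2 (r *r y)) ---> (\<Sum>i\<in>(UNIV::3 set). 0 * cnj 0)) (at_left 1)"
  unfolding n2_def by (intro tendsto_sum tendsto_mult tendsto_cnj lv[OF y])
  then have T2: "((%r. n2 (r *r y)) ---> 0) (at_left 1)" by simp
  have "((%r. SU i. (cr r * ?t i r y) * cnj (v i (r *r y))) ---> (\<Sum>i\<in>(UNIV::3 set). (cr 1 * 0) * cnj 0)) (at_left 1)"
  by (intro tendsto_sum tendsto_mult tendsto_cnj lv[OF y] t0)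
  then have T3: "((%r. SU i. (cr r * ?t i r y) * cnj (v i (r *r y))) ---> 0) (at_left 1)"
  by simp
  have "((%r. (SU i. (cr r * ?t i r y) * cnj (euler (v i) (r *r y)))
  + (1/2) * (cr (ka * (norm (r *r y))^2) * n2 (r *r y))
  + (1/2) * (SU i. (cr r * ?t i r y) * cnj (v i (r *r y))))
  ---> 0 + (1/2) * (cr (ka * (norm (1 *r y))^2) * 0) + (1/2) * 0) (at_left 1)"
  by (intro tendsto_intros T1 T2 T3 tendsto_ident_at)
  then show "((%r. ub (r *r y)) ---> 0) (at_left 1)"
  unfolding ub_def s by simp
 qed simp
 have lG: "((%r. Re (r *r sphr r ub)) ---> Re (1 *r sph (%y. 0))) (at_left 1)"
  by (intro tendsto_intros tendsto_ident_at lub)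
 have Gneg: "G r <= 0" if r: "0 < r" "r < 1" for r
 proof -
  have "G r <= Re (1 *r sph (%y. 0))"
  proof (rule tendsto_lowerbound[OF lG])
  show "\<forall>\<^sub>F s in at_left 1. G r <= Re (s *r sphr s ub)"
  unfolding eventually_at_left_field
  proof (intro exI[of _ r] conjI allI impI)
  fix s assume "r < s" "s < 1"
  then show "G r <= Re (s *r sphr s ub)"
  using mono[of r s] Gub[of s] r by simp
  qed (use r in auto)
  qed simp
  then show ?thesis by (simp add: sph_def)
 qed
 define r where "r = norm x"
 have r: "0 < r" "r < 1" using x by (auto simp: r_def shell_def)
 have "(G has_real_derivative 0) (at r)"
 proof (rule has_field_derivative_transform_within_open[of "%_. 0" _ _ "{0<..<1}"])
  show "0 = G s" if "s : {0<..<1}" for s using Gpos[of s] Gneg[of s] that by auto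
 qed (use r in auto)
 from DERIV_unique[OF this dG[OF r]] have "Re (sphr r n2) = 0" using r pos by simp
 then have z: "sph (%y. Re (n2 (r *r y))) <= 0" using sph_real(1)[OF cS[OF C1_onD(3)[OF C1_n2] r]] by simp
 have "Re (n2 (r *r (x /\<^sub>R norm x))) = 0"
 proof (rule sph_eq_0D[OF _ _ z])
  show "cont_on (sphere 0 1) (%y. Re (n2 (r *r y)))"
  by (intro continuous_on_Re cS C1_onD(3)[OF C1_n2] r)
  show "0 <= Re (n2 (r *r y))" for y by (simp add: n2_eq sum_nonneg)
  show "norm (x /\<^sub>R norm x) = 1" using r by (simp add: r_def)
 qed
 then have "(SU i. (cmod (v i x))^2) = 0" using r by (simp add: r_def n2_eq)
 then show ?thesis by (simp add: sum_nonneg_eq_0_iff)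
qed

end

section \<open>The exterior field: pressure and shear parts\<close>

lemma stress_decomp:
 fixes d :: "3 => 3 => complex"
 shows "(SU j. X j * (SU i. ((if i = j then l * (SU k. d k k) else 0) + m * (d j i + d i j)) * c i))
  = (l + 2 * m) * ((SU k. d k k) * (SU i. X i * c i)) + m * (SU i j. (d j i - d i j) * (X j * c i))
  + 2 * m * (SU i j. c i * (X j * d i j - X i * d j j))"
 by (simp add: sum_3) (simp add: ags)

lemma sum_antisym:
 fixes s h :: "'a::finite => 'a => complex"
 assumes "!!i j. s j i = - s i j"
 shows "(SU i j. s j i * (h j i - h i j)) = 2 * (SU i j. s j i * h j i)"
proof -
 have "(SU i j. s j i * h i j) = (SU j i. s j i * h i j)" by (rule sum.swap)
 also have "... = - (SU i j. s j i * h j i)"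
  unfolding sum_negf[symmetric] by (intro sum.cong refl) (metis assms mult_minus_left)
 finally show ?thesis by (simp add: right_diff_distrib sum_subtractf)
qed

context lame_field
begin

text \<open>\<open>S\<close> collects the components of the curl and \<open>w\<close> is curl curl,
  both written with index pairs so that they match the rotation derivatives
  \<open>ang i j\<close>.\<close>

definition S :: "3 => 3 => cfun" where
 "S a b x = pd a (v b) x - pd b (v a) x"

definition w :: "3 => cfun" where
 "w a x = (SU j. pd j (S a j) x)"

lemma S1: "C1_on U (S a b)"
 unfolding S_def[abs_def] by (intro C1_on_diff pv1)

lemma w_cont: "cont_on U (w a)"
 unfolding w_def[abs_def] by (intro continuous_on_sum C1_onD(2)[OF S1])

lemma pd_S: "x : U ==> pd k (S a b) x = pd k (pd a (v b)) x - pd k (pd b (v a)) x"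
 unfolding S_def[abs_def] by (rule pd_diff) (rule dpv, assumption)+

text \<open>The identity \<open>curl curl = grad div - Lap\<close> turns the Lame system into a
  decomposition of the field into shear and pressure parts. It allows the field in the flux to be
  replaced by its divergence and curl, and makes it vanish once these do.\<close>

lemma lame_decomp:
 assumes x: "x : U"
 shows "cr ka * v i x = cr mu * w i x - cr (lam + 2 * mu) * pd i P x"
proof -
 have "w i x = pd i P x - (SU j. pd j (pd j (v i)) x)"
  unfolding w_def pd_S[OF x] pd_P[OF x] pd_comm[OF x, of _ i] by (simp add: sum_subtractf)
 moreover have "cr ka * v i x = - cr mu * (SU j. pd j (pd j (v i)) x) - cr (lam + mu) * pd i P x"
 proof -
  have lin: "a + b + c = 0 ==> c = - a - b" for a b c :: complex by (auto simp: complex_eq_iff)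
  show ?thesis using lin[OF lame_eq[OF x, of i]] by (simp add: P_def[abs_def])
 qed
 ultimately show ?thesis by (simp only:) (simp add: ags)
qed

text \<open>The conserved flux mixes pressure and shear. Multiplied by \<open>ka\<close> and
  rewritten with \<open>lame_decomp\<close>, its cross terms integrate to real numbers, and what
  remains is \<open>f\<close>, where \<open>P\<close> and the \<open>S a b\<close> are separated. By
  the radiation conditions \<open>Im f / r\<close> is bounded below by the positive form
  \<open>R\<close> up to \<open>K0 / r^4\<close>, so zero flux forces the mean squares of
  \<open>P\<close> and \<open>S a b\<close> to be of order \<open>r^-4\<close>. That is fast enough
  for \<open>weak_helmholtz_zero\<close>.\<close>

lemma exterior_zero:
 assumes U: "U = {x. 1 < norm x}" and pos: "0 < mu" "0 < lam + 2 * mu" "0 < ka"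
  and kp: "kp > 0" "kp^2 * (lam + 2 * mu) = ka" and ks: "ks > 0" "ks^2 * mu = ka"
  and flux0: "!!r. r > 1 ==> Im (sphr r flux) = 0"
  and radp: "!!x. r1 <= norm x ==> cmod ((SU i. cr (x $ i / norm x) * pd i P x) - \<i> * cr kp * P x) <= C / (norm x)^2"
  and rads: "!!a b x. r1 <= norm x ==> cmod ((w a x * cr (x $ b) - w b x * cr (x $ a)) / cr (norm x) - \<i> * cr ks * S a b x) <= C / (norm x)^2"
  and x: "x : U"
 shows "v i x = 0"
proof -
 define al where "al = lam + 2 * mu"
 have al: "al > 0" using pos by (simp add: al_def)
 define W where "W a b x = w a x * cr (x $ b) - w b x * cr (x $ a)" for a b x
 define f where "f x = - cr (al^2) * (P x * cnj (euler P x)) - cr (mu^2 / 2) * (SU i j. S j i x * cnj (W j i x))" for x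
 have c1: "C1_on U P" "!!a b. C1_on U (S a b)" "!!i. C1_on U (v i)" by (rule P1 S1 v1)+
 have cc: "cont_on U P" "!!k. cont_on U (pd k P)" "cont_on U (euler P)" "!!i j. cont_on U (ang i j P)"
  "!!a b. cont_on U (S a b)" "!!a b i j. cont_on U (ang i j (S a b))" "!!i. cont_on U (v i)"
  "!!i j k. cont_on U (ang i j (v k))" "!!a. cont_on U (w a)"
  by (rule C1_onD(3)[OF P1] C1_onD(2)[OF P1] continuous_on_euler[OF P1] continuous_on_ang[OF P1]
  C1_onD(3)[OF S1] continuous_on_ang[OF S1] C1_onD(3)[OF v1] continuous_on_ang[OF v1] w_cont)+
 have cW: "cont_on U (W a b)" for a b
  unfolding W_def[abs_def] by (intro continuous_intros cc)
 have cf: "cont_on U f" unfolding f_def[abs_def] by (intro continuous_intros cc cW)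
 have Imf: "Im (sphr r f) = 0" if r: "r > 1" for r
 proof -
  have sh: "shell 1 (r + 1) \<subseteq> U" unfolding U by (auto simp: shell_def)
  have r': "0 <= (1::real)" "1 < r" "r < r + 1" using r by auto
  have inU: "r *r y : U" if "norm y = 1" for y using that r by (simp add: U)
  define I where "I g = sphr r g" for g :: "cfun"
  have cS: "cont_on (sphere 0 1) (%y. g (r *r y))" if "cont_on U g" for g :: "cfun"
  by (rule continuous_on_shell_sphere[OF continuous_on_subset[OF that sh] r'])
  have Iadd: "I (%x. g x + h x) = I g + I h" if "cont_on U g" "cont_on U h" for g h
  unfolding I_def by (intro sph_add cS that)
  have Idiff: "I (%x. g x - h x) = I g - I h" if "cont_on U g" "cont_on U h" for g h
  unfolding I_def by (intro sph_diff cS that)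
  have Isum: "I (%x. SU i. g i x) = (SU i. I (g i))" if "!!i. cont_on U (g i)" for g :: "3 => cfun"
  unfolding I_def by (intro sph_sum cS that)
  have Icm: "I (%x. z * g x) = z * I g" for z g unfolding I_def sph_def by simp
  have Icnj: "I (%x. cnj (g x)) = cnj (I g)" for g unfolding I_def sph_def by simp
  have Icong: "I g = I h" if "!!x. x : U ==> g x = h x" for g h
  unfolding I_def by (rule sph_cong) (use that inU in auto)
  have parts: "I (%x. ang i j g x * h x) = - I (%x. g x * ang i j h x)" if "C1_on U g" "C1_on U h" for g h i j
  unfolding I_def by (rule sph_ang_parts[OF C1_on_subset[OF that(1) sh] C1_on_subset[OF that(2) sh] r'])
  \<comment> \<open>The tangential remainder of \<open>stress_decomp\<close>. Moving the rotation to
    the other factor and renaming indices shows that it equals its conjugate, so it has no imaginary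
    part.\<close>
  define J where "J = (SU i j. I (%x. cnj (v i x) * ang j i (v j) x))"
  have Jre: "cnj J = J"
  proof -
  have "I (%x. cnj (v i x) * ang j i (v j) x) = cnj (I (%x. cnj (v j x) * ang i j (v i) x))" for i j
  proof -
  have "I (%x. cnj (v i x) * ang j i (v j) x) = I (%x. ang j i (v j) x * cnj (v i x))"
  by (rule Icong) (rule mult.commute)
  also have "... = - I (%x. v j x * ang j i (%x. cnj (v i x)) x)"
  by (rule parts[of "v j" "%x. cnj (v i x)" j i, OF v1 C1_on_cnj[OF v1]])
  also have "... = - 1 * I (%x. v j x * ang j i (%x. cnj (v i x)) x)" by (rule mult_minus1[symmetric])
  also have "... = I (%x. - 1 * (v j x * ang j i (%x. cnj (v i x)) x))" by (rule Icm[symmetric])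
  also have "... = I (%x. cnj (cnj (v j x) * ang i j (v i) x))"
  proof (rule Icong)
  fix x assume x: "x : U"
  have "ang j i (%x. cnj (v i x)) x = cnj (ang j i (v i) x)" by (rule ang_cnj[OF dv[OF x]])
  also have "ang j i (v i) x = - ang i j (v i) x" by (simp add: ang_def)
  finally show "- 1 * (v j x * ang j i (%x. cnj (v i x)) x) = cnj (cnj (v j x) * ang i j (v i) x)" by simp
  qed
  also have "... = cnj (I (%x. cnj (v j x) * ang i j (v i) x))" by (rule Icnj)
  finally show ?thesis .
  qed
  then have "J = (SU i j. cnj (I (%x. cnj (v j x) * ang i j (v i) x)))"
  unfolding J_def by (intro sum.cong refl)
  also have "... = cnj J" unfolding J_def cnj_sum by (rule sum.swap)
  finally show ?thesis by (rule sym)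
  qed
  \<comment> \<open>\<open>q\<close> and \<open>q'\<close> are the two kinds of cross term:
    divergence against curl curl, and curl against the rotated gradient of the divergence. One
    integration by parts on the sphere gives \<open>I q' = - 2 cnj (I q)\<close>, so their
    combination in the flux is twice a real part.\<close>
  define q where "q x = P x * (SU i. cr (x $ i) * cnj (w i x))" for x
  define q' where "q' x = (SU i j. S j i x * cnj (ang j i P x))" for x
  have Santi: "S b a x = - S a b x" for a b x by (simp add: S_def)
  have pdSanti: "pd k (S b a) x = - pd k (S a b) x" if "x : U" for a b k x
  by (simp add: pd_S[OF that])
  have q'I: "I q' = - 2 * cnj (I q)"
  proof -
  have "I (%x. S j i x * cnj (ang j i P x)) = - I (%x. ang j i (S j i) x * cnj (P x))" for i j
  proof -
  have "I (%x. S j i x * cnj (ang j i P x)) = I (%x. S j i x * ang j i (%x. cnj (P x)) x)"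
  by (rule Icong) (simp add: ang_cnj dP)
  also have "... = - I (%x. ang j i (S j i) x * cnj (P x))"
  using parts[OF S1 C1_on_cnj[OF P1], of j i j i] by simp
  finally show ?thesis .
  qed
  then have "I q' = - (SU i j. I (%x. ang j i (S j i) x * cnj (P x)))"
  proof -
  have 1: "cont_on U (%x. SU j. S j i x * cnj (ang j i P x))" for i by (intro continuous_intros cc)
  have 2: "cont_on U (%x. S j i x * cnj (ang j i P x))" for i j by (intro continuous_intros cc)
  assume "!!j i. I (%x. S j i x * cnj (ang j i P x)) = - I (%x. ang j i (S j i) x * cnj (P x))"
  then show ?thesis unfolding q'_def[abs_def] Isum[OF 1] Isum[OF 2] by (simp add: sum_negf)
  qed
  also have "(SU i j. I (%x. ang j i (S j i) x * cnj (P x))) = I (%x. SU i j. ang j i (S j i) x * cnj (P x))"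
  proof -
  have 1: "cont_on U (%x. SU j. ang j i (S j i) x * cnj (P x))" for i by (intro continuous_intros cc)
  have 2: "cont_on U (%x. ang j i (S j i) x * cnj (P x))" for i j by (intro continuous_intros cc)
  show ?thesis unfolding Isum[OF 1] Isum[OF 2] ..
  qed
  also have "... = I (%x. 2 * cnj (q x))"
  proof (rule Icong)
  fix x assume x: "x : U"
  have a: "ang j i (S j i) x = cr (x $ j) * pd i (S j i) x + cr (x $ i) * pd j (S i j) x" for i j
  unfolding ang_def scaleR_conv_of_real pdSanti[OF x, of j i j] by simp
  have "(SU i j. ang j i (S j i) x) = 2 * (SU j. cr (x $ j) * w j x)"
  unfolding a w_def by (simp add: sum_3) (simp add: ags)
  then show "(SU i j. ang j i (S j i) x * cnj (P x)) = 2 * cnj (q x)"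
  unfolding sum_distrib_right[symmetric] by (simp add: q_def)
  qed
  also have "... = 2 * cnj (I q)" unfolding Icm Icnj ..
  finally show ?thesis by simp
  qed
  have key: "cr ka * flux x = f x + cr (al * mu) * (q x - (1/2) * q' x) + cr (2 * mu * ka) * (SU i j. cnj (v i x) * ang j i (v j) x)"
  if x: "x : U" for x
  proof -
  define V where "V = (SU i j. cnj (v i x) * ang j i (v j) x)"
  define X where "X i = rc (x $ i)" for i
  have 1: "flux x = cr al * (P x * (SU i. X i * cnj (v i x))) + cr mu * (SU i j. S j i x * (X j * cnj (v i x)))
  + cr (2 * mu) * V"
  using stress_decomp[of X "cr lam" "%j i. pd j (v i) x" "cr mu" "%i. cnj (v i x)"]
  unfolding flux_def ta_def S_def P_def ang_def al_def scaleR_conv_of_real V_def X_def by simp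
  have kv: "cr ka * cnj (v i x) = cr mu * cnj (w i x) - cr al * cnj (pd i P x)" for i
  using arg_cong[OF lame_decomp[OF x, of i], of cnj] by (simp add: al_def)
  have 2: "cr ka * (P x * (SU i. X i * cnj (v i x))) = cr mu * q x - cr al * (P x * cnj (euler P x))"
  proof -
  have "cr ka * (P x * (SU i. X i * cnj (v i x))) = P x * (SU i. X i * (cr ka * cnj (v i x)))"
  by (simp add: sum_distrib_left mult_ac)
  then show ?thesis unfolding kv q_def euler_def scaleR_conv_of_real X_def
  by (simp add: sum_3 ags)
  qed
  have anti: "(SU i j. S j i x * (h j i - h i j)) = 2 * (SU i j. S j i x * h j i)" for h
  by (rule sum_antisym) (rule Santi)
  have 3: "cr ka * (SU i j. S j i x * (X j * cnj (v i x))) = - cr (mu / 2) * (SU i j. S j i x * cnj (W j i x)) - cr (al / 2) * q' x"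
  proof -
  have W: "cnj (W j i x) = - (X j * cnj (w i x)) - - (X i * cnj (w j x))" for i j
  by (simp add: W_def X_def)
  have a: "cnj (ang j i P x) = X j * cnj (pd i P x) - X i * cnj (pd j P x)" for i j
  by (simp add: ang_def X_def scaleR_conv_of_real)
  have "cr ka * (SU i j. S j i x * (X j * cnj (v i x))) = (SU i j. S j i x * (X j * (cr ka * cnj (v i x))))"
  by (simp add: sum_distrib_left mult_ac)
  also have "... = cr mu * (SU i j. S j i x * (X j * cnj (w i x))) - cr al * (SU i j. S j i x * (X j * cnj (pd i P x)))"
  unfolding kv by (simp add: right_diff_distrib sum_subtractf sum_distrib_left mult_ac)
  finally show ?thesis
  unfolding q'_def W a anti[of "%j i. - (X j * cnj (w i x))"] anti[of "%j i. X j * cnj (pd i P x)"]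
  by (simp add: sum_negf)
  qed
  have "cr ka * flux x = cr al * (cr ka * (P x * (SU i. X i * cnj (v i x)))) + cr mu * (cr ka * (SU i j. S j i x * (X j * cnj (v i x))))
  + cr (2 * mu * ka) * V"
  unfolding 1 by (simp add: ags)
  then show ?thesis unfolding 2 3 f_def V_def[symmetric] by (simp add: ags power2_eq_square)
  qed
  have cq: "cont_on U q" "cont_on U q'"
  unfolding q_def[abs_def] q'_def[abs_def] by (intro continuous_intros cc)+
  have cv: "cont_on U (%x. SU i j. cnj (v i x) * ang j i (v j) x)" by (intro continuous_intros cc)
  have Jeq: "I (%x. SU i j. cnj (v i x) * ang j i (v j) x) = J"
  proof -
  have 1: "cont_on U (%x. SU j. cnj (v i x) * ang j i (v j) x)" for i by (intro continuous_intros cc)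
  have 2: "cont_on U (%x. cnj (v i x) * ang j i (v j) x)" for i j by (intro continuous_intros cc)
  show ?thesis unfolding Isum[OF 1] Isum[OF 2] J_def ..
  qed
  have "cr ka * I flux = I (%x. cr ka * flux x)" by (rule Icm[symmetric])
  also have "... = I (%x. f x + cr (al * mu) * (q x - (1/2) * q' x) + cr (2 * mu * ka) * (SU i j. cnj (v i x) * ang j i (v j) x))"
  by (rule Icong) (rule key)
  also have "... = I f + cr (al * mu) * (I q - (1/2) * I q') + cr (2 * mu * ka) * J"
  proof -
  have 1: "cont_on U (%x. cr (al * mu) * (q x - (1/2) * q' x))" "cont_on U (%x. (1/2) * q' x)"
  "cont_on U (%x. cr (2 * mu * ka) * (SU i j. cnj (v i x) * ang j i (v j) x))"
  by (intro continuous_intros cq cv)+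
  show ?thesis
  unfolding Iadd[OF continuous_on_add[OF cf 1(1)] 1(3)] Iadd[OF cf 1(1)] Icm Idiff[OF cq(1) 1(2)] Jeq ..
  qed
  finally have eq: "cr ka * I flux = I f + cr (al * mu) * (I q + cnj (I q)) + cr (2 * mu * ka) * J"
  unfolding q'I by simp
  have "Im J = 0" using arg_cong[OF Jre, of Im] by simp
  moreover have "Im (I flux) = 0" unfolding I_def by (rule flux0[OF r])
  ultimately show ?thesis
  using arg_cong[OF eq, of Im] unfolding I_def by simp
 qed
 define R where "R x = al^2 * kp / 2 * (cmod (P x))^2 + mu^2 * ks / 4 * (SU i j. (cmod (S j i x))^2)" for x
 \<comment> \<open>Nine is the number of index pairs in the shear sum.\<close>
 define K0 where "K0 = al^2 * C^2 / (2 * kp) + 9 * (mu^2 * C^2 / (4 * ks))"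
 have amgm: "a * c <= k / 2 * a^2 + c^2 / (2 * k)" if "k > 0" for a c k :: real
 proof -
  have "0 <= (k * a - c)^2 / (2 * k)" using that by simp
  also have "... = k / 2 * a^2 + c^2 / (2 * k) - a * c"
  using that by (simp add: power2_eq_square field_simps)
  finally show ?thesis by simp
 qed
 \<comment> \<open>If \<open>u / r\<close> equals \<open>i k z\<close> up to an error of size
   \<open>C / r^2\<close>, then \<open>Im (- (z * cnj u)) / r\<close> is \<open>k |z|^2\<close> up
   to \<open>|z| C / r^2\<close>. Half of the quadratic term absorbs this error and leaves a
   remainder of order \<open>r^-4\<close>.\<close>
 have basic: "k / 2 * (cmod z)^2 - C^2 / (2 * k) / r ^ 4 <= Im (- (z * cnj u)) / r"
  if k: "k > 0" and r: "r > 0" and u: "cmod (u / cr r - \<i> * cr k * z) <= C / r^2" for z u k r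
 proof -
  define ep where "ep = u / cr r - \<i> * cr k * z"
  have ue: "u = cr r * (\<i> * cr k * z + ep)" using r by (simp add: ep_def field_simps)
  have "- (z * cnj u) = cr r * (\<i> * cr k * (z * cnj z) - z * cnj ep)"
  unfolding ue by (simp add: ags)
  also have "... = cr r * (\<i> * cr (k * (cmod z)^2) - z * cnj ep)"
  by (simp add: complex_norm_square[symmetric] del: of_real_power)
  finally have "Im (- (z * cnj u)) / r = k * (cmod z)^2 - Im (z * cnj ep)" using r by simp
  moreover have "Im (z * cnj ep) <= cmod z * (C / r^2)"
  proof -
  have "Im (z * cnj ep) <= cmod (z * cnj ep)" using abs_Im_le_cmod abs_le_D1 by blast
  also have "... = cmod z * cmod ep" by (simp add: norm_mult)
  also have "... <= cmod z * (C / r^2)" using u unfolding ep_def by (intro mult_left_mono) auto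
  finally show ?thesis .
  qed
  moreover have "cmod z * (C / r^2) <= k / 2 * (cmod z)^2 + (C / r^2)^2 / (2 * k)" by (rule amgm[OF k])
  moreover have "(C / r^2)^2 / (2 * k) = C^2 / (2 * k) / r ^ 4" by (simp add: power_divide flip: power_mult)
  ultimately show ?thesis by linarith
 qed
 have low: "R x - K0 / (norm x) ^ 4 <= Im (f x) / norm x" if x: "max r1 2 <= norm x" for x
 proof -
  have r: "norm x > 0" "r1 <= norm x" using x by auto
  have eP: "euler P x / cr (norm x) = (SU i. cr (x $ i / norm x) * pd i P x)"
  by (simp add: euler_def scaleR_conv_of_real sum_divide_distrib)
  have p: "kp / 2 * (cmod (P x))^2 - C^2 / (2 * kp) / norm x ^ 4 <= Im (- (P x * cnj (euler P x))) / norm x"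
  by (rule basic[OF kp(1) r(1)]) (use radp[OF r(2)] in \<open>simp only: eP\<close>)
  have s: "ks / 2 * (cmod (S j i x))^2 - C^2 / (2 * ks) / norm x ^ 4 <= Im (- (S j i x * cnj (W j i x))) / norm x" for i j
  by (rule basic[OF ks(1) r(1)]) (use rads[OF r(2), of j i] in \<open>simp only: W_def\<close>)
  have ss: "(\<Sum>i\<in>(UNIV::3 set). \<Sum>j\<in>(UNIV::3 set). ks / 2 * (cmod (S j i x))^2 - C^2 / (2 * ks) / norm x ^ 4) <= (SU i j. Im (- (S j i x * cnj (W j i x))) / norm x)"
  by (intro sum_mono s)
  have "Im (f x) / norm x = al^2 * (Im (- (P x * cnj (euler P x))) / norm x) + mu^2 / 2 * (SU i j. Im (- (S j i x * cnj (W j i x))) / norm x)"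
  proof -
  have "f x = cr (al^2) * (- (P x * cnj (euler P x))) + cr (mu^2 / 2) * (SU i j. - (S j i x * cnj (W j i x)))"
  unfolding f_def by (simp add: sum_negf)
  then have "Im (f x) = al^2 * Im (- (P x * cnj (euler P x))) + mu^2 / 2 * (SU i j. Im (- (S j i x * cnj (W j i x))))"
  by (simp only: plus_complex.sel times_complex.sel Re_complex_of_real Im_complex_of_real mult_zero_left add_0_right Im_sum)
  then show ?thesis
  unfolding sum_divide_distrib[symmetric] by (simp only: add_divide_distrib times_divide_eq_right)
  qed
  moreover have "al^2 * (kp / 2 * (cmod (P x))^2 - C^2 / (2 * kp) / norm x ^ 4) <= al^2 * (Im (- (P x * cnj (euler P x))) / norm x)"
  by (rule mult_left_mono[OF p]) simp
  moreover have "mu^2 / 2 * (\<Sum>i\<in>(UNIV::3 set). \<Sum>j\<in>(UNIV::3 set). ks / 2 * (cmod (S j i x))^2 - C^2 / (2 * ks) / norm x ^ 4) <= mu^2 / 2 * (SU i j. Im (- (S j i x * cnj (W j i x))) / norm x)"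
  by (rule mult_left_mono[OF ss]) simp
  moreover have "R x - K0 / (norm x) ^ 4 = al^2 * (kp / 2 * (cmod (P x))^2 - C^2 / (2 * kp) / norm x ^ 4) + mu^2 / 2 * (\<Sum>i\<in>(UNIV::3 set). \<Sum>j\<in>(UNIV::3 set). ks / 2 * (cmod (S j i x))^2 - C^2 / (2 * ks) / norm x ^ 4)"
  proof -
  have nine: "(\<Sum>i\<in>(UNIV::3 set). \<Sum>j\<in>(UNIV::3 set). a * h i j - c) = a * (SU i j. h i j) - 9 * c" for a c and h :: "3 => 3 => real"
  by (simp only: sum_subtractf sum_distrib_left[symmetric]) simp
  show ?thesis unfolding R_def K0_def nine by (simp add: ags add_divide_distrib)
  qed
  ultimately show ?thesis by linarith
 qed
 define m where "m = measure sphM (sphere 0 1)"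
 have Rdec: "sphr r R <= K0 * m / r ^ 4" if r: "r \<ge> max r1 2" for r
 proof -
  have sh: "shell 1 (r + 1) \<subseteq> U" unfolding U by (auto simp: shell_def)
  have r': "0 <= (1::real)" "1 < r" "r < r + 1" using r by auto
  have cS: "cont_on (sphere 0 1) (%y. g (r *r y))" if "cont_on U g" for g :: "cfun"
  by (rule continuous_on_shell_sphere[OF continuous_on_subset[OF that sh] r'])
  have "sphr r R <= sph (%y. Im (f (r *r y)) / r + K0 / r ^ 4)"
  proof (rule sph_mono)
  show "cont_on (sphere 0 1) (%y. R (r *r y))" unfolding R_def by (intro continuous_intros cS cc)
  show "cont_on (sphere 0 1) (%y. Im (f (r *r y)) / r + K0 / r ^ 4)"
  unfolding divide_inverse by (intro continuous_intros cS cf)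
  show "R (r *r y) <= Im (f (r *r y)) / r + K0 / r ^ 4" if "norm y = 1" for y
  using low[of "r *r y"] that r by simp
  qed
  also have "... = sph (%y. Im (f (r *r y)) / r) + sph (%y. K0 / r ^ 4)"
  unfolding divide_inverse by (intro sph_add continuous_intros cS cf)
  also have "sph (%y. Im (f (r *r y)) / r) = Im (sphr r f) / r"
  unfolding sph_real(2)[OF cS[OF cf]] by (simp add: sph_def)
  also have "sph (%y. K0 / r ^ 4) = K0 * m / r ^ 4" by (simp add: sph_def m_def)
  finally show ?thesis using Imf[of r] r by simp
 qed
 have dec: "sph (%y. (cmod (g (r *r y)))^2) <= (K0 * m / c) / r ^ 4"
  if c: "c > 0" and g: "cont_on U g" and le: "!!x. c * (cmod (g x))^2 <= R x" and r: "r \<ge> max r1 2" for g c r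
 proof -
  have sh: "shell 1 (r + 1) \<subseteq> U" unfolding U by (auto simp: shell_def)
  have r': "0 <= (1::real)" "1 < r" "r < r + 1" using r by auto
  have cS: "cont_on (sphere 0 1) (%y. g (r *r y))" if "cont_on U g" for g :: "cfun"
  by (rule continuous_on_shell_sphere[OF continuous_on_subset[OF that sh] r'])
  have "c * sph (%y. (cmod (g (r *r y)))^2) = sph (%y. c * (cmod (g (r *r y)))^2)" by (simp add: sph_def)
  also have "... <= sphr r R"
  proof (rule sph_mono[OF _ _ le])
  show "cont_on (sphere 0 1) (%y. c * (cmod (g (r *r y)))^2)" by (intro continuous_intros cS g)
  show "cont_on (sphere 0 1) (%y. R (r *r y))" unfolding R_def by (intro continuous_intros cS cc)
  qed
  also have "... <= K0 * m / r ^ 4" by (rule Rdec[OF r])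
  finally have "c * sph (%y. (cmod (g (r *r y)))^2) / c <= K0 * m / r ^ 4 / c"
  using c by (intro divide_right_mono) auto
  then show ?thesis using c by (simp add: mult.commute)
 qed
 note U' = U[symmetric]
 have P0: "P x = 0" if x: "x : U" for x
 proof (rule weak_helmholtz_zero[where ?r0.0=1 and k=kp and ?r1.0="max r1 2" and C="K0 * m / (al^2 * kp / 2)"])
  show "cont_on {x. 1 < norm x} P" unfolding U' by (rule cc)
  show "1 < norm x" using x by (simp add: U)
  show "sph (%y. (cmod (P (r *r y)))^2) <= K0 * m / (al^2 * kp / 2) / r ^ 4" if "max r1 2 <= r" for r
  by (rule dec[OF _ cc(1) _ that]) (use al kp ks in \<open>auto simp: R_def intro!: mult_nonneg_nonneg sum_nonneg\<close>)
  fix ps assume ps: "C2_on UNIV ps" "supp_in {x. 1 < norm x} ps"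
  have "0 = (LB z. P z * (cr al * (SU i. pd i (pd i ps) z) + cr ka * ps z))"
  using lame_weak(1)[OF oU v2 lame_eq ps(1) ps(2)[unfolded U']] unfolding P_def al_def by simp
  also have "... = (LB z. cr al * (P z * ((SU i. pd i (pd i ps) z) + cr (kp^2) * ps z)))"
  unfolding kp(2)[symmetric] by (rule Bochner_Integration.integral_cong) (auto simp: ags al_def)
  finally show "(LB z. P z * ((SU i. pd i (pd i ps) z) + cr (kp^2) * ps z)) = 0"
  using al by simp
 qed (use kp in auto)
 have S0: "S a b x = 0" if x: "x : U" for a b x
 proof (rule weak_helmholtz_zero[where ?r0.0=1 and k=ks and ?r1.0="max r1 2" and C="K0 * m / (mu^2 * ks / 4)"])
  show "cont_on {x. 1 < norm x} (S a b)" unfolding U' by (rule cc)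
  show "1 < norm x" using x by (simp add: U)
  have le: "mu^2 * ks / 4 * (cmod (S a b x))^2 <= R x" for x
  proof -
  have "(cmod (S a b x))^2 <= (SU j. (cmod (S j b x))^2)"
  by (rule member_le_sum[of a UNIV "%j. (cmod (S j b x))^2"]) auto
  also have "... <= (SU i j. (cmod (S j i x))^2)"
  by (rule member_le_sum[of b UNIV "%i. SU j. (cmod (S j i x))^2"]) (auto intro!: sum_nonneg)
  finally have "mu^2 * ks / 4 * (cmod (S a b x))^2 <= mu^2 * ks / 4 * (SU i j. (cmod (S j i x))^2)"
  using ks by (intro mult_left_mono) auto
  moreover have "0 <= al^2 * kp / 2 * (cmod (P x))^2" using kp by simp
  ultimately show ?thesis unfolding R_def by linarith
  qed
  show "sph (%y. (cmod (S a b (r *r y)))^2) <= K0 * m / (mu^2 * ks / 4) / r ^ 4" if "max r1 2 <= r" for r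
  by (rule dec[OF _ cc(5) le that]) (use pos ks in auto)
  fix ps assume ps: "C2_on UNIV ps" "supp_in {x. 1 < norm x} ps"
  have "0 = (LB z. S a b z * (cr mu * (SU i. pd i (pd i ps) z) + cr ka * ps z))"
  using lame_weak(2)[OF oU v2 lame_eq ps(1) ps(2)[unfolded U'], of a b] unfolding S_def by simp
  also have "... = (LB z. cr mu * (S a b z * ((SU i. pd i (pd i ps) z) + cr (ks^2) * ps z)))"
  unfolding ks(2)[symmetric] by (rule Bochner_Integration.integral_cong) (auto simp: ags)
  finally show "(LB z. S a b z * ((SU i. pd i (pd i ps) z) + cr (ks^2) * ps z)) = 0"
  using pos by simp
 qed (use ks in auto)
 have "pd i P x = pd i (%x. 0) x" by (rule pd_cong_open[where S=U]) (use oU x P0 in auto)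
 moreover have "pd j (S i j) x = pd j (%x. 0) x" for j by (rule pd_cong_open[where S=U]) (use oU x S0 in auto)
 ultimately have "cr ka * v i x = 0"
  unfolding lame_decomp[OF x] w_def by simp
 then show ?thesis using pos by simp
qed

end

section \<open>Uniqueness for the transmission problem\<close>

lemma pd_vec_nth:
 fixes v :: "real^3 => complex^3"
 assumes "open U" "C2_on U v" "x : U"
 shows "pd j v x $ i = pd j (%x. v x $ i) x" "pd k (pd j v) x $ i = pd k (pd j (%x. v x $ i)) x"
proof -
 note c = C2_onD[OF assms(2)]
 have *: "pd j (%x. v x $ i) z = pd j v z $ i" if "z : U" for z
  by (rule pd_nth[OF C1_onD(1)[OF c(1) that]])
 then show "pd j v x $ i = pd j (%x. v x $ i) x" using assms(3) by simp
 have "pd k (pd j v) x $ i = pd k (%x. pd j v x $ i) x"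
  by (rule pd_nth[OF C1_onD(1)[OF c(2) assms(3)], symmetric])
 also have "... = pd k (pd j (%x. v x $ i)) x"
  by (rule pd_cong_open[OF assms(1,3)]) (simp add: *)
 finally show "pd k (pd j v) x $ i = pd k (pd j (%x. v x $ i)) x" .
qed

lemma div_field_eq:
 assumes "open U" "C2_on U v" "x : U"
 shows "div_field v x = (SU j. pd j (%x. v x $ j) x)"
 unfolding div_field_def pd_vec_nth[OF assms] ..

lemma lame_nth:
 assumes U: "open U" "C2_on U v" "x : U"
 shows "lame lam mu v x $ i = cr mu * (SU j. pd j (pd j (%x. v x $ i)) x)
  + cr (lam + mu) * pd i (%x. SU j. pd j (%x. v x $ j) x) x"
proof -
 have "pd i (div_field v) x = pd i (%x. SU j. pd j (%x. v x $ j) x) x"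
  by (rule pd_cong_open[OF U(1,3)]) (rule div_field_eq[OF U(1,2)])
 then show ?thesis
  unfolding lame_def laplacian_def grad_def by (simp add: pd_vec_nth(2)[OF U] scaleR_conv_of_real[where 'a=complex])
qed

lemma lame_fieldI:
 assumes "open U" "C2_on U v" "!!x. x : U ==> lame lam mu v x + ka *r v x = 0"
 shows "lame_field (%i x. v x $ i) lam mu ka U"
proof
 show "open U" by fact
 show "C2_on U (%x. v x $ i)" for i by (rule C2_on_nth[OF assms(2,1)])
 show "cr mu * (SU j. pd j (pd j (%x. v x $ i)) x)
  + cr (lam + mu) * pd i (%x. SU j. pd j (%x. v x $ j) x) x + cr ka * v x $ i = 0" if "x : U" for x i
  using arg_cong[OF assms(3)[OF that], of "%z. z $ i"] lame_nth[OF assms(1,2) that, of lam mu i]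
  by (simp add: scaleR_conv_of_real[where 'a=complex])
qed

text \<open>One-sided limits at a boundary point become limits along its ray, the form that
  spherical integrals can use.\<close>

lemma filterlim_ray:
 assumes y: "norm y = 1" and F: "F = at_left 1 & S = shell 0 1 | F = at_right (1::real) & S = {x. 1 < norm x}"
 shows "filterlim (%r. r *r y) (at y within S) F"
proof -
 have 1: "\<forall>\<^sub>F r in F. r *r y : S & r *r y ~= y"
 proof -
  have ne: "r *r y ~= y" if "r ~= 1" for r
  using that y by (metis norm_zero scaleR_cancel_right scaleR_one zero_neq_one)
  from F show ?thesis
  proof (elim disjE conjE)
  assume "F = at_left 1" "S = shell 0 1"
  moreover have "\<forall>\<^sub>F r in at_left (1::real). r : {0<..<1}" by (rule eventually_at_leftI[of 0]) auto
  ultimately show ?thesis using y ne by (auto simp: shell_def elim!: eventually_mono)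
  next
  assume "F = at_right 1" "S = {x. 1 < norm x}"
  moreover have "\<forall>\<^sub>F r in at_right (1::real). r : {1<..<2}" by (rule eventually_at_rightI[of _ 2]) auto
  ultimately show ?thesis using y ne by (auto elim!: eventually_mono)
  qed
 qed
 have "((%r. r *r y) ---> 1 *r y) F"
  using F by (intro tendsto_intros) (auto intro: tendsto_within_subset[OF tendsto_ident_at])
 then show ?thesis using 1 by (simp add: filterlim_at)
qed

context lame_field
begin

lemma flux_ray: "flux (r *r y) = cr r * (SU i. (SU j. cr (y $ j) * ta i j (r *r y)) * cnj (v i (r *r y)))"
 unfolding flux_def by (simp add: sum_3) (simp add: ags)

lemma flux_cont: "cont_on U flux"
 unfolding flux_def[abs_def] by (intro continuous_intros C1_onD(3)[OF tau1] C1_onD(3)[OF v1])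

text \<open>The limits of the gradient supply boundedness near the sphere, while the value of the
  limit is written with trace and traction, exactly the two quantities that the interface conditions
  match.\<close>

lemma flux_limit:
 assumes F: "F = at_left 1 & U = shell 0 1 | F = at_right (1::real) & U = {x. 1 < norm x}"
  and lv: "!!y i. norm y = 1 ==> (v i ---> a y i) (at y within U)"
  and lp: "!!y i j. norm y = 1 ==> (pd j (v i) ---> G y i j) (at y within U)"
  and lt: "!!y i. norm y = 1 ==> ((%x. SU j. cr (y $ j) * ta i j x) ---> t y i) (at y within U)"
 shows "((%r. sphr r flux) ---> sph (%y. SU i. t y i * cnj (a y i))) F"
proof -
 have S: "U \<inter> sphere 0 1 = {}" using F by (auto simp: shell_def)
 have inU: "\<forall>\<^sub>F r in F. (\<forall>y. norm y = 1 \<longrightarrow> r *r y : U) & \<bar>r - 1\<bar> < e" if e: "e > 0" for e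
  using F
 proof (elim disjE conjE)
  assume "F = at_left 1" "U = shell 0 1"
  moreover have "\<forall>\<^sub>F r in at_left (1::real). r : {max 0 (1 - e)<..<1}" using e by (intro eventually_at_leftI[of "max 0 (1 - e)"]) auto
  ultimately show ?thesis by (auto simp: shell_def elim!: eventually_mono)
 next
  assume "F = at_right 1" "U = {x. 1 < norm x}"
  moreover have "\<forall>\<^sub>F r in at_right (1::real). r : {1<..<1 + e}" using e by (intro eventually_at_rightI[of _ "1 + e"]) auto
  ultimately show ?thesis by (auto elim!: eventually_mono)
 qed
 have lim: "\<exists>l. (flux ---> l) (at y within U)" if y: "norm y = 1" for y
 proof -
  have P: "(P ---> (SU j. G y j j)) (at y within U)" unfolding P_def[abs_def] by (intro tendsto_sum lp y)
  have "(ta i j ---> (if i = j then cr lam * (SU j. G y j j) else 0) + cr mu * (G y i j + G y j i)) (at y within U)" for i j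
  unfolding ta_def[abs_def] by (cases "i = j") (auto intro!: tendsto_intros P lp y)
  then have "(flux ---> (SU j. cr (y $ j) * (SU i. ((if i = j then cr lam * (SU j. G y j j) else 0) + cr mu * (G y i j + G y j i)) * cnj (a y i)))) (at y within U)"
  unfolding flux_def[abs_def] by (intro tendsto_intros lv y)
  then show ?thesis by blast
 qed
 obtain e B where e: "e > 0" "!!x. x : U ==> \<bar>norm x - 1\<bar> < e ==> norm (flux x) <= B"
  using bounded_near_sphere[OF S lim] by blast
 show ?thesis
 proof (rule sph_limit)
  show "F = at_left 1 | F = at_right 1" using F by blast
  show "\<forall>\<^sub>F r in F. cont_on (sphere 0 1) (%y. flux (r *r y))"
  using inU[OF zero_less_one]
  proof eventually_elim
  case (elim r)
  show ?case by (rule continuous_on_compose2[OF flux_cont]) (use elim in \<open>auto intro!: continuous_intros\<close>)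
  qed
  have "\<forall>\<^sub>F r in F. (\<forall>y. norm y = 1 \<longrightarrow> r *r y : U) & \<bar>r - 1\<bar> < min e 1" by (rule inU) (use e in auto)
  then show "\<forall>\<^sub>F r in F. \<forall>y. norm y = 1 \<longrightarrow> norm (flux (r *r y)) <= B"
  proof eventually_elim
  case (elim r)
  then show ?case by (auto intro!: e(2))
  qed
  fix y :: "real^3" assume y: "norm y = 1"
  note ray = filterlim_ray[OF y F]
  have r1: "((%r. r) ---> (1::real)) F" using F by (auto intro: tendsto_within_subset[OF tendsto_ident_at])
  have "((%r. flux (r *r y)) ---> cr 1 * (SU i. t y i * cnj (a y i))) F"
  unfolding flux_ray
  by (intro tendsto_intros r1 filterlim_compose[OF lv[OF y] ray] filterlim_compose[OF lt[OF y] ray])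
  then show "((%r. flux (r *r y)) ---> (SU i. t y i * cnj (a y i))) F" by simp
 qed
qed

text \<open>The conserved quantity is \<open>r\<close> times the integral of a function that stays
  bounded at the puncture, so it can only be 0.\<close>

lemma flux_im_zero:
 assumes sh: "shell 0 1 \<subseteq> U"
  and bv: "!!i x. x : shell 0 1 ==> cmod (v i x) <= B"
  and bp: "!!i j x. x : shell 0 1 ==> cmod (pd j (v i) x) <= B"
  and r: "0 < r" "r < 1"
 shows "Im (sphr r flux) = 0"
proof -
 define x0 :: "real^3" where "x0 = (1/2) *r axis 1 1"
 have x0: "x0 : shell 0 1" by (simp add: x0_def shell_def)
 have B0: "0 <= B" by (rule order_trans[OF norm_ge_zero bv[OF x0]])
 define B1 where "B1 = \<bar>lam\<bar> * (3 * B) + \<bar>mu\<bar> * (2 * B)"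
 have B10: "0 <= B1" unfolding B1_def using B0 by simp
 have bt: "cmod (ta i j x) <= B1" if "x : shell 0 1" for i j x
  unfolding B1_def by (rule tau_bound[OF bp[OF that]])
 have bf: "cmod (flux x) <= 9 * (B1 * B)" if x: "x : shell 0 1" for x
 proof -
  have t: "cmod (cr (x $ j) * (SU i. ta i j x * cnj (v i x))) <= 1 * (3 * (B1 * B))" for j
  proof -
  have "cmod (SU i. ta i j x * cnj (v i x)) <= (\<Sum>i\<in>(UNIV::3 set). B1 * B)"
  by (rule sum_norm_le) (auto simp: norm_mult intro!: mult_mono bt bv x B10)
  moreover have "\<bar>x $ j\<bar> <= 1"
  using component_le_norm_cart[of x j] x by (simp add: shell_def)
  ultimately show ?thesis unfolding norm_mult by (intro mult_mono) auto
  qed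
  have "cmod (flux x) <= (\<Sum>j\<in>(UNIV::3 set). 1 * (3 * (B1 * B)))"
  unfolding flux_def by (rule sum_norm_le) (rule t)
  then show ?thesis by simp
 qed
 define m where "m = measure sphM (sphere 0 1)"
 have m: "m \<ge> 0" by (simp add: m_def)
 define c where "c = Im (r *r sphr r flux)"
 have le: "\<bar>c\<bar> <= s * (9 * (B1 * B) * m)" if s: "0 < s" "s < 1" for s
 proof -
  have "c = Im (s *r sphr s flux)"
  unfolding c_def by (rule flux_im_const[OF sh order_refl r s])
  then have "\<bar>c\<bar> = s * \<bar>Im (sphr s flux)\<bar>" using s by (simp add: abs_mult)
  also have "... <= s * cmod (sphr s flux)" using s by (intro mult_left_mono abs_Im_le_cmod) auto
  also have "... <= s * (9 * (B1 * B) * m)"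
  unfolding m_def using s B0 B10 by (intro mult_left_mono sph_norm_le bf) (auto simp: shell_def)
  finally show ?thesis .
 qed
 have "((%s. s * (9 * (B1 * B) * m)) ---> 0 * (9 * (B1 * B) * m)) (at_right 0)"
  by (intro tendsto_intros)
 moreover have "\<forall>\<^sub>F s in at_right 0. \<bar>c\<bar> <= s * (9 * (B1 * B) * m)"
  by (rule eventually_at_rightI[of _ 1]) (auto intro!: le)
 ultimately have "\<bar>c\<bar> <= 0 * (9 * (B1 * B) * m)"
  by (rule tendsto_lowerbound) simp
 then show ?thesis using r by (simp add: c_def)
qed

lemma curl_eq:
 assumes u: "u = (%x. \<chi> i. v i x)" and z: "z : U"
 shows "curl u z $ 1 = S 2 3 z" "curl u z $ 2 = S 3 1 z" "curl u z $ 3 = S 1 2 z"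
proof -
 have "C2_on U u" by (rule C2_on_vec[OF _ oU]) (simp add: u v2)
 from pd_vec_nth(1)[OF oU this z] have "pd j u z $ i = pd j (v i) z" for i j by (simp add: u)
 then show "curl u z $ 1 = S 2 3 z" "curl u z $ 2 = S 3 1 z" "curl u z $ 3 = S 1 2 z" by (simp_all add: curl_def S_def)
qed

lemma curl_curl_eq:
 assumes u: "u = (%x. \<chi> i. v i x)" and z: "z : U"
 shows "curl (curl u) z $ i = w i z"
proof -
 note c1 = curl_eq[OF u]
 have dc: "curl u differentiable (at z)"
 proof (rule diff_vec)
  fix j :: 3
  show "(%x. curl u x $ j) differentiable (at z)"
  using exhaust_3[of j]
  by (elim disjE) (auto intro!: diff_cong_open[OF oU z c1(1)[symmetric]] diff_cong_open[OF oU z c1(2)[symmetric]]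
  diff_cong_open[OF oU z c1(3)[symmetric]] C1_onD(1)[OF S1 z])
 qed
 have c2: "pd k (curl u) z $ 1 = pd k (S 2 3) z" "pd k (curl u) z $ 2 = pd k (S 3 1) z" "pd k (curl u) z $ 3 = pd k (S 1 2) z" for k
  by (subst pd_nth[OF dc, symmetric], rule pd_cong_open[OF oU z], erule c1)+
 have Sneg: "pd k (S c b) z = - pd k (S b c) z" for k b c
  by (simp add: pd_S[OF z])
 have 0: "pd k (S b b) z = 0" for k b using Sneg[of k b b] by simp
 show ?thesis
  unfolding curl_def[of "curl u"] w_def sum_3 using exhaust_3[of i]
  by (elim disjE) (simp_all add: c2 0 Sneg[of _ 1 3] Sneg[of _ 2 1] Sneg[of _ 3 2])
qed

end

text \<open>Three regions are combined: the neighbourhood of the puncture by assumption, that of the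
  sphere by the existence of limits, and a compact shell in between.\<close>

lemma bounded_shell_glue:
 fixes f :: "real^3 => 'b::real_normed_vector"
 assumes c: "cont_on (shell 0 1) f" and d: "d > 0" "!!x. x : shell 0 d ==> norm (f x) <= B"
  and lim: "!!y. norm y = 1 ==> \<exists>l. (f ---> l) (at y within shell 0 1)"
 shows "\<exists>B. \<forall>x\<in>shell 0 1. norm (f x) <= B"
proof -
 have "shell 0 1 \<inter> sphere 0 (1::real) = ({}::(real^3) set)" by (auto simp: shell_def)
 from bounded_near_sphere[OF this lim] obtain e B1 where e: "e > 0" "!!x. x : shell 0 1 ==> \<bar>norm x - 1\<bar> < e ==> norm (f x) <= B1"
  by blast
 define K :: "(real^3) set" where "K = cball 0 (1 - min e 1 / 2) - ball 0 (min d 1 / 2)"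
 have "compact K" unfolding K_def by (intro compact_diff) auto
 moreover have "K \<subseteq> shell 0 1" using e d by (auto simp: K_def shell_def)
 ultimately have "compact (f ` K)" by (intro compact_continuous_image continuous_on_subset[OF c])
 then obtain B2 where B2: "!!x. x : K ==> norm (f x) <= B2"
  unfolding bounded_iff[THEN iffD1, OF compact_imp_bounded] by (meson bounded_iff compact_imp_bounded imageI)
 have "norm (f x) <= max B (max B1 B2)" if x: "x : shell 0 1" for x
 proof -
  consider "x : shell 0 d" | "\<bar>norm x - 1\<bar> < e" | "x : K"
  proof -
  have "norm x < d | \<bar>norm x - 1\<bar> < e | norm x <= 1 - min e 1 / 2 & \<not> norm x < min d 1 / 2"
  using x d(1) e(1) min.cobounded1[of e 1] min.cobounded1[of d 1] unfolding shell_def by auto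
  then show ?thesis using that x by (auto simp: K_def shell_def)
  qed
  then show ?thesis using d(2) e(2)[OF x] B2 by cases (auto simp: le_max_iff_disj)
 qed
 then show ?thesis by blast
qed

lemma bigo_at_infinityE:
 fixes f :: "real^3 => real"
 assumes "f : O[at_infinity](%x. 1 / norm x ^ 2)"
 obtains C R where "C > 0" "!!z. R <= norm z ==> f z <= C / (norm z)^2"
proof -
 obtain C where C: "C > 0" "\<forall>\<^sub>F x in at_infinity. norm (f x) <= C * norm (1 / norm x ^ 2)"
  using landau_o.bigE[OF assms] by blast
 then obtain R where "!!z. R <= norm z ==> norm (f z) <= C * norm (1 / norm z ^ 2)"
  unfolding eventually_at_infinity by blast
 then have "f z <= C / (norm z)^2" if "R <= norm z" for z using that by fastforce
 with C(1) show ?thesis by (rule that)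
qed

text \<open>The interior flux has no imaginary part and, since trace and traction match, neither has
  the exterior one; \<open>exterior_zero\<close> applies. The exterior field then leaves zero Cauchy
  data on the sphere, and \<open>interior_zero\<close> finishes. The interior is punctured, with
  bounds near the origin, because the fields to be compared include modes that are handled off the
  origin.\<close>

lemma transmission_unique:
 fixes v :: "real^3 => complex^3"
 assumes pos: "0 < mu" "0 < 3 * lam + 2 * mu" "0 < rho" "0 < om"
  and pos': "0 < mu'" "0 < 3 * lam' + 2 * mu'" "0 < ka'"
  and C2: "C2_on (shell 0 1) v" "C2_on {x. 1 < norm x} v"
  and eq1: "!!x. x : shell 0 1 ==> lame lam' mu' v x + ka' *r v x = 0"
  and eq2: "!!x. x : {x. 1 < norm x} ==> lame lam mu v x + (om^2 * rho) *r v x = 0"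
  and d: "d > 0" "!!x. x : shell 0 d ==> norm (v x) <= B" "!!x j. x : shell 0 d ==> norm (pd j v x) <= B"
  and lj1: "!!y. norm y = 1 ==> (jac v ---> G1 y) (at y within shell 0 1)"
  and lj2: "!!y. norm y = 1 ==> (jac v ---> G2 y) (at y within {x. 1 < norm x})"
  and la: "!!y. norm y = 1 ==> (v ---> a y) (at y within shell 0 1)"
  "!!y. norm y = 1 ==> (v ---> a y) (at y within {x. 1 < norm x})"
  and lt: "!!y. norm y = 1 ==> (traction lam' mu' y v ---> t y) (at y within shell 0 1)"
  "!!y. norm y = 1 ==> (traction lam mu y v ---> t y) (at y within {x. 1 < norm x})"
  and rad: "radiating (k_pressure lam mu rho om) (k_shear mu rho om) v"
  and x: "x : shell 0 1 | 1 < norm x"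
 shows "v x = 0"
proof -
 let ?E = "{x::real^3. 1 < norm x}"
 have oE: "open ?E" by (intro open_Collect_less continuous_intros)
 define V where "V i x = v x $ i" for i x
 interpret I: lame_field V lam' mu' ka' "shell 0 1"
  unfolding V_def[abs_def] by (rule lame_fieldI[OF open_shell C2(1) eq1])
 interpret E: lame_field V lam mu "om^2 * rho" ?E
  unfolding V_def[abs_def] by (rule lame_fieldI[OF oE C2(2) eq2])
 have jacV: "jac v x $ i $ j = pd j (V i) x" if "x : U" "C2_on U v" "open U" for x i j U
  using pd_vec_nth(1)[OF that(3,2,1)] by (simp add: jac_def V_def[abs_def])
 have divV: "div_field v x = (SU j. pd j (V j) x)" if "x : U" "C2_on U v" "open U" for x U
  unfolding div_field_eq[OF that(3,2,1)] V_def[abs_def] ..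
 have cvec: "cvec y $ i = cr (y $ i)" for y i by (simp add: cvec_def)
 have lV: "(V i ---> a y $ i) (at y within S)" if "(v ---> a y) (at y within S)" for i y S
  unfolding V_def[abs_def] by (intro tendsto_intros that)
 have lpd: "(pd j (V i) ---> G $ i $ j) (at y within S)"
  if "(jac v ---> G) (at y within S)" "C2_on S v" "open S" for i j y S and G :: "complex^3^3"
 proof -
  have "((%x. jac v x $ i $ j) ---> G $ i $ j) (at y within S)" by (intro tendsto_intros that)
  moreover have "\<forall>\<^sub>F x in at y within S. jac v x $ i $ j = pd j (V i) x"
  unfolding eventually_at_filter by (rule always_eventually) (use jacV that(2,3) in auto)
  ultimately show ?thesis by (rule Lim_transform_eventually)
 qed
 have tr: "traction l m y v x $ i = (SU j. cr (y $ j) * lame_field.ta V l m i j x)"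
  if L: "lame_field V l m k U" and U: "x : U" "C2_on U v" "open U" for l m k U x y i
 proof -
  interpret L: lame_field V l m k U by (rule L)
  have "div_field v x = L.P x" unfolding divV[OF U] L.P_def ..
  moreover have "((jac v x + transpose (jac v x)) *v cvec y) $ i = (SU j. (pd j (V i) x + pd i (V j) x) * cr (y $ j))"
  by (simp add: matrix_vector_mult_def transpose_def cvec jacV[OF U])
  moreover have "(SU j. cr (y $ j) * L.ta i j x) = cr l * (L.P x * cr (y $ i)) + cr m * (SU j. (pd j (V i) x + pd i (V j) x) * cr (y $ j))"
  unfolding L.ta_def using exhaust_3[of i] by (auto simp: sum_3 ags)
  ultimately show ?thesis
  unfolding traction_def by (simp add: scaleR_conv_of_real[where 'a=complex] cvec)
 qed
 have ltr: "((%x. SU j. cr (y $ j) * lame_field.ta V l m i j x) ---> t y $ i) (at y within U)"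
  if "(traction l m y v ---> t y) (at y within U)" "lame_field V l m k U" "C2_on U v" "open U" for l m k U y i
 proof -
  have "((%x. traction l m y v x $ i) ---> t y $ i) (at y within U)" by (intro tendsto_intros that)
  moreover have "\<forall>\<^sub>F x in at y within U. traction l m y v x $ i = (SU j. cr (y $ j) * lame_field.ta V l m i j x)"
  unfolding eventually_at_filter by (rule always_eventually) (use tr[OF that(2) _ that(3,4)] in auto)
  ultimately show ?thesis by (rule Lim_transform_eventually)
 qed
 note lI = lV[OF la(1)] lpd[OF lj1 C2(1) open_shell] ltr[OF lt(1) I.lame_field_axioms C2(1) open_shell]
 note lE = lV[OF la(2)] lpd[OF lj2 C2(2) oE] ltr[OF lt(2) E.lame_field_axioms C2(2) oE]
 have nV: "cmod (V i x) <= norm (v x)" for i x unfolding V_def by (rule Finite_Cartesian_Product.norm_nth_le)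
 have nP: "cmod (pd j (V i) x) <= norm (pd j v x)" if "x : shell 0 1" for i j x
  using pd_vec_nth(1)[OF open_shell C2(1) that, of j i] Finite_Cartesian_Product.norm_nth_le[of "pd j v x" i] by (simp add: V_def[abs_def])
 have b1: "\<exists>B. \<forall>x\<in>shell 0 1. cmod (V i x) <= B" for i
 proof (rule bounded_shell_glue[OF C1_onD(3)[OF I.v1] d(1) order_trans[OF nV d(2)]])
  show "\<exists>l. (V i ---> l) (at y within shell 0 1)" if "norm y = 1" for y using lI(1)[OF that] by (rule exI)
 qed
 have b2: "\<exists>B. \<forall>x\<in>shell 0 1. cmod (pd j (V i) x) <= B" for i j
 proof (rule bounded_shell_glue[OF C1_onD(3)[OF I.pv1]])
  show "0 < min d 1" using d by simp
  show "cmod (pd j (V i) x) <= B" if "x : shell 0 (min d 1)" for x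
  by (rule order_trans[OF nP d(3)]) (use that in \<open>auto simp: shell_def\<close>)
  show "\<exists>l. (pd j (V i) ---> l) (at y within shell 0 1)" if "norm y = 1" for y using lI(2)[OF that] by (rule exI)
 qed
 obtain B1 where B1: "!!i. \<forall>x\<in>shell 0 1. cmod (V i x) <= B1 i" using b1 by metis
 have "\<exists>f. \<forall>i j. \<forall>x\<in>shell 0 1. cmod (pd j (V i) x) <= f i j" using b2 by (intro choice allI)
 then obtain B2 where B2: "!!i j. \<forall>x\<in>shell 0 1. cmod (pd j (V i) x) <= B2 i j" by blast
 define K where "K = (SU i. \<bar>B1 i\<bar>) + (SU i j. \<bar>B2 i j\<bar>)"
 have K: "cmod (V i x) <= K" "cmod (pd j (V i) x) <= K" if x: "x : shell 0 1" for i j x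
 proof -
  have m: "\<bar>B1 i\<bar> <= (SU i. \<bar>B1 i\<bar>)" by (rule member_le_sum) auto
  have "\<bar>B2 i j\<bar> <= (SU j. \<bar>B2 i j\<bar>)" by (rule member_le_sum) auto
  also have "... <= (SU i j. \<bar>B2 i j\<bar>)"
  by (rule member_le_sum[where f="%i. SU j. \<bar>B2 i j\<bar>"]) (auto intro: sum_nonneg)
  finally have m': "\<bar>B2 i j\<bar> <= (SU i j. \<bar>B2 i j\<bar>)" .
  have B: "cmod (V i x) <= B1 i" "cmod (pd j (V i) x) <= B2 i j" using B1 B2 x by blast+
  show "cmod (V i x) <= K" using B m m' unfolding K_def by linarith
  show "cmod (pd j (V i) x) <= K" using B m m' unfolding K_def by linarith
 qed
 \<comment> \<open>The common limit of the flux from both sides: it depends on the field through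
   trace and traction alone.\<close>
 define L where "L = sph (%y. SU i. t y $ i * cnj (a y $ i))"
 have limI: "((%r. sphr r I.flux) ---> L) (at_left 1)"
  unfolding L_def by (rule I.flux_limit[where G="%y i j. G1 y $ i $ j" and a="%y i. a y $ i" and t="%y i. t y $ i"]) ((simp; fail) | rule lI, assumption)+
 have limE: "((%r. sphr r E.flux) ---> L) (at_right 1)"
  unfolding L_def by (rule E.flux_limit[where G="%y i j. G2 y $ i $ j" and a="%y i. a y $ i" and t="%y i. t y $ i"]) ((simp; fail) | rule lE, assumption)+
 have ImL: "Im L = 0"
 proof -
  have "\<forall>\<^sub>F r in at_left 1. Im (sphr r I.flux) = 0"
  by (rule eventually_at_leftI[of 0]) (auto intro!: I.flux_im_zero[OF order_refl K])
  then have "((%r. 0) ---> Im L) (at_left (1::real))"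
  by (rule Lim_transform_eventually[OF tendsto_Im[OF limI]])
  then show ?thesis using tendsto_const_iff trivial_limit_at_left_real by metis
 qed
 have flux0: "Im (sphr r E.flux) = 0" if r: "r > 1" for r
 proof -
  have "\<forall>\<^sub>F s in at_right 1. Im (s *r sphr s E.flux) = Im (r *r sphr r E.flux)"
  proof (rule eventually_at_rightI[of _ 2])
  fix s :: real assume s: "s : {1<..<2}"
  show "Im (s *r sphr s E.flux) = Im (r *r sphr r E.flux)"
  by (rule E.flux_im_const[of 1 "r + s"]) (use r s in \<open>auto simp: shell_def\<close>)
  qed simp
  moreover have "((%s. Im (s *r sphr s E.flux)) ---> Im (1 *r L)) (at_right 1)"
  by (intro tendsto_intros limE)
  ultimately have "((%s. Im (r *r sphr r E.flux)) ---> Im (1 *r L)) (at_right (1::real))"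
  by (rule Lim_transform_eventually[rotated])
  then have "Im (r *r sphr r E.flux) = 0"
  using ImL tendsto_const_iff trivial_limit_at_right_real by (metis scaleR_one)
  then show ?thesis using r by simp
 qed
 have lp: "0 < lam + 2 * mu" using pos by linarith
 have S: "E.S b c z = pd b (V c) z - pd c (V b) z" for b c z by (rule E.S_def)
 have VV: "v = (%x. \<chi> i. V i x)" by (simp add: V_def fun_eq_iff vec_eq_iff)
 note c1 = E.curl_eq[OF VV] and c3 = E.curl_curl_eq[OF VV]
 obtain C1 R1 where C1: "C1 > 0" "!!z. R1 <= norm z ==> norm (ccross (curl (curl v) z) (cvec (z /\<^sub>R norm z)) - (\<i> * cr (k_shear mu rho om)) *s curl v z) <= C1 / (norm z)^2"
  by (rule bigo_at_infinityE[OF conjunct1[OF rad[unfolded radiating_def]]]) (rule that)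
 obtain C2' R2 where C2': "C2' > 0" "!!z. R2 <= norm z ==> norm ((SU i. cvec (z /\<^sub>R norm z) $ i * grad (div_field v) z $ i) - \<i> * cr (k_pressure lam mu rho om) * div_field v z) <= C2' / (norm z)^2"
  by (rule bigo_at_infinityE[OF conjunct2[OF rad[unfolded radiating_def]]]) (rule that)
 define C where "C = max C1 C2'"
 define R where "R = max 2 (max R1 R2)"
 have divE: "div_field v z = E.P z" if "z : ?E" for z
  unfolding divV[OF that C2(2) oE] E.P_def ..
 have vE: "V i z = 0" if z: "z : ?E" for i z
 proof (rule E.exterior_zero[where kp="k_pressure lam mu rho om" and ks="k_shear mu rho om" and ?r1.0=R and C=C])
  show "k_pressure lam mu rho om > 0" "k_shear mu rho om > 0"
  unfolding k_pressure_def k_shear_def using pos lp by auto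
  show "(k_pressure lam mu rho om)^2 * (lam + 2 * mu) = om^2 * rho" "(k_shear mu rho om)^2 * mu = om^2 * rho"
  unfolding k_pressure_def k_shear_def using pos lp by (auto simp: power_mult_distrib)
  fix z :: "real^3" assume zR: "R <= norm z"
  then have z: "z : ?E" and z0: "norm z > 0" and R12: "R1 <= norm z" "R2 <= norm z" by (auto simp: R_def)
  have CC: "C1 / (norm z)^2 <= C / (norm z)^2" "C2' / (norm z)^2 <= C / (norm z)^2"
  by (auto simp: C_def intro!: divide_right_mono)
  have g: "grad (div_field v) z $ i = pd i E.P z" for i
  unfolding grad_def using pd_cong_open[OF oE z divE] by simp
  show "cmod ((SU i. cr (z $ i / norm z) * pd i E.P z) - \<i> * cr (k_pressure lam mu rho om) * E.P z) <= C / (norm z)^2"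
  using order_trans[OF C2'(2)[OF R12(2)] CC(2)] by (simp add: g divE[OF z] cvec_def divide_inverse mult.commute)
  have comp: "cmod ((ccross (curl (curl v) z) (cvec (z /\<^sub>R norm z)) - (\<i> * cr (k_shear mu rho om)) *s curl v z) $ i) <= C / (norm z)^2" for i
  by (rule order_trans[OF Finite_Cartesian_Product.norm_nth_le order_trans[OF C1(2)[OF R12(1)] CC(1)]])
  define W where "W b c = (E.w b z * cr (z $ c) - E.w c z * cr (z $ b)) / cr (norm z) - \<i> * cr (k_shear mu rho om) * E.S b c z" for b c
  have W: "cmod (W 2 3) <= C / (norm z)^2" "cmod (W 3 1) <= C / (norm z)^2" "cmod (W 1 2) <= C / (norm z)^2"
  using comp[of 1] comp[of 2] comp[of 3] unfolding W_def ccross_def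
  by (simp_all add: c1[OF z] c3[OF z] cvec_def divide_inverse ags)
  have Wn: "W c b = - W b c" for b c
  unfolding W_def S by (simp add: ags diff_divide_distrib)
  have W0: "W b b = 0" for b unfolding W_def S by simp
  have C0: "0 <= C / (norm z)^2" using C1(1) by (simp add: C_def)
  have "cmod (W b c) <= C / (norm z)^2" for b c
  using exhaust_3[of b] exhaust_3[of c] W C0
  by (elim disjE) (simp_all add: W0 Wn[of 1 3] Wn[of 2 1] Wn[of 3 2])
  then show "cmod ((E.w b z * cr (z $ c) - E.w c z * cr (z $ b)) / cr (norm z) - \<i> * cr (k_shear mu rho om) * E.S b c z) <= C / (norm z)^2" for b c
  unfolding W_def .
 qed (use pos lp flux0 z in auto)
 show ?thesis
 proof (cases "1 < norm x")
  case True
  then show ?thesis using vE[of x] by (simp add: vec_eq_iff V_def)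
 next
  case False
  with x have x: "x : shell 0 1" by simp
  have bot: "at_right (1::real) ~= bot" by simp
  have rayE: "((%r. f (r *r y)) ---> l) (at_right 1)" if "(f ---> l) (at y within ?E)" "norm y = 1" for f and l :: complex and y
  by (rule filterlim_compose[OF that(1) filterlim_ray[OF that(2)]]) simp
  have zero: "l = 0" if l: "(f ---> l) (at y within ?E)" "norm y = 1" and f: "!!x. x : ?E ==> f x = 0" for f and l :: complex and y
  proof -
  have "\<forall>\<^sub>F r in at_right 1. f (r *r y) = 0"
  by (rule eventually_at_rightI[of _ 2]) (use that(2) f in auto)
  then have "((%r. 0) ---> l) (at_right (1::real))"
  by (rule Lim_transform_eventually[OF rayE[OF l]])
  then show ?thesis using tendsto_unique[OF bot _ tendsto_const] by metis
  qed
  have a0: "a y $ i = 0" if "norm y = 1" for y i by (rule zero[OF lE(1)[OF that] that vE])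
  have pd0: "pd j (V i) z = 0" if "z : ?E" for i j z
  using pd_cong_open[OF oE that, of "V i" "%x. 0"] vE by simp
  have t0: "t y $ i = 0" if "norm y = 1" for y i
  by (rule zero[OF lE(3)[OF that] that]) (simp add: E.ta_def E.P_def pd0 if_distrib[of "%z. _ * z"] cong: if_cong)
  have ray: "((%r. f (r *r y)) ---> l) (at_left 1)" if "(f ---> l) (at y within shell 0 1)" "norm y = 1" for f and l :: complex and y
  by (rule filterlim_compose[OF that(1) filterlim_ray[OF that(2)]]) simp
  have "V i x = 0" for i
  by (rule I.interior_zero[OF order_refl pos' K _ _ x])
  (use ray[OF lI(1)] ray[OF lI(3)] a0 t0 in auto)
  then show ?thesis by (simp add: vec_eq_iff V_def)
 qed
qed

section \<open>Functions smooth off the origin, and solid harmonics\<close>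

inductive_set smooth_fns :: "(cfun) set" where
 const: "(%x. c) : smooth_fns"
| coord: "(%x. cr (x $ i)) : smooth_fns"
| norm: "(%x. cr (norm x)) : smooth_fns"
| inv_norm: "(%x. cr (inverse (norm x))) : smooth_fns"
| add: "f : smooth_fns ==> g : smooth_fns ==> (%x. f x + g x) : smooth_fns"
| mult: "f : smooth_fns ==> g : smooth_fns ==> (%x. f x * g x) : smooth_fns"

lemma smooth_minus: "f : smooth_fns ==> (%x. - f x) : smooth_fns"
 using smooth_fns.mult[OF smooth_fns.const[of "- 1"]] by simp

lemma smooth_sum: "(!!m. m : A ==> f m : smooth_fns) ==> (%x. \<Sum>m\<in>A. f m x) : smooth_fns"
 by (induction A rule: infinite_finite_induct) (auto intro: smooth_fns.intros)

lemma smooth_power: "f : smooth_fns ==> (%x. f x ^ n) : smooth_fns"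
 by (induction n) (auto intro: smooth_fns.intros)

lemma smooth_poly: "(%x. cr (t x)) : smooth_fns ==> (%x. cr (poly q (t x))) : smooth_fns"
 by (induction q) (auto intro!: smooth_fns.intros)

lemma norm_deriv:
 assumes "x ~= (0::real^3)"
 shows "(%x. rc (norm x)) differentiable (at x)"
  "pd i (%x. rc (norm x)) x = cr (x $ i * inverse (norm x))"
  "(%x. rc (inverse (norm x))) differentiable (at x)"
  "pd i (%x. rc (inverse (norm x))) x = - cr (x $ i * inverse (norm x) ^ 3)"
proof -
 have 1: "((%x. rc (norm x)) has_derivative (%h. cr (h \<bullet> sgn x))) (at x)"
  by (intro derivative_intros has_derivative_norm[OF assms])
 have 2: "((%x. rc (inverse (norm x))) has_derivative (%h. cr (- (inverse (norm x) * (h \<bullet> sgn x) * inverse (norm x))))) (at x)"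
  using assms by (intro derivative_intros has_derivative_norm[OF assms] has_derivative_inverse) auto
 show "(%x. rc (norm x)) differentiable (at x)" using 1 by (rule differentiableI)
 show "(%x. rc (inverse (norm x))) differentiable (at x)" using 2 by (rule differentiableI)
 have s: "axis i 1 \<bullet> sgn x = x $ i * inverse (norm x)"
  by (simp add: sgn_div_norm inner_axis' divide_inverse mult.commute)
 show "pd i (%x. rc (norm x)) x = cr (x $ i * inverse (norm x))"
  unfolding pd_eqI[OF 1] s ..
 show "pd i (%x. rc (inverse (norm x))) x = - cr (x $ i * inverse (norm x) ^ 3)"
  unfolding pd_eqI[OF 2] s by (simp add: power3_eq_cube mult_ac)
qed

text \<open>The class is closed under partial derivatives off the origin because it contains the
  norm together with its inverse. Membership thus yields derivatives of every order, and
  \<open>C^2\<close> claims reduce to recognising the shape of a function.\<close>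

lemma smooth_pd:
 assumes "f : smooth_fns"
 shows "(\<forall>x\<in>-{0}. f differentiable (at x)) & (\<exists>g\<in>smooth_fns. \<forall>x\<in>-{0}. pd i f x = g x)"
 using assms
proof induction
 case (const c) show ?case by (auto intro!: bexI[OF _ smooth_fns.const[of 0]])
next
 case (coord j) show ?case by (auto simp: pd_ccoord intro!: bexI[OF _ smooth_fns.const[of "if i = j then 1 else 0"]])
next
 case norm
 have "(%x. cr (x $ i) * cr (inverse (norm x))) : smooth_fns" by (intro smooth_fns.intros)
 then show ?case using norm_deriv by (intro conjI bexI) auto
next
 case inv_norm
 have "(%x. - (cr (x $ i) * cr (inverse (norm x)) ^ 3)) : smooth_fns" by (intro smooth_fns.intros smooth_minus smooth_power)
 then show ?case using norm_deriv by (intro conjI bexI) auto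
next
 case (add f g)
 then obtain f' g' where *: "f' : smooth_fns" "g' : smooth_fns" "!!x. x : -{0} ==> pd i f x = f' x" "!!x. x : -{0} ==> pd i g x = g' x"
  by blast
 then show ?case using add.IH
  by (intro conjI bexI[OF _ smooth_fns.add[OF *(1,2)]]) (auto simp: pd_add)
next
 case (mult f g)
 then obtain f' g' where *: "f' : smooth_fns" "g' : smooth_fns" "!!x. x : -{0} ==> pd i f x = f' x" "!!x. x : -{0} ==> pd i g x = g' x"
  by blast
 then show ?case using mult.IH mult.hyps
  by (intro conjI bexI[OF _ smooth_fns.add[OF smooth_fns.mult[OF *(1) mult.hyps(2)] smooth_fns.mult[OF mult.hyps(1) *(2)]]])
  (auto simp: pd_mult)
qed

lemma open_punctured [simp]: "open (- {0::real^3})" by (rule open_Compl) simp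

lemma smooth_diffble: "f : smooth_fns ==> x ~= 0 ==> f differentiable (at x)"
 using smooth_pd by blast

lemma smooth_cont: "f : smooth_fns ==> cont_on (- {0}) f"
 by (intro continuous_at_imp_continuous_on ballI differentiable_imp_continuous_within smooth_diffble) auto

lemma smooth_C1: "f : smooth_fns ==> C1_on (- {0}) f"
proof -
 assume f: "f : smooth_fns"
 have "cont_on (- {0}) (pd i f)" for i
 proof -
  obtain g where "g : smooth_fns" "\<forall>x\<in>-{0}. pd i f x = g x" using smooth_pd[OF f] by blast
  then show ?thesis using smooth_cont[of g] continuous_on_cong[OF refl, of "-{0}" "pd i f" g] by auto
 qed
 then show ?thesis using smooth_diffble[OF f] by (auto simp: C1_on_def)
qed

lemma smooth_C2: "f : smooth_fns ==> C2_on (- {0}) f"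
proof (rule C2_onI[OF smooth_C1])
 fix i assume f: "f : smooth_fns"
 obtain g where g: "g : smooth_fns" "\<forall>x\<in>-{0}. pd i f x = g x" using smooth_pd[OF f] by blast
 show "C1_on (-{0}) (pd i f)"
  by (rule C1_on_cong[OF open_punctured _ smooth_C1[OF g(1)]]) (use g in auto)
qed

lemma smooth_pd_C2:
 assumes f: "f : smooth_fns"
 shows "C2_on (- {0}) (pd i f)"
proof -
 obtain g where g: "g : smooth_fns" "\<forall>x\<in>-{0}. pd i f x = g x" using smooth_pd[OF f] by blast
 show ?thesis by (rule C2_on_cong[OF open_punctured _ smooth_C2[OF g(1)]]) (use g in auto)
qed

definition lap :: "(cfun) => cfun" where
 "lap f x = (SU i. pd i (pd i f) x)"

definition gdot :: "(cfun) => (cfun) => cfun" where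
 "gdot f g x = (SU i. pd i f x * pd i g x)"

lemma pd_pd:
 assumes "open S" "x : S" "!!x. x : S ==> pd i f x = g x"
 shows "pd j (pd i f) x = pd j g x"
 by (rule pd_cong_open[OF assms])

lemma pd_pd_mult:
 fixes f g :: "cfun"
 assumes S: "open S" "x : S" and f: "C2_on S f" and g: "C2_on S g"
 shows "pd i (pd i (%x. f x * g x)) x = pd i (pd i f) x * g x + 2 * (pd i f x * pd i g x) + f x * pd i (pd i g) x"
proof -
 note c = C1_onD(1)[OF C2_onD(1)[OF f]] C1_onD(1)[OF C2_onD(1)[OF g]] C1_onD(1)[OF C2_onD(2)[OF f]] C1_onD(1)[OF C2_onD(2)[OF g]]
 have "pd i (pd i (%x. f x * g x)) x = pd i (%x. pd i f x * g x + f x * pd i g x) x"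
  by (rule pd_pd[OF S]) (simp add: pd_mult c)
 also have "... = pd i (pd i f) x * g x + 2 * (pd i f x * pd i g x) + f x * pd i (pd i g) x"
  by (simp add: pd_add pd_mult differentiable_mult c S ags)
 finally show ?thesis .
qed

lemma lap_mult:
 assumes "open S" "x : S" "C2_on S f" "C2_on S g"
 shows "lap (%x. f x * g x) x = lap f x * g x + 2 * gdot f g x + f x * lap g x"
 unfolding lap_def gdot_def pd_pd_mult[OF assms] by (simp add: sum.distrib sum_distrib_left sum_distrib_right)

text \<open>The chain rule phrased by partial derivatives: \<open>h'\<close> is the first derivative
  of the outer function along the inner one, given on all of \<open>S\<close>, whereas
  \<open>h''\<close> is the value of the second at \<open>x\<close>.\<close>

lemma lap_comp:
 assumes S: "open S" "x : S" and f: "C2_on S f"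
  and 1: "!!i x. x : S ==> pd i h x = h' x * pd i f x" and 2: "!!i. pd i h' x = h'' * pd i f x"
  and h': "h' differentiable (at x)"
 shows "lap h x = h'' * gdot f f x + h' x * lap f x"
proof -
 have "pd i (pd i h) x = h'' * (pd i f x * pd i f x) + h' x * pd i (pd i f) x" for i
 proof -
  have "pd i (pd i h) x = pd i (%x. h' x * pd i f x) x" by (rule pd_pd[OF S 1])
  then show ?thesis using h' C1_onD(1)[OF C2_onD(2)[OF f] S(2)] by (simp add: pd_mult 2)
 qed
 then show ?thesis unfolding lap_def gdot_def by (simp add: sum.distrib sum_distrib_left)
qed

lemma pd_power:
 fixes f :: "cfun"
 assumes "f differentiable (at x)"
 shows "pd i (%x. f x ^ n) x = of_nat n * f x ^ (n - 1) * pd i f x"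
proof (induction n)
 case (Suc n)
 have "(%x. f x ^ n) differentiable (at x)" using assms by (rule differentiable_power)
 then show ?case using Suc assms by (cases n) (simp_all add: pd_mult ags)
qed simp

lemma pd_poly:
 fixes t :: "real^3 => real"
 assumes "(%x. rc (t x)) differentiable (at x)"
 shows "(%x. rc (poly q (t x))) differentiable (at x)"
  "pd i (%x. rc (poly q (t x))) x = cr (poly (pderiv q) (t x)) * pd i (%x. cr (t x)) x"
proof -
 have "(%x. rc (poly q (t x))) differentiable (at x) &
  pd i (%x. rc (poly q (t x))) x = cr (poly (pderiv q) (t x)) * pd i (%x. cr (t x)) x"
 proof (induction q)
  case (pCons a q)
  then show ?case using assms
  by (simp add: pd_add pd_mult differentiable_mult differentiable_add pderiv_pCons ags)
 qed simp
 then show "(%x. rc (poly q (t x))) differentiable (at x)"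
  "pd i (%x. rc (poly q (t x))) x = cr (poly (pderiv q) (t x)) * pd i (%x. cr (t x)) x" by auto
qed

lemma coord_sum: "(SU i. rc (x $ i) * cr (x $ i)) = (cr (norm x))^2" for x :: "real^3"
 unfolding of_real_power[symmetric] norm_3 sum_3 by (simp add: power2_eq_square)

lemma gdot_norm:
 assumes "x ~= 0"
 shows "gdot (%x. cr (norm x)) f x = cr (inverse (norm x)) * euler f x"
  "gdot f (%x. cr (norm x)) x = cr (inverse (norm x)) * euler f x"
 using assms by (simp_all add: gdot_def norm_deriv euler_def sum_distrib_left scaleR_conv_of_real mult_ac)

lemma euler_norm: "x ~= 0 ==> euler (%x. cr (norm x)) x = rc (norm x)"
 using coord_sum[of x] by (simp add: euler_def norm_deriv scaleR_conv_of_real power2_eq_square field_simps flip: sum_divide_distrib)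

lemma lap_norm:
 assumes x: "x ~= 0"
 shows "lap (%x. cr (norm x)) x = 2 * cr (inverse (norm x))"
proof -
 have "pd i (pd i (%x. rc (norm x))) x = cr (inverse (norm x)) - cr (x $ i) * cr (x $ i) * cr (inverse (norm x)) ^ 3" for i
 proof -
  have "pd i (pd i (%x. rc (norm x))) x = pd i (%x. cr (x $ i) * cr (inverse (norm x))) x"
  by (rule pd_pd[OF open_punctured]) (use x norm_deriv in auto)
  also have "... = cr (inverse (norm x)) - cr (x $ i) * cr (x $ i) * cr (inverse (norm x)) ^ 3"
  using norm_deriv[OF x] by (simp add: pd_coord_mult)
  finally show ?thesis .
 qed
 then have "lap (%x. cr (norm x)) x = (\<Sum>i\<in>(UNIV::3 set). rc (inverse (norm x))) - (SU i. cr (x $ i) * cr (x $ i)) * cr (inverse (norm x)) ^ 3"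
  unfolding lap_def by (simp only: sum_subtractf sum_distrib_right)
 then show ?thesis using x by (simp add: coord_sum power2_eq_square power3_eq_cube field_simps)
qed

text \<open>\<open>A = a\<^sup>m\<close> with \<open>a = x\<^sub>1 \<plusminus> i x\<^sub>2\<close> carries the azimuthal dependence, the polynomial in
 \<open>x\<^sub>3 / |x|\<close> the polar one.\<close>

definition solid :: "nat => nat => complex => real poly => cfun" where
 "solid n m s q x = (cr (x $ 1) + s * cr (x $ 2)) ^ m * cr (norm x) ^ (n - m)
  * cr (poly q (x $ 3 * inverse (norm x)))"

lemma solid_smooth: "solid n m s q : smooth_fns"
 unfolding solid_def[abs_def]
 by (intro smooth_fns.mult smooth_fns.add smooth_power smooth_poly smooth_fns.const smooth_fns.coord smooth_fns.norm)
  (simp only: of_real_mult, intro smooth_fns.intros)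

lemma solid_homogeneous:
 assumes "m <= n" "c > 0"
 shows "solid n m s q (c *r x) = cr c ^ n * solid n m s q x"
proof -
 have a: "rc ((c *r x) $ 1) + s * cr ((c *r x) $ 2) = cr c * (cr (x $ 1) + s * cr (x $ 2))"
  by (simp add: ags)
 have b: "(c *r x) $ 3 * inverse (norm (c *r x)) = x $ 3 * inverse (norm x)" using assms by (simp add: field_simps)
 have c: "rc (norm (c *r x)) = cr c * cr (norm x)" using assms by simp
 have "cr c ^ n = rc c ^ m * cr c ^ (n - m)" using assms by (simp flip: power_add)
 then show ?thesis unfolding solid_def a b c power_mult_distrib by simp
qed

text \<open>\<open>A\<close> is a power of \<open>a\<close>, whose gradient is a null vector because
  \<open>s^2 = - 1\<close>, so \<open>A\<close> is harmonic; \<open>Q\<close> is homogeneous of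
  degree 0. After the product rule the Laplacian is \<open>r^-2\<close> times the ordinary
  differential equation assumed for \<open>q\<close>.\<close>

lemma solid_harmonic:
 assumes m: "m <= n" and s: "s^2 = - 1" and x: "x ~= 0"
  and ode: "!!t. (1 - t^2) * poly (pderiv (pderiv q)) t - 2 * (real m + 1) * t * poly (pderiv q) t
  + (real n - real m) * (real n + real m + 1) * poly q t = 0"
 shows "lap (solid n m s q) x = 0"
proof -
 let ?S = "- {0::real^3}"
 have xS: "x : ?S" using x by simp
 define N where "N = n - m"
 define r u where "r = rc (norm x)" and "u = rc (inverse (norm x))"
 have ru: "r * u = 1" using x by (simp add: r_def u_def)
 define tt :: "real^3 => real" where "tt x = x $ 3 * inverse (norm x)" for x
 define T where "T x = rc (tt x)" for x
 define t where "t = T x"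
 define a where "a x = rc (x $ 1) + s * cr (x $ 2)" for x :: "real^3"
 define e :: "3 => complex" where "e i = (if i = 1 then 1 else if i = 2 then s else 0)" for i
 define A where "A x = a x ^ m" for x
 define R where "R x = rc (norm x) ^ N" for x :: "real^3"
 define Q where "Q x = rc (poly q (tt x))" for x
 define Q1 where "Q1 x = rc (poly (pderiv q) (tt x))" for x
 define q2 where "q2 = rc (poly (pderiv (pderiv q)) (tt x))"
 have T_eq: "T = (%x. cr (x $ 3) * cr (inverse (norm x)))" by (simp add: T_def[abs_def] tt_def)
 have Ts: "T : smooth_fns" unfolding T_eq by (intro smooth_fns.intros)
 have as: "a : smooth_fns" unfolding a_def[abs_def] by (intro smooth_fns.intros)
 have As: "A : smooth_fns" unfolding A_def[abs_def] by (rule smooth_power[OF as])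
 have Rs: "R : smooth_fns" unfolding R_def[abs_def] by (intro smooth_power smooth_fns.intros)
 have Qs: "Q : smooth_fns" unfolding Q_def[abs_def] using Ts by (intro smooth_poly) (simp add: T_def[abs_def])
 have AQs: "(%x. A x * Q x) : smooth_fns" by (intro smooth_fns.mult As Qs)
 have pda: "pd i a y = e i" for i y
  unfolding a_def[abs_def] e_def using exhaust_3[of i]
  by (auto simp: pd_add pd_mult pd_ccoord differentiable_mult)
 have pdT: "pd i T y = (if i = 3 then cr (inverse (norm y)) else 0) - cr (y $ 3) * cr (y $ i) * cr (inverse (norm y)) ^ 3" if "y ~= 0" for i y
  unfolding T_eq using norm_deriv[OF that] by (simp add: pd_coord_mult)
 have dT: "(%x. rc (tt x)) differentiable (at y)" if "y ~= 0" for y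
  using smooth_diffble[OF Ts that] by (simp add: T_def[abs_def])
 have pdQ: "pd i Q y = Q1 y * pd i T y" "pd i Q1 y = cr (poly (pderiv (pderiv q)) (tt y)) * pd i T y"
  "Q1 differentiable (at y)" if "y ~= 0" for i y
  unfolding Q_def[abs_def] Q1_def[abs_def] T_def[abs_def] by (rule pd_poly[OF dT[OF that]])+
 have da: "a differentiable (at y)" for y unfolding a_def[abs_def] by simp
 have pdA: "pd i A y = (of_nat m * a y ^ (m - 1)) * pd i a y" for i y
  unfolding A_def[abs_def] by (rule pd_power[OF da])
 have Eee: "(SU i. e i * e i) = 0" using s by (simp add: sum_3 e_def power2_eq_square)
 have ea: "(SU i. e i * cr (x $ i)) = a x" by (simp add: sum_3 e_def a_def)
 have xx: "(SU i. rc (x $ i) * cr (x $ i)) = r^2" unfolding r_def by (rule coord_sum)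
 have x3: "rc (x $ 3) = r * t" unfolding r_def t_def T_def tt_def using x by simp
 have lapA: "lap A x = 0"
 proof -
  have "lap A x = of_nat m * of_nat (m - 1) * a x ^ (m - 1 - 1) * gdot a a x + of_nat m * a x ^ (m - 1) * lap a x"
  proof (rule lap_comp[OF open_punctured xS smooth_C2[OF as] pdA])
  show "pd i (%y. of_nat m * a y ^ (m - 1)) x = of_nat m * of_nat (m - 1) * a x ^ (m - 1 - 1) * pd i a x" for i
  using da by (simp add: pd_mult pd_power differentiable_power)
  show "(%y. of_nat m * a y ^ (m - 1)) differentiable (at x)"
  using da by (intro differentiable_mult differentiable_power) auto
  qed
  moreover have "gdot a a x = 0" unfolding gdot_def pda by (rule Eee)
  moreover have "lap a x = 0" unfolding lap_def pda[abs_def] by simp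
  ultimately show ?thesis by simp
 qed
 have mA: "of_nat m * a x ^ (m - 1) * a x = of_nat m * A x" by (cases m) (simp_all add: A_def)
 have gAT: "gdot A T x = - (of_nat m * A x * (t * u^2))"
 proof -
  have "gdot A T x = of_nat m * a x ^ (m - 1) * (SU i. e i * pd i T x)"
  unfolding gdot_def pdA pda by (simp add: sum_distrib_left mult_ac)
  also have "(SU i. e i * pd i T x) = - (cr (x $ 3) * u ^ 3 * (SU i. e i * cr (x $ i)))"
  unfolding pdT[OF x] u_def[symmetric] by (simp add: sum_3 e_def ags)
  also have "... = - (a x * (t * u^2))" unfolding ea x3 using ru by (simp add: power2_eq_square power3_eq_cube ags)
  finally have "gdot A T x = - (of_nat m * a x ^ (m - 1) * a x * (t * u^2))" by simp
  then show ?thesis unfolding mA .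
 qed
 have gTT: "gdot T T x = u^2 * (1 - t^2)"
 proof -
  have "gdot T T x = u^2 - 2 * (cr (x $ 3) * cr (x $ 3) * u ^ 4) + (cr (x $ 3) * u ^ 3)^2 * (SU i. cr (x $ i) * cr (x $ i))"
  unfolding gdot_def pdT[OF x] u_def[symmetric] sum_3 by (simp add: ags power2_eq_square power3_eq_cube power4_eq_xxxx)
  also have "... = u^2 - 2 * ((r * u)^2 * (t^2 * u^2)) + (r * u) ^ 4 * (t^2 * u^2)"
  unfolding xx x3 by (simp add: ags power2_eq_square power3_eq_cube power4_eq_xxxx)
  finally show ?thesis unfolding ru by (simp add: ags)
 qed
 have lapT: "lap T x = - 2 * t * u^2"
 proof -
  have "pd i (pd i T) x = (if i = 3 then - 2 * (cr (x $ 3) * u ^ 3) else 0) - cr (x $ 3) * u ^ 3 + 3 * (cr (x $ 3) * (cr (x $ i) * cr (x $ i)) * u ^ 5)" for i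
  proof -
  have "pd i (pd i T) x = pd i (%y. (if i = 3 then cr (inverse (norm y)) else 0) - cr (y $ 3) * (cr (y $ i) * cr (inverse (norm y)) ^ 3)) x"
  by (rule pd_pd[OF open_punctured xS]) (simp add: pdT mult.assoc)
  also have "... = (if i = 3 then - cr (x $ 3) * u ^ 3 else 0) - ((if i = 3 then cr (x $ i) * u ^ 3 else 0) + cr (x $ 3) * (u ^ 3 + cr (x $ i) * (3 * u^2 * - (cr (x $ i) * u ^ 3))))"
  using norm_deriv[OF x] by (cases "i = 3") (simp_all add: u_def pd_diff pd_coord_mult pd_power differentiable_mult differentiable_power differentiable_diff pd_minus)
  also have "... = (if i = 3 then - 2 * (cr (x $ 3) * u ^ 3) else 0) - cr (x $ 3) * u ^ 3 + 3 * (cr (x $ 3) * (cr (x $ i) * cr (x $ i)) * u ^ 5)"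
  by (simp add: ags power2_eq_square power3_eq_cube eval_nat_numeral)
  finally show ?thesis .
  qed
  then have "lap T x = - 2 * (cr (x $ 3) * u ^ 3) - 3 * (cr (x $ 3) * u ^ 3) + 3 * (cr (x $ 3) * (SU i. cr (x $ i) * cr (x $ i)) * u ^ 5)"
  unfolding lap_def sum_3 by (simp only:) (simp add: ags)
  also have "... = - 5 * (r * u * (t * u^2)) + 3 * ((r * u) ^ 3 * (t * u^2))"
  unfolding xx x3 by (simp add: ags power2_eq_square power3_eq_cube eval_nat_numeral)
  finally show ?thesis unfolding ru by simp
 qed
 have lapQ: "lap Q x = q2 * gdot T T x + Q1 x * lap T x"
  unfolding q2_def by (rule lap_comp[OF open_punctured xS smooth_C2[OF Ts]]) (use pdQ x in auto)
 have gAQ: "gdot A Q x = Q1 x * gdot A T x"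
  unfolding gdot_def by (simp add: pdQ[OF x] sum_distrib_left mult_ac)
 have lapAQ: "lap (%x. A x * Q x) x = A x * u^2 * ((1 - t^2) * q2 - 2 * (of_nat m + 1) * t * Q1 x)"
  unfolding lap_mult[OF open_punctured xS smooth_C2[OF As] smooth_C2[OF Qs]] lapA lapQ gAQ gAT gTT lapT
  by (simp add: ags)
 have eAQ: "euler (%x. A x * Q x) x = of_nat m * (A x * Q x)"
 proof -
  have "euler A x = of_nat m * a x ^ (m - 1) * (SU i. e i * cr (x $ i))"
  unfolding euler_def pdA pda scaleR_conv_of_real by (simp add: sum_distrib_left mult_ac)
  then have 1: "euler A x = of_nat m * A x" unfolding ea mA .
  have "euler T x = cr (x $ 3) * u - cr (x $ 3) * u ^ 3 * (SU i. cr (x $ i) * cr (x $ i))"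
  unfolding euler_def pdT[OF x] scaleR_conv_of_real u_def[symmetric] sum_3 by (simp add: ags)
  also have "... = t * (r * u) - t * (r * u) ^ 3" unfolding xx x3 by (simp add: ags power2_eq_square power3_eq_cube)
  finally have "euler T x = 0" unfolding ru by simp
  then have "euler Q x = 0" unfolding euler_def pdQ[OF x] by (simp flip: sum_distrib_left mult_scaleR_right)
  with 1 show ?thesis unfolding euler_mult[OF smooth_diffble[OF As x] smooth_diffble[OF Qs x]] by simp
 qed
 have pdR: "pd i R y = (of_nat N * cr (norm y) ^ (N - 1)) * pd i (%x. cr (norm x)) y" if "y ~= 0" for i y
  unfolding R_def[abs_def] by (rule pd_power[OF norm_deriv(1)[OF that]])
 have rN: "of_nat N * r ^ (N - 1) = of_nat N * (R x * u)" "of_nat N * of_nat (N - 1) * r ^ (N - 1 - 1) = of_nat N * of_nat (N - 1) * (R x * u^2)"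
 proof -
  have *: "r * r ^ k * u = r ^ k" for k using ru by (simp add: ags)
  show "of_nat N * r ^ (N - 1) = of_nat N * (R x * u)"
  unfolding R_def r_def[symmetric] by (cases N) (simp_all add: *)
  show "of_nat N * of_nat (N - 1) * r ^ (N - 1 - 1) = of_nat N * of_nat (N - 1) * (R x * u^2)"
  proof (cases "N < 2")
  case False
  then obtain k where N: "N = Suc (Suc k)" by (metis add_2_eq_Suc le_add_diff_inverse not_less)
  have "R x * u^2 = r * (r * r ^ k * u) * u" unfolding R_def r_def[symmetric] N by (simp add: power2_eq_square)
  then have "R x * u^2 = r ^ k" unfolding * by (simp add: *)
  then show ?thesis unfolding N by simp
  qed (auto simp: less_2_cases_iff)
 qed
 have lapR: "lap R x = of_nat N * (of_nat N + 1) * (R x * u^2)"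
 proof -
  have "lap R x = of_nat N * of_nat (N - 1) * cr (norm x) ^ (N - 1 - 1) * gdot (%x. cr (norm x)) (%x. cr (norm x)) x
  + of_nat N * cr (norm x) ^ (N - 1) * lap (%x. cr (norm x)) x"
  proof (rule lap_comp[OF open_punctured xS smooth_C2[OF smooth_fns.norm] pdR])
  show "pd i (%y. of_nat N * rc (norm y) ^ (N - 1)) x = of_nat N * of_nat (N - 1) * cr (norm x) ^ (N - 1 - 1) * pd i (%x. cr (norm x)) x" for i
  using norm_deriv(1)[OF x] by (simp add: pd_mult pd_power differentiable_power)
  show "(%y. of_nat N * rc (norm y) ^ (N - 1)) differentiable (at x)"
  using norm_deriv(1)[OF x] by (intro differentiable_mult differentiable_power) auto
  qed auto
  also have "... = of_nat N * of_nat (N - 1) * (R x * u^2) * (r * u) + of_nat N * (R x * u) * (2 * u)"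
  unfolding gdot_norm(1)[OF x] euler_norm[OF x] lap_norm[OF x] r_def[symmetric] u_def[symmetric] rN by (simp add: ags)
  also have "... = (of_nat N * of_nat (N - 1) + 2 * of_nat N) * (R x * u^2)" unfolding ru by (simp add: ags power2_eq_square)
  also have "of_nat N * of_nat (N - 1) + 2 * of_nat N = (of_nat N * (of_nat N + 1) :: complex)"
  by (cases N) (simp_all add: ags)
  finally show ?thesis .
 qed
 have gR: "gdot R (%x. A x * Q x) x = of_nat N * (R x * u^2) * (of_nat m * (A x * Q x))"
 proof -
  have "gdot R (%x. A x * Q x) x = of_nat N * r ^ (N - 1) * gdot (%x. cr (norm x)) (%x. A x * Q x) x"
  unfolding gdot_def pdR[OF x] r_def by (simp add: sum_distrib_left mult_ac)
  then show ?thesis unfolding rN gdot_norm(1)[OF x] eAQ u_def[symmetric] by (simp add: power2_eq_square mult_ac)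
 qed
 have eq: "solid n m s q = (%x. R x * (A x * Q x))"
  by (rule ext) (simp add: solid_def A_def R_def Q_def a_def tt_def N_def mult_ac)
 have "lap (solid n m s q) x = R x * A x * u^2 * ((1 - t^2) * q2 - 2 * (of_nat m + 1) * t * Q1 x + (of_nat N * (of_nat N + 1) + 2 * of_nat N * of_nat m) * Q x)"
  unfolding eq lap_mult[OF open_punctured xS smooth_C2[OF Rs] smooth_C2[OF AQs]] lapR gR lapAQ by (simp add: ags)
 also have "(1 - t^2) * q2 - 2 * (of_nat m + 1) * t * Q1 x + (of_nat N * (of_nat N + 1) + 2 * of_nat N * of_nat m) * Q x
  = cr ((1 - (tt x)^2) * poly (pderiv (pderiv q)) (tt x) - 2 * (real m + 1) * tt x * poly (pderiv q) (tt x)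
  + (real n - real m) * (real n + real m + 1) * poly q (tt x))"
  unfolding t_def T_def q2_def Q1_def Q_def using m by (simp add: N_def of_nat_diff ags)
 finally show ?thesis unfolding ode by simp
qed

section \<open>Legendre's equation and the harmonics \<open>r^n Y_n^m\<close>\<close>

lemma legendre_ode_deriv:
 fixes d :: "nat => real => real"
 assumes d: "!!k t. (d k has_real_derivative d (Suc k) t) (at t)"
  and 0: "!!t. (t^2 - 1) * d 1 t = 2 * a * t * d 0 t"
 shows "(t^2 - 1) * d (N + 2) t + 2 * (real N + 1) * t * d (N + 1) t + (real N + 1) * real N * d N t
  - 2 * a * t * d (N + 1) t - 2 * a * (real N + 1) * d N t = 0"
\<comment> \<open>The claim is the hypothesis \<open>0\<close> differentiated \<open>N + 1\<close>
  times; each step differentiates an expression that is identically 0. It is applied to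
  \<open>d 0\<close> a multiple of \<open>(t^2 - 1)^n\<close> and \<open>N = m + n\<close>, which by
  Rodrigues' formula is the equation for the \<open>m\<close>-th derivative of the Legendre
  polynomial.\<close>
proof (induction N arbitrary: t)
 case 0
 have "((%t. (t^2 - 1) * d 1 t - 2 * a * t * d 0 t) has_real_derivative
  (t^2 - 1) * d 2 t + 2 * t * d 1 t - 2 * a * t * d 1 t - 2 * a * d 0 t) (at t)"
  by (auto intro!: derivative_eq_intros d simp: numeral_2_eq_2 ags)
 then have "((%t. 0) has_real_derivative
  (t^2 - 1) * d 2 t + 2 * t * d 1 t - 2 * a * t * d 1 t - 2 * a * d 0 t) (at t)" by (simp add: assms(2)[unfolded One_nat_def])
 from DERIV_unique[OF this DERIV_const] show ?case by (simp add: numeral_2_eq_2)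
next
 case (Suc N)
 have "((%t. (t^2 - 1) * d (N + 2) t + 2 * (real N + 1) * t * d (N + 1) t + (real N + 1) * real N * d N t
  - 2 * a * t * d (N + 1) t - 2 * a * (real N + 1) * d N t) has_real_derivative
  (t^2 - 1) * d (Suc (N + 2)) t + 2 * t * d (N + 2) t + 2 * (real N + 1) * (t * d (Suc (N + 1)) t + d (N + 1) t) + (real N + 1) * real N * d (Suc N) t
  - 2 * a * (t * d (Suc (N + 1)) t + d (N + 1) t) - 2 * a * (real N + 1) * d (Suc N) t) (at t)"
  by (rule derivative_eq_intros d refl | simp)+ (simp add: ags)
 then have "((%t. 0) has_real_derivative
  (t^2 - 1) * d (Suc (N + 2)) t + 2 * t * d (N + 2) t + 2 * (real N + 1) * (t * d (Suc (N + 1)) t + d (N + 1) t) + (real N + 1) * real N * d (Suc N) t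
  - 2 * a * (t * d (Suc (N + 1)) t + d (N + 1) t) - 2 * a * (real N + 1) * d (Suc N) t) (at t)" unfolding Suc .
 from DERIV_unique[OF this DERIV_const] show ?case by (simp add: ags)
qed

lemma pderiv_funpow_smult: "(pderiv ^^ k) (smult c p) = smult c ((pderiv ^^ k) (p :: real poly))"
 by (induction k) (simp_all add: pderiv_smult)

lemma legendre_ode:
 defines "q n m \<equiv> (pderiv ^^ m) (legendre_poly n)"
 shows "(1 - t^2) * poly (pderiv (pderiv (q n m))) t - 2 * (real m + 1) * t * poly (pderiv (q n m)) t
  + (real n - real m) * (real n + real m + 1) * poly (q n m) t = 0"
proof -
 define p :: "real poly" where "p = [:- 1, 0, 1:] ^ n"
 define c :: real where "c = 1 / (2 ^ n * fact n)"
 define d where "d k t = c * poly ((pderiv ^^ k) p) t" for k t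
 have q: "poly ((pderiv ^^ j) (q n m)) t = d (m + n + j) t" for j t
 proof -
  have "(pderiv ^^ j) (q n m) = (pderiv ^^ (j + m + n)) (smult c p)"
  unfolding q_def legendre_poly_def c_def p_def by (simp add: funpow_add pderiv_funpow_smult)
  then show ?thesis by (simp add: d_def pderiv_funpow_smult add_ac)
 qed
 have "(d k has_real_derivative d (Suc k) t) (at t)" for k t
  unfolding d_def[abs_def] by (auto intro!: derivative_eq_intros)
 moreover have "(t^2 - 1) * d 1 t = 2 * real n * t * d 0 t" for t
 proof -
  have e: "poly [:- 1, 0, 1:] t = t^2 - 1" by (simp add: power2_eq_square)
  show ?thesis
  by (cases n) (simp_all add: d_def p_def pderiv_power pderiv_pCons poly_power e del: poly_pCons power_Suc, simp add: poly_pCons power2_eq_square ags)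
 qed
 ultimately have "(t^2 - 1) * d (m + n + 2) t + 2 * (real (m + n) + 1) * t * d (m + n + 1) t + (real (m + n) + 1) * real (m + n) * d (m + n) t
  - 2 * real n * t * d (m + n + 1) t - 2 * real n * (real (m + n) + 1) * d (m + n) t = 0"
  by (rule legendre_ode_deriv)
 then have "(1 - t^2) * d (m + n + 2) t - 2 * (real m + 1) * t * d (m + n + 1) t
  + (real n - real m) * (real n + real m + 1) * d (m + n) t = 0"
  by (simp add: ags)
 then show ?thesis using q[of 0 t] q[of 1 t] q[of 2 t] by (simp add: numeral_2_eq_2)
qed

text \<open>\<open>(t^2 - 1)^n\<close> has degree \<open>2 n\<close> and survives
  \<open>m + n\<close> derivatives as long as these are at most \<open>2 n\<close>.\<close>

lemma legendre_deriv_nonzero: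
 assumes "m <= n"
 shows "(pderiv ^^ m) (legendre_poly n) ~= 0"
proof -
 define p :: "real poly" where "p = [:- 1, 0, 1:] ^ n"
 have p: "p ~= 0" "degree p = 2 * n" unfolding p_def by (simp_all add: degree_power_eq)
 have "degree ((pderiv ^^ k) p) = 2 * n - k & (pderiv ^^ k) p ~= 0" if "k <= 2 * n" for k
  using that by (induction k) (auto simp: p degree_pderiv pderiv_eq_0_iff)
 from this[of "m + n"] assms have "(pderiv ^^ (m + n)) p ~= 0" by simp
 then show ?thesis unfolding legendre_poly_def p_def by (simp add: funpow_add pderiv_funpow_smult)
qed

definition harm_coeff :: "nat => int => real" where
 "harm_coeff n m = sqrt ((2 * real n + 1) / (4 * pi) * (fact (n - nat \<bar>m\<bar>) / fact (n + nat \<bar>m\<bar>)))"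

text \<open>\<open>r^n Y_n^m\<close> in Cartesian form: the sign of \<open>m\<close> chooses between
  \<open>x1 - i x2\<close> and \<open>x1 + i x2\<close>, so no angle and no branch of the argument
  occurs.\<close>

definition solid_harm :: "nat => int => cfun" where
 "solid_harm n m x = cr (harm_coeff n m) *
  solid n (nat \<bar>m\<bar>) (if m < 0 then - \<i> else \<i>) ((pderiv ^^ nat \<bar>m\<bar>) (legendre_poly n)) x"

lemma rcis_sign_power:
 "(cr (r * cos p) + (if m < 0 then - \<i> else \<i>) * cr (r * sin p)) ^ nat \<bar>m\<bar> = cr (r ^ nat \<bar>m\<bar>) * cis (of_int m * p)"
proof -
 have 1: "cr (r * cos p) + (if m < 0 then - \<i> else \<i>) * cr (r * sin p) = cr r * cis (if m < 0 then - p else p)"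
  by (simp add: complex_eq_iff)
 have 2: "real (nat \<bar>m\<bar>) * (if m < 0 then - p else p) = of_int m * p" by (simp add: of_nat_nat)
 show ?thesis unfolding 1 power_mult_distrib Complex.DeMoivre 2 by simp
qed

lemma solid_harm_polar:
 "x ~= 0 ==> x $ 1 = r * cos p ==> x $ 2 = r * sin p ==>
  solid_harm n m x = cr (harm_coeff n m * r ^ nat \<bar>m\<bar> * norm x ^ (n - nat \<bar>m\<bar>)
  * poly ((pderiv ^^ nat \<bar>m\<bar>) (legendre_poly n)) (x $ 3 / norm x)) * cis (of_int m * p)"
 unfolding solid_harm_def solid_def by (simp only: rcis_sign_power) (simp add: divide_inverse mult_ac)

text \<open>The polar form of \<open>x1 + i x2\<close> holds on the polar axis and across the cut of
  \<open>Arg\<close> as well, so the angular definition agrees with the smooth one at every point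
  other than the origin.\<close>

lemma sph_harm_solid:
 assumes x: "x ~= 0" and m: "nat \<bar>m\<bar> <= n"
 shows "sph_harm n m x = cr (inverse (norm x)) ^ n * solid_harm n m x"
proof -
 define z where "z = Complex (x $ 1) (x $ 2)"
 have xx: "norm x ^ 2 = (cmod z)^2 + (x $ 3)^2" by (simp add: norm_3 z_def cmod_def)
 have n0: "norm x > 0" using x by simp
 have t: "\<bar>x $ 3 / norm x\<bar> <= 1"
  using component_le_norm_cart[of x 3] n0 by (simp add: abs_divide)
 have "rcis (cmod z) (Arg z) = z" by (rule rcis_cmod_Arg)
 then have "x $ 1 = cmod z * cos (Arg z)" "x $ 2 = cmod z * sin (Arg z)" by (auto simp: z_def complex_eq_iff)
 note * = solid_harm_polar[OF x this, of n m]
 have s: "sqrt (1 - (x $ 3 / norm x)^2) = cmod z / norm x"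
 proof -
  have "1 - (x $ 3 / norm x)^2 = (cmod z / norm x)^2" using xx n0 by (simp add: power_divide diff_eq_eq add_divide_distrib[symmetric]) (use xx n0 in auto)
  then show ?thesis using n0 by simp
 qed
 have "inverse (norm x) ^ n * norm x ^ (n - nat \<bar>m\<bar>) = inverse (norm x) ^ nat \<bar>m\<bar>"
  using m n0 by (simp add: power_diff power_inverse field_simps)
 note nn = this
 have N: "inverse (norm x) ^ n * (h * c ^ nat \<bar>m\<bar> * norm x ^ (n - nat \<bar>m\<bar>) * q) = h * (c / norm x) ^ nat \<bar>m\<bar> * q" for h c q
 proof -
  have "inverse (norm x) ^ n * (h * c ^ nat \<bar>m\<bar> * norm x ^ (n - nat \<bar>m\<bar>) * q) = h * c ^ nat \<bar>m\<bar> * q * (inverse (norm x) ^ n * norm x ^ (n - nat \<bar>m\<bar>))" by simp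
  then show ?thesis unfolding nn by (simp add: power_mult_distrib divide_inverse)
 qed
 have r: "rc (inverse (norm x)) ^ n * solid_harm n m x
  = cr (harm_coeff n m * (cmod z / norm x) ^ nat \<bar>m\<bar> * poly ((pderiv ^^ nat \<bar>m\<bar>) (legendre_poly n)) (x $ 3 / norm x)) * cis (of_int m * Arg z)"
  unfolding * N[symmetric] by (simp only: of_real_mult of_real_power mult.assoc)
 show ?thesis
  unfolding r sph_harm_def assoc_legendre_def polar_angle_def azimuth_def z_def[symmetric] cos_arccos_abs[OF t] s harm_coeff_def[symmetric]
  by (simp add: cis_conv_exp mult_ac)
qed

section \<open>Toroidal fields\<close>

definition tang :: "(cfun) => real^3 => complex^3" where
 "tang f x = ccross (grad f x) (cvec x)"

lemma tang_nth: "tang f x $ 1 = ang 3 2 f x" "tang f x $ 2 = ang 1 3 f x" "tang f x $ 3 = ang 2 1 f x"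
 by (simp_all add: tang_def ccross_def grad_def cvec_def ang_def scaleR_conv_of_real mult.commute)

lemma pd_scale:
 fixes f :: "cfun"
 assumes "f differentiable (at (c *r x))"
 shows "pd i (%x. f (c *r x)) x = cr c * pd i f (c *r x)"
proof -
 have "((%x. f (c *r x)) has_derivative (%h. SU i. ((c *r h) $ i) *r pd i f (c *r x))) (at x)"
  by (rule has_derivative_compose[of "%x. c *r x" "%h. c *r h", OF _ has_derivative_pd[OF assms]]) (intro derivative_intros)
 from pd_eqI[OF this, of i] show ?thesis
  by (simp add: axis_def scaleR_conv_of_real[where 'a=complex] if_distrib[of "%z. _ * z"] if_distrib[of "%z. rc z * _"] cong: if_cong)
qed

lemma pd_homogeneous:
 fixes f :: "cfun"
 assumes "!!x. f (c *r x) = cr c ^ n * f x" and c: "c ~= 0" and "f differentiable (at x)" "f differentiable (at (c *r x))"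
 shows "cr c * pd i f (c *r x) = cr c ^ n * pd i f x"
 using pd_scale[OF assms(4), of i] assms(3) unfolding assms(1) by (simp add: pd_mult)

lemma tang_homogeneous:
 fixes f :: "cfun"
 assumes "!!x. f (c *r x) = cr c ^ n * f x" and "c ~= 0" and "f differentiable (at x)" "f differentiable (at (c *r x))"
 shows "tang f (c *r x) = cr c ^ n *s tang f x"
proof -
 note h = pd_homogeneous[OF assms]
 have "ang i j f (c *r x) = cr c ^ n * ang i j f x" for i j
 proof -
  have "ang i j f (c *r x) = cr (x $ i) * (cr c * pd j f (c *r x)) - cr (x $ j) * (cr c * pd i f (c *r x))"
  by (simp add: ang_def scaleR_conv_of_real[where 'a=complex] mult_ac)
  then show ?thesis unfolding h by (simp add: ang_def scaleR_conv_of_real[where 'a=complex] ags)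
 qed
 then show ?thesis using exhaust_3 by (auto simp: vec_eq_iff tang_nth forall_3)
qed

lemma tang_inv_norm_power:
 assumes x: "x ~= 0" and f: "f differentiable (at x)"
 shows "tang (%x. cr (inverse (norm x)) ^ n * f x) x = cr (inverse (norm x)) ^ n *s tang f x"
proof -
 have "ang i j (%x. rc (inverse (norm x)) ^ n) x = 0" for i j
  unfolding ang_def pd_power[OF norm_deriv(3)[OF x]] norm_deriv(4)[OF x] by (simp add: scaleR_conv_of_real)
 moreover have "(%x. rc (inverse (norm x)) ^ n) differentiable (at x)"
  by (rule differentiable_power[OF norm_deriv(3)[OF x]])
 ultimately have "ang i j (%x. rc (inverse (norm x)) ^ n * f x) x = cr (inverse (norm x)) ^ n * ang i j f x" for i j
  by (simp only: ang_mult[OF _ f]) simp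
 then show ?thesis by (simp add: vec_eq_iff tang_nth forall_3)
qed

lemma solid_harm_smooth: "solid_harm n m : smooth_fns"
 unfolding solid_harm_def[abs_def] by (intro smooth_fns.intros solid_smooth)

lemma solid_harm_homogeneous:
 assumes "nat \<bar>m\<bar> <= n" "c > 0"
 shows "solid_harm n m (c *r x) = cr c ^ n * solid_harm n m x"
 unfolding solid_harm_def solid_homogeneous[OF assms] by simp

text \<open>The surface gradient is the gradient of the extension of degree 0, which is
  \<open>|x|^-n\<close> times the solid harmonic. The components of \<open>tang\<close> are rotation
  derivatives, which do not see functions of the norm, so the power can be taken out.\<close>

lemma sph_T_eq:
 assumes x: "x ~= 0" and m: "nat \<bar>m\<bar> <= n"
 shows "sph_T n m x = cr (inverse (norm x)) ^ n *s tang (solid_harm n m) x"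
proof -
 define y where "y x = cr (inverse (norm x)) ^ n * solid_harm n m x" for x
 have ys: "y : smooth_fns"
  unfolding y_def[abs_def] by (intro smooth_fns.mult smooth_power smooth_fns.inv_norm solid_harm_smooth)
 have y0: "y (c *r x) = cr c ^ 0 * y x" if "c > 0" for c x
  unfolding y_def solid_harm_homogeneous[OF m that] using that by (simp add: power_mult_distrib field_simps)
 have y: "sph_harm n m (z /\<^sub>R norm z) = y z" if "z ~= 0" for z
 proof -
  have "sph_harm n m (z /\<^sub>R norm z) = y (inverse (norm z) *r z)"
  using sph_harm_solid[of "z /\<^sub>R norm z" m n] that m by (simp add: y_def)
  then show ?thesis using y0[of "inverse (norm z)" z] that by simp
 qed
 define c where "c = inverse (norm x)"
 have c: "c > 0" "c *r x ~= 0" using x by (auto simp: c_def)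
 have "surface_grad (sph_harm n m) (c *r x) = grad y (c *r x)"
  unfolding surface_grad_def grad_def vec_eq_iff
  by (auto intro!: pd_cong_open[OF open_punctured] y simp: c(2)) (use c in auto)
 then have "sph_T n m x = tang y (c *r x)" by (simp add: sph_T_def tang_def c_def)
 also have "... = cr c ^ 0 *s tang y x"
  using c(1) by (intro tang_homogeneous y0 smooth_diffble[OF ys x] smooth_diffble[OF ys c(2)]) auto
 also have "... = cr (inverse (norm x)) ^ n *s tang (solid_harm n m) x"
  unfolding y_def[abs_def] using tang_inv_norm_power[OF x smooth_diffble[OF solid_harm_smooth x]] by simp
 finally show ?thesis .
qed

lemma solid_harm_harmonic:
 assumes "nat \<bar>m\<bar> <= n" "x ~= 0"
 shows "lap (solid_harm n m) x = 0"
proof -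
 define h where "h = solid n (nat \<bar>m\<bar>) (if m < 0 then - \<i> else \<i>) ((pderiv ^^ nat \<bar>m\<bar>) (legendre_poly n))"
 have 0: "lap h x = 0" unfolding h_def
  by (rule solid_harmonic[OF assms(1) _ assms(2) legendre_ode]) auto
 have h: "C2_on (- {0}) h" unfolding h_def by (rule smooth_C2[OF solid_smooth])
 have "lap (%x. cr (harm_coeff n m) * h x) x = 0"
  if *: "lap (%x. cr (harm_coeff n m) * h x) x = lap (%x. cr (harm_coeff n m)) x * h x
  + 2 * gdot (%x. cr (harm_coeff n m)) h x + cr (harm_coeff n m) * lap h x"
 proof -
  have "lap (%x. rc (harm_coeff n m)) x = 0" unfolding lap_def using pd_pd[of UNIV x _ _ "%x. 0"] by (simp add: pd_const[abs_def])
  with * show ?thesis by (simp add: 0 gdot_def)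
 qed
 from this[OF lap_mult[OF open_punctured _ smooth_C2[OF smooth_fns.const] h]] assms(2)
 show ?thesis by (simp add: solid_harm_def[abs_def] h_def)
qed

text \<open>Multiplied by \<open>cis (n p)\<close> the sum is a polynomial of degree at most
  \<open>2 n\<close> in \<open>cis p\<close> that vanishes at infinitely many points of the
  circle.\<close>

lemma trig_poly_zero:
 fixes g :: "int => complex"
 assumes z: "!!p. (\<Sum>m = - int n..int n. g m * cis (of_int m * p)) = 0" and m: "m : {- int n..int n}"
 shows "g m = 0"
proof -
 define P where "P = (\<Sum>j\<le>2 * n. monom (g (int j - int n)) j)"
 have "poly P (cis p) = 0" for p
 proof -
  have "poly P (cis p) = (\<Sum>j\<le>2 * n. g (int j - int n) * cis (of_int (int j) * p))"
  unfolding P_def by (simp add: poly_sum poly_monom Complex.DeMoivre)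
  also have "... = (\<Sum>m = - int n..int n. g m * cis (of_int (m + int n) * p))"
  by (rule sum.reindex_bij_witness[of _ "%m. nat (m + int n)" "%j. int j - int n"]) auto
  also have "... = cis (real n * p) * (\<Sum>m = - int n..int n. g m * cis (of_int m * p))"
  by (simp add: sum_distrib_left distrib_right mult.left_commute flip: cis_mult) (simp add: mult_ac)
  finally show ?thesis using z by simp
 qed
 then have "cis ` {0..pi} \<subseteq> {x. poly P x = 0}" by auto
 moreover have "inj_on cis {0..pi}"
  by (rule inj_onI) (auto simp: complex_eq_iff intro: cos_inj_pi)
 then have "infinite (cis ` {0..pi})" using finite_imageD infinite_Icc[OF pi_gt_zero] by blast
 ultimately have "P = 0" using poly_roots_finite finite_subset by blast
 then have "coeff P (nat (m + int n)) = 0" by simp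
 moreover have "coeff P (nat (m + int n)) = g m"
 proof -
  have "nat (m + int n) <= 2 * n" "int (nat (m + int n)) - int n = m" using m by auto
  then show ?thesis unfolding P_def by (simp add: coeff_sum coeff_monom if_distrib cong: if_cong)
 qed
 ultimately show ?thesis by simp
qed

definition solid_sum :: "nat => (int => complex) => cfun" where
 "solid_sum n f x = (\<Sum>m = - int n..int n. f m * solid_harm n m x)"

text \<open>On a circle of latitude the sum is a trigonometric polynomial. The latitude
  \<open>t\<close> avoids the finitely many zeros of all the Legendre derivatives involved, so each
  \<open>f m\<close> appears there with a nonzero factor.\<close>

lemma solid_sum_nonzero:
 assumes f: "\<exists>m\<in>{- int n..int n}. f m ~= 0"
 shows "\<exists>x. x ~= 0 & solid_sum n f x ~= 0"
proof (rule ccontr)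
 assume "\<not> ?thesis"
 then have 0: "solid_sum n f x = 0" if "x ~= 0" for x using that by blast
 let ?q = "%k. (pderiv ^^ k) (legendre_poly n)"
 have "finite (\<Union>k\<le>n. {t. poly (?q k) t = 0})"
  by (intro finite_UN_I poly_roots_finite legendre_deriv_nonzero) auto
 moreover have "infinite {0<..<1::real}" by simp
 ultimately obtain t where t: "0 < t" "t < 1" "t \<notin> (\<Union>k\<le>n. {t. poly (?q k) t = 0})"
  by (meson finite_subset subsetI greaterThanLessThan_iff)
 have tt: "t^2 < 1" using t by (simp add: power_less_one_iff abs_square_less_1)
 define r where "r = sqrt (1 - t^2)"
 have r: "r > 0" "r^2 = 1 - t^2" using tt by (simp_all add: r_def)
 have "f m * cr (harm_coeff n m * r ^ nat \<bar>m\<bar> * poly (?q (nat \<bar>m\<bar>)) t) = 0" if m: "m : {- int n..int n}" for m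
 proof (rule trig_poly_zero[OF _ m])
  fix p
  define x :: "real^3" where "x = vector [r * cos p, r * sin p, t]"
  have x: "x $ 1 = r * cos p" "x $ 2 = r * sin p" "x $ 3 = t" by (simp_all add: x_def)
  have "norm x ^ 2 = r^2 * ((cos p)^2 + (sin p)^2) + t^2" unfolding norm_3 x power_mult_distrib by (simp only: distrib_left)
  then have "norm x ^ 2 = 1" by (simp add: r)
  then have n1: "norm x = 1" by (simp add: power2_eq_1_iff) (metis norm_ge_zero not_one_le_zero order.trans zero_le_one neg_0_le_iff_le)
  then have x0: "x ~= 0" by auto
  have "0 = solid_sum n f x" by (rule 0[OF x0, symmetric])
  also have "... = (\<Sum>m = - int n..int n. f m * cr (harm_coeff n m * r ^ nat \<bar>m\<bar> * poly (?q (nat \<bar>m\<bar>)) t) * cis (of_int m * p))"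
  unfolding solid_sum_def solid_harm_polar[OF x0 x(1,2)] n1 x(3) by (simp add: mult.assoc)
  finally show "(\<Sum>m = - int n..int n. f m * cr (harm_coeff n m * r ^ nat \<bar>m\<bar> * poly (?q (nat \<bar>m\<bar>)) t) * cis (of_int m * p)) = 0" ..
 qed
 moreover have "harm_coeff n m * r ^ nat \<bar>m\<bar> * poly (?q (nat \<bar>m\<bar>)) t ~= 0" if m: "m : {- int n..int n}" for m
 proof -
  have "nat \<bar>m\<bar> <= n" using m by auto
  then have "poly (?q (nat \<bar>m\<bar>)) t ~= 0" using t(3) by blast
  then show ?thesis using r by (simp add: harm_coeff_def)
 qed
 ultimately show False using f by (metis mult_eq_0_iff of_real_eq_0_iff)
qed

lemma solid_sum_smooth: "solid_sum n f : smooth_fns"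
 unfolding solid_sum_def[abs_def] by (intro smooth_sum smooth_fns.mult smooth_fns.const solid_harm_smooth)

lemma solid_sum_homogeneous: "c > 0 ==> solid_sum n f (c *r x) = cr c ^ n * solid_sum n f x"
 unfolding solid_sum_def sum_distrib_left by (intro sum.cong refl) (auto simp: solid_harm_homogeneous)

lemma solid_sum_harmonic:
 assumes x: "x ~= 0"
 shows "lap (solid_sum n f) x = 0"
proof -
 have d: "solid_harm n m differentiable (at x)" "pd i (solid_harm n m) differentiable (at x)" if "x ~= 0" for x m i
  using that C1_onD(1)[OF C2_onD(1)[OF smooth_C2[OF solid_harm_smooth]], of x] C1_onD(1)[OF C2_onD(2)[OF smooth_C2[OF solid_harm_smooth]], of x] by auto
 have "pd i (pd i (solid_sum n f)) x = (\<Sum>m = - int n..int n. f m * pd i (pd i (solid_harm n m)) x)" for i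
 proof -
  have "pd i (pd i (solid_sum n f)) x = pd i (%x. \<Sum>m = - int n..int n. f m * pd i (solid_harm n m) x) x"
  by (rule pd_pd[OF open_punctured]) (use x in \<open>auto simp: solid_sum_def[abs_def] pd_sum pd_mult d differentiable_mult\<close>)
  then show ?thesis using x by (simp add: pd_sum pd_mult d differentiable_mult)
 qed
 then have "lap (solid_sum n f) x = (\<Sum>m = - int n..int n. f m * lap (solid_harm n m) x)"
  unfolding lap_def by (simp add: sum_distrib_left sum.swap[of _ UNIV])
 also have "... = 0" by (intro sum.neutral ballI) (auto simp: solid_harm_harmonic x)
 finally show ?thesis .
qed

lemma incident_T_eq:
 assumes x: "x ~= 0"
 shows "incident_T k n f x = (cr (sph_bessel_j n (k * norm x)) * cr (inverse (norm x)) ^ n) *s tang (solid_sum n f) x"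
proof -
 have "ang i j (solid_sum n f) x = (\<Sum>m = - int n..int n. f m * ang i j (solid_harm n m) x)" for i j
  unfolding ang_def solid_sum_def[abs_def] using smooth_diffble[OF solid_harm_smooth x]
  by (simp add: pd_sum pd_mult differentiable_mult scaleR_sum_right sum_subtractf[symmetric] right_diff_distrib)
 then have "tang (solid_sum n f) x = (\<Sum>m = - int n..int n. f m *s tang (solid_harm n m) x)"
  by (simp add: vec_eq_iff tang_nth forall_3 sum_component)
 moreover have "incident_T k n f x = (\<Sum>m = - int n..int n. (f m * cr (sph_bessel_j n (k * norm x))) *s (cr (inverse (norm x)) ^ n *s tang (solid_harm n m) x))"
  unfolding incident_T_def by (intro sum.cong refl) (auto simp: sph_T_eq[OF x])
 ultimately show ?thesis
  by (simp add: vec_eq_iff sum_component sum_distrib_left mult_ac)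
qed

section \<open>Modes: a radial factor times a homogeneous harmonic field\<close>

lemma euler_homogeneous:
 fixes f :: "cfun"
 assumes f: "f differentiable (at x)" and h: "!!c. c > 0 ==> f (c *r x) = cr c ^ n * f x"
 shows "euler f x = of_nat n * f x"
proof -
 have "((%r. f (r *r x)) has_vector_derivative euler f x) (at 1)"
  using ray_deriv[of f 1 x] f by (simp add: has_vector_derivative_def euler_def)
 moreover have "((%r. f (r *r x)) has_vector_derivative of_nat n * f x) (at 1)"
 proof (rule has_vector_derivative_transform_within_open[of _ _ _ "{0<..}"])
  show "((%r. cr r ^ n * f x) has_vector_derivative of_nat n * f x) (at 1)"
  by (auto intro!: derivative_eq_intros has_vector_derivative_real_field simp: has_field_derivative_def)
 qed (auto simp: h)
 ultimately show ?thesis by (rule vector_derivative_unique_at)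
qed

lemma traction_nth:
 "traction lam mu y u x $ i = cr lam * (div_field u x * cr (y $ i))
  + cr mu * (SU j. (pd j u x $ i + pd i u x $ j) * cr (y $ j))"
 by (simp add: traction_def scaleR_conv_of_real[where 'a=complex] cvec_def matrix_vector_mult_def transpose_def jac_def)

text \<open>An abstraction of \<open>tang\<close> applied to a solid harmonic. Harmonicity and
  degree decide the radial equation; being solenoidal and tangential turns the Lame system and the
  interface conditions into scalar ones.\<close>

locale harmonic_field =
 fixes V :: "3 => cfun" and n :: nat
 assumes V2: "!!k. C2_on (- {0}) (V k)"
  and V_hom: "!!k c x. c > 0 ==> V k (c *r x) = cr c ^ n * V k x"
  and V_lap: "!!k x. x ~= 0 ==> lap (V k) x = 0"
  and V_div: "!!x. x ~= 0 ==> (SU j. pd j (V j) x) = 0"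
  and V_perp: "!!x. (SU j. cr (x $ j) * V j x) = 0"
begin

lemma dV: "x ~= 0 ==> V k differentiable (at x)"
 using C1_onD(1)[OF C2_onD(1)[OF V2]] by auto

lemma euler_V: "x ~= 0 ==> euler (V k) x = of_nat n * V k x"
 by (rule euler_homogeneous[OF dV V_hom])

text \<open>Homogeneity reduces the bounds to the unit sphere, where compactness applies. The
  derivative is multiplied by \<open>norm x\<close> so that the same power appears on both
  sides.\<close>

lemma V_bound: "\<exists>B>0. \<forall>k j x. x ~= 0 \<longrightarrow> cmod (V k x) <= B * norm x ^ n & norm x * cmod (pd j (V k) x) <= B * norm x ^ n"
proof -
 have b: "\<exists>B. \<forall>y\<in>sphere 0 1. cmod (f y) <= B" if "cont_on (- {0}) f" for f :: "cfun"
 proof -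
  have "compact (f ` sphere 0 1)"
  by (rule compact_continuous_image[OF continuous_on_subset[OF that]]) auto
  then show ?thesis by (meson bounded_iff compact_imp_bounded imageI)
 qed
 obtain B1 where B1: "!!k. \<forall>y\<in>sphere 0 1. cmod (V k y) <= B1 k"
  using b[OF C1_onD(3)[OF C2_onD(1)[OF V2]]] by metis
 have "\<exists>f. \<forall>k j. \<forall>y\<in>sphere 0 1. cmod (pd j (V k) y) <= f k j"
  using b[OF C1_onD(2)[OF C2_onD(1)[OF V2]]] by (intro choice allI)
 then obtain B2 where B2: "!!k j. \<forall>y\<in>sphere 0 1. cmod (pd j (V k) y) <= B2 k j" by blast
 define B where "B = 1 + (SU k. \<bar>B1 k\<bar>) + (SU k j. \<bar>B2 k j\<bar>)"
 have B: "B1 k <= B" "B2 k j <= B" "B > 0" for k j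
 proof -
  have "\<bar>B1 k\<bar> <= (SU i. \<bar>B1 i\<bar>)" by (rule member_le_sum) auto
  moreover have "\<bar>B2 k j\<bar> <= (SU j. \<bar>B2 k j\<bar>)" by (rule member_le_sum) auto
  moreover have "(SU j. \<bar>B2 k j\<bar>) <= (SU i j. \<bar>B2 i j\<bar>)"
  by (rule member_le_sum[where f="%i. SU j. \<bar>B2 i j\<bar>"]) (auto intro: sum_nonneg)
  ultimately show "B1 k <= B" "B2 k j <= B" "B > 0" unfolding B_def by linarith+
 qed
 have "cmod (V k x) <= B * norm x ^ n & norm x * cmod (pd j (V k) x) <= B * norm x ^ n" if x: "x ~= 0" for k j x
 proof
  define c where "c = inverse (norm x)"
  have c: "c > 0" "c * norm x = 1" "c *r x : sphere 0 1" "c *r x ~= 0" using x by (auto simp: c_def)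
  have cn: "norm x ^ n * c ^ n = 1" using c by (simp add: power_mult_distrib[symmetric] mult.commute)
  have "c ^ n * cmod (V k x) = cmod (V k (c *r x))" using c by (simp add: V_hom norm_mult norm_power)
  then have le: "c ^ n * cmod (V k x) <= B" using B1[of k] c(3) B(1)[of k] by (metis order_trans)
  have "cmod (V k x) = norm x ^ n * (c ^ n * cmod (V k x))" by (simp add: mult.assoc[symmetric] cn)
  also have "... <= norm x ^ n * B" by (rule mult_left_mono[OF le]) simp
  finally show "cmod (V k x) <= B * norm x ^ n" by (simp add: mult.commute)
  have "cr c * pd j (V k) (c *r x) = cr c ^ n * pd j (V k) x"
  using c by (intro pd_homogeneous V_hom dV x) auto
  from arg_cong[OF this, of cmod] have "c * cmod (pd j (V k) (c *r x)) = c ^ n * cmod (pd j (V k) x)"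
  using c by (simp add: norm_mult norm_power)
  moreover have "c * cmod (pd j (V k) (c *r x)) <= c * B"
  using B2[of j k] c(3) B(2)[of k j] c(1) by (intro mult_left_mono) (auto intro: order_trans)
  ultimately have le: "c ^ n * cmod (pd j (V k) x) <= c * B" by simp
  have "norm x * cmod (pd j (V k) x) = norm x * norm x ^ n * (c ^ n * cmod (pd j (V k) x))"
  using cn by (simp add: mult.assoc)
  also have "... <= norm x * norm x ^ n * (c * B)" by (rule mult_left_mono[OF le]) simp
  also have "... = (c * norm x) * (B * norm x ^ n)" by simp
  finally show "norm x * cmod (pd j (V k) x) <= B * norm x ^ n" using c by simp
 qed
 then show ?thesis using B(3) by blast
qed

end

text \<open>The radial factors \<open>Ps n t = j\<^sub>n(t) / t\<^sup>n\<close> and \<open>h\<^sub>n(t) / t\<^sup>n\<close> satisfy these two relations.\<close>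

locale radial_ladder =
 fixes Ps :: "nat => real => complex"
 assumes Ps_deriv: "!!n t. t > 0 ==> (Ps n has_vector_derivative - (cr t * Ps (Suc n) t)) (at t)"
  and Ps_rec: "!!n t. t > 0 ==> cr (t^2) * Ps (n + 2) t = of_nat (2 * n + 3) * Ps (n + 1) t - Ps n t"

locale mode = harmonic_field V n + radial_ladder Ps
 for V n Ps +
 fixes k :: real
 assumes k: "k > 0"
begin

definition g :: "nat => cfun" where
 "g m x = Ps m (k * norm x)"

definition W :: "3 => cfun" where
 "W i x = g n x * V i x"

lemma dg:
 assumes x: "x ~= 0"
 shows "g m differentiable (at x)" "pd i (g m) x = cr (x $ i) * (- cr (k^2) * g (Suc m) x)"
proof -
 have "((%x. k * norm x) has_derivative (%h. k * (h \<bullet> sgn x))) (at x)"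
  by (intro derivative_intros has_derivative_norm[OF x])
 from has_derivative_compose[OF this Ps_deriv[of "k * norm x" m, unfolded has_vector_derivative_def]]
 have 1: "(g m has_derivative (%h. (k * (h \<bullet> sgn x)) *r - (cr (k * norm x) * Ps (Suc m) (k * norm x)))) (at x)"
  using k x by (simp add: g_def[abs_def])
 then show "g m differentiable (at x)" by (rule differentiableI)
 have s: "axis i 1 \<bullet> sgn x = x $ i * inverse (norm x)"
  by (simp add: sgn_div_norm inner_axis' divide_inverse mult.commute)
 show "pd i (g m) x = cr (x $ i) * (- cr (k^2) * g (Suc m) x)"
  unfolding pd_eqI[OF 1] s using x by (simp add: g_def scaleR_conv_of_real power2_eq_square)
qed

lemma g2: "C2_on (- {0}) (g m)"
proof -
 have c: "cont_on (- {0}) (g m)" for m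
  by (intro continuous_at_imp_continuous_on ballI differentiable_imp_continuous_within dg(1)) auto
 have 1: "C1_on (- {0}) (g m)" for m
  by (rule C1_onI_eq[OF dg(1) dg(2)]) (auto intro!: continuous_intros c)
 show ?thesis
  by (rule C2_onI_eq[OF open_punctured 1 dg(2)]) (auto intro!: C1_intros 1)
qed

text \<open>Differentiating the radial factor twice raises its order by two; the recurrence brings
  it back to the orders \<open>m\<close> and \<open>m + 1\<close>.\<close>

lemma lap_g:
 assumes x: "x ~= 0"
 shows "lap (g m) x = cr (k^2) * (of_nat (2 * m) * g (Suc m) x - g m x)"
proof -
 have "pd i (pd i (g m)) x = - cr (k^2) * g (Suc m) x + cr (k^2) * cr (k^2) * g (Suc (Suc m)) x * (cr (x $ i) * cr (x $ i))" for i
 proof -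
  have "pd i (pd i (g m)) x = pd i (%x. cr (x $ i) * (- cr (k^2) * g (Suc m) x)) x"
  by (rule pd_pd[OF open_punctured]) (use x dg in auto)
  also have "... = - cr (k^2) * g (Suc m) x + cr (x $ i) * (- cr (k^2) * (cr (x $ i) * (- cr (k^2) * g (Suc (Suc m)) x)))"
  proof -
  have "(%x. - cr (k^2) * g (Suc m) x) differentiable (at x)"
  using dg(1)[OF x] by (intro differentiable_mult) auto
  moreover have "pd i (%x. - cr (k^2) * g (Suc m) x) x = - cr (k^2) * pd i (g (Suc m)) x"
  by (subst pd_mult) (use dg(1)[OF x] in auto)
  ultimately show ?thesis by (simp only: pd_coord_mult dg(2)[OF x]) simp
  qed
  finally show ?thesis by (simp add: mult_ac)
 qed
 then have "lap (g m) x = - 3 * (cr (k^2) * g (Suc m) x) + cr (k^2) * cr (k^2) * g (Suc (Suc m)) x * (SU i. cr (x $ i) * cr (x $ i))"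
  unfolding lap_def by (simp add: sum.distrib sum_distrib_left sum_subtractf)
 also have "... = cr (k^2) * (cr ((k * norm x)^2) * Ps (m + 2) (k * norm x) - 3 * g (Suc m) x)"
  unfolding coord_sum by (simp add: g_def power_mult_distrib ags)
 also have "... = cr (k^2) * (of_nat (2 * m) * g (Suc m) x - g m x)"
 proof -
  have "cr ((k * norm x)^2) * Ps (m + 2) (k * norm x) = of_nat (2 * m + 3) * Ps (m + 1) (k * norm x) - Ps m (k * norm x)"
  by (rule Ps_rec) (use k x in simp)
  then show ?thesis by (simp only:) (simp add: g_def ags)
 qed
 finally show ?thesis .
qed

lemma W2: "C2_on (- {0}) (W i)"
 unfolding W_def[abs_def] by (rule C2_on_mult[OF g2 V2 open_punctured])

lemma pd_W: "x ~= 0 ==> pd j (W i) x = cr (x $ j) * (- cr (k^2) * g (Suc n) x) * V i x + g n x * pd j (V i) x"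
 unfolding W_def[abs_def] by (simp add: pd_mult dg dV)

text \<open>The term \<open>2 n g (n + 1)\<close> from \<open>lap_g\<close> is cancelled by the
  cross term of the product rule, in which the Euler derivative of \<open>V i\<close> contributes
  the degree \<open>n\<close>. This is why the radial factor is paired with a field of the same
  degree.\<close>

lemma lap_W:
 assumes x: "x ~= 0"
 shows "lap (W i) x = - cr (k^2) * W i x"
proof -
 have "gdot (g n) (V i) x = - cr (k^2) * g (Suc n) x * euler (V i) x"
  by (simp add: gdot_def dg(2)[OF x] euler_def scaleR_conv_of_real sum_distrib_left sum_negf mult_ac)
 moreover have "lap (W i) x = lap (g n) x * V i x + 2 * gdot (g n) (V i) x + g n x * lap (V i) x"
  unfolding W_def[abs_def] by (rule lap_mult[OF open_punctured _ g2 V2]) (use x in auto)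
 ultimately show ?thesis unfolding lap_g[OF x] euler_V[OF x] V_lap[OF x] by (simp add: W_def ags)
qed

lemma div_W:
 assumes x: "x ~= 0"
 shows "(SU j. pd j (W j) x) = 0"
proof -
 have "(SU j. pd j (W j) x) = - cr (k^2) * g (Suc n) x * (SU j. cr (x $ j) * V j x) + g n x * (SU j. pd j (V j) x)"
  unfolding pd_W[OF x] by (simp add: sum.distrib sum_subtractf sum_distrib_left mult_ac)
 then show ?thesis unfolding V_perp V_div[OF x] by simp
qed

definition Wv :: "real^3 => complex^3" where
 "Wv x = (\<chi> i. W i x)"

lemma Wv2: "C2_on (- {0}) Wv"
 by (rule C2_on_vec[OF _ open_punctured]) (simp add: Wv_def W2)

text \<open>For a solenoidal field the Lame system reduces to the Helmholtz equation with the shear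
  wave number, for any choice of \<open>lam\<close> and \<open>mu\<close>.\<close>

lemma lame_field_W: "lame_field W lam mu (mu * k^2) (- {0})"
proof
 show "cr mu * (SU j. pd j (pd j (W i)) x) + cr (lam + mu) * pd i (%x. SU j. pd j (W j) x) x + cr (mu * k^2) * W i x = 0"
  if "x : - {0}" for x i
 proof -
  have "pd i (%x. SU j. pd j (W j) x) x = pd i (%x. 0) x"
  by (rule pd_cong_open[OF open_punctured that]) (simp add: div_W)
  then show ?thesis using lap_W[of x i] that by (simp add: lap_def)
 qed
qed (simp_all add: W2)

lemma div_Wv: "x ~= 0 ==> div_field Wv x = 0"
 using div_field_eq[OF open_punctured Wv2, of x] div_W by (simp add: Wv_def)

lemma lame_Wv:
 assumes x: "x ~= 0"
 shows "lame lam mu Wv x + (mu * k^2) *r Wv x = 0"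
proof -
 have "lame lam mu Wv x $ i = - (cr (mu * k^2) * W i x)" for i
  using lame_field.lame_eq[OF lame_field_W, of x mu i lam] x
  by (subst lame_nth[OF open_punctured Wv2]) (simp_all add: Wv_def eq_neg_iff_add_eq_0)
 then show ?thesis by (simp add: vec_eq_iff Wv_def scaleR_conv_of_real[where 'a=complex])
qed

lemma pd_Wv: "x ~= 0 ==> pd j Wv x $ i = pd j (W i) x"
 using pd_vec_nth(1)[OF open_punctured Wv2, of x] by (simp add: Wv_def)

text \<open>For a solenoidal tangential field the traction on the unit sphere is \<open>mu\<close>
  times \<open>r d/dr - 1\<close> applied to the field, the \<open>- 1\<close> coming from
  differentiating \<open>x . V = 0\<close>. Trace and traction are thus multiples of one and the
  same vector function, and the interface conditions become two scalar equations.\<close>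

lemma traction_Wv:
 assumes y: "norm y = 1"
 shows "traction lam mu y Wv y = (cr mu * ((of_nat n - 1) * Ps n k - cr (k^2) * Ps (Suc n) k)) *s (\<chi> i. V i y)"
proof -
 have y0: "y ~= 0" using y by auto
 have g: "g m y = Ps m k" for m by (simp add: g_def y)
 have "(SU j. (pd j Wv y $ i + pd i Wv y $ j) * cr (y $ j)) = ((of_nat n - 1) * Ps n k - cr (k^2) * Ps (Suc n) k) * V i y" for i
 proof -
  have 1: "(SU j. cr (y $ j) * pd j (V i) y) = of_nat n * V i y"
  using euler_V[OF y0, of i] by (simp add: euler_def scaleR_conv_of_real)
  have 2: "(SU j. cr (y $ j) * pd i (V j) y) = - V i y"
  proof -
  have "0 = pd i (%x. SU j. cr (x $ j) * V j x) y" unfolding V_perp by simp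
  also have "... = (SU j. (if i = j then V j y else 0) + cr (y $ j) * pd i (V j) y)"
  by (simp add: pd_sum pd_coord_mult dV[OF y0] differentiable_mult)
  finally show ?thesis by (simp add: sum.distrib eq_neg_iff_add_eq_0 add.commute)
  qed
  have "(SU j. (pd j Wv y $ i + pd i Wv y $ j) * cr (y $ j))
  = - cr (k^2) * Ps (Suc n) k * ((SU j. cr (y $ j) * cr (y $ j)) * V i y + cr (y $ i) * (SU j. cr (y $ j) * V j y))
  + Ps n k * ((SU j. cr (y $ j) * pd j (V i) y) + (SU j. cr (y $ j) * pd i (V j) y))"
  unfolding pd_Wv[OF y0] pd_W[OF y0] g by (simp add: sum_3) (simp add: ags)
  then show ?thesis unfolding V_perp coord_sum 1 2 y by (simp add: ags)
 qed
 then show ?thesis by (simp add: vec_eq_iff traction_nth div_Wv[OF y0] mult.assoc)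
qed

lemma Wv_limits:
 assumes y: "norm y = 1"
 shows "(Wv ---> Wv y) (at y within S)" "(jac Wv ---> jac Wv y) (at y within S)"
  "(traction lam mu y Wv ---> traction lam mu y Wv y) (at y within S)"
proof -
 have y0: "y : - {0}" using y by auto
 have c: "(f ---> f y) (at y within S)" if "cont_on (- {0}) f" for f :: "real^3 => 'b::real_normed_vector"
 proof -
  have "isCont f y" using that y0 continuous_on_eq_continuous_at[OF open_punctured] by blast
  then show ?thesis by (meson isContD tendsto_within_subset subset_UNIV)
 qed
 show "(Wv ---> Wv y) (at y within S)" by (rule c[OF C1_onD(3)[OF C2_onD(1)[OF Wv2]]])
 have p: "(pd j Wv ---> pd j Wv y) (at y within S)" for j by (rule c[OF C1_onD(2)[OF C2_onD(1)[OF Wv2]]])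
 show "(jac Wv ---> jac Wv y) (at y within S)"
  unfolding jac_def[abs_def] by (intro tendsto_vec_lambda tendsto_vec_nth p)
 have d: "(div_field Wv ---> div_field Wv y) (at y within S)"
  unfolding div_field_def[abs_def] by (intro tendsto_intros tendsto_vec_nth p)
 show "(traction lam mu y Wv ---> traction lam mu y Wv y) (at y within S)"
  by (rule vec_tendstoI) (unfold traction_nth, intro tendsto_intros tendsto_vec_nth p d)
qed

text \<open>Since curl curl acts on the mode as \<open>k^2\<close>, the shear condition compares
  \<open>k^2 W\<close> with its curl. The leading part is \<open>Ps n t - i t Ps (n + 1) t\<close>,
  assumed to be one order smaller than its two terms; the rest is of order \<open>r^-2\<close> by
  itself. The pressure condition holds because the divergence is 0.\<close>

lemma Wv_radiating:
 assumes b1: "!!t. t \<ge> T ==> cmod (Ps n t) <= C / t ^ (n + 1)"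
  and b2: "!!t. t \<ge> T ==> cmod (Ps n t - \<i> * cr t * Ps (Suc n) t) <= C / t ^ (n + 2)"
 shows "radiating kp k Wv"
proof -
 let ?z = "%x. ccross (curl (curl Wv) x) (cvec (x /\<^sub>R norm x)) - (\<i> * cr k) *s curl Wv x"
 let ?y = "%x. (SU i. cvec (x /\<^sub>R norm x) $ i * grad (div_field Wv) x $ i) - \<i> * cr kp * div_field Wv x"
 let ?x = "%r. Ps n (k * r) - \<i> * cr (k * r) * Ps (Suc n) (k * r)"
 interpret L: lame_field W 0 1 "1 * k^2" "- {0}" by (rule lame_field_W)
 have P0: "L.P x = 0" if "x ~= 0" for x unfolding L.P_def by (rule div_W[OF that])
 have w: "L.w i x = cr (k^2) * W i x" if x: "x ~= 0" for i x
 proof -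
  have "pd i L.P x = pd i (%x. 0) x" by (rule pd_cong_open[OF open_punctured]) (use x P0 in auto)
  then show ?thesis using L.lame_decomp[of x i] x by simp
 qed
 obtain B where B: "B > 0" "!!k j x. x ~= 0 ==> cmod (V k x) <= B * norm x ^ n"
  "!!k j x. x ~= 0 ==> norm x * cmod (pd j (V k) x) <= B * norm x ^ n"
  using V_bound by blast
 define C1 where "C1 = \<bar>C\<bar> / k ^ (n + 1)"
 define C2 where "C2 = \<bar>C\<bar> / k ^ (n + 2)"
 define K where "K = k^2 * (2 * B) * C2 + k * C1 * (2 * B)"
 define R where "R = max 1 (T / k)"
 have comp: "cmod ((L.w a x * cr (x $ b) - L.w b x * cr (x $ a)) / cr (norm x) - \<i> * cr k * L.S a b x) <= K / (norm x)^2"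
  if R: "R <= norm x" for a b x
 proof -
  define r where "r = norm x"
  have r: "r \<ge> 1" "k * r \<ge> T" using R k by (auto simp: R_def r_def field_simps)
  have x: "x ~= 0" using r by (auto simp: r_def)
  define X where "X = V a x * cr (x $ b) - V b x * cr (x $ a)"
  define Y where "Y = pd a (V b) x - pd b (V a) x"
  have S: "L.S a b x = g n x * Y + cr (k^2) * g (Suc n) x * X"
  unfolding L.S_def pd_W[OF x] X_def Y_def by (simp add: ags)
  have eq: "(L.w a x * cr (x $ b) - L.w b x * cr (x $ a)) / cr r - \<i> * cr k * L.S a b x
  = cr (k^2) * X * (?x r / cr r) - \<i> * cr k * (g n x * Y)"
  unfolding w[OF x] S W_def X_def using r by (simp add: g_def r_def[symmetric] field_simps power2_eq_square)
  have "cmod X <= cmod (V a x) * \<bar>x $ b\<bar> + cmod (V b x) * \<bar>x $ a\<bar>"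
  unfolding X_def using norm_triangle_ineq4[of "V a x * cr (x $ b)" "V b x * cr (x $ a)"] by (simp add: norm_mult)
  also have "... <= (B * r ^ n) * r + (B * r ^ n) * r"
  unfolding r_def using B(1) by (intro add_mono mult_mono B(2)[OF x] component_le_norm_cart) auto
  finally have X: "cmod X <= 2 * B * r ^ (n + 1)" by (simp add: mult_ac)
  have "r * cmod Y <= r * cmod (pd a (V b) x) + r * cmod (pd b (V a) x)"
  unfolding Y_def distrib_left[symmetric] using r by (intro mult_left_mono norm_triangle_ineq4) auto
  also have "... <= B * r ^ n + B * r ^ n" unfolding r_def by (intro add_mono B(3)[OF x])
  finally have Y: "r * cmod Y <= 2 * B * r ^ n" by simp
  have g: "cmod (g n x) <= C1 / r ^ (n + 1)"
  proof -
  have "cmod (g n x) <= C / (k * r) ^ (n + 1)" using b1[OF r(2)] by (simp add: g_def r_def)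
  also have "... <= \<bar>C\<bar> / (k * r) ^ (n + 1)" using k r by (intro divide_right_mono) auto
  finally show ?thesis by (simp add: C1_def power_mult_distrib mult_ac)
  qed
  have h: "cmod (?x r / cr r) <= C2 / r ^ (n + 3)"
  proof -
  have "cmod (?x r) <= C / (k * r) ^ (n + 2)" by (rule b2[OF r(2)])
  also have "... <= \<bar>C\<bar> / (k * r) ^ (n + 2)" using k r by (intro divide_right_mono) auto
  finally have "cmod (?x r) / r <= C2 / r ^ (n + 2) / r"
  using r by (intro divide_right_mono) (auto simp: C2_def power_mult_distrib mult_ac)
  then show ?thesis using r by (simp add: norm_divide eval_nat_numeral mult_ac)
  qed
  have "cmod (cr (k^2) * X * (?x r / cr r)) <= k^2 * (2 * B * r ^ (n + 1)) * (C2 / r ^ (n + 3))"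
  unfolding norm_mult using B(1) r by (intro mult_mono X h) (auto simp: norm_power C2_def)
  also have "... = k^2 * (2 * B) * C2 / r^2" using r by (simp add: power_add field_simps eval_nat_numeral)
  finally have 1: "cmod (cr (k^2) * X * (?x r / cr r)) <= k^2 * (2 * B) * C2 / r^2" .
  have "cmod (\<i> * cr k * (g n x * Y)) = k * cmod (g n x) * (r * cmod Y) / r"
  using k r by (simp add: norm_mult)
  also have "... <= k * (C1 / r ^ (n + 1)) * (2 * B * r ^ n) / r"
  using k r B(1) by (intro divide_right_mono mult_mono[OF mult_left_mono[OF g] Y]) (auto simp: C1_def)
  also have "... = k * C1 * (2 * B) / r^2" using r by (simp add: power_add field_simps eval_nat_numeral)
  finally have 2: "cmod (\<i> * cr k * (g n x * Y)) <= k * C1 * (2 * B) / r^2" .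
  have "K / r^2 = k^2 * (2 * B) * C2 / r^2 + k * C1 * (2 * B) / r^2" by (simp add: K_def add_divide_distrib)
  then show ?thesis
  unfolding r_def[symmetric] eq using norm_triangle_ineq4 1 2 by (smt (verit))
 qed
 have WW: "Wv = (%x. \<chi> i. W i x)" by (rule ext) (simp add: Wv_def)
 note c = L.curl_eq[OF WW] L.curl_curl_eq[OF WW]
 have *: "norm (?z x) <= 3 * K * norm (1 / (norm x)^2)" if R: "R <= norm x" for x
 proof -
  have x: "x : - {0}" using R by (auto simp: R_def)
  define Z where "Z = ccross (curl (curl Wv) x) (cvec (x /\<^sub>R norm x)) - (\<i> * cr k) *s curl Wv x"
  have Z: "cmod (Z $ i) <= K / (norm x)^2" for i
  using exhaust_3[of i] comp[OF R, of 2 3] comp[OF R, of 3 1] comp[OF R, of 1 2]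
  by (elim disjE) (simp_all add: Z_def ccross_def c[OF x] cvec_def divide_inverse ags)
  have "norm Z <= (SU i. cmod (Z $ i))" by (simp add: norm_vec_def L2_set_le_sum)
  also have "... <= (\<Sum>i\<in>(UNIV::3 set). K / (norm x)^2)" by (intro sum_mono Z)
  finally show ?thesis unfolding Z_def by simp
 qed
 have 1: "(%x. norm (?z x)) : O[at_infinity](%x. 1 / norm x ^ 2)"
 proof (intro landau_o.bigI[of "max 1 (3 * K)"])
  show "\<forall>\<^sub>F x in at_infinity. norm (norm (?z x)) <= max 1 (3 * K) * norm (1 / norm x ^ 2)"
  unfolding eventually_at_infinity real_norm_def abs_norm_cancel
  proof (intro exI[of _ R] allI impI)
  fix x :: "real^3" assume "R <= norm x"
  from this[THEN *] show "norm (?z x) <= max 1 (3 * K) * \<bar>1 / norm x ^ 2\<bar>"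
  unfolding real_norm_def by (rule order_trans) (intro mult_right_mono, auto)
  qed
 qed (simp add: max_def)
 have z: "(SU i. cvec (x /\<^sub>R norm x) $ i * grad (div_field Wv) x $ i) - \<i> * cr kp * div_field Wv x = 0" if x: "x ~= 0" for x
 proof -
  have "grad (div_field Wv) x $ i = pd i (%x. 0) x" for i
  unfolding grad_def using pd_cong_open[OF open_punctured, of x "div_field Wv" "%x. 0"] x div_Wv by simp
  then show ?thesis by (simp add: div_Wv[OF x])
 qed
 have "\<forall>\<^sub>F x in at_infinity. norm (?y x) = 0"
  unfolding eventually_at_infinity
 proof (intro exI[of _ 1] allI impI)
  fix x :: "real^3" assume "1 <= norm x"
  then have "x ~= 0" by auto
  then show "norm (?y x) = 0"
  by (subst z) auto
 qed
 then have 2: "(%x. norm (?y x)) : O[at_infinity](%x. 1 / norm x ^ 2)"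
  by (subst landau_o.big.in_cong[where g="%x. 0"]) auto
 show ?thesis unfolding radiating_def using 1 2 by blast
qed

end

section \<open>Harmonicity and nontriviality of the toroidal fields\<close>

lemma lap_diff:
 assumes S: "open S" "x : S" and f: "C2_on S f" and g: "C2_on S g"
 shows "lap (%x. f x - g x) x = lap f x - lap g x"
proof -
 note c = C1_onD(1)[OF C2_onD(1)[OF f]] C1_onD(1)[OF C2_onD(1)[OF g]] C1_onD(1)[OF C2_onD(2)[OF f]] C1_onD(1)[OF C2_onD(2)[OF g]]
 have "pd i (pd i (%x. f x - g x)) x = pd i (%x. pd i f x - pd i g x) x" for i
  by (rule pd_pd[OF S]) (simp add: pd_diff c)
 then show ?thesis unfolding lap_def by (simp add: pd_diff c S sum_subtractf)
qed

text \<open>Rotation derivatives commute with the Laplacian: for harmonic \<open>H\<close>, the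
  Laplacian of \<open>x_i pd j H\<close> is \<open>2 pd i (pd j H)\<close>, which is symmetric in
  \<open>i\<close> and \<open>j\<close> and cancels in \<open>ang\<close>.\<close>

lemma smooth_ang_lap:
 assumes H: "H : smooth_fns" and h: "!!x. x ~= 0 ==> lap H x = 0" and x: "x ~= 0"
 shows "C2_on (- {0}) (ang i j H)" "lap (ang i j H) x = 0"
proof -
 have p2: "C2_on (- {0}) (pd j H)" for j by (rule smooth_pd_C2[OF H])
 have X2: "C2_on (- {0}) (%x. rc (x $ i))" for i by (rule smooth_C2[OF smooth_fns.coord])
 have Xp: "C2_on (- {0}) (%x. rc (x $ i) * pd j H x)" for i j by (rule C2_on_mult[OF X2 p2 open_punctured])
 have eq: "ang i j H = (%x. rc (x $ i) * pd j H x - rc (x $ j) * pd i H x)"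
  by (simp add: ang_def[abs_def] scaleR_conv_of_real)
 show "C2_on (- {0}) (ang i j H)" unfolding eq by (rule C2_on_diff[OF Xp Xp open_punctured])
 have xS: "x : - {0}" using x by simp
 have lp: "lap (pd j H) x = 0" for j
 proof -
  have "pd i (pd i (pd j H)) x = pd j (pd i (pd i H)) x" for i
  proof -
  have "pd i (pd i (pd j H)) x = pd i (pd j (pd i H)) x"
  by (rule pd_cong_open[OF open_punctured xS], rule pd_commute[OF open_punctured smooth_C2[OF H]])
  also have "... = pd j (pd i (pd i H)) x" by (rule pd_commute[OF open_punctured p2 xS])
  finally show ?thesis .
  qed
  then have "lap (pd j H) x = (SU i. pd j (pd i (pd i H)) x)" by (simp add: lap_def)
  also have "... = pd j (lap H) x"
  unfolding lap_def[abs_def] by (rule pd_sum[symmetric]) (rule C1_onD(1)[OF C2_onD(2)[OF p2] xS])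
  also have "... = pd j (%x. 0) x" by (rule pd_cong_open[OF open_punctured xS]) (simp add: h)
  finally show ?thesis by simp
 qed
 have lX: "lap (%x. rc (x $ i) * pd j H x) x = 2 * pd i (pd j H) x" for i j
 proof -
  have "lap (%x. rc (x $ i)) x = 0"
  unfolding lap_def pd_ccoord[abs_def] by simp
  moreover have "gdot (%x. rc (x $ i)) (pd j H) x = pd i (pd j H) x"
  by (simp add: gdot_def pd_ccoord if_distrib[of "%z. z * _"] cong: if_cong)
  ultimately show ?thesis by (simp add: lap_mult[OF open_punctured xS X2 p2] lp)
 qed
 show "lap (ang i j H) x = 0"
  unfolding eq lap_diff[OF open_punctured xS Xp Xp] lX
  using pd_commute[OF open_punctured smooth_C2[OF H] xS] by simp
qed

lemma tang_harmonic_field: "harmonic_field (%i x. tang (solid_sum n f) x $ i) n"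
proof -
 define H where "H = solid_sum n f"
 have H: "H : smooth_fns" unfolding H_def by (rule solid_sum_smooth)
 have h: "lap H x = 0" if "x ~= 0" for x unfolding H_def by (rule solid_sum_harmonic[OF that])
 have hom: "H (c *r x) = cr c ^ n * H x" if "c > 0" for c x unfolding H_def by (rule solid_sum_homogeneous[OF that])
 have t: "\<exists>a b. (%x. tang H x $ i) = ang a b H" for i
  using exhaust_3[of i] tang_nth[of H] by (auto simp: fun_eq_iff)
 have pc: "pd i (pd j H) x = pd j (pd i H) x" if "x ~= 0" for i j x
  by (rule pd_commute[OF open_punctured smooth_C2[OF H]]) (use that in simp)
 show ?thesis unfolding H_def[symmetric]
 proof
  show "C2_on (- {0}) (%x. tang H x $ i)" for i
  using t[of i] smooth_ang_lap(1)[OF H h, of "axis 1 1"] by (auto simp: axis_eq_0_iff)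
  show "tang H (c *r x) $ i = cr c ^ n * tang H x $ i" if "c > 0" for i c x
  proof (cases "x = 0")
  case True
  then show ?thesis using exhaust_3[of i] by (auto simp: tang_nth ang_def)
  next
  case False
  then have "tang H (c *r x) = cr c ^ n *s tang H x"
  using that by (intro tang_homogeneous hom smooth_diffble[OF H]) auto
  then show ?thesis by simp
  qed
  show "lap (%x. tang H x $ i) x = 0" if "x ~= 0" for i x
  using t[of i] smooth_ang_lap(2)[OF H h that] by auto
  show "(SU j. cr (x $ j) * tang H x $ j) = 0" for x
  by (simp add: sum_3 tang_nth ang_def scaleR_conv_of_real ags)
  show "(SU j. pd j (%x. tang H x $ j) x) = 0" if x: "x ~= 0" for x
  proof -
  have xS: "x : - {0}" using x by simp
  show ?thesis unfolding sum_3 tang_nth pd_ang[OF smooth_C2[OF H] xS] pc[OF x, of 2 1] pc[OF x, of 3 1] pc[OF x, of 3 2] by simp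
  qed
 qed
qed

text \<open>If all rotation derivatives of \<open>H\<close> vanished, \<open>euler_euler\<close>
  would reduce to \<open>E (E H) = - E H\<close>, whereas homogeneity gives
  \<open>E H = n H\<close>. Then \<open>n (n + 1) H = 0\<close>, so \<open>H\<close> would vanish
  for \<open>n >= 1\<close>.\<close>

lemma tang_nonzero:
 assumes n: "n \<ge> 1" and f: "\<exists>m\<in>{- int n..int n}. f m ~= 0"
 shows "\<exists>x i. x ~= 0 & tang (solid_sum n f) x $ i ~= 0"
proof (rule ccontr)
 assume "\<not> ?thesis"
 then have t: "tang (solid_sum n f) x $ i = 0" if "x ~= 0" for x i using that by blast
 define H where "H = solid_sum n f"
 have H: "C2_on (- {0}) H" unfolding H_def by (rule smooth_C2[OF solid_sum_smooth])
 have a: "ang i j H x = 0" if "x ~= 0" for i j x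
  using t[OF that, folded H_def, of 1] t[OF that, folded H_def, of 2] t[OF that, folded H_def, of 3] exhaust_3[of i] exhaust_3[of j]
  unfolding tang_nth by (auto simp: ang_def)
 obtain x where x: "x ~= 0" "H x ~= 0" using solid_sum_nonzero[OF f] by (auto simp: H_def)
 have xS: "x : - {0}" using x by simp
 have E: "euler H x = of_nat n * H x" if "x ~= 0" for x
  by (rule euler_homogeneous[OF C1_onD(1)[OF C2_onD(1)[OF H]]]) (use that in \<open>auto simp: H_def solid_sum_homogeneous\<close>)
 have "pd j (ang i k H) x = 0" for i j k
  using pd_cong_open[OF open_punctured xS, of "ang i k H" "%x. 0" j] a by simp
 then have aa: "ang i j (ang i j H) x = 0" for i j by (simp add: ang_def[of i j "ang i j H"])
 have "euler (euler H) x = (SU i. (x $ i) *r pd i (%x. of_nat n * H x) x)"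
  unfolding euler_def[of "euler H"] by (intro sum.cong refl arg_cong[of _ _ "scaleR _"] pd_cong_open[OF open_punctured xS]) (simp add: E)
 also have "... = of_nat n * euler H x"
  using C1_onD(1)[OF C2_onD(1)[OF H] xS] by (simp add: pd_mult euler_def sum_distrib_left)
 finally have "of_nat n * (of_nat n * H x) = - (of_nat n * H x)"
  using euler_euler[OF open_punctured H xS] solid_sum_harmonic[OF x(1), of n f] unfolding E[OF x(1)] aa H_def[symmetric] lap_def by simp
 then have "of_nat n * (of_nat n + 1) * H x = (0::complex)" by (simp add: ags)
 moreover have "of_nat n + 1 ~= (0::complex)" by (metis of_nat_Suc of_nat_neq_0 add.commute)
 ultimately show False using x n by simp
qed

section \<open>Spherical Bessel functions near the origin\<close>

definition bessel_coeff :: "nat => nat => real" where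
 "bessel_coeff n p = (- 1) ^ p / (2 ^ p * fact p * (\<Prod>i\<le>n + p. 2 * real i + 1))"

text \<open>\<open>j_n(t) / t^n\<close> as an entire function of \<open>s = t^2\<close>.\<close>

definition bser :: "nat => real => real" where
 "bser n s = (\<Sum>p. bessel_coeff n p * s ^ p)"

definition dfact :: "nat => real" where
 "dfact n = (\<Prod>i\<le>n. 2 * real i + 1)"

lemma dfact_pos: "dfact n > 0" and dfact_Suc: "dfact (Suc n) = (2 * real n + 3) * dfact n"
 by (auto simp: dfact_def ags intro!: prod_pos)

text \<open>Multiplication by the double factorial makes the bound independent of \<open>n\<close>,
  because \<open>dfact\<close> is increasing. The uniformity in \<open>n\<close> of all interior
  estimates rests on this.\<close>

lemma bessel_coeff_bound: "\<bar>dfact n * bessel_coeff n p\<bar> <= (1 / 2) ^ p * (1 / fact p)"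
proof -
 have "dfact n <= dfact (n + p)"
 proof (induction p)
  case (Suc p)
  have "1 * dfact (n + p) <= (2 * real (n + p) + 3) * dfact (n + p)"
  by (rule mult_right_mono) (use dfact_pos[of "n + p"] in auto)
  with Suc show ?case by (simp add: dfact_Suc)
 qed simp
 then have "dfact n / dfact (n + p) <= 1" using dfact_pos[of "n + p"] by simp
 then have "(1 / 2) ^ p * (1 / fact p) * (dfact n / dfact (n + p)) <= (1 / 2) ^ p * (1 / fact p) * 1"
  by (intro mult_left_mono) auto
 moreover have "\<bar>dfact n * bessel_coeff n p\<bar> = (1 / 2) ^ p * (1 / fact p) * (dfact n / dfact (n + p))"
  using dfact_pos[of n] dfact_pos[of "n + p"]
  unfolding bessel_coeff_def dfact_def[symmetric] by (simp add: abs_mult power_abs power_divide)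
 ultimately show ?thesis by simp
qed

lemma bessel_summable: "summable (%p. bessel_coeff n p * s ^ p)"
proof -
 have "summable (%p. dfact n * (bessel_coeff n p * s ^ p))"
 proof (rule summable_comparison_test'[where N=0, OF summable_exp[of "\<bar>s\<bar> / 2"]])
  fix p
  have "norm (dfact n * (bessel_coeff n p * s ^ p)) = \<bar>dfact n * bessel_coeff n p\<bar> * \<bar>s\<bar> ^ p" by (simp add: abs_mult power_abs)
  also have "... <= (1 / 2) ^ p * (1 / fact p) * \<bar>s\<bar> ^ p" by (intro mult_right_mono bessel_coeff_bound) simp
  also have "... = inverse (fact p) * (\<bar>s\<bar> / 2) ^ p" by (simp add: power_divide field_simps)
  finally show "norm (dfact n * (bessel_coeff n p * s ^ p)) <= inverse (fact p) * (\<bar>s\<bar> / 2) ^ p" .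
 qed
 then show ?thesis using dfact_pos[of n] by (simp add: summable_cmult_iff)
qed

text \<open>The factor \<open>- 1 / 2\<close> belongs to the variable \<open>s = t^2\<close>; in the
  variable \<open>t\<close> it becomes the \<open>- t\<close> of
  \<open>radial_ladder\<close>.\<close>

lemma bser_deriv: "(bser n has_real_derivative - (1 / 2) * bser (Suc n) s) (at s)"
proof -
 have "diffs (bessel_coeff n) p = - (1 / 2) * bessel_coeff (Suc n) p" for p
 proof -
  have "x * (a / (2 * b * (x * c) * d)) = (1 / 2) * (a / (b * c * d))" if "x ~= 0" for x a b c d :: real
  using that by simp
  from this[of "real (Suc p)" "- ((- 1) ^ p)" "2 ^ p" "fact p" "dfact (Suc n + p)"]
  show ?thesis unfolding diffs_def bessel_coeff_def dfact_def[symmetric] by simp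
 qed
 then have "(\<Sum>p. diffs (bessel_coeff n) p * s ^ p) = - (1 / 2) * bser (Suc n) s"
  unfolding bser_def using suminf_mult[OF bessel_summable, of "- (1 / 2)" "Suc n" s] by (simp add: mult.assoc)
 then show ?thesis
  using termdiffs_strong_converges_everywhere[OF bessel_summable, of n s] unfolding bser_def[abs_def] by simp
qed

text \<open>Comparison of coefficients: on the right the constant terms cancel, which accounts for
  the factor \<open>s\<close> on the left.\<close>

lemma bser_rec: "s * bser (n + 2) s = (2 * real n + 3) * bser (n + 1) s - bser n s"
proof -
 let ?c = "%p. (2 * real n + 3) * bessel_coeff (n + 1) p - bessel_coeff n p"
 have 0: "?c 0 = 0"
  using dfact_pos[of n] unfolding bessel_coeff_def by (simp add: dfact_def[symmetric] dfact_Suc)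
 have S: "?c (Suc p) = bessel_coeff (n + 2) p" for p
 proof -
  define d q where "d = dfact (n + p)" and "q = real n + real p"
  have d: "d > 0" "q \<ge> 0" by (simp_all add: d_def q_def dfact_pos)
  have e: "bessel_coeff (n + 1) (Suc p) = - ((- 1) ^ p) / (2 * 2 ^ p * (real (Suc p) * fact p) * ((2 * q + 5) * ((2 * q + 3) * d)))"
  "bessel_coeff n (Suc p) = - ((- 1) ^ p) / (2 * 2 ^ p * (real (Suc p) * fact p) * ((2 * q + 3) * d))"
  "bessel_coeff (n + 2) p = (- 1) ^ p / (2 ^ p * fact p * ((2 * q + 5) * ((2 * q + 3) * d)))"
  unfolding bessel_coeff_def dfact_def[symmetric] d_def q_def by (simp_all add: dfact_Suc ags)
  define f where "f = (2::real) ^ p * fact p"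
  have f: "f > 0" by (simp add: f_def)
  have "(2 * real n + 3) - (2 * q + 5) = - (2 * real (Suc p))" by (simp add: q_def)
  then show ?thesis unfolding e using d f
  by (simp add: divide_simps f_def[symmetric]) (simp add: q_def f_def ags)
 qed
 have sm: "summable (%p. ?c p * s ^ p)"
  using summable_diff[OF summable_mult[OF bessel_summable[of "n + 1" s], of "2 * real n + 3"] bessel_summable[of n s]]
  by (simp add: ags)
 have "(2 * real n + 3) * bser (n + 1) s - bser n s = (\<Sum>p. ?c p * s ^ p)"
  unfolding bser_def
  by (subst suminf_mult[symmetric, OF bessel_summable], subst suminf_diff[OF summable_mult[OF bessel_summable] bessel_summable])
  (simp add: ags)
 also have "... = (\<Sum>p. ?c (Suc p) * s ^ Suc p)"
  using suminf_split_head[OF sm] 0 by simp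
 also have "... = (\<Sum>p. s * (bessel_coeff (n + 2) p * s ^ p))" unfolding S by (simp add: mult_ac)
 also have "... = s * bser (n + 2) s" unfolding bser_def by (rule suminf_mult[OF bessel_summable])
 finally show ?thesis ..
qed

text \<open>After normalisation the constant term is 1, and the later terms are dominated by a
  geometric series with sum \<open>s\<close>, whatever \<open>n\<close> is.\<close>

lemma bser_bound:
 assumes s: "0 <= s" "s <= 1"
 shows "\<bar>dfact n * bser n s - 1\<bar> <= s"
proof -
 have 0: "dfact n * bessel_coeff n 0 = 1" using dfact_pos[of n] by (simp add: bessel_coeff_def dfact_def)
 have sm: "summable (%p. dfact n * (bessel_coeff n p * s ^ p))" by (rule summable_mult[OF bessel_summable])
 have le: "norm (dfact n * (bessel_coeff n (Suc p) * s ^ Suc p)) <= s / 2 * (1 / 2) ^ p" for p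
 proof -
  have "norm (dfact n * (bessel_coeff n (Suc p) * s ^ Suc p)) = \<bar>dfact n * bessel_coeff n (Suc p)\<bar> * s ^ Suc p"
  using s by (simp add: abs_mult)
  also have "... <= (1 / 2) ^ Suc p * (1 / fact (Suc p)) * (s * 1)"
  using s by (intro mult_mono bessel_coeff_bound) (auto simp: power_le_one mult_left_le)
  also have "... <= (1 / 2) ^ Suc p * 1 * (s * 1)"
  proof -
  have "1 / fact (Suc p) <= (1::real)" using fact_ge_1[of "Suc p", where 'a=real] by (simp del: fact_Suc)
  then show ?thesis using s by (intro mult_right_mono mult_left_mono) auto
  qed
  finally show ?thesis by (simp add: mult_ac)
 qed
 have g: "(%p. s / 2 * (1 / 2) ^ p) sums (s / 2 * 2)"
  using sums_mult[OF geometric_sums[of "1 / 2 :: real"], of "s / 2"] by simp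
 have "dfact n * bser n s - 1 = (\<Sum>p. dfact n * (bessel_coeff n (Suc p) * s ^ Suc p))"
  unfolding bser_def suminf_mult[OF bessel_summable, symmetric] using suminf_split_head[OF sm] 0 by simp
 also have "\<bar>...\<bar> <= (\<Sum>p. s / 2 * (1 / 2) ^ p)"
  using norm_suminf_le[OF le sums_summable[OF g]] by simp
 also have "... = s" using sums_unique[OF g] by simp
 finally show ?thesis .
qed

lemma sph_bessel_j_eq: "sph_bessel_j n t = t ^ n * bser n (t^2)"
proof -
 have "sph_bessel_j n t = (\<Sum>p. t ^ n * (bessel_coeff n p * (t^2) ^ p))"
  unfolding sph_bessel_j_def bessel_coeff_def by (simp only: power_add power_mult) (simp add: mult_ac)
 then show ?thesis unfolding bser_def suminf_mult[OF bessel_summable] .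
qed

lemma radial_ladder_bessel: "radial_ladder (%n t. a * cr (bser n (t^2)))"
proof
 fix n and t :: real
 have "((%t. bser n (t^2)) has_real_derivative - (1 / 2) * bser (Suc n) (t^2) * (2 * t)) (at t)"
  by (rule DERIV_chain2[OF bser_deriv]) (auto intro!: derivative_eq_intros)
 then have "((%t. a * cr (bser n (t^2))) has_vector_derivative a * cr (- (1 / 2) * bser (Suc n) (t^2) * (2 * t))) (at t)"
  by (intro has_vector_derivative_mult_right has_vector_derivative_of_real) (simp add: has_real_derivative_iff_has_vector_derivative)
 then show "((%t. a * cr (bser n (t^2))) has_vector_derivative - (cr t * (a * cr (bser (Suc n) (t^2))))) (at t)"
  by (simp add: mult_ac)
 have "rc (t^2 * bser (n + 2) (t^2)) = cr ((2 * real n + 3) * bser (n + 1) (t^2) - bser n (t^2))"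
  unfolding bser_rec ..
 then have "a * (rc (t^2) * cr (bser (n + 2) (t^2))) = a * (of_nat (2 * n + 3) * cr (bser (n + 1) (t^2)) - cr (bser n (t^2)))"
  by simp
 then show "cr (t^2) * (a * cr (bser (n + 2) (t^2))) = of_nat (2 * n + 3) * (a * cr (bser (n + 1) (t^2))) - a * cr (bser n (t^2))"
  by (simp add: ags)
qed

section \<open>Outgoing spherical Hankel functions\<close>

fun hankel_poly :: "nat => real => complex" where
 "hankel_poly 0 t = 1"
| "hankel_poly (Suc 0) t = 1 - \<i> * cr t"
| "hankel_poly (Suc (Suc n)) t = of_nat (2 * n + 3) * hankel_poly (Suc n) t - cr (t^2) * hankel_poly n t"

text \<open>Up to the constant factor \<open>i\<close> this is the outgoing spherical Hankel
  function divided by \<open>t^n\<close>; \<open>hankel_poly n t\<close> is the reverse Bessel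
  polynomial of degree \<open>n\<close> at \<open>- i t\<close>.\<close>

definition hankel :: "nat => real => complex" where
 "hankel n t = cis t * hankel_poly n t / cr t ^ (2 * n + 1)"

lemma hankel_rec:
 assumes "t > 0"
 shows "cr (t^2) * hankel (n + 2) t = of_nat (2 * n + 3) * hankel (n + 1) t - hankel n t"
proof -
 define z where "z = rc t"
 have z: "z ~= 0" using assms by (simp add: z_def)
 have "z^2 * (cis t * q / (z ^ 4 * w)) = cis t * q / (z^2 * w)" for q w using z by (simp add: field_simps eval_nat_numeral)
 then show ?thesis
  using z by (simp add: hankel_def z_def[symmetric] power_add eval_nat_numeral) (simp add: field_simps)
qed

text \<open>The recurrence has depth two, so two consecutive orders are carried through the
  induction; the next one is differentiated through its expression by the two preceding.\<close>

lemma hankel_deriv: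
 assumes t: "t > 0"
 shows "(hankel n has_vector_derivative - (cr t * hankel (Suc n) t)) (at t)"
proof -
 have cis: "(cis has_vector_derivative \<i> * cis t) (at t)" for t
  unfolding cis_conv_exp[abs_def]
  by (rule has_vector_derivative_real_field[where f="%z. exp (\<i> * z)"]) (auto intro!: derivative_eq_intros)
 have id: "(rc has_vector_derivative 1) (at t)" for t
  using has_vector_derivative_of_real[OF DERIV_ident] by simp
 have quot: "((%t. u t / cr t ^ k) has_vector_derivative (u' - of_nat k * u t / cr t) / cr t ^ k) (at t)"
  if "t > 0" and u: "(u has_vector_derivative u') (at t)" for u :: "real => complex" and u' t k
 proof -
  have "((%t. u t * inverse (rc t ^ k)) has_vector_derivative (u' - of_nat k * u t / cr t) / cr t ^ k) (at t)"
  proof -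
  have "((%z. inverse (z ^ k)) has_field_derivative - (of_nat k * inverse (z ^ Suc k))) (at z)" if "z ~= 0" for z :: complex

  proof -
  have "((%z. inverse (z ^ k)) has_field_derivative - (inverse (z ^ k) * (of_nat k * (1 * z ^ (k - Suc 0))) * inverse (z ^ k))) (at z)"
  by (rule DERIV_inverse'[OF DERIV_power[OF DERIV_ident]]) (use that in simp)
  moreover have "inverse (z ^ k) * (of_nat k * (1 * z ^ (k - Suc 0))) * inverse (z ^ k) = of_nat k * inverse (z ^ Suc k)"
  using that by (cases k) (auto simp: field_simps)
  ultimately show ?thesis by (simp only:)
  qed
  from has_vector_derivative_mult[OF u has_vector_derivative_real_field[OF this[of "cr t"]]] show ?thesis
  using `t > 0` by (simp add: field_simps)
  qed
  then show ?thesis by (simp add: divide_inverse)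
 qed
 have "(hankel n has_vector_derivative - (cr t * hankel (Suc n) t)) (at t) &
  (hankel (Suc n) has_vector_derivative - (cr t * hankel (Suc (Suc n)) t)) (at t)" if "t > 0" for t
  using that
 proof (induction n arbitrary: t)
  case 0
  define z where "z = rc t"
  have z: "z ~= 0" using 0 by (simp add: z_def)
  have "((%t. cis t * (1 - \<i> * cr t)) has_vector_derivative cis t * (0 - \<i> * 1) + \<i> * cis t * (1 - \<i> * cr t)) (at t)"
  by (intro has_vector_derivative_mult has_vector_derivative_diff has_vector_derivative_const has_vector_derivative_mult_right cis id)
  then have p: "((%t. cis t * (1 - \<i> * cr t)) has_vector_derivative z * cis t) (at t)"
  by (simp add: z_def ags)
  have "(\<i> * cis t - of_nat 1 * cis t / z) / z ^ 1 = - (z * hankel 1 t)"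
  "(z * cis t - of_nat 3 * (cis t * (1 - \<i> * z)) / z) / z ^ 3 = - (z * hankel 2 t)"
  using z by (simp_all add: hankel_def z_def[symmetric] eval_nat_numeral field_simps)
  moreover have "hankel 0 = (%t. cis t / cr t ^ 1)" "hankel (Suc 0) = (%t. cis t * (1 - \<i> * cr t) / cr t ^ 3)"
  by (simp_all add: fun_eq_iff hankel_def eval_nat_numeral)
  ultimately show ?case
  using quot[OF 0 cis, of 1] quot[OF 0 p, of 3] unfolding z_def[symmetric] numeral_2_eq_2 by simp
 next
  case (Suc n)
  have "((%t. (of_nat (2 * n + 3) * hankel (n + 1) t - hankel n t) / cr t ^ 2) has_vector_derivative
  ((of_nat (2 * n + 3) * - (cr t * hankel (n + 2) t) - - (cr t * hankel (n + 1) t)) - of_nat 2 * (of_nat (2 * n + 3) * hankel (n + 1) t - hankel n t) / cr t) / cr t ^ 2) (at t)"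
  using Suc.IH[OF Suc.prems] Suc.prems
  by (intro quot has_vector_derivative_diff has_vector_derivative_mult_right) simp_all
  moreover have "((of_nat (2 * n + 3) * - (cr t * hankel (n + 2) t) - - (cr t * hankel (n + 1) t)) - of_nat 2 * (of_nat (2 * n + 3) * hankel (n + 1) t - hankel n t) / cr t) / cr t ^ 2
  = - (cr t * hankel (n + 3) t)"
  proof -
  define z where "z = rc t"
  have z: "z ~= 0" using Suc.prems by (simp add: z_def)
  have 0: "of_nat (2 * n + 3) * hankel (n + 1) t - hankel n t = z^2 * hankel (n + 2) t"
  using hankel_rec[OF Suc.prems, of n] by (simp add: z_def)
  have 1: "hankel (n + 1) t = (of_nat (2 * n + 3) + 2) * hankel (n + 2) t - z^2 * hankel (n + 3) t"
  using hankel_rec[OF Suc.prems, of "n + 1"] by (simp add: z_def ags eval_nat_numeral)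
  show ?thesis unfolding 0 z_def[symmetric] unfolding 1 using z by (simp add: field_simps power2_eq_square)
  qed
  ultimately have "((%t. (of_nat (2 * n + 3) * hankel (n + 1) t - hankel n t) / cr t ^ 2) has_vector_derivative - (cr t * hankel (n + 3) t)) (at t)"
  by simp
  then have "(hankel (n + 2) has_vector_derivative - (cr t * hankel (n + 3) t)) (at t)"
  by (rule has_vector_derivative_transform_within_open[of _ _ _ "{0<..}"])
  (use Suc.prems hankel_rec[of _ n] in \<open>auto simp: field_simps\<close>)
  then show ?case using Suc.IH[OF Suc.prems] by (simp add: eval_nat_numeral)
 qed
 then show ?thesis using t by blast
qed

text \<open>\<open>hankel_poly n\<close> grows like \<open>t^n\<close>, and \<open>?d n\<close>
  could be expected to grow like \<open>t^(n + 1)\<close>, but its leading terms cancel. This gain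
  of one order is the radiation condition for the mode.\<close>

lemma hankel_bounds:
 "\<exists>C. \<forall>t\<ge>1. cmod (hankel n t) <= C / t ^ (n + 1) & cmod (hankel n t - \<i> * cr t * hankel (Suc n) t) <= C / t ^ (n + 2)"
proof -
 let ?d = "%n t. cr t * hankel_poly n t - \<i> * hankel_poly (Suc n) t"
 have "\<exists>C\<ge>0. \<forall>t\<ge>1. cmod (hankel_poly n t) <= C * t ^ n & cmod (hankel_poly (Suc n) t) <= C * t ^ Suc n & cmod (?d n t) <= C * t ^ n"
 proof (induction n)
  case 0
  have "cmod (1 - \<i> * cr t) <= 2 * t" if "t \<ge> 1" for t
  using that norm_triangle_ineq4[of 1 "\<i> * cr t"] by (simp add: norm_mult)
  moreover have "?d 0 t = - \<i>" for t by (simp add: ags)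
  ultimately show ?case by (intro exI[of _ 2]) auto
 next
  case (Suc n)
  then obtain C where C: "C \<ge> 0" "!!t. t \<ge> 1 ==> cmod (hankel_poly n t) <= C * t ^ n" "!!t. t \<ge> 1 ==> cmod (hankel_poly (Suc n) t) <= C * t ^ Suc n" "!!t. t \<ge> 1 ==> cmod (?d n t) <= C * t ^ n"
  by blast
  define K where "K = (2 * real n + 4) * C"
  have K: "C <= K" "0 <= K" using C(1) by (simp_all add: K_def mult_right_mono[of 1 "2 * real n + 4" C, simplified])
  have 1: "cmod (hankel_poly (Suc (Suc n)) t) <= K * t ^ Suc (Suc n)" "cmod (?d (Suc n) t) <= K * t ^ Suc n" if t: "t \<ge> 1" for t
  proof -
  have a: "cmod (of_nat (2 * n + 3) * hankel_poly (Suc n) t) <= (2 * real n + 3) * (C * t ^ Suc n)"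
  unfolding norm_mult norm_of_nat using C(3)[OF t] by (intro mult_mono) auto
  have "cmod (cr (t^2) * hankel_poly n t) <= t^2 * (C * t ^ n)"
  unfolding norm_mult using C(2)[OF t] t by (intro mult_mono) (auto simp: norm_power)
  moreover have "t ^ Suc n <= t ^ Suc (Suc n)" using t by (intro power_increasing) auto
  then have "(2 * real n + 3) * (C * t ^ Suc n) <= (2 * real n + 3) * (C * t ^ Suc (Suc n))"
  using C(1) by (intro mult_left_mono) auto
  ultimately show "cmod (hankel_poly (Suc (Suc n)) t) <= K * t ^ Suc (Suc n)"
  using a norm_triangle_ineq4[of "of_nat (2 * n + 3) * hankel_poly (Suc n) t" "cr (t^2) * hankel_poly n t"]
  by (simp add: K_def ags power2_eq_square)
  have "?d (Suc n) t = \<i> * (cr t * ?d n t - of_nat (2 * n + 3) * hankel_poly (Suc n) t)"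
  by (simp add: ags power2_eq_square)
  also have "cmod ... <= cmod (cr t * ?d n t) + cmod (of_nat (2 * n + 3) * hankel_poly (Suc n) t)"
  unfolding norm_mult[of \<i>] by (simp only: norm_ii mult_1 norm_triangle_ineq4)
  also have "... <= t * (C * t ^ n) + (2 * real n + 3) * (C * t ^ Suc n)"
  using a C(4)[OF t] t by (intro add_mono) (auto simp: norm_mult intro!: mult_left_mono)
  finally show "cmod (?d (Suc n) t) <= K * t ^ Suc n" by (simp add: K_def ags)
  qed
  have "cmod (hankel_poly (Suc n) t) <= K * t ^ Suc n" if "t \<ge> 1" for t
  using C(3)[OF that] K(1) that by (meson order_trans mult_right_mono zero_le_power zero_le_one)
  with 1 K(2) show ?case by blast
 qed
 then obtain C where C: "!!t. t \<ge> 1 ==> cmod (hankel_poly n t) <= C * t ^ n" "!!t. t \<ge> 1 ==> cmod (?d n t) <= C * t ^ n"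
  by blast
 have "cmod (hankel n t) <= C / t ^ (n + 1) & cmod (hankel n t - \<i> * cr t * hankel (Suc n) t) <= C / t ^ (n + 2)" if t: "t \<ge> 1" for t
 proof
  have p: "t ^ (2 * n + 1) = t ^ n * t ^ (n + 1)" "t ^ (2 * n + 2) = t ^ n * t ^ (n + 2)" by (simp_all add: mult_2 power_add)
  have "cmod (hankel n t) = cmod (hankel_poly n t) / t ^ (2 * n + 1)"
  using t by (simp add: hankel_def norm_mult norm_divide norm_power)
  also have "... <= C * t ^ n / t ^ (2 * n + 1)" using t by (intro divide_right_mono C) auto
  finally show "cmod (hankel n t) <= C / t ^ (n + 1)" using t unfolding p(1) by simp
  have "hankel n t - \<i> * cr t * hankel (Suc n) t = cis t * ?d n t / cr t ^ (2 * n + 2)"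
  using t by (simp add: hankel_def field_simps)
  then have "cmod (hankel n t - \<i> * cr t * hankel (Suc n) t) = cmod (?d n t) / t ^ (2 * n + 2)"
  using t by (simp add: norm_mult norm_divide norm_power)
  also have "... <= C * t ^ n / t ^ (2 * n + 2)" using t by (intro divide_right_mono C) auto
  finally show "cmod (hankel n t - \<i> * cr t * hankel (Suc n) t) <= C / t ^ (n + 2)" using t unfolding p(2) by simp
 qed
 then show ?thesis by blast
qed

text \<open>The divisor \<open>(2 n - 1)!!\<close> is the value of \<open>hankel_poly n\<close> at
  0, so the normalised function equals 1 there.\<close>

definition hankel_norm :: "nat => real => complex" where
 "hankel_norm n t = hankel_poly n t / cr (\<Prod>i<n. 2 * real i + 1)"

lemma hankel_norm_Suc: "hankel_norm (Suc (Suc n)) t = hankel_norm (Suc n) t - cr (t^2 / ((2 * real n + 3) * (2 * real n + 1))) * hankel_norm n t"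
proof -
 define d where "d = rc (\<Prod>i<n. 2 * real i + 1)"
 define a b where "a = rc (2 * real n + 1)" and "b = rc (2 * real n + 3)"
 have "(\<Prod>i<n. 2 * real i + 1) > 0" by (intro prod_pos) auto
 then have d: "d ~= 0" unfolding d_def of_real_eq_0_iff by linarith
 have ab: "a ~= 0" "b ~= 0" unfolding a_def b_def of_real_eq_0_iff by linarith+
 have "hankel_norm (Suc (Suc n)) t = (b * hankel_poly (Suc n) t - cr (t^2) * hankel_poly n t) / (d * a * b)"
  unfolding hankel_norm_def d_def a_def b_def by (simp add: add.commute)
 moreover have "hankel_norm (Suc n) t = hankel_poly (Suc n) t / (d * a)" unfolding hankel_norm_def d_def a_def by simp
 moreover have "hankel_norm n t = hankel_poly n t / d" unfolding hankel_norm_def d_def ..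
 moreover have "rc (t^2 / ((2 * real n + 3) * (2 * real n + 1))) = cr (t^2) / (b * a)"
  unfolding a_def b_def by (simp only: of_real_divide of_real_mult)
 ultimately show ?thesis using d ab by (simp only:) (simp add: field_simps)
qed

text \<open>By the recurrence each order adds an error of at most
  \<open>2 t^2 / ((2 n + 1) (2 n + 3))\<close>, a telescoping sum that stays below
  \<open>t^2\<close>. All orders from 1 on therefore lie within \<open>t^2\<close> of
  \<open>1 - i t\<close>, whose modulus is between 1 and \<open>1 + t^2\<close>.\<close>

lemma hankel_norm_bound:
 assumes t: "0 <= t" "t <= 1 / 2"
 shows "1 - t^2 <= cmod (hankel_norm n t)" "cmod (hankel_norm n t) <= 1 + 2 * t^2" "cmod (hankel_norm n t) <= 2"
proof -
 have tt: "t^2 <= 1 / 4" using power_mono[OF t(2) t(1), of 2] by (simp add: power2_eq_square)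
 let ?z = "1 - \<i> * rc t"
 have z: "1 <= cmod ?z" "cmod ?z <= 1 + t^2"
 proof -
  have "(cmod ?z)^2 = 1 + t^2" by (simp add: cmod_power2)
  moreover have "1 + s <= (1 + s)^2" if "s \<ge> 0" for s :: real using that by (simp add: power2_eq_square ags)
  ultimately show "1 <= cmod ?z" "cmod ?z <= 1 + t^2" by (auto intro!: power2_le_imp_le[of 1] power2_le_imp_le[of "cmod ?z"])
 qed
 have b2: "cmod w <= 2" if "cmod (w - ?z) <= t^2" for w
  using norm_triangle_ineq[of "w - ?z" ?z] that z tt by simp
 have main: "cmod (hankel_norm (Suc n) t - ?z) <= t^2 * (1 - 1 / (2 * real n + 1)) & cmod (hankel_norm n t) <= 2" for n
 proof (induction n)
  case (Suc n)
  have l: "t^2 * (1 - 1 / (2 * real n + 1)) <= t^2 * 1" by (intro mult_left_mono) auto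
  have "cmod (hankel_norm (Suc (Suc n)) t - ?z) <= cmod (hankel_norm (Suc n) t - ?z) + cmod (cr (t^2 / ((2 * real n + 3) * (2 * real n + 1))) * hankel_norm n t)"
  proof -
  have "hankel_norm (Suc (Suc n)) t - ?z = hankel_norm (Suc n) t - ?z - cr (t^2 / ((2 * real n + 3) * (2 * real n + 1))) * hankel_norm n t"
  unfolding hankel_norm_Suc by simp
  then show ?thesis by (simp only: norm_triangle_ineq4)
  qed
  also have "... <= t^2 * (1 - 1 / (2 * real n + 1)) + t^2 / ((2 * real n + 3) * (2 * real n + 1)) * 2"
  using Suc unfolding norm_mult norm_of_real by (intro add_mono mult_mono) auto
  also have "... = t^2 * (1 - 1 / (2 * real (Suc n) + 1))"
  by (simp add: divide_simps) (simp add: ags)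
  finally show ?case using b2[of "hankel_norm (Suc n) t"] Suc l by auto
 qed (simp add: hankel_norm_def)
 show "cmod (hankel_norm n t) <= 2" using main by blast
 have "1 - t^2 <= cmod (hankel_norm n t) & cmod (hankel_norm n t) <= 1 + 2 * t^2"
 proof (cases n)
  case (Suc m)
  have "t^2 * (1 - 1 / (2 * real m + 1)) <= t^2 * 1" by (intro mult_left_mono) auto
  with main[of m] have "cmod (hankel_norm n t - ?z) <= t^2" unfolding Suc by linarith
  then show ?thesis using z norm_triangle_ineq2[of ?z "hankel_norm n t"] norm_triangle_ineq2[of "hankel_norm n t" ?z]
  by (simp add: norm_minus_commute)
 qed (simp add: hankel_norm_def)
 then show "1 - t^2 <= cmod (hankel_norm n t)" "cmod (hankel_norm n t) <= 1 + 2 * t^2" by auto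
qed

lemma radial_ladder_hankel: "radial_ladder (%n t. b * hankel n t)"
proof
 show "((%t. b * hankel n t) has_vector_derivative - (cr t * (b * hankel (Suc n) t))) (at t)" if "t > 0" for n t
  using has_vector_derivative_mult_right[OF hankel_deriv[OF that], of b n] by (simp add: mult_ac)
 show "cr (t^2) * (b * hankel (n + 2) t) = of_nat (2 * n + 3) * (b * hankel (n + 1) t) - b * hankel n t" if "t > 0" for n t
  using arg_cong[OF hankel_rec[OF that, of n], of "%z. b * z"] by (simp add: ags)
qed

lemma radial_ladder_add:
 assumes "radial_ladder \<Phi>" "radial_ladder Ps"
 shows "radial_ladder (%n t. \<Phi> n t + Ps n t)"
proof
 interpret A: radial_ladder \<Phi> by fact
 interpret B: radial_ladder Ps by fact
 show "((%t. \<Phi> n t + Ps n t) has_vector_derivative - (cr t * (\<Phi> (Suc n) t + Ps (Suc n) t))) (at t)" if "t > 0" for n t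
  using has_vector_derivative_add[OF A.Ps_deriv[OF that] B.Ps_deriv[OF that], of n n] by (simp add: ags)
 show "cr (t^2) * (\<Phi> (n + 2) t + Ps (n + 2) t) = of_nat (2 * n + 3) * (\<Phi> (n + 1) t + Ps (n + 1) t) - (\<Phi> n t + Ps n t)" if "t > 0" for n t
  unfolding distrib_left A.Ps_rec[OF that] B.Ps_rec[OF that] by (simp add: ags)
qed

section \<open>Quotients of radial functions and the transmission coefficients\<close>

lemma bessel_quotient:
 assumes t: "0 <= t" "t <= 1 / 2"
 shows "bser n (t^2) > 0" "0 <= bser (Suc n) (t^2)" "bser (Suc n) (t^2) <= bser n (t^2)"
proof -
 have tt: "t^2 <= 1 / 4" using power_mono[OF t(2) t(1), of 2] by (simp add: power2_eq_square)
 have b: "dfact m * bser m (t^2) \<ge> 3 / 4" "dfact m * bser m (t^2) <= 5 / 4" for m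
  using bser_bound[of "t^2" m] tt by auto
 have pos: "bser m (t^2) > 0" for m
  by (rule zero_less_mult_pos[OF _ dfact_pos[of m]]) (use b(1)[of m] in linarith)
 then show "bser n (t^2) > 0" "0 <= bser (Suc n) (t^2)" by (auto intro: less_imp_le)
 have "3 * (dfact n * bser (Suc n) (t^2)) <= (2 * real n + 3) * (dfact n * bser (Suc n) (t^2))"
  using pos[of "Suc n"] dfact_pos[of n] by (intro mult_right_mono) auto
 also have "... <= 5 / 4" using b(2)[of "Suc n"] by (simp add: dfact_Suc mult.assoc)
 finally have "dfact n * bser (Suc n) (t^2) <= dfact n * bser n (t^2)" using b(1)[of n] by linarith
 then show "bser (Suc n) (t^2) <= bser n (t^2)" using dfact_pos[of n] by simp
qed

lemma hankel_eq:
 assumes "t > 0"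
 shows "hankel n t = cis t * cr (\<Prod>i<n. 2 * real i + 1) * hankel_norm n t / cr t ^ (2 * n + 1)"
proof -
 have "(\<Prod>i<n. 2 * real i + 1) > 0" by (intro prod_pos) auto
 then have "rc (\<Prod>i<n. 2 * real i + 1) ~= 0" unfolding of_real_eq_0_iff by linarith
 then show ?thesis by (simp add: hankel_def hankel_norm_def del: of_real_prod)
qed

text \<open>The quotient equals \<open>2 n + 1\<close> times \<open>w\<close>, and the recurrence
  keeps \<open>w\<close> within 2/9 of 1 for \<open>t <= 1 / 2\<close>;
  \<open>7 / 9 * (2 n + 1)\<close> still exceeds \<open>n - 1\<close>. This inequality gives the
  traction of the outgoing mode the sign that prevents resonance.\<close>

lemma hankel_quotient:
 assumes n: "n \<ge> 1" and t: "0 < t" "t <= 1 / 2"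
 shows "hankel n t ~= 0" "Re (cr (t^2) * hankel (Suc n) t / hankel n t) > real n - 1"
proof -
 have t0: "0 <= t" using t by simp
 have tt: "t^2 <= 1 / 4" using power_mono[OF t(2) t0, of 2] by (simp add: power2_eq_square)
 define p where "p = rc (\<Prod>i<n. 2 * real i + 1)"
 have "(\<Prod>i<n. 2 * real i + 1) > 0" by (intro prod_pos) auto
 then have p: "p ~= 0" unfolding p_def of_real_eq_0_iff by linarith
 have N: "cmod (hankel_norm n t) \<ge> 3 / 4" using hankel_norm_bound(1)[OF t0 t(2), of n] tt by linarith
 then have N0: "hankel_norm n t ~= 0" by auto
 have z: "rc t ~= 0" using t by simp
 have h: "hankel n t = cis t * p * hankel_norm n t / cr t ^ (2 * n + 1)"
  unfolding p_def by (rule hankel_eq[OF t(1)])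
 then show h0: "hankel n t ~= 0" using p N0 z by simp
 define w where "w = hankel_norm (Suc n) t / hankel_norm n t"
 have "hankel (Suc n) t = cis t * (p * cr (2 * real n + 1)) * hankel_norm (Suc n) t / cr t ^ (2 * n + 3)"
  unfolding hankel_eq[OF t(1)] p_def by (simp add: eval_nat_numeral mult_ac)
 then have q: "cr (t^2) * hankel (Suc n) t / hankel n t = cr (2 * real n + 1) * w"
  unfolding h w_def using p N0 z by (simp add: field_simps eval_nat_numeral)
 obtain m where m: "n = Suc m" using n by (cases n) auto
 have "cmod (w - 1) = cmod (cr (t^2 / ((2 * real m + 3) * (2 * real m + 1))) * hankel_norm m t) / cmod (hankel_norm n t)"
 proof -
  have "w - 1 = - (cr (t^2 / ((2 * real m + 3) * (2 * real m + 1))) * hankel_norm m t) / hankel_norm n t"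
  unfolding w_def m hankel_norm_Suc using N0 unfolding m by (simp only: diff_divide_distrib) simp
  then show ?thesis by (simp only: norm_divide norm_minus_cancel)
 qed
 also have "... <= (1 / 12 * 2) / (3 / 4)"
 proof (rule frac_le[OF _ _ _ N])
  have "t^2 / ((2 * real m + 3) * (2 * real m + 1)) <= (1 / 4) / (3 * 1)"
  using tt by (intro frac_le mult_mono) auto
  then show "cmod (cr (t^2 / ((2 * real m + 3) * (2 * real m + 1))) * hankel_norm m t) <= 1 / 12 * 2"
  unfolding norm_mult norm_of_real using hankel_norm_bound(3)[OF t0 t(2), of m] by (intro mult_mono) auto
 qed auto
 finally have "cmod (w - 1) <= 2 / 9" by simp
 then have "\<bar>Re w - 1\<bar> <= 2 / 9" using abs_Re_le_cmod[of "w - 1"] by simp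
 then have "Re w \<ge> 7 / 9" by linarith
 then have "(2 * real n + 1) * (7 / 9) <= (2 * real n + 1) * Re w" by (intro mult_left_mono) auto
 then show "Re (cr (t^2) * hankel (Suc n) t / hankel n t) > real n - 1" unfolding q by simp
qed

text \<open>\<open>X\<close> and \<open>Y\<close> are the ratios of traction to trace, divided by
  the shear modulus, of the regular and the outgoing mode. Relative to the exterior modulus the
  ratios are \<open>z'\<close> inside, \<open>z\<close> for the incident mode and \<open>Y\<close>
  for the scattered one. The determinant is a multiple of \<open>z' - Y\<close>, nonzero since
  \<open>z'\<close> is nonnegative and \<open>Re Y\<close> negative.\<close>

lemma transmission_coefficients:
 assumes n: "n \<ge> 2" and k: "0 < k'" "k' <= k" "k <= 1 / 2" and dd: "0 < dd" "dd < 1 / 2" and A: "A ~= 0"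
 obtains a b :: complex where "a ~= 0" "b ~= 0"
  "a * cr (bser n (k'^2)) = A * cr (bser n (k^2)) + b * hankel n k"
  "cr (mu / dd) * ((of_nat n - 1) * (a * cr (bser n (k'^2))) - cr (k'^2) * (a * cr (bser (Suc n) (k'^2))))
  = cr mu * ((of_nat n - 1) * (A * cr (bser n (k^2)) + b * hankel n k)
  - cr (k^2) * (A * cr (bser (Suc n) (k^2)) + b * hankel (Suc n) k))"
proof -
 define X where "X t = real n - 1 - t^2 * bser (Suc n) (t^2) / bser n (t^2)" for t
 define Y where "Y = of_nat n - 1 - cr (k^2) * hankel (Suc n) k / hankel n k"
 have X: "real n - 1 - 1 / 4 <= X t" "X t <= real n - 1" if t: "0 < t" "t <= 1 / 2" for t
 proof -
  have t0: "0 <= t" using t by simp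
  note q = bessel_quotient[OF t0 t(2), of n]
  have tt: "t^2 <= 1 / 4" using power_mono[OF t(2) t0, of 2] by (simp add: power2_eq_square)
  have "t^2 * bser (Suc n) (t^2) / bser n (t^2) <= t^2 * bser n (t^2) / bser n (t^2)"
  using q by (intro divide_right_mono mult_left_mono) auto
  then show "real n - 1 - 1 / 4 <= X t" using q(1) tt by (simp add: X_def)
  show "X t <= real n - 1" using q by (simp add: X_def)
 qed
 have k0: "0 < k" "k' <= 1 / 2" using k by auto
 note Xk = X[OF k0(1) k(3)] and Xk' = X[OF k(1) k0(2)]
 define g g' where "g = rc (bser n (k^2))" and "g' = rc (bser n (k'^2))"
 have g: "g ~= 0" "g' ~= 0"
  using bessel_quotient(1)[of k n] bessel_quotient(1)[of k' n] k k0 by (auto simp: g_def g'_def)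
 define h where "h = hankel n k"
 have h: "h ~= 0" unfolding h_def by (rule hankel_quotient(1)) (use n k k0 in auto)
 have ReY: "Re Y < 0" using hankel_quotient(2)[of n k] n k k0 by (simp add: Y_def)
 define z z' where "z = rc (X k)" and "z' = rc (X k' / dd)"
 have d: "Re (z' - Y) > 0" "Re (z - Y) > 0"
 proof -
  have "0 <= X k'" "0 <= X k" using Xk Xk' n by linarith+
  then have "0 <= X k' / dd" using dd by simp
  then show "Re (z' - Y) > 0" "Re (z - Y) > 0" using ReY `0 <= X k` by (simp_all add: z_def z'_def)
 qed
 \<comment> \<open>Equal ratios would mean that no field is scattered. The contrast
   \<open>dd < 1 / 2\<close> gives \<open>X k * dd <= (n - 1) / 2\<close>, which for
   \<open>n >= 2\<close> is below \<open>n - 5 / 4\<close>, the lower bound for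
   \<open>X k'\<close>.\<close>
 have zz: "z ~= z'"
 proof -
  have "X k' / dd > X k"
  proof -
  have "X k * dd <= (real n - 1) * (1 / 2)" using Xk Xk' n dd by (intro mult_mono) auto
  also have "... < X k'" using Xk' n by simp
  finally show ?thesis using dd by (simp add: field_simps)
  qed
  then show ?thesis unfolding z_def z'_def of_real_eq_iff by simp
 qed
 \<comment> \<open>Cramer's rule for continuity of trace and of traction, with \<open>A\<close> the
   amplitude of the incident mode.\<close>
 define a b where "a = A * g * (z - Y) / (g' * (z' - Y))" and "b = A * g * (z - z') / (h * (z' - Y))"
 have dn: "z' - Y ~= 0" "z - Y ~= 0" using d by auto
 have ab: "a ~= 0" "b ~= 0" using A g h zz dn by (auto simp: a_def b_def)
 have ag: "a * g' = A * g * (z - Y) / (z' - Y)" and bh: "b * h = A * g * (z - z') / (z' - Y)" using g h by (simp_all add: a_def b_def)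
 have 1: "a * g' = A * g + b * h" unfolding ag bh using dn(1) by (simp add: field_simps)
 have 2: "z' * (a * g') = A * g * z + b * h * Y" unfolding ag bh using dn(1) by (simp add: field_simps)
 have Gk: "cr (k^2) * rc (bser (Suc n) (k^2)) = (of_nat n - 1 - z) * g"
  using g by (simp add: z_def X_def g_def)
 have Gk': "cr (k'^2) * rc (bser (Suc n) (k'^2)) = (of_nat n - 1 - cr dd * z') * g'"
  using g dd by (simp add: z'_def X_def g'_def)
 have Hk: "cr (k^2) * hankel (Suc n) k = (of_nat n - 1 - Y) * h"
  using h by (simp add: Y_def h_def)
 have L: "(of_nat n - 1) * (a * g') - cr (k'^2) * (a * cr (bser (Suc n) (k'^2))) = cr dd * (z' * (a * g'))"
 proof -
  have "cr (k'^2) * (a * cr (bser (Suc n) (k'^2))) = a * ((of_nat n - 1 - cr dd * z') * g')"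
  unfolding Gk'[symmetric] by simp
  then show ?thesis by (simp add: ags)
 qed
 have R: "(of_nat n - 1) * (A * g + b * h) - cr (k^2) * (A * cr (bser (Suc n) (k^2)) + b * hankel (Suc n) k) = A * g * z + b * h * Y"
 proof -
  have "cr (k^2) * (A * cr (bser (Suc n) (k^2)) + b * hankel (Suc n) k) = A * ((of_nat n - 1 - z) * g) + b * ((of_nat n - 1 - Y) * h)"
  unfolding Gk[symmetric] Hk[symmetric] by (simp add: ags)
  then show ?thesis by (simp add: ags)
 qed
 show ?thesis
  by (rule that[OF ab]) (unfold g_def[symmetric] g'_def[symmetric] h_def[symmetric] L R 2, simp_all add: 1 dd(1)[THEN less_imp_neq, symmetric])
qed

section \<open>Identification of the field in the inclusion problem\<close>

locale difference =
 fixes S and v p q :: "real^3 => complex^3"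
 assumes S: "open S" and p: "C2_on S p" and q: "C2_on S q" and v: "!!x. x : S ==> v x = p x - q x"
begin

lemmas d = C1_onD(1)[OF C2_onD(1)[OF p]] C1_onD(1)[OF C2_onD(1)[OF q]]
 C1_onD(1)[OF C2_onD(2)[OF p]] C1_onD(1)[OF C2_onD(2)[OF q]]

lemma C2: "C2_on S v"
 by (rule C2_on_cong[OF S v[symmetric] C2_on_diff[OF p q S]])

lemma pd1: "x : S ==> pd j v x = pd j p x - pd j q x"
 using pd_cong_open[OF S _ v, where x=x and i=j] by (simp add: pd_diff d)

lemma pd2: "x : S ==> pd i (pd j v) x = pd i (pd j p) x - pd i (pd j q) x"
 using pd_cong_open[OF S _ pd1, where x=x and i=i] by (simp add: pd_diff d)

lemma div: "x : S ==> div_field v x = div_field p x - div_field q x"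
 by (simp add: div_field_def pd1 sum_subtractf)

lemma div_differentiable: "x : S ==> div_field p differentiable (at x)" "x : S ==> div_field q differentiable (at x)"
 unfolding div_field_def[abs_def] by (auto intro!: differentiable_sum diff_nth d)

lemma grad_div: "x : S ==> grad (div_field v) x = grad (div_field p) x - grad (div_field q) x"
 using pd_cong_open[OF S _ div, where x=x] by (simp add: grad_def vec_eq_iff pd_diff div_differentiable)

lemma lame: "x : S ==> lame l m v x = lame l m p x - lame l m q x"
 unfolding lame_def laplacian_def by (simp add: pd2 grad_div sum_subtractf ags)

lemma jac: "x : S ==> jac v x = jac p x - jac q x"
 by (simp add: jac_def vec_eq_iff pd1)

lemma traction: "x : S ==> traction l m y v x = traction l m y p x - traction l m y q x"
 by (simp add: vec_eq_iff traction_nth pd1 div sum_3 ags)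

lemma curl: "x : S ==> curl v x = curl p x - curl q x"
 by (simp add: curl_def vec_eq_iff forall_3 pd1)

lemma curl_differentiable:
 assumes x: "x : S"
 shows "curl p differentiable (at x)" "curl q differentiable (at x)"
proof -
 have "curl u differentiable (at x)" if "!!i. pd i u differentiable (at x)" for u :: "real^3 => complex^3"
 proof (rule diff_vec)
  show "(%x. curl u x $ j) differentiable (at x)" for j
  using exhaust_3[of j] by (elim disjE) (simp_all add: curl_def that differentiable_diff diff_nth)
 qed
 then show "curl p differentiable (at x)" "curl q differentiable (at x)" using d(3,4)[OF x] by auto
qed

lemma curl_curl: "x : S ==> curl (curl v) x = curl (curl p) x - curl (curl q) x"
 using pd_cong_open[OF S _ curl, where x=x]
 by (simp add: curl_def[of "curl v"] curl_def[of "curl p"] curl_def[of "curl q"] vec_eq_iff forall_3 pd_diff curl_differentiable)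

lemma limits:
 fixes F :: "real^3 => 'b::real_normed_vector"
 assumes "!!x. x : S ==> F x = F1 x - F2 x" "(F1 ---> l1) (at y within T)" "S \<subseteq> T" "(F2 ---> l2) (at y within S)"
 shows "(F ---> l1 - l2) (at y within S)"
proof (rule Lim_transform_eventually[OF tendsto_diff[OF tendsto_within_subset[OF assms(2,3)] assms(4)]])
 show "\<forall>\<^sub>F x in at y within S. F1 x - F2 x = F x"
  unfolding eventually_at_filter by (rule always_eventually) (simp add: assms(1))
qed

lemma radiating:
 assumes S: "S = {x. 1 < norm x}" and "radiating kp ks p" "radiating kp ks q"
 shows "radiating kp ks v"
proof -
 define F where "F u x = ccross (curl (curl u) x) (cvec (x /\<^sub>R norm x)) - (\<i> * cr ks) *s curl u x" for u x
 define G where "G u x = (SU i. cvec (x /\<^sub>R norm x) $ i * grad (div_field u) x $ i) - \<i> * cr kp * div_field u x" for u x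
 have ev: "\<forall>\<^sub>F x in at_infinity. x : S" unfolding S eventually_at_infinity by (intro exI[of _ 2]) auto
 have F: "F v x = F p x - F q x" and G: "G v x = G p x - G q x" if "x : S" for x
  by (simp_all add: F_def G_def ccross_def curl_curl[OF that] curl[OF that] grad_div[OF that] div[OF that] vec_eq_iff forall_3 sum_3 ags)
 have big: "(%x. norm (h v x)) : O[at_infinity](%x. 1 / norm x ^ 2)"
  if "(%x. norm (h p x)) : O[at_infinity](%x. 1 / norm x ^ 2)" "(%x. norm (h q x)) : O[at_infinity](%x. 1 / norm x ^ 2)"
  "!!x. x : S ==> h v x = h p x - h q x" for h :: "_ => real^3 => 'c::real_normed_vector"
 proof -
  have "(%x. norm (h v x)) : O[at_infinity](%x. norm (h p x) + norm (h q x))"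
  by (rule landau_o.big_mono, rule eventually_mono[OF ev]) (simp add: that(3) norm_triangle_ineq4)
  also have "(%x. norm (h p x) + norm (h q x)) : O[at_infinity](%x. 1 / norm x ^ 2)"
  by (rule sum_in_bigo[OF that(1,2)])
  finally show ?thesis .
 qed
 from assms(2,3) show ?thesis
  unfolding radiating_def F_def[symmetric] G_def[symmetric] using big[of F, OF _ _ F] big[of G, OF _ _ G] by blast
qed

end

lemma norm_le_3:
 assumes "!!i. cmod (z $ i) <= b"
 shows "norm (z :: complex^3) <= 3 * b"
proof -
 have "norm z <= (SU i. cmod (z $ i))" by (simp add: norm_vec_def L2_set_le_sum)
 also have "... <= (\<Sum>i\<in>(UNIV::3 set). b)" by (intro sum_mono assms)
 finally show ?thesis by simp
qed

text \<open>Degree at least 1 keeps the first derivatives of \<open>V\<close> bounded at the origin;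
  this provides the bounds that uniqueness on the punctured ball asks for.\<close>

lemma (in mode) Wv_bounded:
 assumes n: "n \<ge> 1" and K: "!!t. 0 < t ==> t <= k ==> cmod (Ps n t) <= K" "!!t. 0 < t ==> t <= k ==> cmod (Ps (Suc n) t) <= K"
 shows "\<exists>B. \<forall>x\<in>shell 0 1. norm (Wv x) <= B & (\<forall>j. norm (pd j Wv x) <= B)"
proof -
 obtain B where B: "B > 0" "!!k j x. x ~= 0 ==> cmod (V k x) <= B * norm x ^ n"
  "!!k j x. x ~= 0 ==> norm x * cmod (pd j (V k) x) <= B * norm x ^ n"
  using V_bound by blast
 have K0: "0 <= K" by (rule order_trans[OF norm_ge_zero K(1)[OF k order_refl]])
 have "norm (Wv x) <= 3 * (k^2 * K * B + K * B) & (\<forall>j. norm (pd j Wv x) <= 3 * (k^2 * K * B + K * B))" if x: "x : shell 0 1" for x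
 proof -
  have x0: "x ~= 0" and r: "0 < norm x" "norm x <= 1" using x by (auto simp: shell_def)
  have g: "cmod (g n x) <= K" "cmod (g (Suc n) x) <= K"
  unfolding g_def using r k by (auto intro!: K mult_left_le)
  have rn: "norm x ^ n <= 1" using r by (intro power_le_one) auto
  have V: "cmod (V i x) <= B" for i
  using B(2)[OF x0, of i] rn B(1) mult_left_le[of "norm x ^ n" B] by linarith
  have pV: "cmod (pd j (V i) x) <= B" for i j
  proof -
  have "norm x ^ n = norm x * norm x ^ (n - 1)" using n by (cases n) auto
  then have "norm x * cmod (pd j (V i) x) <= norm x * (B * norm x ^ (n - 1))" using B(3)[OF x0, of j i] by (simp add: mult_ac)
  then have "cmod (pd j (V i) x) <= B * norm x ^ (n - 1)" using r by simp
  also have "... <= B" using r B(1) by (intro mult_left_le power_le_one) auto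
  finally show ?thesis .
  qed
  have W: "cmod (W i x) <= k^2 * K * B + K * B" for i
  proof -
  have "cmod (W i x) <= K * B" unfolding W_def norm_mult by (intro mult_mono g V K0) auto
  then show ?thesis using K0 B(1) by (simp add: add_increasing)
  qed
  have pW: "cmod (pd j (W i) x) <= k^2 * K * B + K * B" for i j
  proof -
  have "cmod (cr (x $ j) * (- cr (k^2) * g (Suc n) x) * V i x) <= 1 * (k^2 * K) * B"
  unfolding norm_mult norm_minus_cancel norm_of_real
  using component_le_norm_cart[of x j] r K0 by (intro mult_mono g V) auto
  moreover have "cmod (g n x * pd j (V i) x) <= K * B" unfolding norm_mult by (intro mult_mono g pV K0) auto
  ultimately show ?thesis unfolding pd_W[OF x0] by (intro norm_triangle_le) simp
  qed
  show ?thesis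
  by (intro conjI allI norm_le_3) (simp_all only: Wv_def vec_lambda_beta W pd_Wv[OF x0] pW)
 qed
 then show ?thesis by blast
qed

text \<open>A solution is built from modes, and the difference between the given field and it solves
  the transmission problem without incident wave. By \<open>transmission_unique\<close> this
  difference vanishes off the origin and the sphere.\<close>

lemma inclusion_solution:
 assumes sc: "elastic_scattering (ball 0 1) (%y. y) lam mu rho (lam / dd) (mu / dd) (rho / ep) om (incident_T (k_shear mu rho om) n f) u"
  and pos: "0 < mu" "0 < 3 * lam + 2 * mu" "0 < rho" "0 < om"
  and dd: "0 < dd" "dd < 1 / 2" "0 < ep" "sqrt (dd / ep) < 1" and n: "n \<ge> 2" and k2: "k_shear mu rho om <= 1 / 2"
 obtains k' a b where "0 < k'" "k' <= k_shear mu rho om" "a ~= 0" "b ~= 0"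
  "!!x. x : shell 0 1 ==> u x = (a * cr (bser n ((k' * norm x)^2))) *s tang (solid_sum n f) x"
  "!!x. 1 < norm x ==> u x - incident_T (k_shear mu rho om) n f x = (b * hankel n (k_shear mu rho om * norm x)) *s tang (solid_sum n f) x"
proof -
 define k where "k = k_shear mu rho om"
 \<comment> \<open>The interior wave number. The contrasts enter the wave speed through
   \<open>sqrt (dd / ep)\<close> alone, and its being below 1 gives \<open>k' <= k\<close>.\<close>
 define k' where "k' = k * sqrt (dd / ep)"
 define ui where "ui = incident_T k n f"
 define V where "V i x = tang (solid_sum n f) x $ i" for i x
 let ?E = "{x::real^3. 1 < norm x}"
 have oE: "open ?E" by (intro open_Collect_less continuous_intros)
 have k: "0 < k" "k <= 1 / 2" using pos k2 by (simp_all add: k_def k_shear_def)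
 have k': "0 < k'" "k' <= k" using k dd by (simp_all add: k'_def mult_left_le)
 have ka: "mu * k^2 = om^2 * rho" using pos by (simp add: k_def k_shear_def power_mult_distrib)
 have ka': "mu / dd * k'^2 = om^2 * (rho / ep)" using ka dd by (simp add: k'_def power_mult_distrib field_simps)
 \<comment> \<open>From \<open>j_n(k r) = (k r)^n bser n ((k r)^2)\<close>: the incident field is
   the mode with coefficient \<open>k^n\<close> in front of \<open>bser\<close>.\<close>
 define A where "A = rc k ^ n"
 have A: "A ~= 0" using k by (simp add: A_def)
 obtain a b where ab: "a ~= 0" "b ~= 0"
  and c1: "a * cr (bser n (k'^2)) = A * cr (bser n (k^2)) + b * hankel n k"
  and c2: "cr (mu / dd) * ((of_nat n - 1) * (a * cr (bser n (k'^2))) - cr (k'^2) * (a * cr (bser (Suc n) (k'^2))))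
  = cr mu * ((of_nat n - 1) * (A * cr (bser n (k^2)) + b * hankel n k)
  - cr (k^2) * (A * cr (bser (Suc n) (k^2)) + b * hankel (Suc n) k))"
  by (rule transmission_coefficients[OF n k' k(2) dd(1,2) A])
 have hf: "harmonic_field V n" unfolding V_def[abs_def] by (rule tang_harmonic_field)
 interpret I: mode V n "%n t. a * cr (bser n (t^2))" k'
  using hf radial_ladder_bessel k' by (simp add: mode_def mode_axioms_def)
 interpret H: mode V n "%n t. b * hankel n t" k
  using hf radial_ladder_hankel k by (simp add: mode_def mode_axioms_def)
 interpret J: mode V n "%n t. A * cr (bser n (t^2)) + b * hankel n t" k
  using hf radial_ladder_add[OF radial_ladder_bessel radial_ladder_hankel] k by (simp add: mode_def mode_axioms_def)
 have Wi: "I.Wv x = (a * cr (bser n ((k' * norm x)^2))) *s tang (solid_sum n f) x" for x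
  by (simp add: I.Wv_def I.W_def I.g_def V_def vec_eq_iff)
 have Wh: "H.Wv x = (b * hankel n (k * norm x)) *s tang (solid_sum n f) x" for x
  by (simp add: H.Wv_def H.W_def H.g_def V_def vec_eq_iff)
 have Wj: "J.Wv x = ui x + H.Wv x" if x: "x ~= 0" for x
 proof -
  have "rc (sph_bessel_j n (k * norm x)) * cr (inverse (norm x)) ^ n = A * cr (bser n ((k * norm x)^2))"
  unfolding sph_bessel_j_eq A_def using x by (simp add: power_mult_distrib field_simps)
  then show ?thesis unfolding ui_def incident_T_eq[OF x] Wh
  by (simp add: J.Wv_def J.W_def J.g_def V_def vec_eq_iff distrib_right)
 qed
 have Wj': "J.Wv x = ui x + H.Wv x" if "1 < norm x" for x by (rule Wj) (use that in auto)
 have lin: "p + c *r p' - (q + c *r q') = p - q + c *r (p' - q')" for p q p' q' :: "complex^3" and c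
  by (simp add: ags)
 have EE: "- cball 0 1 = ?E" by auto
 have sc': "C2_on (ball 0 1) u" "C2_on ?E u"
  "!!x. x : ball 0 1 ==> lame (lam / dd) (mu / dd) u x + (om^2 * (rho / ep)) *r u x = 0"
  "!!x. x : ?E ==> lame lam mu u x + (om^2 * rho) *r u x = 0"
  "radiating (k_pressure lam mu rho om) k (%x. u x - ui x)"
  and tr: "!!y. norm y = 1 ==> (\<exists>G. (jac u ---> G) (at y within ball 0 1)) & (\<exists>G. (jac u ---> G) (at y within ?E)) &
  (\<exists>a. (u ---> a) (at y within ball 0 1) & (u ---> a) (at y within ?E)) &
  (\<exists>t. (traction (lam / dd) (mu / dd) y u ---> t) (at y within ball 0 1) & (traction lam mu y u ---> t) (at y within ?E))"
  using sc EE unfolding elastic_scattering_def k_def[symmetric] ui_def[symmetric] by auto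
 obtain G1 where G1: "!!y. norm y = 1 ==> (jac u ---> G1 y) (at y within ball 0 1)" using tr by metis
 obtain G2 where G2: "!!y. norm y = 1 ==> (jac u ---> G2 y) (at y within ?E)" using tr by metis
 obtain av where av: "!!y. norm y = 1 ==> (u ---> av y) (at y within ball 0 1)" "!!y. norm y = 1 ==> (u ---> av y) (at y within ?E)"
  using tr by metis
 obtain tv where tv: "!!y. norm y = 1 ==> (traction (lam / dd) (mu / dd) y u ---> tv y) (at y within ball 0 1)"
  "!!y. norm y = 1 ==> (traction lam mu y u ---> tv y) (at y within ?E)"
  using tr by metis
 \<comment> \<open>Outside, \<open>J\<close> is the incident field plus the scattered mode, so
   subtracting it from the total field leaves a radiating field.\<close>
 define v where "v x = u x - (if norm x < 1 then I.Wv x else J.Wv x)" for x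
 have sb: "shell 0 1 \<subseteq> ball 0 1" by (auto simp: shell_def)
 interpret P: difference "shell 0 1" v u I.Wv
  by (rule difference.intro[OF open_shell C2_on_subset[OF sc'(1) sb] C2_on_subset[OF I.Wv2]]) (auto simp: v_def shell_def)
 interpret Q: difference ?E v u J.Wv
  by (rule difference.intro[OF oE sc'(2) C2_on_subset[OF J.Wv2]]) (auto simp: v_def)
 have W1: "I.Wv y = J.Wv y" and T1: "traction (lam / dd) (mu / dd) y I.Wv y = traction lam mu y J.Wv y" if y: "norm y = 1" for y
  unfolding I.traction_Wv[OF y] J.traction_Wv[OF y] c2
  by (simp_all add: I.Wv_def I.W_def I.g_def J.Wv_def J.W_def J.g_def y c1)
 have z: "v x = 0" if x: "x : shell 0 1 | 1 < norm x" for x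
 proof -
  have bd: "\<exists>B. \<forall>x\<in>cball 0 (1 / 2). norm (F x) <= B" if "cont_on (ball 0 1) F" for F :: "real^3 => complex^3"
  proof -
  have "cball 0 (1 / 2) \<subseteq> (ball 0 1 :: (real^3) set)" by auto
  then have "compact (F ` cball 0 (1 / 2))" by (intro compact_continuous_image continuous_on_subset[OF that]) auto
  then show ?thesis by (meson bounded_iff compact_imp_bounded imageI)
  qed
  obtain B1 where "\<forall>x\<in>cball 0 (1 / 2). norm (u x) <= B1"
  using bd[OF C1_onD(3)[OF C2_onD(1)[OF sc'(1)]]] by blast
  then have B1: "norm (u x) <= B1" if "x : cball 0 (1 / 2)" for x using that by simp
  obtain B2 where "!!j. \<forall>x\<in>cball 0 (1 / 2). norm (pd j u x) <= B2 j"
  using bd[OF C1_onD(2)[OF C2_onD(1)[OF sc'(1)]]] by metis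
  then have B2: "norm (pd j u x) <= B2 j" if "x : cball 0 (1 / 2)" for j x using that by simp
  have K: "cmod (a * cr (bser m (t^2))) <= cmod a * (2 / dfact m)" if "0 < t" "t <= k'" for m t
  proof -
  have "t^2 <= 1" using that k' k by (intro power_le_one) auto
  then have "\<bar>dfact m * bser m (t^2)\<bar> <= 2" using bser_bound[of "t^2" m] by auto
  then have "\<bar>bser m (t^2)\<bar> <= 2 / dfact m" using dfact_pos[of m] by (simp add: abs_mult field_simps)
  from mult_left_mono[OF this, of "cmod a"] show ?thesis by (simp add: norm_mult)
  qed
  obtain B3 where B3: "!!x. x : shell 0 1 ==> norm (I.Wv x) <= B3" "!!x j. x : shell 0 1 ==> norm (pd j I.Wv x) <= B3"
  proof -
  have "\<exists>B. \<forall>x\<in>shell 0 1. norm (I.Wv x) <= B & (\<forall>j. norm (pd j I.Wv x) <= B)"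
  by (rule I.Wv_bounded[where K="max (cmod a * (2 / dfact n)) (cmod a * (2 / dfact (Suc n)))"])
  (use n K in \<open>auto simp only: le_max_iff_disj\<close>)
  then show ?thesis using that by blast
  qed
  define B where "B = \<bar>B1\<bar> + (SU j. \<bar>B2 j\<bar>) + B3"
  have Bj: "\<bar>B2 j\<bar> <= (SU j. \<bar>B2 j\<bar>)" for j by (rule member_le_sum) auto
  have half: "x : cball 0 (1 / 2)" "x : shell 0 1" if "x : shell 0 (1 / 2)" for x using that by (auto simp: shell_def)
  have rad: "radiating (k_pressure lam mu rho om) (k_shear mu rho om) v"
  proof -
  obtain C where C': "\<forall>t\<ge>1. cmod (hankel n t) <= C / t ^ (n + 1) & cmod (hankel n t - \<i> * cr t * hankel (Suc n) t) <= C / t ^ (n + 2)"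
  using hankel_bounds[of n] by (rule exE)
  have C: "cmod (hankel n t) <= C / t ^ (n + 1)" "cmod (hankel n t - \<i> * cr t * hankel (Suc n) t) <= C / t ^ (n + 2)" if "t \<ge> 1" for t
  using C'[rule_format, OF that] by (rule conjunct1, rule conjunct2)
  have hr: "radiating (k_pressure lam mu rho om) k H.Wv"
  proof (rule H.Wv_radiating[where T=1 and C="cmod b * C"])
  show "cmod (b * hankel n t) <= cmod b * C / t ^ (n + 1)" if "1 <= t" for t
  using mult_left_mono[OF C(1)[OF that], of "cmod b"] by (simp add: norm_mult)
  have "b * hankel n t - \<i> * cr t * (b * hankel (Suc n) t) = b * (hankel n t - \<i> * cr t * hankel (Suc n) t)" for t
  by (simp add: ags)
  then show "cmod (b * hankel n t - \<i> * cr t * (b * hankel (Suc n) t)) <= cmod b * C / t ^ (n + 2)" if "1 <= t" for t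
  using mult_left_mono[OF C(2)[OF that], of "cmod b"] by (simp add: norm_mult)
  qed
  \<comment> \<open>The incident field is \<open>C^2\<close> outside because it is the difference of
    the modes \<open>J\<close> and \<open>H\<close>.\<close>
  have ud: "C2_on ?E (%x. u x - ui x)"
  proof (rule C2_on_diff[OF sc'(2) _ oE])
  show "C2_on ?E ui"
  by (rule C2_on_cong[OF oE _ C2_on_diff[OF C2_on_subset[OF J.Wv2] C2_on_subset[OF H.Wv2] oE]]) (auto simp: Wj')
  qed
  interpret D: difference ?E v "%x. u x - ui x" H.Wv
  by (rule difference.intro[OF oE ud C2_on_subset[OF H.Wv2]]) (auto simp: v_def Wj')
  show ?thesis unfolding k_def[symmetric] by (rule D.radiating[OF refl sc'(5) hr])
  qed
  show ?thesis
  proof (rule transmission_unique[where d="1/2" and B=B and ?G1.0="%y. G1 y - jac I.Wv y" and ?G2.0="%y. G2 y - jac J.Wv y"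
  and a="%y. av y - I.Wv y" and t="%y. tv y - traction lam mu y J.Wv y", OF pos])
  show "0 < mu / dd" "0 < 3 * (lam / dd) + 2 * (mu / dd)" "0 < om^2 * (rho / ep)"
  using pos dd by (auto simp flip: add_divide_distrib)
  show "lame (lam / dd) (mu / dd) v x + (om^2 * (rho / ep)) *r v x = 0" if "x : shell 0 1" for x
  proof -
  have "x : ball 0 1" "x ~= 0" using that by (auto simp: shell_def)
  then show ?thesis
  unfolding P.lame[OF that] P.v[OF that] lin[symmetric] using sc'(3) I.lame_Wv[of x "lam / dd" "mu / dd"] unfolding ka' by simp
  qed
  show "lame lam mu v x + (om^2 * rho) *r v x = 0" if "x : ?E" for x
  proof -
  have "x ~= 0" using that by auto
  then show ?thesis
  unfolding Q.lame[OF that] Q.v[OF that] lin[symmetric] using sc'(4)[OF that] J.lame_Wv[of x lam mu] unfolding ka by simp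
  qed
  show "norm (v x) <= B" if "x : shell 0 (1 / 2)" for x
  unfolding P.v[OF half(2)[OF that]] B_def
  using norm_triangle_ineq4[of "u x" "I.Wv x"] B1[OF half(1)[OF that]] B3(1)[OF half(2)[OF that]] Bj[of 1] by linarith
  show "norm (pd j v x) <= B" if "x : shell 0 (1 / 2)" for x j
  unfolding P.pd1[OF half(2)[OF that]] B_def
  using norm_triangle_ineq4[of "pd j u x" "pd j I.Wv x"] B2[OF half(1)[OF that], of j] B3(2)[OF half(2)[OF that], of j] Bj[of j] by linarith
  show "(jac v ---> G1 y - jac I.Wv y) (at y within shell 0 1)" if "norm y = 1" for y
  by (rule P.limits[OF P.jac G1[OF that] sb I.Wv_limits(2)[OF that]])
  show "(jac v ---> G2 y - jac J.Wv y) (at y within ?E)" if "norm y = 1" for y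
  by (rule Q.limits[OF Q.jac G2[OF that] subset_refl J.Wv_limits(2)[OF that]])
  show "(v ---> av y - I.Wv y) (at y within shell 0 1)" if "norm y = 1" for y
  by (rule P.limits[OF P.v av(1)[OF that] sb I.Wv_limits(1)[OF that]])
  show "(v ---> av y - I.Wv y) (at y within ?E)" if "norm y = 1" for y
  unfolding W1[OF that] by (rule Q.limits[OF Q.v av(2)[OF that] subset_refl J.Wv_limits(1)[OF that]])
  show "(traction (lam / dd) (mu / dd) y v ---> tv y - traction lam mu y J.Wv y) (at y within shell 0 1)" if "norm y = 1" for y
  unfolding T1[OF that, symmetric] by (rule P.limits[OF P.traction tv(1)[OF that] sb I.Wv_limits(3)[OF that]])
  show "(traction lam mu y v ---> tv y - traction lam mu y J.Wv y) (at y within ?E)" if "norm y = 1" for y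
  by (rule Q.limits[OF Q.traction tv(2)[OF that] subset_refl J.Wv_limits(3)[OF that]])
  qed (use x rad P.C2 Q.C2 in auto)
 qed
 show ?thesis
 proof (rule that[OF k'[unfolded k_def] ab])
  show "u x = (a * cr (bser n ((k' * norm x)^2))) *s tang (solid_sum n f) x" if "x : shell 0 1" for x
  using z[of x] P.v[OF that] that unfolding Wi by simp
  show "u x - incident_T (k_shear mu rho om) n f x = (b * hankel n (k_shear mu rho om * norm x)) *s tang (solid_sum n f) x" if "1 < norm x" for x
  using z[of x] Q.v[of x] that Wj'[of x] unfolding k_def[symmetric] ui_def[symmetric] Wh by auto
 qed
qed

section \<open>Localization ratios by dilation\<close>

lemma L2_norm_sq_eq:
 assumes "S : sets borel" "cont_on S v"
 shows "L2_norm_sq S v = enn2real (NN x. ennreal (indicator S x * (norm (v x))^2))"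
proof -
 have "(%x. indicator S x *r (norm (v x))^2) : borel_measurable borel"
  using assms by (intro borel_measurable_continuous_on_indicator continuous_intros) auto
 then show ?thesis
  unfolding L2_norm_sq_def set_lebesgue_integral_def by (subst integral_eq_nn_integral) auto
qed

text \<open>Up to null sets, \<open>S\<close> lies in the image of \<open>T\<close> under dilation
  by \<open>c\<close>. The change of variables costs \<open>c^3\<close>, and the comparison of
  \<open>v (c x)\<close> with \<open>v x\<close> costs \<open>K\<close>. The comparison leaves out
  the origin and the unit sphere, null sets where the field is not given by a formula.\<close>

lemma L2_ratio:
 fixes v :: "real^3 => complex^3"
 assumes T: "open T" "bounded T" and S: "S : sets borel" "S \<subseteq> T" and v: "cont_on T v"
  and B: "!!x. x : T ==> norm (v x) <= B" and x0: "x0 : T" "v x0 ~= 0" and c: "c > 0" and K: "K \<ge> 0"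
  and le: "!!x. x ~= 0 ==> norm x ~= 1 ==> c *r x : S ==> x : T & (norm (v (c *r x)))^2 <= K * (norm (v x))^2"
 shows "0 < L2_norm_sq T v & L2_norm_sq S v / L2_norm_sq T v <= c ^ 3 * K"
proof -
 define N where "N S = (NN x. ennreal (indicator S x * (norm (v x))^2))" for S
 have Tb: "T : sets borel" using T by simp
 have m: "(%x. ennreal (indicator S x * (norm (v x))^2)) : borel_measurable borel" if "S : sets borel" "S \<subseteq> T" for S
 proof -
  have "(%x. indicator S x *r (norm (v x))^2) : borel_measurable borel"
  using that by (intro borel_measurable_continuous_on_indicator continuous_intros continuous_on_subset[OF v]) auto
  then show ?thesis by simp
 qed
 have L: "L2_norm_sq S v = enn2real (N S)" if "S : sets borel" "S \<subseteq> T" for S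
  unfolding N_def by (rule L2_norm_sq_eq[OF that(1) continuous_on_subset[OF v that(2)]])
 have fin: "N T < \<infinity>"
 proof -
  have "0 <= B" using B[OF x0(1)] norm_ge_zero order_trans by blast
  then have "N T <= (NN x. ennreal (B^2) * indicator T x)"
  unfolding N_def by (intro nn_integral_mono) (auto simp: indicator_def intro!: power_mono B ennreal_leI)
  also have "... = ennreal (B^2) * emeasure lborel T" using Tb by (simp add: nn_integral_cmult_indicator)
  also have "... < \<infinity>" using emeasure_bounded_finite[OF T(2)] by (simp add: ennreal_mult_less_top)
  finally show ?thesis .
 qed
 \<comment> \<open>A zero norm would make the open set where \<open>v\<close> does not vanish a null
   set, but it contains \<open>x0\<close>.\<close>
 have pos: "N T ~= 0"
 proof
  assume "N T = 0"
  then have ae: "AE x in lborel. ennreal (indicator T x * (norm (v x))^2) = 0"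
  unfolding N_def by (subst (asm) nn_integral_0_iff_AE) (use m[OF Tb order_refl] in auto)
  define Z where "Z = T \<inter> v -` (- {0})"
  have Z: "open Z" unfolding Z_def by (rule continuous_open_preimage[OF v T(1)]) auto
  have "AE x in lborel. x \<notin> Z" using ae by eventually_elim (auto simp: Z_def ennreal_eq_0_iff)
  moreover have "Z : sets lborel" using Z by simp
  ultimately have "Z : null_sets lborel" using AE_iff_null_sets by blast
  then have "negligible Z" by (simp add: negligible_iff_null_sets null_sets_completionI)
  then show False using open_not_negligible[OF Z] x0 by (auto simp: Z_def)
 qed
 have sph0: "sphere (0::real^3) 1 : null_sets lborel"
  using negligible_sphere[of "0::real^3" 1] unfolding negligible_iff_null_sets by (subst (asm) null_sets_completion_iff) auto
 have ae: "AE x in lborel. x ~= (0::real^3) & norm x ~= 1"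
  using AE_lborel_singleton[of "0::real^3"] AE_not_in[OF sph0] by eventually_elim auto
 have "N S = ennreal (c ^ 3) * (NN x. ennreal (indicator S (c *r x) * (norm (v (c *r x)))^2))"
  unfolding N_def by (rule nn_integral_lborel_scale[OF m[OF S] c])
 also have "... <= ennreal (c ^ 3) * (NN x. ennreal K * ennreal (indicator T x * (norm (v x))^2))"
 proof (intro mult_left_mono nn_integral_mono_AE)
  show "AE x in lborel. ennreal (indicator S (c *r x) * (norm (v (c *r x)))^2) <= ennreal K * ennreal (indicator T x * (norm (v x))^2)"
  using ae
  proof eventually_elim
  case (elim x)
  then show ?case using le[of x] K by (cases "c *r x : S") (auto simp flip: ennreal_mult)
  qed
 qed simp
 also have "... = ennreal (c ^ 3 * K) * N T"
  unfolding N_def using m[OF Tb order_refl] c K by (subst nn_integral_cmult) (auto simp: ennreal_mult mult_ac)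
 finally have NS: "N S <= ennreal (c ^ 3 * K) * N T" .
 have "enn2real (N S) <= enn2real (ennreal (c ^ 3 * K) * N T)"
  by (rule enn2real_mono[OF NS]) (use fin in \<open>simp add: ennreal_mult_less_top\<close>)
 then have r: "enn2real (N S) <= c ^ 3 * K * enn2real (N T)" using c K by (simp add: enn2real_mult)
 have p: "0 < enn2real (N T)" using pos fin by (simp add: enn2real_positive_iff zero_less_iff_neq_zero)
 show ?thesis using r p unfolding L[OF Tb order_refl] L[OF S] by (simp add: divide_le_eq)
qed

text \<open>For \<open>q <= 1 / 4\<close> the quotient \<open>(1 + 2 q) / (1 - q)\<close> is at most
  \<open>1 + 4 q\<close>, whose square is at most \<open>1 + 12 q\<close>. This is the source of the
  12 in the final constant.\<close>

lemma ratio_square: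
 fixes q x y :: real
 assumes "0 <= q" "q <= 1 / 4" "0 <= x" "x <= 1 + 2 * q" "1 - q <= y"
 shows "x^2 <= (1 + 12 * q) * y^2"
proof -
 have q: "4 * (q * q) <= q" using mult_left_mono[OF assms(2,1)] by simp
 then have "1 + 2 * q <= (1 + 4 * q) * (1 - q)" by (simp add: ags)
 also have "... <= (1 + 4 * q) * y" using assms by (intro mult_left_mono) auto
 finally have "x^2 <= ((1 + 4 * q) * y)^2" using assms by (intro power_mono) auto
 also have "... = (1 + 4 * q)^2 * y^2" by (rule power_mult_distrib)
 also have "(1 + 4 * q)^2 * y^2 <= (1 + 12 * q) * y^2"
  using q by (intro mult_right_mono) (auto simp: power2_eq_square ags)
 finally show ?thesis .
qed

lemma tang_scale:
 assumes "c > 0"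
 shows "tang (solid_sum n f) (c *r x) = cr (c ^ n) *s tang (solid_sum n f) x"
 using harmonic_field.V_hom[OF tang_harmonic_field assms] by (simp add: vec_eq_iff)

lemma norm_smult_complex: "norm (z *s (v :: complex^'n)) = cmod z * norm v"
 by (simp add: norm_vec_def L2_set_def norm_mult power_mult_distrib sum_distrib_left[symmetric] real_sqrt_mult)

text \<open>The homogeneous field gives \<open>c^(2 n)\<close> exactly; the normalised Bessel
  factors at both points are within \<open>q\<close> of 1, and \<open>ratio_square\<close> compares
  them.\<close>

lemma interior_scaling:
 assumes q: "0 <= k" "k^2 <= q" "q <= 1 / 4" and c: "0 < c" "c <= 1" and x: "norm x <= 1"
  and w: "!!z. z : {x, c *r x} ==> w z = (a * cr (bser n ((k * norm z)^2))) *s tang (solid_sum n f) z"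
 shows "(norm (w (c *r x)))^2 <= c ^ (2 * n) * (1 + 12 * q) * (norm (w x))^2"
proof -
 have s: "(k * r)^2 <= q" if "0 <= r" "r <= 1" for r
 proof -
  have "(k * r)^2 <= (k * 1)^2" using that q by (intro power_mono mult_left_mono) auto
  then show ?thesis using q by simp
 qed
 have b: "\<bar>dfact n * bser n ((k * r)^2) - 1\<bar> <= q" if "0 <= r" "r <= 1" for r
  using bser_bound[of "(k * r)^2" n] s[OF that] q by auto
 let ?r = "norm x"
 have c'r: "0 <= c * ?r" "c * ?r <= 1" using c x mult_mono[of c 1 ?r 1] by auto
 have "(dfact n * bser n ((k * (c * ?r))^2))^2 <= (1 + 12 * q) * (dfact n * bser n ((k * ?r)^2))^2"
  using b[OF c'r] b[of ?r] x q by (intro ratio_square) (auto simp: abs_le_iff)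
 then have "(bser n ((k * (c * ?r))^2))^2 <= (1 + 12 * q) * (bser n ((k * ?r)^2))^2"
  using dfact_pos[of n] by (simp add: power_mult_distrib mult.left_commute[of _ "(dfact n)^2"])
 then have "(cmod a)^2 * (c ^ (2 * n) * (norm (tang (solid_sum n f) x))^2) * (bser n ((k * (c * ?r))^2))^2
  <= (cmod a)^2 * (c ^ (2 * n) * (norm (tang (solid_sum n f) x))^2) * ((1 + 12 * q) * (bser n ((k * ?r)^2))^2)"
  using c by (intro mult_left_mono) auto
 then show ?thesis
  using c
  by (simp add: w norm_smult_complex tang_scale norm_mult norm_power power_mult_distrib power_mult[symmetric] mult_ac)
qed

text \<open>The homogeneous field contributes \<open>c^(2 n)\<close> and the power in the Hankel
  function \<open>c^-(4 n + 2)\<close>, together \<open>c^-(2 n + 2)\<close>; the normalised Hankel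
  factors are compared by \<open>ratio_square\<close>.\<close>

lemma exterior_scaling:
 assumes k: "0 < k" and c: "1 <= c" and x: "0 < norm x" and q: "(k * (c * norm x))^2 <= q" "q <= 1 / 4"
  and w: "!!z. z : {x, c *r x} ==> w z = (b * hankel n (k * norm z)) *s tang (solid_sum n f) z"
 shows "(norm (w (c *r x)))^2 <= (1 / c) ^ (2 * n + 2) * (1 + 12 * q) * (norm (w x))^2"
proof -
 let ?r = "norm x"
 define p where "p = (\<Prod>i<n. 2 * real i + 1)"
 have h: "cmod (hankel n t) = \<bar>p\<bar> * cmod (hankel_norm n t) / t ^ (2 * n + 1)" if "t > 0" for t
  unfolding hankel_eq[OF that] p_def[symmetric] using that by (simp add: norm_mult norm_divide norm_power)
 have half: "t <= 1 / 2" if "0 <= t" "t^2 <= q" for t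
  by (rule power2_le_imp_le) (use that q in \<open>auto simp: power2_eq_square\<close>)
 have t: "0 < k * ?r" "0 < k * (c * ?r)" using k c x by auto
 have "?r <= c * ?r" using c mult_right_mono[of 1 c ?r] by simp
 then have "(k * ?r)^2 <= (k * (c * ?r))^2" using k by (intro power_mono mult_left_mono) auto
 then have q1: "(k * ?r)^2 <= q" using q by linarith
 have "0 <= q" by (rule order_trans[OF zero_le_power2 q1])
 then have "(cmod (hankel_norm n (k * (c * ?r))))^2 <= (1 + 12 * q) * (cmod (hankel_norm n (k * ?r)))^2"
  using hankel_norm_bound(2)[OF less_imp_le[OF t(2)] half[OF less_imp_le[OF t(2)] q(1)], of n]
  hankel_norm_bound(1)[OF less_imp_le[OF t(1)] half[OF less_imp_le[OF t(1)] q1], of n] q q1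
  by (intro ratio_square) auto
 then have "(p / (k * ?r) ^ (2 * n + 1))^2 * (cmod (hankel_norm n (k * (c * ?r))))^2 <= (p / (k * ?r) ^ (2 * n + 1))^2 * ((1 + 12 * q) * (cmod (hankel_norm n (k * ?r)))^2)"
  by (intro mult_left_mono) auto
 then have 1: "(cmod (hankel n (k * (c * ?r))) * c ^ (2 * n + 1))^2 <= (1 + 12 * q) * (cmod (hankel n (k * ?r)))^2"
  unfolding h[OF t(1)] h[OF t(2)] using c by (simp add: power_mult_distrib power_divide mult_ac)
 define C where "C = (cmod b)^2 * (norm (tang (solid_sum n f) x))^2 * (1 / c) ^ (2 * n + 2)"
 have 2: "C * (cmod (hankel n (k * (c * ?r))) * c ^ (2 * n + 1))^2 <= C * ((1 + 12 * q) * (cmod (hankel n (k * ?r)))^2)"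
  by (rule mult_left_mono[OF 1]) (use c in \<open>simp add: C_def\<close>)
 have cc: "(1 / c) ^ (2 * n + 2) * (c ^ (2 * n + 1))^2 = (c ^ n)^2"
  using c by (simp add: power_divide power_mult[symmetric] divide_eq_eq flip: power_add) (simp add: ags power2_eq_square)
 have E: "C * (h * c ^ (2 * n + 1))^2 = (cmod b)^2 * (norm (tang (solid_sum n f) x))^2 * h^2 * (c ^ n)^2" for h
  unfolding cc[symmetric] C_def by (simp only: power_mult_distrib mult_ac)
 have 3: "(norm (w (c *r x)))^2 = C * (cmod (hankel n (k * (c * ?r))) * c ^ (2 * n + 1))^2"
  unfolding E using c
  by (simp add: w tang_scale norm_smult_complex norm_mult norm_power power_mult_distrib mult_ac)
 show ?thesis
  using 2 unfolding 3 C_def by (simp add: w norm_smult_complex norm_mult power_mult_distrib mult_ac)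
qed

text \<open>Since \<open>floor y + 1 > y\<close>, the index conditions are strict inequalities
  between logarithms, where multiplying by the negative \<open>ln g1\<close> reverses the order. The
  exponents are those of the dilations: \<open>2 n + 3\<close> inside and
  \<open>3 - (2 n + 2)\<close> outside. For \<open>e < g1 ^ 5\<close> the quotient
  \<open>ln e / ln g1\<close> exceeds 5, just enough to exclude \<open>n = 1\<close>.\<close>

lemma index_bounds:
 assumes e: "0 < e" and \<gamma>: "0 < g1" "g1 < 1" "1 < g2"
  and n: "max (n_interior g1 e) (n_exterior g2 e) <= int n"
 shows "g1 ^ (2 * n + 3) <= e" "g2 ^ 3 * (1 / g2) ^ (2 * n + 2) <= e" "e < g1 ^ 5 ==> n \<ge> 2"
proof -
 have l: "ln g1 < 0" "ln g2 > 0" using \<gamma> by auto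
 have n1: "(ln e / ln g1 - 3) / 2 < real n" and n2: "(1 - ln e / ln g2) / 2 < real n"
  using n unfolding n_interior_def n_exterior_def by linarith+
 have "ln e / ln g1 < 2 * real n + 3" using n1 by simp
 then have "(2 * real n + 3) * ln g1 < ln e" using l by (simp add: divide_less_eq)
 then have "ln (g1 ^ (2 * n + 3)) < ln e" using \<gamma> by (simp add: ln_realpow)
 then show "g1 ^ (2 * n + 3) <= e" using e \<gamma> by (simp add: less_imp_le)
 have "1 - 2 * real n < ln e / ln g2" using n2 by simp
 then have 1: "(1 - 2 * real n) * ln g2 < ln e" using l by (simp add: less_divide_eq)
 have "ln (g2 ^ 3 * (1 / g2) ^ (2 * n + 2)) = (1 - 2 * real n) * ln g2"
  using \<gamma> by (simp add: ln_mult ln_realpow ln_div ags)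
 with 1 have "ln (g2 ^ 3 * (1 / g2) ^ (2 * n + 2)) < ln e" by simp
 then show "g2 ^ 3 * (1 / g2) ^ (2 * n + 2) <= e" using e \<gamma> by (simp add: less_imp_le)
 assume "e < g1 ^ 5"
 then have "ln e < 5 * ln g1" using e \<gamma> ln_less_cancel_iff[of e "g1 ^ 5"] by (simp add: ln_realpow)
 then have "5 < ln e / ln g1" using l by (simp add: less_divide_eq)
 then have "1 < real n" using n1 by simp
 then show "n \<ge> 2" by simp
qed

theorem theorem3p1:
  fixes M R :: real and D :: "(real^3) set"
  assumes D: "D = ball 0 1" and DR: "D \<subseteq> ball 0 R" and M: "1 \<le> M"
  shows
    "\<exists>\<delta>\<^sub>0>0. \<exists>\<epsilon>\<^sub>0>0. \<forall>\<delta> \<epsilon> \<gamma>\<^sub>1 \<gamma>\<^sub>2 :: real.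
       0 < \<delta> \<and> \<delta> < \<delta>\<^sub>0 \<and> 0 < \<epsilon> \<and> \<epsilon> < \<epsilon>\<^sub>0 \<and> sqrt (\<delta> / \<epsilon>) < 1 \<and>
       0 < \<gamma>\<^sub>1 \<and> \<gamma>\<^sub>1 < 1 \<and> 1 < \<gamma>\<^sub>2 \<and> \<gamma>\<^sub>2 < R \<longrightarrow>
       (\<exists>C>0. \<exists>\<omega>\<^sub>0>0. \<forall>\<eta>>0. \<exists>e\<^sub>0>0.
          \<forall>(lam :: real) (mu :: real) (rho :: real) (e :: real) (\<omega> :: real) (n :: nat)
            (f :: int \<Rightarrow> complex) (u :: real^3 \<Rightarrow> complex^3).
            \<bar>lam\<bar> \<le> M \<and> 1 / M \<le> mu \<and> mu \<le> M \<and> 1 / M \<le> rho \<and> rho \<le> M \<and>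
            0 < mu \<and> 0 < 3 * lam + 2 * mu \<and> 0 < rho \<and>
            0 < e \<and> e < e\<^sub>0 \<and> 0 < \<omega> \<and> \<omega> < \<omega>\<^sub>0 \<and>
            1 \<le> n \<and> max (n_interior \<gamma>\<^sub>1 e) (n_exterior \<gamma>\<^sub>2 e) \<le> int n \<and>
            (\<exists>m\<in>{- int n..int n}. f m \<noteq> 0) \<and>
            elastic_scattering D (\<lambda>y. y) lam mu rho (lam / \<delta>) (mu / \<delta>) (rho / \<epsilon>) \<omega>
              (incident_T (k_shear mu rho \<omega>) n f) u \<longrightarrow>
            (let ui = incident_T (k_shear mu rho \<omega>) n f;
                 us = (\<lambda>x. u x - ui x);
                 bound = e + C * (e * \<omega>\<^sup>2)
             in 0 < L2_norm_sq D u \<and>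
                L2_norm_sq (D - inner_layer D (1 - \<gamma>\<^sub>1)) u / L2_norm_sq D u \<le> bound \<and>
                0 < L2_norm_sq (ball 0 R - closure D) us \<and>
                L2_norm_sq ((ball 0 R - closure D) - outer_layer D R (\<gamma>\<^sub>2 - 1)) us
                  / L2_norm_sq (ball 0 R - closure D) us \<le> bound \<and>
                bound < \<eta>))"
proof -
 \<comment> \<open>From \<open>rho / mu <= M^2\<close> the shear wave number is at most
   \<open>M\<close> times the frequency. The bound on the frequency then makes \<open>k R\<close> at
   most 1/2, and \<open>C\<close> is 12 times the resulting bound for \<open>(k R)^2\<close> divided
   by the squared frequency.\<close>
 define C where "C = 12 * M^2 * (max 1 R)^2"
 define \<omega>\<^sub>0 where "\<omega>\<^sub>0 = 1 / (2 * M * max 1 R)"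
 have C0: "C > 0" and \<omega>0: "\<omega>\<^sub>0 > 0" using M by (simp_all add: C_def \<omega>\<^sub>0_def)
 let ?Q = "%u us e \<omega> g1 g2. 0 < L2_norm_sq D u & L2_norm_sq (D - inner_layer D (1 - g1)) u / L2_norm_sq D u <= e + C * (e * \<omega>^2) &
  0 < L2_norm_sq (ball 0 R - closure D) us &
  L2_norm_sq ((ball 0 R - closure D) - outer_layer D R (g2 - 1)) us / L2_norm_sq (ball 0 R - closure D) us <= e + C * (e * \<omega>^2)"
 have main: "?Q u (%x. u x - incident_T (k_shear mu rho \<omega>) n f x) e \<omega> g1 g2"
  if \<delta>: "0 < \<delta>" "\<delta> < 1 / 2" "0 < \<epsilon>" "sqrt (\<delta> / \<epsilon>) < 1"
  and \<gamma>: "0 < g1" "g1 < 1" "1 < g2" "g2 < R"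
  and par: "1 / M <= mu" "rho <= M" "0 < mu" "0 < 3 * lam + 2 * mu" "0 < rho"
  and e: "0 < e" "e < g1 ^ 5" and \<omega>: "0 < \<omega>" "\<omega> < \<omega>\<^sub>0"
  and n: "max (n_interior g1 e) (n_exterior g2 e) <= int n"
  and f: "\<exists>m\<in>{- int n..int n}. f m ~= 0"
  and sc: "elastic_scattering D (%y. y) lam mu rho (lam / \<delta>) (mu / \<delta>) (rho / \<epsilon>) \<omega> (incident_T (k_shear mu rho \<omega>) n f) u"
  for \<delta> \<epsilon> g1 g2 lam mu rho e \<omega> n f u
 proof -
  define k where "k = k_shear mu rho \<omega>"
  define us where "us x = u x - incident_T k n f x" for x
  define q where "q = (k * R)^2"
  have R: "R > 1" using \<gamma> by simp
  have k0: "k > 0" using par \<omega> by (simp add: k_def k_shear_def)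
  have kM: "k <= \<omega> * M"
  proof -
  have "rho / mu <= M / (1 / M)" by (rule frac_le) (use par M in auto)
  then have "sqrt (rho / mu) <= M" using M by (intro real_le_lsqrt) (auto simp: power2_eq_square)
  then show ?thesis unfolding k_def k_shear_def using \<omega> by (intro mult_left_mono) auto
  qed
  have kR: "k * R <= \<omega> * M * R" using kM R by (intro mult_right_mono) auto
  have kR2: "k * R <= 1 / 2"
  proof -
  have "\<omega> * (2 * M * R) <= 1" using \<omega> M R by (simp add: \<omega>\<^sub>0_def field_simps)
  then show ?thesis using kR by simp
  qed
  have k1: "k * 1 <= k * R" using k0 R by (intro mult_left_mono) auto
  have k2: "k <= 1 / 2" using kR2 k1 by linarith
  have q: "0 <= q" "q <= 1 / 4" "12 * q <= C * \<omega>^2"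
  proof -
  show "0 <= q" by (simp add: q_def)
  show "q <= 1 / 4" using power_mono[OF kR2, of 2] k0 R by (simp add: q_def power2_eq_square)
  have "q <= (\<omega> * M * R)^2" unfolding q_def using k0 R by (intro power_mono kR) auto
  then show "12 * q <= C * \<omega>^2" using R by (simp add: C_def max_def power_mult_distrib mult_ac)
  qed
  note ib = index_bounds[OF e(1) \<gamma>(1,2,3) n]
  have n2: "n \<ge> 2" by (rule ib(3)[OF e(2)])
  obtain k' a b where k': "0 < k'" "k' <= k_shear mu rho \<omega>" and ab: "a ~= 0" "b ~= 0"
  and u: "!!x. x : shell 0 1 ==> u x = (a * cr (bser n ((k' * norm x)^2))) *s tang (solid_sum n f) x"
  and us': "!!x. 1 < norm x ==> u x - incident_T (k_shear mu rho \<omega>) n f x = (b * hankel n (k_shear mu rho \<omega> * norm x)) *s tang (solid_sum n f) x"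
  by (rule inclusion_solution[OF sc[unfolded D] par(3,4,5) \<omega>(1) \<delta> n2 k2[unfolded k_def]]) (rule that)
  have us: "us x = (b * hankel n (k * norm x)) *s tang (solid_sum n f) x" if "1 < norm x" for x
  using us'[OF that] by (simp add: us_def k_def)
  note k' = k'[folded k_def]
  define V where "V = tang (solid_sum n f)"
  obtain x1 where x1: "x1 ~= 0" "V x1 ~= 0"
  using tang_nonzero[OF _ f] n2 unfolding V_def by (metis one_le_numeral order_trans zero_index)
  have Vs: "V (c *r x1) ~= 0" if "c > 0" for c
  using x1(2) that unfolding V_def tang_scale[OF that] by (simp add: vec_eq_iff)
  interpret harmonic_field "%i x. V x $ i" n unfolding V_def by (rule tang_harmonic_field)
  obtain B where B: "B > 0" "!!x i. x ~= 0 ==> cmod (V x $ i) <= B * norm x ^ n" using V_bound by blast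
  have VB: "norm (V x) <= 3 * (B * norm x ^ n)" if "x ~= 0" for x by (rule norm_le_3[OF B(2)[OF that]])
  have fD: "frontier D = sphere 0 1" "closure D = cball 0 1" unfolding D by simp_all
  \<comment> \<open>The radial projection is a competitor for the distance. This upper bound
    suffices: a point outside the layer has distance at least the width of the layer, so its norm
    differs from 1 by at least as much.\<close>
  have inf: "infdist x (sphere 0 1) <= \<bar>norm x - 1\<bar>" if "x ~= 0" for x :: "real^3"
  proof -
  have "infdist x (sphere 0 1) <= dist x (x /\<^sub>R norm x)" by (rule infdist_le) (use that in simp)
  also have "dist x (x /\<^sub>R norm x) = norm ((1 - inverse (norm x)) *r x)" unfolding dist_norm by (simp only: scaleR_diff_left scaleR_one)
  also have "... = \<bar>(1 - inverse (norm x)) * norm x\<bar>" by (simp add: abs_mult)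
  also have "(1 - inverse (norm x)) * norm x = norm x - 1" using that by (simp add: left_diff_distrib)
  finally show ?thesis .
  qed
  have oL: "open {x::real^3. infdist x (frontier D) < \<xi>}" for \<xi> by (intro open_Collect_less continuous_intros)
  have eb: "t * (1 + 12 * q) <= e + C * (e * \<omega>^2)" if "0 <= t" "t <= e" for t
  proof -
  have "t * (1 + 12 * q) <= e * (1 + C * \<omega>^2)" using that q e C0 by (intro mult_mono) auto
  then show ?thesis by (simp add: ags)
  qed
  have kq: "k'^2 <= q"
  proof -
  have "k' <= k * R" using k' k1 by linarith
  then show ?thesis unfolding q_def using k' by (intro power_mono) auto
  qed
  have uc: "cont_on D u" using sc unfolding elastic_scattering_def by (auto dest: C2_onD intro: C1_onD(3))
  have int: "0 < L2_norm_sq D u & L2_norm_sq (D - inner_layer D (1 - g1)) u / L2_norm_sq D u <= g1 ^ 3 * (g1 ^ (2 * n) * (1 + 12 * q))"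
  proof (rule L2_ratio[where v=u and T=D and c=g1])
  show "open D" "bounded D" unfolding D by auto
  have "inner_layer D (1 - g1) = D \<inter> {x. infdist x (frontier D) < 1 - g1}" by (auto simp: inner_layer_def)
  then show "D - inner_layer D (1 - g1) : sets borel" using oL unfolding D by auto
  show "cont_on D u" by (rule uc)
  \<comment> \<open>The formula for \<open>u\<close> holds off the origin, so the value there enters
    through \<open>max\<close>. The bound itself serves to make the norm over \<open>D\<close>
    finite.\<close>
  show "norm (u x) <= max (norm (u 0)) (cmod a * (2 / dfact n) * (3 * B))" if x: "x : D" for x
  proof (cases "x = 0")
  case False
  then have xs: "x : shell 0 1" using x by (auto simp: D shell_def)
  then have r: "0 < norm x" "norm x <= 1" by (auto simp: shell_def)
  have "(k' * norm x)^2 <= 1"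
  using k' k2 r mult_mono[of k' 1 "norm x" 1] by (intro power_le_one) auto
  then have "\<bar>dfact n * bser n ((k' * norm x)^2)\<bar> <= 2" using bser_bound[of "(k' * norm x)^2" n] by auto
  then have "\<bar>bser n ((k' * norm x)^2)\<bar> <= 2 / dfact n" using dfact_pos[of n] by (simp add: abs_mult field_simps)
  moreover have "B * norm x ^ n <= B * 1" using r B(1) by (intro mult_left_mono power_le_one) auto
  then have "norm (V x) <= 3 * B" using VB[OF False] by linarith
  ultimately have "norm (u x) <= cmod a * (2 / dfact n) * (3 * B)"
  unfolding u[OF xs] norm_smult_complex norm_mult V_def[symmetric] norm_of_real using dfact_pos[of n]
  by (intro mult_mono) auto
  then show ?thesis by simp
  qed simp
  \<comment> \<open>Homogeneity moves the point where the tangential field is nonzero to norm 1/2,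
    inside the ball.\<close>
  define c where "c = 1 / (2 * norm x1)"
  have c: "c > 0" "norm (c *r x1) = 1 / 2" using x1 by (simp_all add: c_def)
  then have cs: "c *r x1 : shell 0 1" by (auto simp: shell_def)
  show "c *r x1 : D" using c by (simp add: D)
  have "bser n ((k' * norm (c *r x1))^2) > 0" by (rule bessel_quotient(1)) (unfold c(2), use k' k2 in auto)
  then show "u (c *r x1) ~= 0" unfolding u[OF cs] using ab Vs[OF c(1)] by (auto simp: vec_eq_iff V_def)
  show "x : D & (norm (u (g1 *r x)))^2 <= g1 ^ (2 * n) * (1 + 12 * q) * (norm (u x))^2"
  if x: "x ~= 0" "norm x ~= 1" "g1 *r x : D - inner_layer D (1 - g1)" for x
  proof -
  have 1: "g1 * norm x < 1" and 2: "1 - g1 <= infdist (g1 *r x) (sphere 0 1)"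
  using x(3) \<gamma> fD by (auto simp: inner_layer_def D)
  have "infdist (g1 *r x) (sphere 0 1) <= \<bar>g1 * norm x - 1\<bar>" using inf[of "g1 *r x"] \<gamma> x(1) by simp
  with 1 2 have "g1 * norm x <= g1 * 1" by linarith
  then have x1: "norm x < 1" using \<gamma> x(2) by simp
  then have "x : shell 0 1" "g1 *r x : shell 0 1" using x(1) 1 \<gamma> by (auto simp: shell_def)
  then have "(norm (u (g1 *r x)))^2 <= g1 ^ (2 * n) * (1 + 12 * q) * (norm (u x))^2"
  using k' kq q \<gamma> x1 u by (intro interior_scaling[where k=k' and a=a and f=f]) auto
  then show ?thesis using x1 by (simp add: D)
  qed
  qed (use \<gamma> q in auto)
  define T where "T = ball (0::real^3) R - closure D"
  have T: "x : T \<longleftrightarrow> 1 < norm x & norm x < R" for x by (auto simp: T_def fD)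
  have usc: "cont_on {x. 1 < norm x} us"
  proof -
  have oE: "open {x::real^3. 1 < norm x}" by (intro open_Collect_less continuous_intros)
  interpret H: mode "%i x. V x $ i" n "%n t. b * hankel n t" k
  using harmonic_field_axioms radial_ladder_hankel k0 by (simp add: mode_def mode_axioms_def)
  have "C2_on {x. 1 < norm x} us"
  by (rule C2_on_cong[OF oE _ C2_on_subset[OF H.Wv2]])
  (auto simp: us[folded V_def] H.Wv_def H.W_def H.g_def vec_eq_iff)
  then show ?thesis by (intro C1_onD(3) C2_onD(1))
  qed
  have ext: "0 < L2_norm_sq T us & L2_norm_sq (T - outer_layer D R (g2 - 1)) us / L2_norm_sq T us <= g2 ^ 3 * ((1 / g2) ^ (2 * n + 2) * (1 + 12 * q))"
  proof (rule L2_ratio[where v=us and T=T and c=g2])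
  show "open T" "bounded T" unfolding T_def fD by (auto intro: bounded_subset[OF bounded_ball])
  have "outer_layer D R (g2 - 1) = T \<inter> {x. infdist x (frontier D) < g2 - 1}" by (auto simp: outer_layer_def T_def)
  then show "T - outer_layer D R (g2 - 1) : sets borel" using oL `open T` by auto
  show "cont_on T us" by (rule continuous_on_subset[OF usc]) (auto simp: T)
  define p where "p = (\<Prod>i<n. 2 * real i + 1)"
  have kx: "0 < k * norm x" "k * norm x <= 1 / 2" "k * 1 <= k * norm x" if "x : T" for x
  proof -
  have "1 < norm x" "norm x < R" using that T by auto
  then show "0 < k * norm x" "k * norm x <= 1 / 2" "k * 1 <= k * norm x"
  proof -
  show a: "k * 1 <= k * norm x" using k0 `1 < norm x` by (intro mult_left_mono) auto
  have "k * norm x <= k * R" using k0 `norm x < R` by (intro mult_left_mono) auto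
  then show "k * norm x <= 1 / 2" using kR2 by linarith
  show "0 < k * norm x" using a k0 by linarith
  qed
  qed
  show "norm (us x) <= cmod b * (\<bar>p\<bar> * 2 / k ^ (2 * n + 1)) * (3 * (B * R ^ n))" if x: "x : T" for x
  proof -
  have r: "1 < norm x" "norm x < R" using x T by auto
  have "cmod (hankel n (k * norm x)) = \<bar>p\<bar> * cmod (hankel_norm n (k * norm x)) / (k * norm x) ^ (2 * n + 1)"
  unfolding hankel_eq[OF kx(1)[OF x]] p_def[symmetric] using kx(1)[OF x] k0 by (simp add: norm_mult norm_divide norm_power)
  also have "... <= \<bar>p\<bar> * 2 / k ^ (2 * n + 1)"
  using k0 kx[OF x] hankel_norm_bound(3)[of "k * norm x" n] by (intro frac_le mult_left_mono power_mono) auto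
  finally have h: "cmod (hankel n (k * norm x)) <= \<bar>p\<bar> * 2 / k ^ (2 * n + 1)" .
  have "x ~= 0" using r by auto
  from VB[OF this] have v: "norm (V x) <= 3 * (B * R ^ n)"
  using B(1) r by (elim order_trans) (intro mult_left_mono power_mono, auto)
  show ?thesis
  unfolding us[OF r(1)] norm_smult_complex norm_mult V_def[symmetric]
  using k0 by (intro mult_mono h v) auto
  qed
  define c where "c = (1 + R) / 2 / norm x1"
  have c: "c > 0" "norm (c *r x1) = (1 + R) / 2" using x1 R by (simp_all add: c_def)
  show cT: "c *r x1 : T" unfolding T c using R by auto
  have "hankel n (k * norm (c *r x1)) ~= 0" using hankel_quotient(1)[OF _ kx(1,2)[OF cT], of n] n2 by simp
  then show "us (c *r x1) ~= 0" using cT us[of "c *r x1"] ab Vs[OF c(1)] by (auto simp: vec_eq_iff V_def T)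
  show "x : T & (norm (us (g2 *r x)))^2 <= (1 / g2) ^ (2 * n + 2) * (1 + 12 * q) * (norm (us x))^2"
  if x: "x ~= 0" "norm x ~= 1" "g2 *r x : T - outer_layer D R (g2 - 1)" for x
  proof -
  have 1: "1 < g2 * norm x" "g2 * norm x < R" using x(3) \<gamma> by (auto simp: T)
  have 2: "g2 - 1 <= infdist (g2 *r x) (sphere 0 1)" using x(3) fD by (auto simp: outer_layer_def T_def)
  have "infdist (g2 *r x) (sphere 0 1) <= \<bar>g2 * norm x - 1\<bar>" using inf[of "g2 *r x"] \<gamma> x(1) by simp
  with 1 2 have "g2 * 1 <= g2 * norm x" by linarith
  then have x1: "1 < norm x" using \<gamma> x(2) by simp
  have "norm x < R" using 1(2) \<gamma> mult_right_mono[of 1 g2 "norm x"] by simp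
  moreover have "(k * (g2 * norm x))^2 <= q" unfolding q_def using k0 1 by (intro power_mono mult_left_mono) auto
  then have "(norm (us (g2 *r x)))^2 <= (1 / g2) ^ (2 * n + 2) * (1 + 12 * q) * (norm (us x))^2"
  using k0 \<gamma> x1 1 q us by (intro exterior_scaling[where k=k and b=b and f=f]) auto
  ultimately show ?thesis using x1 by (simp add: T)
  qed
  qed (use \<gamma> q in auto)
  have "g1 ^ 3 * (g1 ^ (2 * n) * (1 + 12 * q)) = g1 ^ (2 * n + 3) * (1 + 12 * q)"
  by (simp only: power_add mult_ac)
  then have i: "g1 ^ 3 * (g1 ^ (2 * n) * (1 + 12 * q)) <= e + C * (e * \<omega>^2)"
  using eb[OF _ ib(1)] \<gamma> by (simp only:) simp
  have x: "g2 ^ 3 * ((1 / g2) ^ (2 * n + 2) * (1 + 12 * q)) <= e + C * (e * \<omega>^2)"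
  using eb[OF _ ib(2)] \<gamma> unfolding mult.assoc[symmetric] by simp
  show ?thesis
  using int ext order_trans[OF conjunct2[OF int] i] order_trans[OF conjunct2[OF ext] x] unfolding T_def us_def[abs_def] k_def by (intro conjI) simp_all
 qed
 have bnd: "e + C * (e * \<omega>^2) < \<eta>" if "0 < e" "e < \<eta> / (1 + C * \<omega>\<^sub>0^2)" "0 < \<omega>" "\<omega> < \<omega>\<^sub>0" for e \<omega> \<eta>
 proof -
  have "\<omega>^2 <= \<omega>\<^sub>0^2" using that by (intro power_mono) auto
  then have "e * (1 + C * \<omega>^2) <= e * (1 + C * \<omega>\<^sub>0^2)" using that C0 by (intro mult_left_mono add_left_mono) auto
  also have "... < \<eta>" using that C0 by (simp add: less_divide_eq add_pos_nonneg)
  finally show ?thesis by (simp add: ags)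
 qed
 show ?thesis
 \<comment> \<open>The bound 1/2 on the Lame contrast is the one that keeps the scattering
   coefficient nonzero; the density contrast acts through the quotient of both.\<close>
 proof (rule exI[of _ "1 / 2"], intro conjI, simp, rule exI[of _ 1], intro conjI, simp, intro allI impI, elim conjE,
  rule exI[of _ C], intro conjI C0, rule exI[of _ \<omega>\<^sub>0], intro conjI \<omega>0 allI impI, goal_cases)
  case (1 \<delta> \<epsilon> g1 g2 \<eta>)
  note \<delta> = 1(1,2,3,5) and \<gamma> = 1(6-9) and \<eta> = 1(10)
  show ?case
  \<comment> \<open>The first bound forces \<open>n >= 2\<close>; the second makes
    \<open>e + C * (e * \<omega>\<^sup>2)\<close> smaller than \<open>\<eta>\<close> for every
    admissible frequency.\<close>
  proof (rule exI[of _ "min (g1 ^ 5) (\<eta> / (1 + C * \<omega>\<^sub>0^2))"], intro conjI allI impI, goal_cases)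
  case 1
  then show ?case using \<gamma> \<eta> C0 by (simp add: add_pos_nonneg)
  next
  case (2 lam mu rho e \<omega> n f u)
  then have h: "e < g1 ^ 5" "e < \<eta> / (1 + C * \<omega>\<^sub>0^2)" "0 < e" "0 < \<omega>" "\<omega> < \<omega>\<^sub>0" by auto
  have "?Q u (%x. u x - incident_T (k_shear mu rho \<omega>) n f x) e \<omega> g1 g2"
  by (rule main[OF \<delta> \<gamma> _ _ _ _ _ h(3,1,4,5), of mu rho lam n f u]) (use 2 in simp_all)
  with bnd[OF h(3,2,4,5)] show ?case unfolding Let_def by (elim conjE) (intro conjI; assumption)
  qed
 qed
qed

end
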